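(* Let $B=\mathbb K\mathcal G^1$ be the groupoid algebra of a small groupoid $\mathcal G$ with finite set of objects over a field $\mathbb K$ of characteristic zero. Then $$\mathrm{HH}_\ast(B)=\bigoplus_{[l]\in\mathcal T(\mathcal G)}\mathrm H_\ast(\mathcal G^1_l,\mathbb K),$$ $$\mathrm{HC}_\ast(B)=\Big(\bigoplus_{\substack{[l]\in\mathcal T(\mathcal G)\\\mathrm{ord}(l)<\infty}}\ \bigoplus_{i\ge0}\mathrm H_{\ast-2i}(\mathcal G^1_l/\langle l\rangle,\mathbb K)\Big)\bigoplus\Big(\bigoplus_{\substack{[l]\in\mathcal T(\mathcal G)\\\mathrm{ord}(l)=\infty}}\mathrm H_\ast(\mathcal G^1_l/\langle l\rangle,\mathbb K)\Big).$$
   Context: For a small groupoid $\mathcal G$, $\mathcal G^0$ and $\mathcal G^1$ are the sets of objects and morphisms, $s,t$ source and target. The groupoid algebra $B=\mathbb K\mathcal G^1$ has basis $\mathcal G^1$ and product $gg'=g\circ g'$ if $s(g)=t(g')$ and $0$ otherwise; it is unital since $\mathcal G^0$ is finite. $\mathcal L(\mathcal G)=\{g\in\mathcal G^1\mid s(g)=t(g)\}$ is the set of loops; $[l]=\{g\circ l\circ g^{-1}\mid s(g)=s(l)\}$ is the orbit of $l\in\mathcal L(\mathcal G)$ under the adjoint action and $\mathcal T(\mathcal G)$ is the set of these orbits. $\mathcal G^1_l=\{l'\in\mathcal L(\mathcal G)\mid s(l')=s(l),\ l'\circ l\circ l'^{-1}=l\}$ is the centralizer of $l$ in the group of loops at $s(l)$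 (up to isomorphism it depends only on $[l]$), $\langle l\rangle$ is the cyclic subgroup generated by $l$, and $\mathrm{ord}(l)$ is the order of $l$ in the group of loops at $s(l)$. $\mathrm H_\ast(G,\mathbb K)$ is group homology with trivial coefficients; $\mathrm{HH}_\ast(B)$ and $\mathrm{HC}_\ast(B)$ are the ordinary Hochschild and cyclic homologies of the $\mathbb K$-algebra $B$. Equalities mean isomorphisms of $\mathbb K$-vector spaces in each degree. *)

theory Defs
  imports "HOL-Algebra.Algebra" "HOL-Algebra.Algebraic_Closure_Type"
begin

text \<open>
  Vector spaces over a field type \<open>'k\<close> are records of type \<open>('k, 'v) module\<close>; the scalars are
  \<open>ring_of_type_algebra\<close>. This record type extends the one of rings, so a vector space
  carries two fields \<open>mult\<close> and \<open>one\<close>, which are left undefined below. A record in which they are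
  meaningful, such as \<open>groupoid_algebra\<close>, describes an associative unital \<open>'k\<close>-algebra.
  (The locale \<open>algebra\<close> of HOL-Algebra is restricted to commutative algebras.)
\<close>

section \<open>Vector spaces\<close>

definition vs_isomorphic :: "('k, 'v) module \<Rightarrow> ('k, 'w) module \<Rightarrow> bool" where
  "vs_isomorphic V W \<longleftrightarrow> (\<exists>f. bij_betw f (carrier V) (carrier W) \<and>
     (\<forall>x \<in> carrier V. \<forall>y \<in> carrier V. f (x \<oplus>\<^bsub>V\<^esub> y) = f x \<oplus>\<^bsub>W\<^esub> f y) \<and>
     (\<forall>k. \<forall>x \<in> carrier V. f (k \<odot>\<^bsub>V\<^esub> x) = k \<odot>\<^bsub>W\<^esub> f x))"

definition submodule_span :: "('k::field, 'v) module \<Rightarrow> 'v set \<Rightarrow> 'v set" where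
  "submodule_span V S = \<Inter>{W. submodule W ring_of_type_algebra V \<and> S \<subseteq> W}"

text \<open>The summand \<open>W\<close> in the scalar multiplication makes \<open>0 \<odot> S\<close> equal to \<open>W\<close> rather than to
  the singleton of the zero vector.\<close>

definition quotient_module :: "('k, 'v) module \<Rightarrow> 'v set \<Rightarrow> ('k, 'v set) module" where
  "quotient_module V W =
     \<lparr> carrier = a_rcosets\<^bsub>V\<^esub> W, monoid.mult = undefined, one = undefined,
       ring.zero = W, add = (<+>\<^bsub>V\<^esub>),
       module.smult = (\<lambda>k S. W <+>\<^bsub>V\<^esub> ((\<lambda>x. k \<odot>\<^bsub>V\<^esub> x) ` S)) \<rparr>"

text \<open>The map between quotients that is induced by a map \<open>f\<close> into \<open>V'\<close>, where the target is
  \<open>V'\<close> modulo \<open>W'\<close>.\<close>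

definition coset_map :: "('k, 'w) module \<Rightarrow> 'w set \<Rightarrow> ('v \<Rightarrow> 'w) \<Rightarrow> 'v set \<Rightarrow> 'w set" where
  "coset_map V' W' f S = (\<Union>x\<in>S. W' +>\<^bsub>V'\<^esub> f x)"

definition direct_sum :: "'i set \<Rightarrow> ('i \<Rightarrow> ('k, 'v) module) \<Rightarrow> ('k, 'i \<Rightarrow> 'v) module" where
  "direct_sum I V =
     \<lparr> carrier = {f \<in> \<Pi>\<^sub>E i\<in>I. carrier (V i). finite {i\<in>I. f i \<noteq> \<zero>\<^bsub>V i\<^esub>}},
       monoid.mult = undefined, one = undefined,
       ring.zero = (\<lambda>i\<in>I. \<zero>\<^bsub>V i\<^esub>), add = (\<lambda>f g. \<lambda>i\<in>I. f i \<oplus>\<^bsub>V i\<^esub> g i),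
       module.smult = (\<lambda>k f. \<lambda>i\<in>I. k \<odot>\<^bsub>V i\<^esub> f i) \<rparr>"

definition direct_sum2 :: "('k, 'v) module \<Rightarrow> ('k, 'w) module \<Rightarrow> ('k, 'v \<times> 'w) module" where
  "direct_sum2 V W =
     \<lparr> carrier = carrier V \<times> carrier W, monoid.mult = undefined, one = undefined,
       ring.zero = (\<zero>\<^bsub>V\<^esub>, \<zero>\<^bsub>W\<^esub>),
       add = (\<lambda>x y. (fst x \<oplus>\<^bsub>V\<^esub> fst y, snd x \<oplus>\<^bsub>W\<^esub> snd y)),
       module.smult = (\<lambda>k x. (k \<odot>\<^bsub>V\<^esub> fst x, k \<odot>\<^bsub>W\<^esub> snd x)) \<rparr>"

definition free_module :: "'x set \<Rightarrow> ('k::field, 'x \<Rightarrow> 'k) module" where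
  "free_module A =
     \<lparr> carrier = {f. finite {x. f x \<noteq> 0} \<and> {x. f x \<noteq> 0} \<subseteq> A},
       monoid.mult = undefined, one = undefined,
       ring.zero = (\<lambda>x. 0), add = (\<lambda>f g x. f x + g x), module.smult = (\<lambda>k f x. k * f x) \<rparr>"

definition delta :: "'x \<Rightarrow> 'x \<Rightarrow> 'k::field" where
  "delta a = (\<lambda>x. if x = a then 1 else 0)"

text \<open>The linear extension of a map between bases, \<open>\<Sum>\<^sub>a f(a) a \<mapsto> \<Sum>\<^sub>a f(a) \<phi>(a)\<close>.\<close>

definition free_map :: "('x \<Rightarrow> 'y) \<Rightarrow> ('x \<Rightarrow> 'k::field) \<Rightarrow> 'y \<Rightarrow> 'k" where
  "free_map \<phi> f = (\<lambda>y. \<Sum>a | f a \<noteq> 0 \<and> \<phi> a = y. f a)"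


section \<open>Tensor powers\<close>

definition tensor_gen :: "('k::field, 'b) module \<Rightarrow> nat \<Rightarrow> ('k, 'b list \<Rightarrow> 'k) module" where
  "tensor_gen V n = free_module {xs \<in> lists (carrier V). length xs = n}"

definition tensor_rel :: "('k::field, 'b) module \<Rightarrow> nat \<Rightarrow> ('b list \<Rightarrow> 'k) set" where
  "tensor_rel V n = submodule_span (tensor_gen V n)
     ({(\<lambda>z. delta (xs @ (a \<oplus>\<^bsub>V\<^esub> b) # ys) z - delta (xs @ a # ys) z - delta (xs @ b # ys) z) |xs ys a b.
         xs \<in> lists (carrier V) \<and> ys \<in> lists (carrier V) \<and> length xs + length ys + 1 = n \<and>
         a \<in> carrier V \<and> b \<in> carrier V} \<union>
      {(\<lambda>z. delta (xs @ (k \<odot>\<^bsub>V\<^esub> a) # ys) z - k * delta (xs @ a # ys) z) |xs ys a k.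
         xs \<in> lists (carrier V) \<and> ys \<in> lists (carrier V) \<and> length xs + length ys + 1 = n \<and>
         a \<in> carrier V})"

definition tensor_power :: "('k::field, 'b) module \<Rightarrow> nat \<Rightarrow> ('k, ('b list \<Rightarrow> 'k) set) module" where
  "tensor_power V n = quotient_module (tensor_gen V n) (tensor_rel V n)"

text \<open>The linear map into the \<open>m\<close>-th tensor power with
  \<open>a\<^sub>1 \<otimes> \<dots> \<otimes> a\<^sub>n \<mapsto> \<phi>(a\<^sub>1, \<dots>, a\<^sub>n)\<close>; meaningful if this is multilinear.\<close>

definition tensor_map ::
    "('k::field, 'b) module \<Rightarrow> nat \<Rightarrow> ('b list \<Rightarrow> 'b list) \<Rightarrow> ('b list \<Rightarrow> 'k) set \<Rightarrow> ('b list \<Rightarrow> 'k) set" where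
  "tensor_map V m \<phi> = coset_map (tensor_gen V m) (tensor_rel V m) (free_map \<phi>)"


section \<open>Homology of chain complexes\<close>

text \<open>A chain complex in nonnegative degrees is given by spaces \<open>C n\<close> and differentials \<open>d n\<close>
  from \<open>C n\<close> to \<open>C (n - 1)\<close> for \<open>n > 0\<close>; the value of \<open>d 0\<close> is ignored, as the differential in
  degree 0 is the zero map.\<close>

definition cycles :: "(nat \<Rightarrow> ('k, 'v) module) \<Rightarrow> (nat \<Rightarrow> 'v \<Rightarrow> 'v) \<Rightarrow> nat \<Rightarrow> 'v set" where
  "cycles C d n =
     (if n = 0 then carrier (C 0) else {x \<in> carrier (C n). d n x = \<zero>\<^bsub>C (n - 1)\<^esub>})"

definition boundaries :: "(nat \<Rightarrow> ('k, 'v) module) \<Rightarrow> (nat \<Rightarrow> 'v \<Rightarrow> 'v) \<Rightarrow> nat \<Rightarrow> 'v set" where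
  "boundaries C d n = d (Suc n) ` carrier (C (Suc n))"

definition homology ::
    "(nat \<Rightarrow> ('k, 'v) module) \<Rightarrow> (nat \<Rightarrow> 'v \<Rightarrow> 'v) \<Rightarrow> nat \<Rightarrow> ('k, 'v set) module" where
  "homology C d n = quotient_module ((C n)\<lparr>carrier := cycles C d n\<rparr>) (boundaries C d n)"

text \<open>For a presimplicial module with faces \<open>\<delta> n i\<close> from \<open>C n\<close> to \<open>C (n - 1)\<close>, \<open>0 \<le> i \<le> n\<close>,
  these are \<open>b = \<Sum>\<^sub>i\<^sub>\<le>\<^sub>n (-1)\<^sup>i \<delta>\<^sub>i\<close> and \<open>b' = \<Sum>\<^sub>i\<^sub><\<^sub>n (-1)\<^sup>i \<delta>\<^sub>i\<close>.\<close>

definition face_sum ::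
    "(nat \<Rightarrow> ('k::field, 'v) module) \<Rightarrow> (nat \<Rightarrow> nat \<Rightarrow> 'v \<Rightarrow> 'v) \<Rightarrow> nat \<Rightarrow> 'v \<Rightarrow> 'v" where
  "face_sum C \<delta> n x = (\<Oplus>\<^bsub>C (n - 1)\<^esub>i\<in>{..n}. ((-1) ^ i) \<odot>\<^bsub>C (n - 1)\<^esub> \<delta> n i x)"

definition face_sum' ::
    "(nat \<Rightarrow> ('k::field, 'v) module) \<Rightarrow> (nat \<Rightarrow> nat \<Rightarrow> 'v \<Rightarrow> 'v) \<Rightarrow> nat \<Rightarrow> 'v \<Rightarrow> 'v" where
  "face_sum' C \<delta> n x = (\<Oplus>\<^bsub>C (n - 1)\<^esub>i\<in>{..<n}. ((-1) ^ i) \<odot>\<^bsub>C (n - 1)\<^esub> \<delta> n i x)"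


section \<open>Tsygan's double complex of a cyclic module\<close>

text \<open>\<open>\<tau> n\<close> is the cyclic operator on \<open>C n\<close>, without sign; \<open>signed_cyc\<close> is \<open>t = (-1)\<^sup>n \<tau>\<^sub>n\<close>, and
  \<open>cyc_norm\<close> is \<open>N = 1 + t + \<dots> + t\<^sup>n\<close>.\<close>

definition signed_cyc ::
    "(nat \<Rightarrow> ('k::field, 'v) module) \<Rightarrow> (nat \<Rightarrow> 'v \<Rightarrow> 'v) \<Rightarrow> nat \<Rightarrow> 'v \<Rightarrow> 'v" where
  "signed_cyc C \<tau> n x = ((-1) ^ n) \<odot>\<^bsub>C n\<^esub> \<tau> n x"

definition cyc_norm ::
    "(nat \<Rightarrow> ('k::field, 'v) module) \<Rightarrow> (nat \<Rightarrow> 'v \<Rightarrow> 'v) \<Rightarrow> nat \<Rightarrow> 'v \<Rightarrow> 'v" where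
  "cyc_norm C \<tau> n x = (\<Oplus>\<^bsub>C n\<^esub>i\<in>{..n}. (signed_cyc C \<tau> n ^^ i) x)"

text \<open>The double complex has \<open>C q\<close> in column \<open>p \<ge> 0\<close> and row \<open>q \<ge> 0\<close>. The vertical differential
  is \<open>b\<close> in even columns and \<open>-b'\<close> in odd ones; the horizontal one, from column \<open>p + 1\<close> to
  column \<open>p\<close>, is \<open>1 - t\<close> for even \<open>p\<close> and \<open>N\<close> for odd \<open>p\<close>. An element of degree \<open>n\<close> of the
  total complex is a family \<open>x\<close> with \<open>x p\<close> in column \<open>p\<close> and row \<open>n - p\<close>.\<close>

definition tot_chain :: "(nat \<Rightarrow> ('k, 'v) module) \<Rightarrow> nat \<Rightarrow> ('k, nat \<Rightarrow> 'v) module" where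
  "tot_chain C n = direct_sum {..n} (\<lambda>p. C (n - p))"

definition tot_diff ::
    "(nat \<Rightarrow> ('k::field, 'v) module) \<Rightarrow> (nat \<Rightarrow> nat \<Rightarrow> 'v \<Rightarrow> 'v) \<Rightarrow> (nat \<Rightarrow> 'v \<Rightarrow> 'v) \<Rightarrow>
      nat \<Rightarrow> (nat \<Rightarrow> 'v) \<Rightarrow> nat \<Rightarrow> 'v" where
  "tot_diff C \<delta> \<tau> n x = (\<lambda>p\<in>{..n - 1}. let q = n - 1 - p in
     (if even p then face_sum C \<delta> (Suc q) (x p) else \<ominus>\<^bsub>C q\<^esub> face_sum' C \<delta> (Suc q) (x p)) \<oplus>\<^bsub>C q\<^esub>
     (if even p then x (Suc p) \<ominus>\<^bsub>C q\<^esub> signed_cyc C \<tau> q (x (Suc p)) else cyc_norm C \<tau> q (x (Suc p))))"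


section \<open>Hochschild and cyclic homology of an algebra\<close>

text \<open>\<open>hoch_chain B n\<close> is the tensor power of \<open>B\<close> with \<open>n + 1\<close> factors. The faces are
  \<open>\<delta>\<^sub>i(a\<^sub>0 \<otimes> \<dots> \<otimes> a\<^sub>n) = a\<^sub>0 \<otimes> \<dots> \<otimes> a\<^sub>i a\<^sub>i\<^sub>+\<^sub>1 \<otimes> \<dots> \<otimes> a\<^sub>n\<close> for \<open>i < n\<close> and
  \<open>\<delta>\<^sub>n(a\<^sub>0 \<otimes> \<dots> \<otimes> a\<^sub>n) = a\<^sub>n a\<^sub>0 \<otimes> a\<^sub>1 \<otimes> \<dots> \<otimes> a\<^sub>n\<^sub>-\<^sub>1\<close>; the cyclic operator sends
  \<open>a\<^sub>0 \<otimes> \<dots> \<otimes> a\<^sub>n\<close> to \<open>a\<^sub>n \<otimes> a\<^sub>0 \<otimes> \<dots> \<otimes> a\<^sub>n\<^sub>-\<^sub>1\<close>.\<close>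

definition hoch_chain :: "('k::field, 'b) module \<Rightarrow> nat \<Rightarrow> ('k, ('b list \<Rightarrow> 'k) set) module" where
  "hoch_chain B n = tensor_power B (Suc n)"

definition hoch_face_tuple :: "('k, 'b) module \<Rightarrow> nat \<Rightarrow> nat \<Rightarrow> 'b list \<Rightarrow> 'b list" where
  "hoch_face_tuple B n i xs =
     (if i < n then take i xs @ (xs ! i \<otimes>\<^bsub>B\<^esub> xs ! Suc i) # drop (i + 2) xs
      else (last xs \<otimes>\<^bsub>B\<^esub> hd xs) # butlast (tl xs))"

definition hoch_face ::
    "('k::field, 'b) module \<Rightarrow> nat \<Rightarrow> nat \<Rightarrow> ('b list \<Rightarrow> 'k) set \<Rightarrow> ('b list \<Rightarrow> 'k) set" where
  "hoch_face B n i = tensor_map B n (hoch_face_tuple B n i)"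

definition hoch_cyc ::
    "('k::field, 'b) module \<Rightarrow> nat \<Rightarrow> ('b list \<Rightarrow> 'k) set \<Rightarrow> ('b list \<Rightarrow> 'k) set" where
  "hoch_cyc B n = tensor_map B (Suc n) (\<lambda>xs. last xs # butlast xs)"

definition hochschild_homology ::
    "('k::field, 'b) module \<Rightarrow> nat \<Rightarrow> ('k, ('b list \<Rightarrow> 'k) set set) module" where
  "hochschild_homology B = homology (hoch_chain B) (face_sum (hoch_chain B) (hoch_face B))"

definition cyclic_homology ::
    "('k::field, 'b) module \<Rightarrow> nat \<Rightarrow> ('k, (nat \<Rightarrow> ('b list \<Rightarrow> 'k) set) set) module" where
  "cyclic_homology B =
     homology (tot_chain (hoch_chain B)) (tot_diff (hoch_chain B) (hoch_face B) (hoch_cyc B))"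


section \<open>Group homology with trivial coefficients\<close>

text \<open>The inhomogeneous bar complex: \<open>bar_chain G n\<close> has the basis \<open>G\<^sup>n\<close>, and the faces of
  \<open>[g\<^sub>1|\<dots>|g\<^sub>n]\<close> are \<open>[g\<^sub>2|\<dots>|g\<^sub>n]\<close>, \<open>[g\<^sub>1|\<dots>|g\<^sub>i g\<^sub>i\<^sub>+\<^sub>1|\<dots>|g\<^sub>n]\<close> for \<open>0 < i < n\<close>, and
  \<open>[g\<^sub>1|\<dots>|g\<^sub>n\<^sub>-\<^sub>1]\<close>. List indices start at 0, so \<open>g\<^sub>i\<close> is \<open>xs ! (i - 1)\<close>.\<close>

definition bar_chain :: "('a, 'c) monoid_scheme \<Rightarrow> nat \<Rightarrow> ('k::field, 'a list \<Rightarrow> 'k) module" where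
  "bar_chain G n = free_module {xs \<in> lists (carrier G). length xs = n}"

definition bar_face_tuple :: "('a, 'c) monoid_scheme \<Rightarrow> nat \<Rightarrow> nat \<Rightarrow> 'a list \<Rightarrow> 'a list" where
  "bar_face_tuple G n i xs =
     (if i = 0 then tl xs
      else if i < n then take (i - 1) xs @ (xs ! (i - 1) \<otimes>\<^bsub>G\<^esub> xs ! i) # drop (i + 1) xs
      else butlast xs)"

definition group_homology ::
    "('a, 'c) monoid_scheme \<Rightarrow> nat \<Rightarrow> ('k::field, ('a list \<Rightarrow> 'k) set) module" where
  "group_homology G =
     homology (bar_chain G) (face_sum (bar_chain G) (\<lambda>n i. free_map (bar_face_tuple G n i)))"


section \<open>Groupoids\<close>

text \<open>\<open>comp_mor G g h\<close> is \<open>g \<circ> h\<close>, relevant only if the source of \<open>g\<close> is the target of \<open>h\<close>.\<close>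

record ('o, 'm) groupoid_data =
  objs :: "'o set"
  mors :: "'m set"
  src :: "'m \<Rightarrow> 'o"
  tgt :: "'m \<Rightarrow> 'o"
  comp_mor :: "'m \<Rightarrow> 'm \<Rightarrow> 'm"
  ident :: "'o \<Rightarrow> 'm"

locale groupoid =
  fixes G :: "('o, 'm) groupoid_data"
  assumes src_closed: "g \<in> mors G \<Longrightarrow> src G g \<in> objs G"
    and tgt_closed: "g \<in> mors G \<Longrightarrow> tgt G g \<in> objs G"
    and ident_closed: "x \<in> objs G \<Longrightarrow> ident G x \<in> mors G"
    and src_ident: "x \<in> objs G \<Longrightarrow> src G (ident G x) = x"
    and tgt_ident: "x \<in> objs G \<Longrightarrow> tgt G (ident G x) = x"
    and comp_closed: "\<lbrakk>g \<in> mors G; h \<in> mors G; src G g = tgt G h\<rbrakk> \<Longrightarrow>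
      comp_mor G g h \<in> mors G"
    and src_comp: "\<lbrakk>g \<in> mors G; h \<in> mors G; src G g = tgt G h\<rbrakk> \<Longrightarrow>
      src G (comp_mor G g h) = src G h"
    and tgt_comp: "\<lbrakk>g \<in> mors G; h \<in> mors G; src G g = tgt G h\<rbrakk> \<Longrightarrow>
      tgt G (comp_mor G g h) = tgt G g"
    and comp_assoc: "\<lbrakk>f \<in> mors G; g \<in> mors G; h \<in> mors G;
      src G f = tgt G g; src G g = tgt G h\<rbrakk> \<Longrightarrow>
      comp_mor G (comp_mor G f g) h = comp_mor G f (comp_mor G g h)"
    and comp_ident_left: "g \<in> mors G \<Longrightarrow> comp_mor G (ident G (tgt G g)) g = g"
    and comp_ident_right: "g \<in> mors G \<Longrightarrow> comp_mor G g (ident G (src G g)) = g"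
    and ex_inverse: "g \<in> mors G \<Longrightarrow> \<exists>h \<in> mors G.
      src G h = tgt G g \<and> tgt G h = src G g \<and>
      comp_mor G h g = ident G (src G g) \<and> comp_mor G g h = ident G (tgt G g)"

definition inverse_mor :: "('o, 'm) groupoid_data \<Rightarrow> 'm \<Rightarrow> 'm" where
  "inverse_mor G g = (THE h. h \<in> mors G \<and> src G h = tgt G g \<and> tgt G h = src G g \<and>
      comp_mor G h g = ident G (src G g) \<and> comp_mor G g h = ident G (tgt G g))"

definition loops :: "('o, 'm) groupoid_data \<Rightarrow> 'm set" where
  "loops G = {g \<in> mors G. src G g = tgt G g}"

definition loop_orbit :: "('o, 'm) groupoid_data \<Rightarrow> 'm \<Rightarrow> 'm set" where
  "loop_orbit G l =
     {comp_mor G (comp_mor G g l) (inverse_mor G g) |g. g \<in> mors G \<and> src G g = src G l}"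

definition loop_orbits :: "('o, 'm) groupoid_data \<Rightarrow> 'm set set" where
  "loop_orbits G = loop_orbit G ` loops G"

definition loop_group :: "('o, 'm) groupoid_data \<Rightarrow> 'o \<Rightarrow> 'm monoid" where
  "loop_group G x =
     \<lparr> carrier = {g \<in> loops G. src G g = x}, monoid.mult = comp_mor G, one = ident G x \<rparr>"

definition centralizer :: "('o, 'm) groupoid_data \<Rightarrow> 'm \<Rightarrow> 'm monoid" where
  "centralizer G l = (loop_group G (src G l))
     \<lparr>carrier := {l' \<in> loops G. src G l' = src G l \<and>
                   comp_mor G (comp_mor G l' l) (inverse_mor G l') = l}\<rparr>"

definition cyclic_subgroup :: "('o, 'm) groupoid_data \<Rightarrow> 'm \<Rightarrow> 'm set" where
  "cyclic_subgroup G l = generate (loop_group G (src G l)) {l}"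

text \<open>As usual for \<open>group.ord\<close>, the value 0 stands for infinite order.\<close>

definition loop_ord :: "('o, 'm) groupoid_data \<Rightarrow> 'm \<Rightarrow> nat" where
  "loop_ord G l = group.ord (loop_group G (src G l)) l"

text \<open>Its elements are the formal linear combinations of morphisms; the product is the bilinear
  extension of composition, with non-composable pairs multiplying to zero, and the unit is the
  sum of all identities.\<close>

definition groupoid_algebra :: "('o, 'm) groupoid_data \<Rightarrow> ('k::field, 'm \<Rightarrow> 'k) module" where
  "groupoid_algebra G = (free_module (mors G))
     \<lparr> monoid.mult := (\<lambda>f g m. \<Sum>(a, b) | f a \<noteq> 0 \<and> g b \<noteq> 0 \<and> src G a = tgt G b \<and> comp_mor G a b = m. f a * g b),
       one := (\<lambda>m. if m \<in> ident G ` objs G then 1 else 0) \<rparr>"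

end

theory Submission
  imports Defs "HOL-Library.Poly_Mapping"
begin

text \<open>
  The groupoid algebra has the basis of morphisms, so its cyclic module is spanned by tuples of
  morphisms, on which each face is a tuple or zero. The tuples with a non-composable pair of cyclic
  neighbours span a contractible subcomplex. The others split according to the orbit of their
  product. If \<open>l\<close> lies in this orbit, they are the tuples
  \<open>(h\<^sub>n l h\<^sub>0\<^sup>-\<^sup>1, h\<^sub>0 h\<^sub>1\<^sup>-\<^sup>1, \<dots>, h\<^sub>n\<^sub>-\<^sub>1 h\<^sub>n\<^sup>-\<^sup>1)\<close> for morphisms \<open>h\<^sub>i\<close> out of the source of \<open>l\<close>,
  that is, the orbits of the free tuples \<open>(h\<^sub>0, \<dots>, h\<^sub>n)\<close> under the centralizer \<open>Z\<close> of \<open>l\<close>; the cyclic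
  operator becomes \<open>(h\<^sub>0, \<dots>, h\<^sub>n) \<mapsto> (h\<^sub>n l, h\<^sub>0, \<dots>, h\<^sub>n\<^sub>-\<^sub>1)\<close>. Hence this summand computes the
  homology of \<open>Z\<close>. For cyclic homology, divide the free tuples by \<open>\<langle>l\<rangle>\<close> first and map the quotient
  to the homogeneous chains of \<open>Z/\<langle>l\<rangle>\<close>; antisymmetrization makes this map invariant under the cyclic
  operator. If \<open>l\<close> has finite order, then averaging over \<open>\<langle>l\<rangle>\<close> shows that every even column of the
  quotient double complex is a resolution, while the odd columns are contractible. If \<open>l\<close> has
  infinite order, then \<open>1 - t\<close> is injective on the free tuples, and the total complex of the quotient
  is itself a resolution. Exactness of mapping cones passes to the orbits under \<open>Z\<close>.
\<close>

section \<open>Linear extension\<close>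

text \<open>Dividing a resolution by \<open>Z\<close> destroys its exactness. What survives is the
  acyclicity of a mapping cone: if a group permutes the basis, and any two group elements that agree
  at one basis element agree at all of them, then an acyclic complex has an equivariant contraction,
  which descends. So every comparison is made before dividing by \<open>Z\<close>, between two
  augmented resolutions, and only its cone is divided.

  Two facts shape the cyclic case. The power \<open>n + 1\<close> of the operator on free tuples of
  degree \<open>n\<close> is translation by \<open>l\<close>, so this operator is cyclic only modulo
  the subgroup generated by \<open>l\<close>. And a homogeneous tuple of the quotient group is not
  fixed by the signed cyclic operator, while its antisymmetrization is; the comparison map then
  kills \<open>1 - t\<close> and extends by zero over the odd columns.

  Characteristic zero enters in three places: in antisymmetrization, in averaging over a finite
  cyclic subgroup, and in the exactness of the rows of the double complex away from column 0.

  The concrete records of the definitions are reached only at the end, through presentations by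
  chains.\<close>

type_synonym ('x, 'k) chain = "'x \<Rightarrow>\<^sub>0 'k"

abbreviation bas :: "'x \<Rightarrow> 'x \<Rightarrow>\<^sub>0 'k::field" where
  "bas x \<equiv> Poly_Mapping.single x 1"

abbreviation lookup :: "('x \<Rightarrow>\<^sub>0 'k::zero) \<Rightarrow> 'x \<Rightarrow> 'k" where
  "lookup \<equiv> Poly_Mapping.lookup"

definition cmul :: "'k::field \<Rightarrow> ('x \<Rightarrow>\<^sub>0 'k) \<Rightarrow> 'x \<Rightarrow>\<^sub>0 'k" where
  "cmul c p = Poly_Mapping.map ((*) c) p"

text \<open>One type of chains serves all complexes: degree parts, subcomplexes and summands are cut
  out of it by subsets of the basis.\<close>

definition Lin :: "'x set \<Rightarrow> ('x \<Rightarrow>\<^sub>0 'k::field) set" where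
  "Lin A = {p. Poly_Mapping.keys p \<subseteq> A}"

definition lext :: "('x \<Rightarrow> 'y \<Rightarrow>\<^sub>0 'k::field) \<Rightarrow> ('x \<Rightarrow>\<^sub>0 'k) \<Rightarrow> 'y \<Rightarrow>\<^sub>0 'k" where
  "lext \<phi> p = (\<Sum>x\<in>Poly_Mapping.keys p. cmul (lookup p x) (\<phi> x))"

definition pmap :: "('x \<Rightarrow> 'y) \<Rightarrow> ('x \<Rightarrow>\<^sub>0 'k::field) \<Rightarrow> 'y \<Rightarrow>\<^sub>0 'k" where
  "pmap g = lext (\<lambda>x. bas (g x))"

lemma lookup_cmul [simp]: "lookup (cmul c p) x = c * lookup p x"
  by (simp add: cmul_def Poly_Mapping.map.rep_eq when_def)

lemma cmul_add: "cmul c (p + q) = cmul c p + cmul c q"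
  by (rule poly_mapping_eqI) (simp add: lookup_add algebra_simps)

lemma cmul_add_left: "cmul (c + d) p = cmul c p + cmul d p"
  by (rule poly_mapping_eqI) (simp add: lookup_add algebra_simps)

lemma cmul_diff: "cmul c (p - q) = cmul c p - cmul c q"
  by (rule poly_mapping_eqI) (simp add: lookup_minus algebra_simps)

lemma cmul_uminus: "cmul c (- p) = - cmul c p"
  by (rule poly_mapping_eqI) simp

lemma cmul_uminus_left: "cmul (- c) p = - cmul c p"
  by (rule poly_mapping_eqI) simp

lemma cmul_zero [simp]: "cmul c 0 = 0" "cmul 0 p = 0"
  by (rule poly_mapping_eqI, simp)+

lemma cmul_one [simp]: "cmul 1 p = p"
  by (rule poly_mapping_eqI) simp

lemma cmul_minus_one [simp]: "cmul (- 1) p = - p"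
  by (rule poly_mapping_eqI) simp

lemma cmul_cmul [simp]: "cmul c (cmul d p) = cmul (c * d) p"
  by (rule poly_mapping_eqI) simp

lemma cmul_sum: "cmul c (sum f I) = (\<Sum>i\<in>I. cmul c (f i))"
  by (rule poly_mapping_eqI) (simp add: lookup_sum sum_distrib_left)

lemma cmul_sum_left: "cmul (sum f I) p = (\<Sum>i\<in>I. cmul (f i) p)"
  by (rule poly_mapping_eqI) (simp add: lookup_sum sum_distrib_right)

lemma keys_cmul: "Poly_Mapping.keys (cmul c p) \<subseteq> Poly_Mapping.keys p"
  by (auto simp: in_keys_iff)

lemma lext_superset:
  assumes "finite A" "Poly_Mapping.keys p \<subseteq> A"
  shows "lext \<phi> p = (\<Sum>x\<in>A. cmul (lookup p x) (\<phi> x))"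
  unfolding lext_def using assms
  by (intro sum.mono_neutral_left) (auto simp: in_keys_iff)

lemma lext_add: "lext \<phi> (p + q) = lext \<phi> p + lext \<phi> q"
proof -
  let ?A = "Poly_Mapping.keys p \<union> Poly_Mapping.keys q"
  have "lext \<phi> (p + q) = (\<Sum>x\<in>?A. cmul (lookup (p + q) x) (\<phi> x))"
    using keys_add[of p q] by (intro lext_superset) auto
  also have "\<dots> = lext \<phi> p + lext \<phi> q"
    by (subst (1 2) lext_superset[where A = ?A])
      (auto simp: lookup_add cmul_add_left sum.distrib)
  finally show ?thesis .
qed

lemma lext_cmul: "lext \<phi> (cmul c p) = cmul c (lext \<phi> p)"
  by (subst lext_superset[OF _ keys_cmul]) (auto simp: lext_def cmul_sum)

lemma lext_zero [simp]: "lext \<phi> 0 = 0"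
  by (simp add: lext_def)

lemma lext_uminus: "lext \<phi> (- p) = - lext \<phi> p"
  using lext_cmul[of \<phi> "- 1" p] by simp

lemma lext_diff: "lext \<phi> (p - q) = lext \<phi> p - lext \<phi> q"
  using lext_add[of \<phi> p "- q"] by (simp add: lext_uminus)

lemma lext_sum: "lext \<phi> (sum f I) = (\<Sum>i\<in>I. lext \<phi> (f i))"
  by (induction I rule: infinite_finite_induct) (auto simp: lext_add)

lemma lext_bas [simp]: "lext \<phi> (bas x) = \<phi> x"
  by (simp add: lext_def)

lemmas lext_lin = lext_add lext_cmul lext_uminus lext_diff lext_sum

lemma lext_cong: "(\<And>x. x \<in> Poly_Mapping.keys p \<Longrightarrow> \<phi> x = \<psi> x) \<Longrightarrow> lext \<phi> p = lext \<psi> p"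
  by (simp add: lext_def)

lemma lext_cong_on: "p \<in> Lin A \<Longrightarrow> (\<And>x. x \<in> A \<Longrightarrow> \<phi> x = \<psi> x) \<Longrightarrow> lext \<phi> p = lext \<psi> p"
  by (rule lext_cong) (auto simp: Lin_def)

lemma lext_lext: "lext \<phi> (lext \<psi> p) = lext (\<lambda>x. lext \<phi> (\<psi> x)) p"
  by (simp add: lext_def[of \<psi>] lext_sum lext_cmul) (simp add: lext_def[of "\<lambda>x. lext \<phi> (\<psi> x)"])

lemma lext_fun_add: "lext (\<lambda>x. \<phi> x + \<psi> x) p = lext \<phi> p + lext \<psi> p"
  by (simp add: lext_def cmul_add sum.distrib)

lemma lext_fun_diff: "lext (\<lambda>x. \<phi> x - \<psi> x) p = lext \<phi> p - lext \<psi> p"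
  by (simp add: lext_def cmul_diff sum_subtractf)

lemma lext_fun_uminus: "lext (\<lambda>x. - \<phi> x) p = - lext \<phi> p"
  by (simp add: lext_def cmul_uminus sum_negf)

lemma lext_fun_cmul: "lext (\<lambda>x. cmul c (\<phi> x)) p = cmul c (lext \<phi> p)"
  by (simp add: lext_def cmul_sum mult.commute)

lemma lext_fun_zero [simp]: "lext (\<lambda>x. 0) p = 0"
  by (simp add: lext_def)

lemma lext_fun_sum: "lext (\<lambda>x. \<Sum>i\<in>I. \<phi> i x) p = (\<Sum>i\<in>I. lext (\<phi> i) p)"
  by (induction I rule: infinite_finite_induct) (auto simp: lext_fun_add)

lemma lookup_lext: "lookup (lext \<phi> p) y = (\<Sum>x\<in>Poly_Mapping.keys p. lookup p x * lookup (\<phi> x) y)"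
  by (simp add: lext_def lookup_sum)

lemma lext_bas_id [simp]: "lext bas p = p"
proof (rule poly_mapping_eqI)
  fix y
  have "lookup (lext bas p) y = (\<Sum>x\<in>Poly_Mapping.keys p. if x = y then lookup p x else 0)"
    unfolding lookup_lext by (intro sum.cong) (auto simp: lookup_single)
  also have "\<dots> = lookup p y"
    by (simp add: sum.delta in_keys_iff)
  finally show "lookup (lext bas p) y = lookup p y" .
qed

lemma chain_decomp: "p = (\<Sum>x\<in>Poly_Mapping.keys p. cmul (lookup p x) (bas x))"
  by (rule trans[OF lext_bas_id[symmetric]]) (simp only: lext_def)

lemma LinI: "Poly_Mapping.keys p \<subseteq> A \<Longrightarrow> p \<in> Lin A"
  by (simp add: Lin_def)

lemma Lin_bas [simp]: "bas x \<in> (Lin A :: ('x \<Rightarrow>\<^sub>0 'k::field) set) \<longleftrightarrow> x \<in> A"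
  by (simp add: Lin_def)

lemma Lin_zero [simp]: "0 \<in> Lin A"
  by (simp add: Lin_def)

lemma Lin_empty [simp]: "p \<in> Lin {} \<longleftrightarrow> p = 0"
  by (auto simp: Lin_def poly_mapping_eq_iff fun_eq_iff in_keys_iff)

lemma Lin_add: "p \<in> Lin A \<Longrightarrow> q \<in> Lin A \<Longrightarrow> p + q \<in> Lin A"
  using keys_add[of p q] by (auto simp: Lin_def)

lemma Lin_cmul: "p \<in> Lin A \<Longrightarrow> cmul c p \<in> Lin A"
  using keys_cmul[of c p] by (auto simp: Lin_def)

lemma Lin_uminus: "p \<in> Lin A \<Longrightarrow> - p \<in> Lin A"
  using Lin_cmul[of p A "- 1"] by simp

lemma Lin_diff: "p \<in> Lin A \<Longrightarrow> q \<in> Lin A \<Longrightarrow> p - q \<in> Lin A"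
  using Lin_add[of p A "- q"] by (simp add: Lin_uminus)

lemma Lin_sum: "(\<And>i. i \<in> I \<Longrightarrow> f i \<in> Lin A) \<Longrightarrow> sum f I \<in> Lin A"
  by (induction I rule: infinite_finite_induct) (auto simp: Lin_add)

lemma Lin_lext:
  "p \<in> Lin A \<Longrightarrow> (\<And>x. x \<in> A \<Longrightarrow> \<phi> x \<in> Lin C) \<Longrightarrow> lext \<phi> p \<in> Lin C"
  unfolding lext_def by (intro Lin_sum Lin_cmul) (auto simp: Lin_def)

lemma Lin_mono: "p \<in> Lin A \<Longrightarrow> A \<subseteq> C \<Longrightarrow> p \<in> Lin C"
  by (auto simp: Lin_def)

lemma lext_eqI: "(\<And>x. x \<in> A \<Longrightarrow> \<phi> x = 0) \<Longrightarrow> p \<in> Lin A \<Longrightarrow> lext \<phi> p = 0"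
  using lext_cong_on[of p A \<phi> "\<lambda>_. 0"] by simp

lemma pmap_bas [simp]: "pmap g (bas x) = bas (g x)"
  by (simp add: pmap_def)

lemma pmap_zero [simp]: "pmap g 0 = 0"
  by (simp add: pmap_def)

lemma pmap_add: "pmap g (p + q) = pmap g p + pmap g q"
  and pmap_cmul: "pmap g (cmul c p) = cmul c (pmap g p)"
  and pmap_uminus: "pmap g (- p) = - pmap g p"
  and pmap_diff: "pmap g (p - q) = pmap g p - pmap g q"
  and pmap_sum: "pmap g (sum f I) = (\<Sum>i\<in>I. pmap g (f i))"
  by (simp_all add: pmap_def lext_lin)

lemmas pmap_lin = pmap_add pmap_cmul pmap_uminus pmap_diff pmap_sum

lemma pmap_lext: "pmap g (lext \<phi> p) = lext (\<lambda>x. pmap g (\<phi> x)) p"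
  by (simp add: pmap_def lext_lext)

lemma lext_pmap: "lext \<phi> (pmap g p) = lext (\<lambda>x. \<phi> (g x)) p"
  by (simp add: pmap_def lext_lext)

lemma pmap_pmap: "pmap g (pmap h p) = pmap (\<lambda>x. g (h x)) p"
  by (simp add: pmap_def lext_lext)

lemma pmap_cong_on: "p \<in> Lin A \<Longrightarrow> (\<And>x. x \<in> A \<Longrightarrow> g x = h x) \<Longrightarrow> pmap g p = pmap h p"
  unfolding pmap_def by (rule lext_cong_on) auto

lemma pmap_id [simp]: "pmap (\<lambda>x. x) p = p"
  by (simp add: pmap_def)

lemma Lin_pmap: "p \<in> Lin A \<Longrightarrow> (\<And>x. x \<in> A \<Longrightarrow> g x \<in> C) \<Longrightarrow> pmap g p \<in> Lin C"
  unfolding pmap_def by (rule Lin_lext) auto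

lemma pmap_surj:
  assumes "p \<in> Lin (g ` A)"
  shows "\<exists>q\<in>Lin A. pmap g q = p"
proof (intro bexI)
  define s where "s y = (SOME x. x \<in> A \<and> g x = y)" for y
  have s: "s y \<in> A \<and> g (s y) = y" if "y \<in> g ` A" for y
    unfolding s_def by (rule someI_ex) (use that in blast)
  show "pmap s p \<in> Lin A"
    by (rule Lin_pmap[OF assms]) (use s in blast)
  show "pmap g (pmap s p) = p"
    using pmap_cong_on[OF assms, of "\<lambda>x. g (s x)" "\<lambda>x. x"] s by (simp add: pmap_pmap)
qed

lemma Lin_induct [consumes 1, case_names add bas]:
  assumes "p \<in> Lin A"
    and "\<And>c x q. x \<in> A \<Longrightarrow> P q \<Longrightarrow> q \<in> Lin A \<Longrightarrow> P (cmul c (bas x) + q)" and "P 0"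
  shows "P p"
proof -
  have "P (\<Sum>x\<in>F. cmul (f x) (bas x)) \<and> (\<Sum>x\<in>F. cmul (f x) (bas x)) \<in> Lin A"
    if "finite F" "F \<subseteq> A" for F and f :: "'a \<Rightarrow> 'b"
    using that assms(2,3)
    by (induction F) (auto intro!: Lin_add Lin_cmul)
  from this[of "Poly_Mapping.keys p" "lookup p"] show ?thesis
    using assms(1) chain_decomp[of p] by (auto simp: Lin_def)
qed

section \<open>Based chain complexes\<close>

text \<open>The grading condition \<open>Suc (dg y) = dg x\<close> leaves no basis element below
  degree 0, so \<open>D\<close> vanishes there without a separate axiom.\<close>

locale based_complex =
  fixes S :: "'x set" and dg :: "'x \<Rightarrow> nat" and D :: "'x \<Rightarrow> 'x \<Rightarrow>\<^sub>0 'k::field"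
  assumes D_in: "x \<in> S \<Longrightarrow> D x \<in> Lin {y \<in> S. Suc (dg y) = dg x}"
    and DD: "x \<in> S \<Longrightarrow> lext D (D x) = 0"
begin

lemma lext_D_in:
  "p \<in> Lin {x \<in> S. dg x = n} \<Longrightarrow> lext D p \<in> Lin {y \<in> S. Suc (dg y) = n}"
  by (rule Lin_lext) (auto intro: Lin_mono[OF D_in])

lemma lext_DD: "p \<in> Lin S \<Longrightarrow> lext D (lext D p) = 0"
  unfolding lext_lext by (rule lext_eqI) (auto simp: DD)

end

text \<open>There is no augmentation: in degree 0 every chain has to be a boundary. This is the
  right notion for mapping cones, not for resolutions.\<close>

definition acyclic_on :: "'x set \<Rightarrow> ('x \<Rightarrow> nat) \<Rightarrow> ('x \<Rightarrow> 'x \<Rightarrow>\<^sub>0 'k::field) \<Rightarrow> bool" where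
  "acyclic_on S dg D \<longleftrightarrow> (\<forall>n. \<forall>a \<in> Lin {x \<in> S. dg x = n}. lext D a = 0 \<longrightarrow>
     (\<exists>b \<in> Lin {x \<in> S. dg x = Suc n}. lext D b = a))"

text \<open>The mapping cone of \<open>f\<close> is acyclic.\<close>

definition cone_exact ::
    "'x set \<Rightarrow> ('x \<Rightarrow> nat) \<Rightarrow> ('x \<Rightarrow> 'x \<Rightarrow>\<^sub>0 'k::field) \<Rightarrow>
     'y set \<Rightarrow> ('y \<Rightarrow> nat) \<Rightarrow> ('y \<Rightarrow> 'y \<Rightarrow>\<^sub>0 'k) \<Rightarrow> ('x \<Rightarrow> 'y \<Rightarrow>\<^sub>0 'k) \<Rightarrow> bool" where
  "cone_exact S dg D S' dg' D' f \<longleftrightarrow>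
     (\<forall>n. \<forall>a \<in> Lin {x \<in> S. Suc (dg x) = n}. \<forall>b \<in> Lin {y \<in> S'. dg' y = n}.
        lext D a = 0 \<longrightarrow> lext f a = lext D' b \<longrightarrow>
        (\<exists>a' \<in> Lin {x \<in> S. dg x = n}. \<exists>b' \<in> Lin {y \<in> S'. dg' y = Suc n}.
           lext D a' = a \<and> b = lext f a' + lext D' b'))"

text \<open>A based complex with a group acting on its basis, and the complex on the orbits.
  \<open>\<Gamma>\<close> need only be closed under composing actions; inverses are hidden in
  \<open>orbit\<close>, which is symmetric in \<open>x\<close> and \<open>y\<close>. The axiom
  \<open>pseudo_free\<close> weakens freeness: the action may have a kernel, but modulo the kernel
  it is free. This is the situation of \<open>Z\<close> acting on objects that only see a quotient
  of \<open>Z\<close>.\<close>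

locale orbit_complex = based_complex S dg D
  for S :: "'x set" and dg and D :: "'x \<Rightarrow> 'x \<Rightarrow>\<^sub>0 'k::field" +
  fixes q :: "'x \<Rightarrow> 'y" and \<Gamma> :: "'g set" and act :: "'g \<Rightarrow> 'x \<Rightarrow> 'x" and D' :: "'y \<Rightarrow> 'y \<Rightarrow>\<^sub>0 'k"
  assumes act_in: "g \<in> \<Gamma> \<Longrightarrow> x \<in> S \<Longrightarrow> act g x \<in> S"
    and act_deg: "g \<in> \<Gamma> \<Longrightarrow> x \<in> S \<Longrightarrow> dg (act g x) = dg x"
    and act_D: "g \<in> \<Gamma> \<Longrightarrow> x \<in> S \<Longrightarrow> D (act g x) = pmap (act g) (D x)"
    and act_comp: "g \<in> \<Gamma> \<Longrightarrow> h \<in> \<Gamma> \<Longrightarrow> \<exists>k\<in>\<Gamma>. \<forall>x\<in>S. act g (act h x) = act k x"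
    and pseudo_free: "g \<in> \<Gamma> \<Longrightarrow> h \<in> \<Gamma> \<Longrightarrow> x \<in> S \<Longrightarrow> act g x = act h x \<Longrightarrow> y \<in> S \<Longrightarrow> act g y = act h y"
    and orbit: "x \<in> S \<Longrightarrow> y \<in> S \<Longrightarrow> q x = q y \<Longrightarrow> \<exists>g\<in>\<Gamma>. y = act g x"
    and q_act: "g \<in> \<Gamma> \<Longrightarrow> x \<in> S \<Longrightarrow> q (act g x) = q x"
    and q_D: "x \<in> S \<Longrightarrow> D' (q x) = pmap q (D x)"
begin

definition rp :: "'y \<Rightarrow> 'x" where "rp y = (SOME x. x \<in> S \<and> q x = y)"
definition gg :: "'x \<Rightarrow> 'g" where "gg x = (SOME g. g \<in> \<Gamma> \<and> x = act g (rp (q x)))"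

lemma rp: "x \<in> S \<Longrightarrow> rp (q x) \<in> S \<and> q (rp (q x)) = q x"
  unfolding rp_def by (rule someI_ex) auto

lemma gg: "x \<in> S \<Longrightarrow> gg x \<in> \<Gamma> \<and> x = act (gg x) (rp (q x))"
  unfolding gg_def by (rule someI_ex) (use orbit rp in blast)

lemma deg_rp: "x \<in> S \<Longrightarrow> dg (rp (q x)) = dg x"
  by (metis act_deg gg rp)

definition fill :: "nat \<Rightarrow> ('x \<Rightarrow>\<^sub>0 'k) \<Rightarrow> ('x \<Rightarrow>\<^sub>0 'k)" where
  "fill n w = (SOME y. y \<in> Lin {x \<in> S. dg x = Suc n} \<and> lext D y = w)"

text \<open>\<open>hot (Suc n)\<close> is the degree \<open>n\<close> part of an equivariant contraction.\<close>

primrec hot :: "nat \<Rightarrow> 'x \<Rightarrow> ('x \<Rightarrow>\<^sub>0 'k)" where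
  "hot 0 = (\<lambda>x. 0)"
| "hot (Suc n) = (\<lambda>x. pmap (act (gg x))
     (fill n (bas (rp (q x)) - lext (hot n) (D (rp (q x))))))"

lemma lext_act:
  assumes "p \<in> Lin S" "g \<in> \<Gamma>"
  shows "lext D (pmap (act g) p) = pmap (act g) (lext D p)"
  using assms unfolding lext_pmap pmap_lext by (intro lext_cong_on[OF assms(1)]) (auto simp: act_D)

text \<open>Induction on the degree, where \<open>hot n\<close> is evaluated in degree
  \<open>n - 1\<close> and \<open>hot 0\<close> stands for degree -1. By the induction hypothesis
  \<open>bas r - lext (hot n) (D r)\<close> is a cycle for the representative \<open>r\<close> of an
  orbit, so it has a filling, and the filling is carried along the orbit. Equivariance holds because
  two group elements that send \<open>r\<close> to the same place act alike on the whole filling, by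
  \<open>pseudo_free\<close>.\<close>

lemma hot:
  assumes "acyclic_on S dg D"
  shows "x \<in> S \<Longrightarrow> Suc (dg x) = n \<Longrightarrow>
     hot n x \<in> Lin {x \<in> S. dg x = n} \<and> lext D (hot n x) = bas x - lext (hot (n - 1)) (D x) \<and>
     (\<forall>g\<in>\<Gamma>. hot n (act g x) = pmap (act g) (hot n x))"
proof (induction n arbitrary: x)
  case (Suc n)
  have IH: "z \<in> S \<Longrightarrow> Suc (dg z) = n \<Longrightarrow> hot n z \<in> Lin {x \<in> S. dg x = n}"
    "z \<in> S \<Longrightarrow> Suc (dg z) = n \<Longrightarrow> lext D (hot n z) = bas z - lext (hot (n - 1)) (D z)"
    "z \<in> S \<Longrightarrow> Suc (dg z) = n \<Longrightarrow> g \<in> \<Gamma> \<Longrightarrow> hot n (act g z) = pmap (act g) (hot n z)" for z g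
    using Suc.IH by blast+
  define r where "r = rp (q x)"
  have r: "r \<in> S" "dg r = n" "q r = q x"
    using Suc.prems rp deg_rp by (auto simp: r_def)
  define g where "g = gg x"
  have g: "g \<in> \<Gamma>" "x = act g r"
    using Suc.prems gg by (auto simp: r_def g_def)
  have Dr: "D r \<in> Lin {z \<in> S. Suc (dg z) = n}"
    using D_in[OF r(1)] r(2) by simp
  define w where "w = bas r - lext (hot n) (D r)"
  have "lext D (lext (hot n) (D r)) = lext (\<lambda>z. bas z - lext (hot (n - 1)) (D z)) (D r)"
    unfolding lext_lext by (rule lext_cong_on[OF Dr]) (use IH(2) in auto)
  also have "\<dots> = D r - lext (hot (n - 1)) (lext D (D r))"
    by (simp add: lext_fun_diff lext_lext)
  finally have "lext D w = 0"
    by (simp add: w_def lext_diff DD[OF r(1)])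
  moreover have "w \<in> Lin {x \<in> S. dg x = n}"
    unfolding w_def using r by (intro Lin_diff Lin_lext[OF Dr]) (auto simp: IH(1))
  ultimately have "\<exists>y. y \<in> Lin {x \<in> S. dg x = Suc n} \<and> lext D y = w"
    using assms unfolding acyclic_on_def by blast
  then have f: "fill n w \<in> Lin {x \<in> S. dg x = Suc n}" "lext D (fill n w) = w"
    unfolding fill_def by (metis (mono_tags, lifting) someI_ex)+
  then have fS: "fill n w \<in> Lin S"
    by (auto intro: Lin_mono)
  have h: "hot (Suc n) x = pmap (act g) (fill n w)"
    by (simp add: g_def w_def r_def)
  have 1: "hot (Suc n) x \<in> Lin {x \<in> S. dg x = Suc n}"
    unfolding h by (rule Lin_pmap[OF f(1)]) (use g act_in act_deg in auto)
  have "lext D (hot (Suc n) x) = pmap (act g) w"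
    by (simp only: h lext_act[OF fS g(1)] f)
  also have "\<dots> = bas x - pmap (act g) (lext (hot n) (D r))"
    by (simp add: w_def pmap_diff g(2))
  also have "pmap (act g) (lext (hot n) (D r)) = lext (hot n) (pmap (act g) (D r))"
    unfolding pmap_lext lext_pmap by (rule lext_cong_on[OF Dr]) (use IH(3) g in auto)
  also have "pmap (act g) (D r) = D x"
    using act_D g r by simp
  finally have 2: "lext D (hot (Suc n) x) = bas x - lext (hot n) (D x)" .
  have 3: "hot (Suc n) (act h x) = pmap (act h) (hot (Suc n) x)" if hG: "h \<in> \<Gamma>" for h
  proof -
    have hx: "act h x \<in> S" "q (act h x) = q x"
      using hG Suc.prems act_in q_act by auto
    define g' where "g' = gg (act h x)"
    have g': "g' \<in> \<Gamma>" "act h x = act g' r"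
      using gg[OF hx(1)] hx(2) by (auto simp: g'_def r_def)
    obtain k where k: "k \<in> \<Gamma>" "\<And>z. z \<in> S \<Longrightarrow> act h (act g z) = act k z"
      using act_comp[OF hG g(1)] by blast
    have "act g' r = act k r"
      using k(2)[OF r(1)] g' g by simp
    then have "act g' z = act h (act g z)" if "z \<in> S" for z
      using pseudo_free[OF g'(1) k(1) r(1) _ that] k(2)[OF that] by simp
    then have "pmap (act g') (fill n w) = pmap (act h) (pmap (act g) (fill n w))"
      unfolding pmap_pmap by (rule pmap_cong_on[OF fS])
    then show ?thesis
      unfolding h by (simp add: hx g'_def w_def r_def)
  qed
  show ?case
    using 1 2 3 by simp
qed simp

text \<open>A lift \<open>c\<close> of the cycle \<open>a\<close> need not be a cycle, and the
  contraction of \<open>c\<close> has boundary \<open>c\<close> minus the contraction of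
  \<open>lext D c\<close>. The projection of that error term depends only on the projection of
  \<open>lext D c\<close>, which is 0.\<close>

lemma acyclic_quotient:
  assumes "acyclic_on S dg D" and a: "a \<in> Lin (q ` {x \<in> S. dg x = n})" and "lext D' a = 0"
  shows "\<exists>b \<in> Lin (q ` {x \<in> S. dg x = Suc n}). lext D' b = a"
proof -
  have lift: "lext D' (pmap q p) = pmap q (lext D p)" if "p \<in> Lin S" for p
    unfolding lext_pmap pmap_lext by (rule lext_cong_on[OF that]) (auto simp: q_D)
  obtain c where c: "c \<in> Lin {x \<in> S. dg x = n}" "pmap q c = a"
    using pmap_surj[OF a] by blast
  have cS: "c \<in> Lin S" using c(1) by (rule Lin_mono) auto
  define W where "W = lext (hot (Suc n)) c"
  have W: "W \<in> Lin {x \<in> S. dg x = Suc n}"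
    unfolding W_def by (rule Lin_lext[OF c(1)]) (use hot[OF assms(1)] in blast)
  have WS: "W \<in> Lin S" using W by (rule Lin_mono) auto
  have "lext D W = lext (\<lambda>x. bas x - lext (hot n) (D x)) c"
    unfolding W_def lext_lext by (rule lext_cong_on[OF c(1)]) (use hot[OF assms(1), of _ "Suc n"] in auto)
  also have "\<dots> = c - lext (hot n) (lext D c)"
    by (simp add: lext_fun_diff lext_lext)
  finally have DW: "lext D W = c - lext (hot n) (lext D c)" .
  have Dc: "lext D c \<in> Lin {y \<in> S. Suc (dg y) = n}"
    by (rule lext_D_in[OF c(1)])
  \<comment> \<open>Equivariance at work: up to orbits, \<open>hot n\<close> at \<open>x\<close>
    agrees with \<open>hot n\<close> at the representative of \<open>x\<close>, so it factors
    through \<open>q\<close>.\<close>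
  have "pmap q (lext (hot n) (lext D c)) = lext (\<lambda>y. pmap q (hot n (rp y))) (pmap q (lext D c))"
    unfolding pmap_lext[of _ "hot n"] lext_pmap[of _ q]
  proof (rule lext_cong_on[OF Dc])
    fix x assume "x \<in> {y \<in> S. Suc (dg y) = n}"
    then have x: "x \<in> S" "Suc (dg x) = n" by auto
    let ?r = "rp (q x)"
    have r: "?r \<in> S" "Suc (dg ?r) = n" using x rp deg_rp by auto
    have "hot n x = pmap (act (gg x)) (hot n ?r)"
      using hot[OF assms(1) r] gg[OF x(1)] by metis
    then have "pmap q (hot n x) = pmap (\<lambda>z. q (act (gg x) z)) (hot n ?r)"
      by (simp add: pmap_pmap)
    also have "\<dots> = pmap q (hot n ?r)"
      by (rule pmap_cong_on[of _ "{x \<in> S. dg x = n}"])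
        (use hot[OF assms(1) r] gg[OF x(1)] q_act in auto)
    finally show "pmap q (hot n x) = pmap q (hot n ?r)" .
  qed
  also have "pmap q (lext D c) = 0"
    using lift[OF cS] c(2) assms(3) by simp
  finally have "lext D' (pmap q W) = a"
    by (simp add: lift[OF WS] DW pmap_diff c(2))
  moreover have "pmap q W \<in> Lin (q ` {x \<in> S. dg x = Suc n})"
    by (rule Lin_pmap[OF W]) auto
  ultimately show ?thesis by blast
qed

end

text \<open>An element of the mapping cone of degree \<open>n\<close> is a pair of chains of degrees \<open>n - 1\<close> and \<open>n\<close>,
  encoded by the basis \<open>S + S'\<close>.\<close>

definition cone_deg :: "('x \<Rightarrow> nat) \<Rightarrow> ('y \<Rightarrow> nat) \<Rightarrow> 'x + 'y \<Rightarrow> nat" where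
  "cone_deg dg dg' = case_sum (\<lambda>x. Suc (dg x)) dg'"

text \<open>The minus sign in front of \<open>D\<close> makes the square vanish when
  \<open>f\<close> is a chain map.\<close>

definition cone_diff :: "('x \<Rightarrow> 'x \<Rightarrow>\<^sub>0 'k::field) \<Rightarrow> ('y \<Rightarrow> 'y \<Rightarrow>\<^sub>0 'k) \<Rightarrow> ('x \<Rightarrow> 'y \<Rightarrow>\<^sub>0 'k) \<Rightarrow>
    'x + 'y \<Rightarrow> 'x + 'y \<Rightarrow>\<^sub>0 'k" where
  "cone_diff D D' f = case_sum (\<lambda>x. pmap Inr (f x) - pmap Inl (D x)) (\<lambda>y. pmap Inr (D' y))"

definition getl :: "('x + 'y \<Rightarrow>\<^sub>0 'k::field) \<Rightarrow> 'x \<Rightarrow>\<^sub>0 'k" where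
  "getl = lext (case_sum bas (\<lambda>_. 0))"
definition getr :: "('x + 'y \<Rightarrow>\<^sub>0 'k::field) \<Rightarrow> 'y \<Rightarrow>\<^sub>0 'k" where
  "getr = lext (case_sum (\<lambda>_. 0) bas)"

lemma get_simps [simp]:
  "getl (pmap Inl a) = a" "getl (pmap Inr b) = 0" "getr (pmap Inl a) = 0" "getr (pmap Inr b) = b"
  by (simp_all add: getl_def getr_def lext_pmap)

lemma get_lin: "getl (p + p') = getl p + getl p'" "getl (p - p') = getl p - getl p'" "getl (- p) = - getl p"
  "getr (p + p') = getr p + getr p'" "getr (p - p') = getr p - getr p'" "getr (- p) = - getr p"
  by (simp_all add: getl_def getr_def lext_lin)

lemma get_decomp: "pmap Inl (getl p) + pmap Inr (getr p) = p"
proof -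
  have "pmap Inl (getl p) + pmap Inr (getr p)
      = lext (\<lambda>z. pmap Inl (case_sum bas (\<lambda>_. 0) z) + pmap Inr (case_sum (\<lambda>_. 0) bas z)) p"
    by (simp add: getl_def getr_def pmap_lext lext_fun_add)
  also have "\<dots> = lext bas p"
    by (rule lext_cong) (auto split: sum.splits)
  finally show ?thesis by simp
qed

lemma lext_cone_diff:
  "lext (cone_diff D D' f) (pmap Inl a + pmap Inr b)
   = pmap Inr (lext f a + lext D' b) - pmap Inl (lext D a)"
  by (simp add: lext_add lext_pmap cone_diff_def lext_fun_diff pmap_add flip: pmap_lext)

lemma cone_eq_iff: "pmap Inl a + pmap Inr b = pmap Inl a' + pmap Inr b' \<longleftrightarrow> a = a' \<and> b = b'"
  using get_lin(1) get_lin(4) get_simps by (metis add.right_neutral add.left_neutral)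

lemma get_in:
  assumes "p \<in> Lin {z \<in> S <+> S'. cone_deg dg dg' z = n}"
  shows "getl p \<in> Lin {x \<in> S. Suc (dg x) = n}" "getr p \<in> Lin {x \<in> S'. dg' x = n}"
  unfolding getl_def getr_def
  by (rule Lin_lext[OF assms], auto simp: cone_deg_def)+

lemma put_in:
  assumes "a \<in> Lin {x \<in> S. Suc (dg x) = n}" "b \<in> Lin {x \<in> S'. dg' x = n}"
  shows "pmap Inl a + pmap Inr b \<in> Lin {z \<in> S <+> S'. cone_deg dg dg' z = n}"
  by (intro Lin_add Lin_pmap[OF assms(1)] Lin_pmap[OF assms(2)])
    (auto simp: cone_deg_def)

text \<open>A cycle of the cone is a pair with \<open>lext D a = 0\<close> and
  \<open>lext f a + lext D' b = 0\<close>, while \<open>cone_exact\<close> is phrased with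
  \<open>lext f a = lext D' b\<close>. Hence the sign changes of \<open>b\<close>, \<open>a'\<close>
  and \<open>b'\<close> in both directions.\<close>

lemma cone_exact_iff_acyclic:
  "cone_exact S dg D S' dg' D' f \<longleftrightarrow> acyclic_on (S <+> S') (cone_deg dg dg') (cone_diff D D' f)"
proof
  assume *: "cone_exact S dg D S' dg' D' f"
  show "acyclic_on (S <+> S') (cone_deg dg dg') (cone_diff D D' f)"
    unfolding acyclic_on_def
  proof (intro allI ballI impI)
    fix n p assume p: "p \<in> Lin {x \<in> S <+> S'. cone_deg dg dg' x = n}"
      and 0: "lext (cone_diff D D' f) p = 0"
    define a b where "a = getl p" and "b = getr p"
    have ab: "a \<in> Lin {x \<in> S. Suc (dg x) = n}" "b \<in> Lin {x \<in> S'. dg' x = n}"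
      using get_in[OF p] by (auto simp: a_def b_def)
    have pe: "p = pmap Inl a + pmap Inr b" by (simp add: a_def b_def get_decomp)
    have "pmap Inl (- lext D a) + pmap Inr (lext f a + lext D' b) = pmap Inl 0 + pmap Inr 0"
      using 0 unfolding pe lext_cone_diff by (simp add: pmap_lin)
    then have "lext D a = 0" "lext f a + lext D' b = 0"
      unfolding cone_eq_iff by auto
    then have "lext D a = 0" "lext f a = lext D' (- b)" "- b \<in> Lin {x \<in> S'. dg' x = n}"
      using ab by (auto simp: lext_uminus Lin_uminus eq_neg_iff_add_eq_0)
    then obtain a' b' where a'b': "a' \<in> Lin {x \<in> S. dg x = n}" "b' \<in> Lin {y \<in> S'. dg' y = Suc n}"
      "lext D a' = a" "- b = lext f a' + lext D' b'"
      using * ab(1) unfolding cone_exact_def by blast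
    then have "b = - lext f a' - lext D' b'" by (metis minus_add_distrib minus_minus diff_conv_add_uminus)
    then have "lext (cone_diff D D' f) (pmap Inl (- a') + pmap Inr (- b')) = p"
      unfolding lext_cone_diff pe by (simp add: pmap_lin lext_lin a'b')
    moreover have "pmap Inl (- a') + pmap Inr (- b') \<in> Lin {x \<in> S <+> S'. cone_deg dg dg' x = Suc n}"
      using a'b' by (intro put_in) (auto intro: Lin_uminus)
    ultimately show "\<exists>b\<in>Lin {x \<in> S <+> S'. cone_deg dg dg' x = Suc n}. lext (cone_diff D D' f) b = p"
      by blast
  qed
next
  assume *: "acyclic_on (S <+> S') (cone_deg dg dg') (cone_diff D D' f)"
  show "cone_exact S dg D S' dg' D' f"
    unfolding cone_exact_def
  proof (intro allI ballI impI)
    fix n a b assume ab: "a \<in> Lin {x \<in> S. Suc (dg x) = n}" "b \<in> Lin {y \<in> S'. dg' y = n}"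
      and eq: "lext D a = 0" "lext f a = lext D' b"
    define p where "p = pmap Inl a + pmap Inr (- b)"
    have "p \<in> Lin {x \<in> S <+> S'. cone_deg dg dg' x = n}"
      unfolding p_def using ab by (intro put_in) (auto intro: Lin_uminus)
    moreover have "lext (cone_diff D D' f) p = 0"
      unfolding p_def lext_cone_diff by (simp add: eq lext_uminus)
    ultimately obtain r where r: "r \<in> Lin {x \<in> S <+> S'. cone_deg dg dg' x = Suc n}"
      "lext (cone_diff D D' f) r = p"
      using * unfolding acyclic_on_def by blast
    define a' b' where "a' = - getl r" and "b' = - getr r"
    have re: "r = pmap Inl (- a') + pmap Inr (- b')" by (simp add: a'_def b'_def get_decomp)
    have "pmap Inl (lext D a') + pmap Inr (- lext f a' - lext D' b') = pmap Inl a + pmap Inr (- b)"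
      using r(2) unfolding re lext_cone_diff p_def by (simp add: pmap_lin lext_lin add.commute)
    then have "lext D a' = a" "b = lext f a' + lext D' b'"
      unfolding cone_eq_iff by (auto simp: algebra_simps)
    moreover have "a' \<in> Lin {x \<in> S. dg x = n}" "b' \<in> Lin {y \<in> S'. dg' y = Suc n}"
      using get_in[OF r(1)] by (auto simp: a'_def b'_def intro: Lin_uminus)
    ultimately show "\<exists>a'\<in>Lin {x \<in> S. dg x = n}. \<exists>b'\<in>Lin {y \<in> S'. dg' y = Suc n}.
        lext D a' = a \<and> b = lext f a' + lext D' b'" by blast
  qed
qed

text \<open>The cone is itself an orbit complex for the action on both summands, so
  \<open>acyclic_quotient\<close> applies to it. The assumptions \<open>free1\<close> and
  \<open>free2\<close> say that two group elements agree on one summand exactly when they agree on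
  the other; without this the cone would not be pseudo-free although both summands are.\<close>

lemma cone_exact_quotient:
  fixes f :: "'x \<Rightarrow> 'y \<Rightarrow>\<^sub>0 'k::field" and \<Gamma> :: "'g set"
  assumes P: "orbit_complex S dg D q \<Gamma> act Dq" and Q: "orbit_complex S' dg' D' q' \<Gamma> act' Dq'"
    and f_in: "\<And>x. x \<in> S \<Longrightarrow> f x \<in> Lin {y \<in> S'. dg' y = dg x}"
    and chain: "\<And>x. x \<in> S \<Longrightarrow> lext f (D x) = lext D' (f x)"
    and equiv: "\<And>g x. g \<in> \<Gamma> \<Longrightarrow> x \<in> S \<Longrightarrow> f (act g x) = pmap (act' g) (f x)"
    and comp: "\<And>g h. g \<in> \<Gamma> \<Longrightarrow> h \<in> \<Gamma> \<Longrightarrow> \<exists>k\<in>\<Gamma>. (\<forall>x\<in>S. act g (act h x) = act k x) \<and> (\<forall>y\<in>S'. act' g (act' h y) = act' k y)"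
    and free1: "\<And>g h x y. g \<in> \<Gamma> \<Longrightarrow> h \<in> \<Gamma> \<Longrightarrow> x \<in> S \<Longrightarrow> act g x = act h x \<Longrightarrow> y \<in> S' \<Longrightarrow> act' g y = act' h y"
    and free2: "\<And>g h x y. g \<in> \<Gamma> \<Longrightarrow> h \<in> \<Gamma> \<Longrightarrow> y \<in> S' \<Longrightarrow> act' g y = act' h y \<Longrightarrow> x \<in> S \<Longrightarrow> act g x = act h x"
    and fq: "\<And>x. x \<in> S \<Longrightarrow> fq (q x) = pmap q' (f x)"
    and dq: "\<And>x. x \<in> S \<Longrightarrow> dgq (q x) = dg x" and dq': "\<And>y. y \<in> S' \<Longrightarrow> dgq' (q' y) = dg' y"
    and ex: "cone_exact S dg D S' dg' D' f"
  shows "cone_exact (q ` S) dgq Dq (q' ` S') dgq' Dq' fq"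
proof -
  interpret P: orbit_complex S dg D q \<Gamma> act Dq by fact
  interpret Q: orbit_complex S' dg' D' q' \<Gamma> act' Dq' by fact
  define C where "C = S <+> S'"
  define cd where "cd = cone_deg dg dg'"
  define CD where "CD = cone_diff D D' f"
  define cq where "cq = map_sum q q'"
  define ca where "ca g = map_sum (act g) (act' g)" for g
  define CDq where "CDq = cone_diff Dq Dq' fq"
  have fS: "f x \<in> Lin S'" if "x \<in> S" for x using f_in[OF that] by (rule Lin_mono) auto
  have "orbit_complex C cd CD cq \<Gamma> ca CDq"
  proof
    fix z assume z: "z \<in> C"
    show "CD z \<in> Lin {y \<in> C. Suc (cd y) = cd z}"
    proof (cases z)
      case (Inl x)
      then have x: "x \<in> S" using z by (auto simp: C_def)
      show ?thesis unfolding CD_def cone_diff_def Inl C_def cd_def cone_deg_def sum.case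
        by (intro Lin_diff Lin_pmap[OF f_in[OF x]] Lin_pmap[OF P.D_in[OF x]]) auto
    next
      case (Inr y)
      then have y: "y \<in> S'" using z by (auto simp: C_def)
      show ?thesis unfolding CD_def cone_diff_def Inr C_def cd_def cone_deg_def sum.case
        by (intro Lin_pmap[OF Q.D_in[OF y]]) auto
    qed
    show "lext CD (CD z) = 0"
    proof (cases z)
      case (Inl x)
      then have x: "x \<in> S" using z by (auto simp: C_def)
      have "CD z = pmap Inl (- D x) + pmap Inr (f x)"
        by (simp add: CD_def cone_diff_def Inl pmap_lin)
      then show ?thesis
        unfolding CD_def by (simp only: lext_cone_diff) (simp add: lext_uminus chain[OF x] P.DD[OF x])
    next
      case (Inr y)
      then have y: "y \<in> S'" using z by (auto simp: C_def)
      have "CD z = pmap Inl 0 + pmap Inr (D' y)"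
        by (simp add: CD_def cone_diff_def Inr pmap_lin)
      then show ?thesis
        unfolding CD_def by (simp only: lext_cone_diff) (simp add: Q.DD[OF y])
    qed
    show "CDq (cq z) = pmap cq (CD z)"
      using z by (auto simp: C_def cq_def CDq_def CD_def cone_diff_def pmap_diff pmap_pmap P.q_D Q.q_D fq)
  next
    fix g z assume g: "g \<in> \<Gamma>" and z: "z \<in> C"
    show "ca g z \<in> C" using g z by (auto simp: C_def ca_def P.act_in Q.act_in)
    show "cd (ca g z) = cd z" using g z by (auto simp: C_def ca_def cd_def cone_deg_def P.act_deg Q.act_deg)
    show "cq (ca g z) = cq z" using g z by (auto simp: C_def ca_def cq_def P.q_act Q.q_act)
    show "CD (ca g z) = pmap (ca g) (CD z)"
      using g z by (auto simp: C_def ca_def CD_def cone_diff_def P.act_D Q.act_D equiv pmap_diff pmap_pmap)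
  next
    fix g h assume "g \<in> \<Gamma>" "h \<in> \<Gamma>"
    then show "\<exists>k\<in>\<Gamma>. \<forall>x\<in>C. ca g (ca h x) = ca k x"
      using comp[of g h] by (fastforce simp: C_def ca_def)
  next
    fix g h z z' assume g: "g \<in> \<Gamma>" "h \<in> \<Gamma>" and z: "z \<in> C" "ca g z = ca h z" "z' \<in> C"
    have "(\<forall>x\<in>S. act g x = act h x) \<and> (\<forall>y\<in>S'. act' g y = act' h y)"
    proof (cases z)
      case (Inl x)
      then have "x \<in> S" "act g x = act h x" using z by (auto simp: C_def ca_def)
      then show ?thesis using P.pseudo_free[OF g] free1[OF g] by blast
    next
      case (Inr y)
      then have "y \<in> S'" "act' g y = act' h y" using z by (auto simp: C_def ca_def)
      then show ?thesis using Q.pseudo_free[OF g] free2[OF g] by blast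
    qed
    then show "ca g z' = ca h z'"
      using z(3) by (auto simp: C_def ca_def)
  next
    fix x y assume "x \<in> C" "y \<in> C" "cq x = cq y"
    then show "\<exists>g\<in>\<Gamma>. y = ca g x"
      using P.orbit Q.orbit by (auto simp: C_def ca_def cq_def)
  qed
  then interpret C: orbit_complex C cd CD cq \<Gamma> ca CDq .
  have ac: "acyclic_on C cd CD"
    using ex unfolding cone_exact_iff_acyclic C_def cd_def CD_def .
  \<comment> \<open>The quotient maps respect degrees, so the images in
    \<open>acyclic_quotient\<close> are the degree parts of the cone of the quotients.\<close>
  have im: "cq ` {x \<in> C. cd x = n} = {z \<in> q ` S <+> q' ` S'. cone_deg dgq dgq' z = n}" for n
    by (auto simp: C_def cq_def cd_def cone_deg_def dq dq' image_iff Plus_def)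
      (auto simp: image_iff)
  show ?thesis
    unfolding cone_exact_iff_acyclic using C.acyclic_quotient[OF ac] unfolding im CDq_def acyclic_on_def by blast
qed

lemma cone_exactD:
  assumes "cone_exact S dg D S' dg' D' f" "a \<in> Lin {x \<in> S. Suc (dg x) = n}"
    "b \<in> Lin {y \<in> S'. dg' y = n}" "lext D a = 0" "lext f a = lext D' b"
  obtains a' b' where "a' \<in> Lin {x \<in> S. dg x = n}" "b' \<in> Lin {y \<in> S'. dg' y = Suc n}"
    "lext D a' = a" "b = lext f a' + lext D' b'"
  using assms unfolding cone_exact_def by blast

text \<open>Exactness of a resolution of the ground field, which is written
  \<open>unit \<Rightarrow>\<^sub>0 'k\<close>, with augmentation \<open>e\<close>. That
  \<open>e\<close> is onto and kills boundaries is not included; it is assumed separately where it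
  matters.\<close>

definition aug_acyclic ::
    "'x set \<Rightarrow> ('x \<Rightarrow> nat) \<Rightarrow> ('x \<Rightarrow> 'x \<Rightarrow>\<^sub>0 'k::field) \<Rightarrow> ('x \<Rightarrow> unit \<Rightarrow>\<^sub>0 'k) \<Rightarrow> bool" where
  "aug_acyclic S dg D e \<longleftrightarrow> (\<forall>n. \<forall>a \<in> Lin {x \<in> S. dg x = n}. lext D a = 0 \<longrightarrow>
     (n = 0 \<longrightarrow> lext e a = 0) \<longrightarrow> (\<exists>b \<in> Lin {x \<in> S. dg x = Suc n}. lext D b = a))"

lemma aug_acyclicD:
  assumes "aug_acyclic S dg D e" "a \<in> Lin {x \<in> S. dg x = n}" "lext D a = 0" "n = 0 \<Longrightarrow> lext e a = 0"
  obtains b where "b \<in> Lin {x \<in> S. dg x = Suc n}" "lext D b = a"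
  using assms(1)[unfolded aug_acyclic_def, rule_format, OF assms(2-4)] by blast

lemma unit_chain: "(p :: unit \<Rightarrow>\<^sub>0 'k::field) = cmul (lookup p ()) (bas ())"
  by (rule poly_mapping_eqI) simp

text \<open>A chain map between two resolutions that respects the augmentations has an acyclic cone.
  In positive degree, \<open>a\<close> has a preimage \<open>a'\<close> in the source and
  \<open>b - lext f a'\<close> is a cycle of the target, hence a boundary. In degree 0 one has
  \<open>a = 0\<close> and uses \<open>a'\<close> to adjust the augmentation of
  \<open>b\<close>.\<close>

lemma cone_exact_augmented:
  fixes f :: "'x \<Rightarrow> 'y \<Rightarrow>\<^sub>0 'k::field"
  assumes P: "based_complex S dg D" and Q: "based_complex S' dg' D'"
    and accP: "aug_acyclic S dg D e" and accQ: "aug_acyclic S' dg' D' e'"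
    and p0: "p0 \<in> Lin {x \<in> S. dg x = 0}" "lext e p0 = bas ()"
    and e'D: "\<And>y. y \<in> S' \<Longrightarrow> dg' y = 1 \<Longrightarrow> lext e' (D' y) = 0"
    and f_in: "\<And>x. x \<in> S \<Longrightarrow> f x \<in> Lin {y \<in> S'. dg' y = dg x}"
    and chain: "\<And>x. x \<in> S \<Longrightarrow> lext f (D x) = lext D' (f x)"
    and e'f: "\<And>x. x \<in> S \<Longrightarrow> dg x = 0 \<Longrightarrow> lext e' (f x) = e x"
  shows "cone_exact S dg D S' dg' D' f"
  unfolding cone_exact_def
proof (intro allI ballI impI)
  fix n a b assume a: "a \<in> Lin {x \<in> S. Suc (dg x) = n}" and b: "b \<in> Lin {y \<in> S'. dg' y = n}"
    and Da: "lext D a = 0" and fa: "lext f a = lext D' b"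
  interpret P: based_complex S dg D by fact
  interpret Q: based_complex S' dg' D' by fact
  have fin: "lext f p \<in> Lin {y \<in> S'. dg' y = m}" if "p \<in> Lin {x \<in> S. dg x = m}" for p m
    by (rule Lin_lext[OF that]) (auto intro: Lin_mono[OF f_in])
  have ch: "lext D' (lext f p) = lext f (lext D p)" if "p \<in> Lin {x \<in> S. dg x = m}" for p m
    unfolding lext_lext by (rule lext_cong_on[OF that]) (auto simp: chain)
  have ef: "lext e' (lext f p) = lext e p" if "p \<in> Lin {x \<in> S. dg x = 0}" for p
    unfolding lext_lext by (rule lext_cong_on[OF that]) (auto simp: e'f)
  show "\<exists>a'\<in>Lin {x \<in> S. dg x = n}. \<exists>b'\<in>Lin {y \<in> S'. dg' y = Suc n}.
          lext D a' = a \<and> b = lext f a' + lext D' b'"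
  proof (cases n)
    case 0
    then have a0: "a = 0" using a by simp
    \<comment> \<open>The multiple of \<open>p0\<close> whose augmentation is that of
      \<open>b\<close>.\<close>
    define a' where "a' = cmul (lookup (lext e' b) ()) p0"
    have a': "a' \<in> Lin {x \<in> S. dg x = 0}"
      using p0 by (simp add: a'_def Lin_cmul)
    have ea': "lext e a' = lext e' b"
      using p0 unit_chain[of "lext e' b"] by (simp add: a'_def lext_cmul)
    have Da': "lext D a' = 0"
      using P.lext_D_in[OF a'] by simp
    have 1: "b - lext f a' \<in> Lin {y \<in> S'. dg' y = 0}"
      using b 0 fin[OF a'] by (auto intro: Lin_diff)
    have 2: "lext D' (b - lext f a') = 0"
      using fa a0 by (simp add: lext_diff ch[OF a'] Da')
    have 3: "lext e' (b - lext f a') = 0"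
      by (simp add: lext_diff ef[OF a'] ea')
    obtain b' where b': "b' \<in> Lin {y \<in> S'. dg' y = Suc 0}" "lext D' b' = b - lext f a'"
      by (rule aug_acyclicD[OF accQ 1 2 3])
    then show ?thesis
      using a' a0 Da' 0 by (intro bexI[of _ a'] bexI[of _ b']) auto
  next
    case (Suc m)
    have am: "a \<in> Lin {x \<in> S. dg x = m}" using a Suc by simp
    \<comment> \<open>Here \<open>a\<close> sits in degree 0, and its augmentation equals that of
      the boundary \<open>lext D' b\<close>.\<close>
    have "lext e a = 0" if "m = 0"
    proof -
      have "lext e a = lext e' (lext D' b)" using ef[of a] am that fa by simp
      also have "\<dots> = 0"
        unfolding lext_lext by (rule lext_eqI[OF _ b]) (use that Suc e'D in auto)
      finally show ?thesis .
    qed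
    then obtain a' where a': "a' \<in> Lin {x \<in> S. dg x = n}" "lext D a' = a"
      using aug_acyclicD[OF accP am Da, folded Suc] by blast
    have 1: "b - lext f a' \<in> Lin {y \<in> S'. dg' y = n}"
      using b fin[OF a'(1)] by (auto intro: Lin_diff)
    have 2: "lext D' (b - lext f a') = 0"
      using fa by (simp add: lext_diff ch[OF a'(1)] a'(2))
    obtain b' where b': "b' \<in> Lin {y \<in> S'. dg' y = Suc n}" "lext D' b' = b - lext f a'"
      by (rule aug_acyclicD[OF accQ 1 2]) (use Suc in auto)
    then show ?thesis
      using a' by (intro bexI[of _ a'] bexI[of _ b']) auto
  qed
qed

section \<open>Splitting a complex by an index on its basis\<close>

definition part :: "('x \<Rightarrow> 'j) \<Rightarrow> 'j \<Rightarrow> ('x \<Rightarrow>\<^sub>0 'k::field) \<Rightarrow> 'x \<Rightarrow>\<^sub>0 'k" where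
  "part idx j = lext (\<lambda>x. if idx x = j then bas x else 0)"

lemma part_in: "p \<in> Lin A \<Longrightarrow> part idx j p \<in> Lin {x \<in> A. idx x = j}"
  unfolding part_def by (erule Lin_lext) auto

lemma part_eq: "p \<in> Lin {x. idx x = i} \<Longrightarrow> part idx j p = (if i = j then p else 0)"
  using lext_cong_on[of p "{x. idx x = i}" "\<lambda>x. if idx x = j then bas x else 0" "\<lambda>x. if i = j then bas x else 0"]
  by (simp add: part_def)

lemma sum_part:
  assumes "finite J" "idx ` Poly_Mapping.keys p \<subseteq> J"
  shows "(\<Sum>j\<in>J. part idx j p) = p"
proof -
  have "(\<Sum>j\<in>J. part idx j p) = lext (\<lambda>x. \<Sum>j\<in>J. if idx x = j then bas x else 0) p"
    by (simp add: part_def lext_fun_sum)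
  also have "\<dots> = lext bas p"
    by (rule lext_cong) (use assms in auto)
  finally show ?thesis by simp
qed

lemma lext_part:
  assumes "p \<in> Lin S" "\<And>x. x \<in> S \<Longrightarrow> f x \<in> Lin {y. idx' y = idx x}"
  shows "lext f (part idx j p) = part idx' j (lext f p)"
proof -
  have "lext f (part idx j p) = lext (\<lambda>x. if idx x = j then f x else 0) p"
    unfolding part_def lext_lext by (rule lext_cong) auto
  also have "\<dots> = lext (\<lambda>x. part idx' j (f x)) p"
    by (rule lext_cong_on[OF assms(1)]) (simp add: part_eq[OF assms(2)])
  also have "\<dots> = part idx' j (lext f p)"
    by (simp add: part_def lext_lext)
  finally show ?thesis .
qed

text \<open>All maps preserve the index, so the problem splits into its components. Solutions are
  chosen for every index at once, but only the finitely many indices that occur in \<open>a\<close>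
  or \<open>b\<close> are summed.\<close>

lemma cone_exact_Union:
  fixes f :: "'x \<Rightarrow> 'y \<Rightarrow>\<^sub>0 'k::field"
  assumes D: "\<And>x. x \<in> S \<Longrightarrow> D x \<in> Lin {z. idx z = idx x}"
    and D': "\<And>y. y \<in> S' \<Longrightarrow> D' y \<in> Lin {z. idx' z = idx' y}"
    and f: "\<And>x. x \<in> S \<Longrightarrow> f x \<in> Lin {y. idx' y = idx x}"
    and ex: "\<And>j. cone_exact {x \<in> S. idx x = j} dg D {y \<in> S'. idx' y = j} dg' D' f"
  shows "cone_exact S dg D S' dg' D' f"
  unfolding cone_exact_def
proof (intro allI ballI impI)
  fix n a b assume a: "a \<in> Lin {x \<in> S. Suc (dg x) = n}" and b: "b \<in> Lin {y \<in> S'. dg' y = n}"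
    and Da: "lext D a = 0" and fa: "lext f a = lext D' b"
  have aS: "a \<in> Lin S" and bS: "b \<in> Lin S'"
    using a b by (auto intro: Lin_mono)
  have "\<forall>j. \<exists>z. fst z \<in> Lin {x \<in> {x \<in> S. idx x = j}. dg x = n} \<and>
      snd z \<in> Lin {y \<in> {y \<in> S'. idx' y = j}. dg' y = Suc n} \<and>
      lext D (fst z) = part idx j a \<and> part idx' j b = lext f (fst z) + lext D' (snd z)"
  proof
    fix j
    have 1: "part idx j a \<in> Lin {x \<in> {x \<in> S. idx x = j}. Suc (dg x) = n}"
      using part_in[OF a] by (rule Lin_mono) auto
    have 2: "part idx' j b \<in> Lin {x \<in> {x \<in> S'. idx' x = j}. dg' x = n}"
      using part_in[OF b] by (rule Lin_mono) auto
    have 3: "lext D (part idx j a) = 0"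
      using lext_part[OF aS D] Da by (simp add: part_def)
    have 4: "lext f (part idx j a) = lext D' (part idx' j b)"
      using lext_part[OF aS f] lext_part[OF bS D'] fa by simp
    obtain a' b' where "a' \<in> Lin {x \<in> {x \<in> S. idx x = j}. dg x = n}"
      "b' \<in> Lin {y \<in> {y \<in> S'. idx' y = j}. dg' y = Suc n}"
      "lext D a' = part idx j a" "part idx' j b = lext f a' + lext D' b'"
      by (rule cone_exactD[OF ex 1 2 3 4])
    then show "\<exists>z. fst z \<in> Lin {x \<in> {x \<in> S. idx x = j}. dg x = n} \<and>
      snd z \<in> Lin {y \<in> {y \<in> S'. idx' y = j}. dg' y = Suc n} \<and>
      lext D (fst z) = part idx j a \<and> part idx' j b = lext f (fst z) + lext D' (snd z)"
      by (intro exI[of _ "(a', b')"]) simp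
  qed
  from choice[OF this] obtain F where F: "\<forall>j. fst (F j) \<in> Lin {x \<in> {x \<in> S. idx x = j}. dg x = n} \<and>
      snd (F j) \<in> Lin {y \<in> {y \<in> S'. idx' y = j}. dg' y = Suc n} \<and>
      lext D (fst (F j)) = part idx j a \<and> part idx' j b = lext f (fst (F j)) + lext D' (snd (F j))" ..
  define A B where "A j = fst (F j)" and "B j = snd (F j)" for j
  have AB: "A j \<in> Lin {x \<in> {x \<in> S. idx x = j}. dg x = n}"
      "B j \<in> Lin {y \<in> {y \<in> S'. idx' y = j}. dg' y = Suc n}"
      "lext D (A j) = part idx j a" "part idx' j b = lext f (A j) + lext D' (B j)" for j
    using F[rule_format, of j] by (auto simp: A_def B_def)
  define J where "J = idx ` Poly_Mapping.keys a \<union> idx' ` Poly_Mapping.keys b"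
  have J: "(\<Sum>j\<in>J. part idx j a) = a" "(\<Sum>j\<in>J. part idx' j b) = b"
    by (rule sum_part; simp add: J_def)+
  show "\<exists>a'\<in>Lin {x \<in> S. dg x = n}. \<exists>b'\<in>Lin {y \<in> S'. dg' y = Suc n}.
        lext D a' = a \<and> b = lext f a' + lext D' b'"
  proof (intro bexI conjI)
    show "lext D (\<Sum>j\<in>J. A j) = a"
      by (simp add: lext_sum AB(3) J)
    show "b = lext f (\<Sum>j\<in>J. A j) + lext D' (\<Sum>j\<in>J. B j)"
      by (subst J(2)[symmetric]) (simp add: lext_sum AB(4) sum.distrib)
    show "(\<Sum>j\<in>J. A j) \<in> Lin {x \<in> S. dg x = n}"
      by (intro Lin_sum Lin_mono[OF AB(1)]) auto
    show "(\<Sum>j\<in>J. B j) \<in> Lin {y \<in> S'. dg' y = Suc n}"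
      by (intro Lin_sum Lin_mono[OF AB(2)]) auto
  qed
qed

section \<open>Cyclic operators and the double complex\<close>

lemma funpow_lext:
  fixes f :: "'a \<Rightarrow> 'a \<Rightarrow>\<^sub>0 'c::field"
  shows "(lext f ^^ i) p = lext (\<lambda>x. (lext f ^^ i) (bas x)) p"
proof (induction i)
  case (Suc i)
  have "(lext f ^^ Suc i) p = lext f (lext (\<lambda>x. (lext f ^^ i) (bas x)) p)"
    using Suc by simp
  then show ?case by (simp only: lext_lext funpow.simps o_apply)
qed simp

lemma minus_one_power_eq: "even (i + j) \<Longrightarrow> (-1 :: 'a::ring_1) ^ i = (-1) ^ j"
  by (metis even_add neg_one_even_power neg_one_odd_power)

text \<open>Bases of (pre)cyclic modules on which the faces are linear combinations of basis elements, and
  the cyclic operator is, up to sign, a map \<open>tau\<close> of the basis. The relation \<open>tau ^ (n + 1) = 1\<close>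
  is not required at this stage.\<close>

locale precyclic =
  fixes S :: "'x set" and dg :: "'x \<Rightarrow> nat" and face :: "nat \<Rightarrow> 'x \<Rightarrow> 'x \<Rightarrow>\<^sub>0 'k::field" and tau :: "'x \<Rightarrow> 'x"
  assumes face_in: "x \<in> S \<Longrightarrow> i \<le> dg x \<Longrightarrow> 0 < dg x \<Longrightarrow> face i x \<in> Lin {y \<in> S. Suc (dg y) = dg x}"
    and tau_in: "x \<in> S \<Longrightarrow> tau x \<in> S"
    and dg_tau: "x \<in> S \<Longrightarrow> dg (tau x) = dg x"
    and face_Suc_tau: "x \<in> S \<Longrightarrow> i < dg x \<Longrightarrow> face (Suc i) (tau x) = pmap tau (face i x)"
    and face_0_tau: "x \<in> S \<Longrightarrow> 0 < dg x \<Longrightarrow> face 0 (tau x) = face (dg x) x"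
begin

definition b :: "'x \<Rightarrow> 'x \<Rightarrow>\<^sub>0 'k" where
  "b x = (if dg x = 0 then 0 else \<Sum>i\<le>dg x. cmul ((-1) ^ i) (face i x))"

definition b' :: "'x \<Rightarrow> 'x \<Rightarrow>\<^sub>0 'k" where
  "b' x = (if dg x = 0 then 0 else \<Sum>i<dg x. cmul ((-1) ^ i) (face i x))"

definition t :: "'x \<Rightarrow> 'x \<Rightarrow>\<^sub>0 'k" where
  "t x = cmul ((-1) ^ dg x) (bas (tau x))"

definition N :: "'x \<Rightarrow> 'x \<Rightarrow>\<^sub>0 'k" where
  "N x = (\<Sum>i\<le>dg x. (lext t ^^ i) (bas x))"

lemma b_in: "x \<in> S \<Longrightarrow> b x \<in> Lin {y \<in> S. Suc (dg y) = dg x}"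
  unfolding b_def by (auto intro!: Lin_sum Lin_cmul face_in)

lemma b'_in: "x \<in> S \<Longrightarrow> b' x \<in> Lin {y \<in> S. Suc (dg y) = dg x}"
  unfolding b'_def by (auto intro!: Lin_sum Lin_cmul face_in)

lemma t_in: "x \<in> S \<Longrightarrow> t x \<in> Lin {y \<in> S. dg y = dg x}"
  unfolding t_def by (auto intro!: Lin_cmul simp: tau_in dg_tau)

lemma lext_b_in: "p \<in> Lin {x \<in> S. dg x = n} \<Longrightarrow> lext b p \<in> Lin {y \<in> S. Suc (dg y) = n}"
  by (rule Lin_lext) (auto intro: Lin_mono[OF b_in])

lemma lext_b'_in: "p \<in> Lin {x \<in> S. dg x = n} \<Longrightarrow> lext b' p \<in> Lin {y \<in> S. Suc (dg y) = n}"
  by (rule Lin_lext) (auto intro: Lin_mono[OF b'_in])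

lemma lext_t_in: "p \<in> Lin {x \<in> S. dg x = n} \<Longrightarrow> lext t p \<in> Lin {y \<in> S. dg y = n}"
  by (rule Lin_lext) (auto intro: Lin_mono[OF t_in])

lemma t_pow_in: "p \<in> Lin {x \<in> S. dg x = n} \<Longrightarrow> (lext t ^^ i) p \<in> Lin {y \<in> S. dg y = n}"
  by (induction i) (auto intro: lext_t_in)

lemma lext_t_eq: "p \<in> Lin {x \<in> S. dg x = n} \<Longrightarrow> lext t p = cmul ((-1) ^ n) (pmap tau p)"
  unfolding pmap_def lext_fun_cmul[symmetric] by (rule lext_cong_on) (auto simp: t_def)

lemma tau_pow_in: "x \<in> S \<Longrightarrow> (tau ^^ j) x \<in> S \<and> dg ((tau ^^ j) x) = dg x"
  by (induction j) (auto simp: tau_in dg_tau)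

lemma t_pow_bas: "x \<in> S \<Longrightarrow> (lext t ^^ j) (bas x) = cmul ((-1) ^ (dg x * j)) (bas ((tau ^^ j) x))"
proof (induction j)
  case (Suc j)
  then have "(lext t ^^ Suc j) (bas x) = cmul ((-1) ^ (dg x * j)) (t ((tau ^^ j) x))"
    by (simp add: lext_cmul)
  then show ?case
    using tau_pow_in[OF Suc.prems, of j] unfolding t_def[of "(tau ^^ j) x"]
    by (simp add: power_add mult.commute)
qed simp

lemma N_eq: "x \<in> S \<Longrightarrow> N x = (\<Sum>i\<le>dg x. cmul ((-1) ^ (dg x * i)) (bas ((tau ^^ i) x)))"
  unfolding N_def by (intro sum.cong) (auto simp: t_pow_bas)

lemma N_in: "x \<in> S \<Longrightarrow> N x \<in> Lin {y \<in> S. dg y = dg x}"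
  unfolding N_def by (intro Lin_sum t_pow_in) auto

lemma lext_N_in: "p \<in> Lin {x \<in> S. dg x = n} \<Longrightarrow> lext N p \<in> Lin {y \<in> S. dg y = n}"
  by (rule Lin_lext) (auto intro: Lin_mono[OF N_in])

lemma lext_N:
  assumes "p \<in> Lin {x \<in> S. dg x = n}"
  shows "lext N p = (\<Sum>i\<le>n. (lext t ^^ i) p)"
proof -
  have "lext N p = lext (\<lambda>x. \<Sum>i\<le>n. (lext t ^^ i) (bas x)) p"
    by (rule lext_cong_on[OF assms]) (simp add: N_def)
  then show ?thesis by (simp only: lext_fun_sum funpow_lext[symmetric])
qed

text \<open>Under \<open>tau\<close> face 0 turns into the last face and the other faces shift by
  one. With the sign of \<open>t\<close> the two last faces cancel, and what is left of
  \<open>b\<close> is \<open>b'\<close>.\<close>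

lemma b_t: "x \<in> S \<Longrightarrow> lext b (bas x - t x) = b' x - lext t (b' x)"
proof (cases "dg x = 0")
  case False
  assume x: "x \<in> S"
  obtain m where m: "dg x = Suc m" using False by (cases "dg x") auto
  have b'x: "b' x \<in> Lin {y \<in> S. dg y = m}"
    using b'_in[OF x] m by simp
  have "b (tau x) = (\<Sum>i\<le>dg x. cmul ((-1) ^ i) (face i (tau x)))"
    using False x by (simp add: b_def dg_tau)
  also have "\<dots> = face (dg x) x + (\<Sum>i\<le>m. cmul ((-1) ^ Suc i) (face (Suc i) (tau x)))"
    unfolding m by (subst sum.atMost_Suc_shift) (use face_0_tau[OF x] m in simp)
  also have "(\<Sum>i\<le>m. cmul ((-1) ^ Suc i) (face (Suc i) (tau x))) = - pmap tau (b' x)"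
    using False by (simp add: b'_def m lessThan_Suc_atMost pmap_sum pmap_cmul face_Suc_tau[OF x] cmul_uminus_left sum_negf)
  finally have "b (tau x) = face (dg x) x - pmap tau (b' x)" by simp
  moreover have "b x = b' x + cmul ((-1) ^ dg x) (face (dg x) x)"
    using False by (simp add: b_def b'_def lessThan_Suc_atMost[symmetric])
  ultimately show ?thesis
    unfolding lext_t_eq[OF b'x] lext_diff
    by (simp add: t_def lext_cmul lext_uminus cmul_diff cmul_add m cmul_uminus_left)
qed (simp add: b_def b'_def t_def lext_diff lext_cmul dg_tau)

lemma lext_b_t: "p \<in> Lin S \<Longrightarrow> lext b (p - lext t p) = lext b' p - lext t (lext b' p)"
proof -
  assume "p \<in> Lin S"
  then have "lext (\<lambda>x. lext b (bas x - t x)) p = lext (\<lambda>x. b' x - lext t (b' x)) p"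
    by (rule lext_cong_on) (rule b_t)
  then show ?thesis by (simp add: lext_fun_diff lext_diff lext_lext)
qed

lemma face_tau_pow_ge:
  "x \<in> S \<Longrightarrow> j \<le> i \<Longrightarrow> i \<le> dg x \<Longrightarrow> 0 < dg x \<Longrightarrow> face i ((tau ^^ j) x) = pmap (tau ^^ j) (face (i - j) x)"
proof (induction j arbitrary: i)
  case (Suc j)
  then obtain i' where i': "i = Suc i'" by (cases i) auto
  have "face i ((tau ^^ Suc j) x) = pmap tau (face i' ((tau ^^ j) x))"
    using Suc.prems tau_pow_in[of x j] i' by (simp add: face_Suc_tau)
  also have "\<dots> = pmap tau (pmap (tau ^^ j) (face (i' - j) x))"
    using Suc i' by simp
  finally show ?case by (simp add: pmap_pmap i' o_def)
qed (simp add: pmap_def)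

text \<open>Write \<open>j = i + 1 + k\<close>. The first \<open>i\<close> steps lower face
  \<open>i\<close> to face 0, the next one turns it into the last face and uses up one
  \<open>tau\<close>, and the remaining \<open>k\<close> steps lower the last face. This explains
  the exponent \<open>j - 1\<close>.\<close>

lemma face_tau_pow_less:
  assumes "x \<in> S" "i < j" "j \<le> dg x"
  shows "face i ((tau ^^ j) x) = pmap (tau ^^ (j - 1)) (face (Suc (dg x + i) - j) x)"
proof -
  define k where "k = j - i - 1"
  have j: "j = i + Suc k" using assms by (simp add: k_def)
  define y where "y = (tau ^^ k) x"
  have y: "y \<in> S" "dg y = dg x" using tau_pow_in assms by (auto simp: y_def)
  have ty: "tau y \<in> S" "dg (tau y) = dg x" using y tau_in dg_tau by auto
  have "(tau ^^ j) x = (tau ^^ i) (tau y)"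
    by (simp only: j funpow_add y_def) simp
  then have "face i ((tau ^^ j) x) = pmap (tau ^^ i) (face 0 (tau y))"
    using face_tau_pow_ge[OF ty(1), of i i] ty assms by simp
  also have "face 0 (tau y) = face (dg x) y"
    using face_0_tau y assms by simp
  also have "\<dots> = pmap (tau ^^ k) (face (dg x - k) x)"
    unfolding y_def using assms by (intro face_tau_pow_ge) (auto simp: k_def)
  finally have "face i ((tau ^^ j) x) = pmap (\<lambda>z. (tau ^^ i) ((tau ^^ k) z)) (face (dg x - k) x)"
    by (simp add: pmap_pmap)
  moreover have "(\<lambda>z. (tau ^^ i) ((tau ^^ k) z)) = tau ^^ (j - 1)"
    unfolding j by (simp add: funpow_add o_def)
  moreover have "dg x - k = Suc (dg x + i) - j" using assms by (simp add: k_def)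
  ultimately show ?thesis by simp
qed

text \<open>With \<open>n = dg x\<close>, a term of the left side is face \<open>i\<close> of
  \<open>(tau ^^ j) x\<close>. Pulling \<open>tau\<close> out gives \<open>tau ^^ m\<close> applied
  to face \<open>k\<close> of \<open>x\<close>, with \<open>(k, m) = (i - j, j)\<close> if
  \<open>j \<le> i\<close>, and \<open>(Suc (n + i) - j, j - 1)\<close> if the face wraps around.
  This matches the terms of both sides bijectively, and the sign exponents have equal
  parity.\<close>

lemma b'_N: "x \<in> S \<Longrightarrow> lext b' (N x) = lext N (b x)"
proof (cases "dg x = 0")
  case True
  assume x: "x \<in> S"
  then show ?thesis using True by (simp add: N_eq lext_sum lext_cmul b_def b'_def tau_pow_in)
next
  case False
  assume x: "x \<in> S"
  let ?n = "dg x"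
  have "lext b' (N x) = (\<Sum>j\<le>?n. cmul ((-1) ^ (?n * j)) (b' ((tau ^^ j) x)))"
    by (simp add: N_eq[OF x] lext_sum lext_cmul)
  also have "\<dots> = (\<Sum>j\<le>?n. \<Sum>i<?n. cmul ((-1) ^ (?n * j + i)) (face i ((tau ^^ j) x)))"
    using False tau_pow_in[OF x] by (intro sum.cong) (auto simp: b'_def cmul_sum power_add)
  also have "\<dots> = (\<Sum>(j, i)\<in>{..?n} \<times> {..<?n}. cmul ((-1) ^ (?n * j + i)) (face i ((tau ^^ j) x)))"
    by (simp add: sum.cartesian_product)
  also have "\<dots> = (\<Sum>(k, m)\<in>{..?n} \<times> {..<?n}. cmul ((-1) ^ (k + (?n - 1) * m)) (pmap (tau ^^ m) (face k x)))"
  proof (rule sum.reindex_bij_witness[where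
        j = "\<lambda>(j, i). if j \<le> i then (i - j, j) else (Suc (?n + i) - j, j - 1)" and
        i = "\<lambda>(k, m). if k + m < ?n then (m, k + m) else (Suc m, k + m - ?n)"])
    fix z assume z: "z \<in> {..?n} \<times> {..<?n}"
    obtain j i where ji: "z = (j, i)" by (cases z)
    obtain n' where n': "?n = Suc n'" using False by (cases ?n) auto
    have le: "j \<le> ?n" "i < ?n" using z ji by auto
    show "(case (case z of (j, i) \<Rightarrow> if j \<le> i then (i - j, j) else (Suc (?n + i) - j, j - 1)) of
        (k, m) \<Rightarrow> cmul ((-1) ^ (k + (?n - 1) * m)) (pmap (tau ^^ m) (face k x)))
      = (case z of (j, i) \<Rightarrow> cmul ((-1) ^ (?n * j + i)) (face i ((tau ^^ j) x)))"
    proof (cases "j \<le> i")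
      case True
      have "(-1 :: 'k) ^ (i - j + (?n - 1) * j) = (-1) ^ (?n * j + i)"
        using True by (intro minus_one_power_eq) (auto simp: n' even_add even_mult_iff)
      then show ?thesis
        using ji True le False face_tau_pow_ge[OF x True] by simp
    next
      case F: False
      obtain j' where j': "j = Suc j'" using F by (cases j) auto
      have "(-1 :: 'k) ^ (Suc (?n + i) - j + (?n - 1) * (j - 1)) = (-1) ^ (?n * j + i)"
        using F le by (intro minus_one_power_eq) (auto simp: n' j' even_add even_mult_iff)
      then show ?thesis
        using ji F le False face_tau_pow_less[OF x, of i j] by simp
    qed
  qed (use False in \<open>auto split: if_splits\<close>)
  also have "\<dots> = (\<Sum>k\<le>?n. \<Sum>m<?n. cmul ((-1) ^ (k + (?n - 1) * m)) (pmap (tau ^^ m) (face k x)))"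
    by (simp add: sum.cartesian_product)
  also have "\<dots> = (\<Sum>k\<le>?n. cmul ((-1) ^ k) (lext N (face k x)))"
  proof (intro sum.cong refl)
    fix k assume k: "k \<in> {..?n}"
    obtain n' where n': "?n = Suc n'" using False by (cases ?n) auto
    have f: "face k x \<in> Lin {y \<in> S. dg y = n'}"
      using face_in[OF x, of k] k n' by auto
    have "lext N (face k x) = lext (\<lambda>y. \<Sum>m\<le>n'. cmul ((-1) ^ (n' * m)) (bas ((tau ^^ m) y))) (face k x)"
      by (rule lext_cong_on[OF f]) (auto simp: N_eq)
    also have "\<dots> = (\<Sum>m<?n. cmul ((-1) ^ ((?n - 1) * m)) (pmap (tau ^^ m) (face k x)))"
      by (simp add: lext_fun_sum lext_fun_cmul pmap_def n' lessThan_Suc_atMost)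
    finally show "(\<Sum>m<?n. cmul ((-1) ^ (k + (?n - 1) * m)) (pmap (tau ^^ m) (face k x))) = cmul ((-1) ^ k) (lext N (face k x))"
      by (simp add: cmul_sum power_add)
  qed
  also have "\<dots> = lext N (b x)"
    using False by (simp add: b_def lext_sum lext_cmul)
  finally show ?thesis .
qed

lemma lext_b'_N: "p \<in> Lin S \<Longrightarrow> lext b' (lext N p) = lext N (lext b p)"
  unfolding lext_lext by (erule lext_cong_on) (rule b'_N)

end

section \<open>The double complex on the basis of pairs of a column and a basis element\<close>

definition col :: "nat \<Rightarrow> (nat \<times> 'x \<Rightarrow>\<^sub>0 'k::field) \<Rightarrow> 'x \<Rightarrow>\<^sub>0 'k" where
  "col p = lext (\<lambda>z. if fst z = p then bas (snd z) else 0)"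

lemma col_lin: "col p (v + w) = col p v + col p w" "col p (v - w) = col p v - col p w"
  "col p (- v) = - col p v" "col p 0 = 0"
  by (simp_all add: col_def lext_lin)

lemma col_Pair: "col p (pmap (Pair p') a) = (if p' = p then a else 0)"
  by (simp add: col_def lext_pmap)

lemma Pair_col: "pmap (Pair p) (col p v) = part fst p v"
  unfolding col_def part_def pmap_lext by (rule lext_cong) auto

lemma col_in: "v \<in> Lin A \<Longrightarrow> col p v \<in> Lin {x. (p, x) \<in> A}"
  unfolding col_def by (erule Lin_lext) auto

lemma Lin_Suc:
  assumes "v \<in> Lin {z. R z \<and> fst z < Suc p}"
  shows "v - pmap (Pair p) (col p v) \<in> Lin {z. R z \<and> fst z < p}"
proof -
  have "v - pmap (Pair p) (col p v) = lext (\<lambda>z. bas z - (if fst z = p then bas z else 0)) v"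
    unfolding Pair_col by (simp add: part_def lext_fun_diff)
  also have "\<dots> \<in> Lin {z. R z \<and> fst z < p}"
    by (rule Lin_lext[OF assms]) auto
  finally show ?thesis .
qed

lemma Lin_ge_Suc:
  assumes "v \<in> Lin {z. R z \<and> fst z \<ge> p}" "col p v = 0"
  shows "v \<in> Lin {z. R z \<and> fst z \<ge> Suc p}"
proof -
  have "v = v - pmap (Pair p) (col p v)" by (simp add: assms(2))
  also have "\<dots> = lext (\<lambda>z. bas z - (if fst z = p then bas z else 0)) v"
    unfolding Pair_col by (simp add: part_def lext_fun_diff)
  also have "\<dots> \<in> Lin {z. R z \<and> fst z \<ge> Suc p}"
    by (rule Lin_lext[OF assms(1)]) auto
  finally show ?thesis .
qed

lemma sum_shift: "(\<Sum>i\<le>n. f (Suc i)) + f 0 = (\<Sum>i\<le>n. f i) + (f (Suc n) :: 'z::ab_group_add)"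
  by (induction n) (auto simp: algebra_simps)

text \<open>The target of the comparison is a sum of copies of one complex, copy \<open>i\<close>
  raised by \<open>2 * i\<close> degrees; \<open>smap\<close> sends column \<open>2 * i\<close> to
  copy \<open>i\<close>. As the shift is even, \<open>sdiff\<close> carries no sign.\<close>

definition sdeg :: "('y \<Rightarrow> nat) \<Rightarrow> nat \<times> 'y \<Rightarrow> nat" where "sdeg dgQ z = 2 * fst z + dgQ (snd z)"
definition sdiff :: "('y \<Rightarrow> 'y \<Rightarrow>\<^sub>0 'k::field) \<Rightarrow> nat \<times> 'y \<Rightarrow> nat \<times> 'y \<Rightarrow>\<^sub>0 'k" where
  "sdiff DQ z = pmap (Pair (fst z)) (DQ (snd z))"
definition smap :: "('x \<Rightarrow> 'y \<Rightarrow>\<^sub>0 'k::field) \<Rightarrow> nat \<times> 'x \<Rightarrow> nat \<times> 'y \<Rightarrow>\<^sub>0 'k" where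
  "smap f z = (if even (fst z) then pmap (Pair (fst z div 2)) (f (snd z)) else 0)"

context precyclic
begin

definition vert :: "nat \<Rightarrow> 'x \<Rightarrow> 'x \<Rightarrow>\<^sub>0 'k" where
  "vert p x = (if even p then b x else - b' x)"

text \<open>The index \<open>p\<close> is that of the target column: the map starts in column
  \<open>Suc p\<close>.\<close>

definition hor :: "nat \<Rightarrow> 'x \<Rightarrow> 'x \<Rightarrow>\<^sub>0 'k" where
  "hor p x = (if even p then bas x - t x else N x)"

definition tdeg :: "nat \<times> 'x \<Rightarrow> nat" where "tdeg z = fst z + dg (snd z)"

definition tdiff :: "nat \<times> 'x \<Rightarrow> nat \<times> 'x \<Rightarrow>\<^sub>0 'k" where
  "tdiff z = pmap (Pair (fst z)) (vert (fst z) (snd z)) +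
     (case fst z of 0 \<Rightarrow> 0 | Suc p \<Rightarrow> pmap (Pair p) (hor p (snd z)))"

lemma lext_vert: "lext (vert p) a = (if even p then lext b a else - lext b' a)"
  by (simp add: vert_def[abs_def] lext_fun_uminus)

lemma lext_hor: "lext (hor p) a = (if even p then a - lext t a else lext N a)"
  by (simp add: hor_def[abs_def] lext_fun_diff)

lemma tdiff_Pair: "lext tdiff (pmap (Pair p) a) = pmap (Pair p) (lext (vert p) a) +
     (case p of 0 \<Rightarrow> 0 | Suc p' \<Rightarrow> pmap (Pair p') (lext (hor p') a))"
  by (cases p) (simp_all add: lext_pmap tdiff_def lext_fun_add pmap_lext)

lemma tdiff_Pair_Suc: "lext tdiff (pmap (Pair (Suc p)) a) =
    pmap (Pair (Suc p)) (lext (vert (Suc p)) a) + pmap (Pair p) (lext (hor p) a)"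
  by (simp add: tdiff_Pair)

lemma col_tdiff: "col p (lext tdiff v) = lext (vert p) (col p v) + lext (hor p) (col (Suc p) v)"
proof -
  have "col p (lext tdiff v) = lext (\<lambda>z. col p (tdiff z)) v"
    by (simp add: col_def lext_lext)
  also have "\<dots> = lext (\<lambda>z. lext (vert p) (if fst z = p then bas (snd z) else 0)
      + lext (hor p) (if fst z = Suc p then bas (snd z) else 0)) v"
    by (rule lext_cong) (auto simp: tdiff_def col_lin col_Pair split: nat.splits)
  also have "\<dots> = lext (vert p) (col p v) + lext (hor p) (col (Suc p) v)"
    by (simp add: lext_fun_add col_def lext_lext)
  finally show ?thesis .
qed

lemma vert_in: "p \<in> Lin {x \<in> S. dg x = n} \<Longrightarrow> lext (vert i) p \<in> Lin {y \<in> S. Suc (dg y) = n}"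
  unfolding lext_vert by (auto intro: Lin_uminus lext_b_in lext_b'_in)

lemma hor_in: "p \<in> Lin {x \<in> S. dg x = n} \<Longrightarrow> lext (hor i) p \<in> Lin {y \<in> S. dg y = n}"
  unfolding lext_hor by (auto intro: Lin_diff lext_N_in lext_t_in)

lemma Pair_in:
  assumes "a \<in> Lin {x \<in> S. dg x = m}" "p + m = n"
  shows "pmap (Pair p) a \<in> Lin {z \<in> UNIV \<times> S. tdeg z = n}"
  by (rule Lin_pmap[OF assms(1)]) (use assms(2) in \<open>auto simp: tdeg_def\<close>)

lemma tdiff_in: "z \<in> UNIV \<times> S \<Longrightarrow> tdiff z \<in> Lin {w \<in> UNIV \<times> S. Suc (tdeg w) = tdeg z}"
proof -
  assume z: "z \<in> UNIV \<times> S"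
  then have x: "snd z \<in> S" by auto
  have "bas (snd z) \<in> Lin {x \<in> S. dg x = dg (snd z)}" using x by simp
  note 1 = vert_in[OF this] and 2 = hor_in[OF this]
  show ?thesis
    unfolding tdiff_def
  proof (rule Lin_add)
    show "pmap (Pair (fst z)) (vert (fst z) (snd z)) \<in> Lin {w \<in> UNIV \<times> S. Suc (tdeg w) = tdeg z}"
      using 1[of "fst z"] unfolding lext_bas by (rule Lin_pmap) (auto simp: tdeg_def)
    show "(case fst z of 0 \<Rightarrow> 0 | Suc p \<Rightarrow> pmap (Pair p) (hor p (snd z)))
        \<in> Lin {w \<in> UNIV \<times> S. Suc (tdeg w) = tdeg z}"
    proof (cases "fst z")
      case (Suc p)
      show ?thesis
        using 2[of p] unfolding lext_bas Suc by (simp, elim Lin_pmap) (auto simp: tdeg_def Suc)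
    qed simp
  qed
qed

lemma lext_tdiff_in:
  "p \<in> Lin {x \<in> UNIV \<times> S. tdeg x = n} \<Longrightarrow> lext tdiff p \<in> Lin {y \<in> UNIV \<times> S. Suc (tdeg y) = n}"
  by (rule Lin_lext) (auto intro: Lin_mono[OF tdiff_in])

end

locale cyclic_basis = precyclic +
  assumes tau_per: "x \<in> S \<Longrightarrow> (tau ^^ Suc (dg x)) x = x"
begin

text \<open>The sign of \<open>t\<close> enters \<open>n + 1\<close> times with exponent
  \<open>n\<close>, and \<open>n * Suc n\<close> is even.\<close>

lemma t_per: "a \<in> Lin {x \<in> S. dg x = n} \<Longrightarrow> (lext t ^^ Suc n) a = a"
proof -
  assume a: "a \<in> Lin {x \<in> S. dg x = n}"
  have "(lext t ^^ Suc n) a = lext (\<lambda>x. (lext t ^^ Suc n) (bas x)) a"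
    by (rule funpow_lext)
  also have "\<dots> = lext bas a"
  proof (rule lext_cong_on[OF a])
    fix x assume "x \<in> {x \<in> S. dg x = n}"
    then have x: "x \<in> S" "dg x = n" by auto
    have "(-1 :: 'b) ^ (n * Suc n) = 1" by (simp add: minus_one_power_iff)
    then show "(lext t ^^ Suc n) (bas x) = bas x"
      using t_pow_bas[OF x(1), of "Suc n"] tau_per[OF x(1)] x(2) by (simp del: funpow.simps)
  qed
  finally show ?thesis by simp
qed

lemma N_t: "a \<in> Lin {x \<in> S. dg x = n} \<Longrightarrow> lext N (lext t a) = lext N a"
  using lext_N[of "lext t a" n] lext_N[of a n] lext_t_in[of a n] t_per[of a n]
    sum_shift[of "\<lambda>i. (lext t ^^ i) a" n] by (simp add: funpow_swap1)

lemma t_N: "a \<in> Lin {x \<in> S. dg x = n} \<Longrightarrow> lext t (lext N a) = lext N a"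
  using lext_N[of a n] t_per[of a n]
    sum_shift[of "\<lambda>i. (lext t ^^ i) a" n] by (simp add: lext_sum)

text \<open>The mixed terms cancel by \<open>lext_b_t\<close> and \<open>lext_b'_N\<close>, and two
  horizontal steps compose to 0 by \<open>N_t\<close> and \<open>t_N\<close>. The vertical square
  remains, since the locale contains no relation between two faces.\<close>

lemma tdiff_tdiff:
  assumes a: "a \<in> Lin {x \<in> S. dg x = n}"
  shows "lext tdiff (lext tdiff (pmap (Pair p) a)) = pmap (Pair p) (lext (vert p) (lext (vert p) a))"
proof (cases p)
  case 0
  then show ?thesis by (simp add: tdiff_Pair)
next
  case (Suc p')
  have aS: "a \<in> Lin S" using a by (rule Lin_mono) auto
  have vh: "lext (hor p') (lext (vert (Suc p')) a) + lext (vert p') (lext (hor p') a) = 0"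
    unfolding lext_hor lext_vert using lext_b_t[OF aS] lext_b'_N[OF aS]
    by (auto simp: lext_uminus lext_diff)
  have hh: "lext (hor i) (lext (hor (Suc i)) a) = 0" for i
    unfolding lext_hor using N_t[OF a] t_N[OF a] by (auto simp: lext_diff)
  show ?thesis
  proof (cases p')
    case 0
    then show ?thesis
      using vh by (simp add: Suc tdiff_Pair_Suc tdiff_Pair lext_add add.assoc flip: pmap_add)
  next
    case S2: (Suc p'')
    show ?thesis
      using vh hh[of p''] unfolding Suc S2
      by (simp add: tdiff_Pair_Suc lext_add add.assoc flip: pmap_add)
  qed
qed

lemma tot_based_complex:
  assumes "\<And>x. x \<in> S \<Longrightarrow> lext b (b x) = 0" "\<And>x. x \<in> S \<Longrightarrow> lext b' (b' x) = 0"
  shows "based_complex (UNIV \<times> S) tdeg tdiff"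
proof
  fix z :: "nat \<times> 'a" assume z: "z \<in> UNIV \<times> S"
  show "tdiff z \<in> Lin {y \<in> UNIV \<times> S. Suc (tdeg y) = tdeg z}" by (rule tdiff_in[OF z])
  have "bas (snd z) \<in> Lin {x \<in> S. dg x = dg (snd z)}" using z by auto
  note tdiff_tdiff[OF this, of "fst z"]
  moreover have "lext (vert p) (vert p (snd z)) = 0" for p
    unfolding lext_vert using assms z by (auto simp: vert_def lext_uminus)
  ultimately show "lext tdiff (tdiff z) = 0" by simp
qed

lemma sdiff_Pair: "lext (sdiff DQ) (pmap (Pair i) a) = pmap (Pair i) (lext DQ a)"
  by (simp add: lext_pmap sdiff_def pmap_lext)

lemma smap_Pair: "lext (smap f) (pmap (Pair p) a) = (if even p then pmap (Pair (p div 2)) (lext f a) else 0)"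
  by (simp add: lext_pmap smap_def pmap_lext)

lemma col_sdiff: "col i (lext (sdiff DQ) v) = lext DQ (col i v)"
  unfolding col_def lext_lext by (rule lext_cong) (auto simp: sdiff_def lext_pmap)

lemma col_smap: "col i (lext (smap f) v) = lext f (col (2 * i) v)"
  unfolding col_def lext_lext by (rule lext_cong) (auto simp: smap_def lext_pmap)

text \<open>Column by column, starting with the last one, a cone-exact map out of \<open>(S, b)\<close> that is
  invariant under \<open>t\<close> yields one out of the double complex, since the odd columns are acyclic.\<close>

lemma cone_exact_columns:
  fixes f :: "'a \<Rightarrow> 'y \<Rightarrow>\<^sub>0 'b"
  assumes Q: "based_complex Q dgQ DQ" and ex: "cone_exact S dg b Q dgQ DQ f"
    and f_in: "\<And>x. x \<in> S \<Longrightarrow> f x \<in> Lin {y \<in> Q. dgQ y = dg x}"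
    and chain: "\<And>x. x \<in> S \<Longrightarrow> lext f (b x) = lext DQ (f x)"
    and f_t: "\<And>x. x \<in> S \<Longrightarrow> lext f (t x) = f x"
    and contr: "\<And>n a. a \<in> Lin {x \<in> S. dg x = n} \<Longrightarrow> lext b' a = 0 \<Longrightarrow>
        \<exists>c \<in> Lin {x \<in> S. dg x = Suc n}. lext b' c = a"
  shows "cone_exact (UNIV \<times> S) tdeg tdiff (UNIV \<times> Q) (sdeg dgQ) (sdiff DQ) (smap f)"
  unfolding cone_exact_def
proof (intro allI ballI impI)
  interpret Q: based_complex Q dgQ DQ by fact
  fix n V Y assume V: "V \<in> Lin {x \<in> UNIV \<times> S. Suc (tdeg x) = n}"
    and Y: "Y \<in> Lin {y \<in> UNIV \<times> Q. sdeg dgQ y = n}"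
    and DV: "lext tdiff V = 0" and fV: "lext (smap f) V = lext (sdiff DQ) Y"
  let ?goal = "\<lambda>V Y. \<exists>a'\<in>Lin {x \<in> UNIV \<times> S. tdeg x = n}. \<exists>b'\<in>Lin {y \<in> UNIV \<times> Q. sdeg dgQ y = Suc n}.
      lext tdiff a' = V \<and> Y = lext (smap f) a' + lext (sdiff DQ) b'"
  let ?A = "\<lambda>P. Lin {z. (z \<in> UNIV \<times> S \<and> Suc (tdeg z) = n) \<and> fst z < P}"
  let ?B = "\<lambda>P. Lin {z. (z \<in> UNIV \<times> Q \<and> sdeg dgQ z = n) \<and> 2 * fst z < P}"
  \<comment> \<open>Induction on a bound \<open>P\<close> for the columns that occur, where copy
    \<open>i\<close> of the target counts as column \<open>2 * i\<close>. Subtracting a suitable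
    boundary removes column \<open>P\<close> and disturbs only column \<open>P - 1\<close>.\<close>
  have claim: "?goal V Y" if "V \<in> ?A P" "Y \<in> ?B P" "lext tdiff V = 0" "lext (smap f) V = lext (sdiff DQ) Y" "P \<le> Suc n" for P V Y
    using that
  proof (induction P arbitrary: V Y)
    case 0
    then have "V = 0" "Y = 0" by simp_all
    then show ?case by (intro bexI[of _ 0]) auto
  next
    case (Suc P)
    define m where "m = n - P"
    have m: "n = P + m" using Suc.prems by (simp add: m_def)
    define v where "v = col P V"
    have v: "v \<in> Lin {x \<in> S. Suc (dg x) = m}"
      unfolding v_def by (rule Lin_mono[OF col_in[OF Suc.prems(1)]]) (auto simp: tdeg_def m)
    have "col (Suc P) V = 0"
      using col_in[OF Suc.prems(1), of "Suc P"] by simp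
    then have vv: "lext (vert P) v = 0"
      using col_tdiff[of P V] Suc.prems(3) by (simp add: v_def col_lin)
    \<comment> \<open>The top column of \<open>V\<close> is a vertical cycle. In an even column the
      exact cone of \<open>f\<close> provides \<open>c\<close> together with a correction
      \<open>y'\<close> in copy \<open>P div 2\<close>. In an odd column there is nothing in the
      target, and \<open>c\<close> comes from the contractibility of \<open>b'\<close>, up to the
      sign in \<open>vert\<close>.\<close>
    have "\<exists>c y'. c \<in> Lin {x \<in> S. dg x = m} \<and> y' \<in> Lin {z \<in> UNIV \<times> Q. sdeg dgQ z = Suc n} \<and>
       lext (vert P) c = v \<and> lext (sdiff DQ) (lext (sdiff DQ) y') = 0 \<and>
       Y - lext (smap f) (pmap (Pair P) c) - lext (sdiff DQ) y' \<in> ?B P"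
    proof (cases "even P")
      case True
      then obtain i where i: "P = 2 * i" by blast
      define y where "y = col i Y"
      have y: "y \<in> Lin {x \<in> Q. dgQ x = m}"
        unfolding y_def by (rule Lin_mono[OF col_in[OF Suc.prems(2)]]) (auto simp: sdeg_def m i)
      have bv: "lext b v = 0" using vv True by (simp add: lext_vert)
      have fv: "lext f v = lext DQ y"
        unfolding v_def y_def i by (simp flip: col_smap col_sdiff) (simp add: Suc.prems(4))
      obtain c y' where c: "c \<in> Lin {x \<in> S. dg x = m}" "y' \<in> Lin {z \<in> Q. dgQ z = Suc m}"
        "lext b c = v" "y = lext f c + lext DQ y'"
        by (rule cone_exactD[OF ex v y bv fv])
      have "Y - lext (smap f) (pmap (Pair P) c) - lext (sdiff DQ) (pmap (Pair i) y') = Y - pmap (Pair i) (col i Y)"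
        by (simp add: smap_Pair sdiff_Pair True i flip: y_def) (simp add: c(4) pmap_add)
      also have "Y - pmap (Pair i) (col i Y) \<in> Lin {z. (z \<in> UNIV \<times> Q \<and> sdeg dgQ z = n) \<and> fst z < i}"
        by (rule Lin_Suc) (use Suc.prems(2) i in \<open>auto elim!: Lin_mono\<close>)
      also have "\<dots> = ?B P" using i by simp
      finally have "Y - lext (smap f) (pmap (Pair P) c) - lext (sdiff DQ) (pmap (Pair i) y') \<in> ?B P" .
      moreover have "lext DQ (lext DQ y') = 0"
        by (rule Q.lext_DD) (rule Lin_mono[OF c(2)], auto)
      then have "lext (sdiff DQ) (lext (sdiff DQ) (pmap (Pair i) y')) = 0"
        by (simp add: sdiff_Pair)
      moreover have "pmap (Pair i) y' \<in> Lin {z \<in> UNIV \<times> Q. sdeg dgQ z = Suc n}"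
        by (rule Lin_pmap[OF c(2)]) (auto simp: sdeg_def m i)
      ultimately show ?thesis
        using c True by (intro exI[of _ c] exI[of _ "pmap (Pair i) y'"]) (simp add: lext_vert)
    next
      case False
      have bv: "lext b' v = 0" using vv False by (simp add: lext_vert)
      obtain c where c: "c \<in> Lin {x \<in> S. dg x = m}" "lext b' c = v"
      proof (cases m)
        case 0
        then have "v = 0" using v by simp
        then show ?thesis using that[of 0] by simp
      next
        case (Suc m')
        then have "v \<in> Lin {x \<in> S. dg x = m'}" using v by simp
        from contr[OF this bv] show ?thesis using that Suc by blast
      qed
      have "Y \<in> ?B P"
      proof (rule Lin_mono[OF Suc.prems(2)], safe)
        fix i assume "2 * fst (i :: nat \<times> 'y) < Suc P"
        moreover have "2 * fst i \<noteq> P" using False by auto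
        ultimately show "2 * fst i < P" by linarith
      qed
      then show ?thesis
        using c False by (intro exI[of _ "- c"] exI[of _ 0]) (simp add: smap_Pair lext_vert lext_uminus Lin_uminus)
    qed
    then obtain c y' where c: "c \<in> Lin {x \<in> S. dg x = m}" "lext (vert P) c = v"
      and y': "y' \<in> Lin {z \<in> UNIV \<times> Q. sdeg dgQ z = Suc n}" "lext (sdiff DQ) (lext (sdiff DQ) y') = 0"
      and Y1: "Y - lext (smap f) (pmap (Pair P) c) - lext (sdiff DQ) y' \<in> ?B P"
      by blast
    define W where "W = pmap (Pair P) c"
    have W: "W \<in> Lin {z \<in> UNIV \<times> S. tdeg z = n}"
      unfolding W_def by (rule Pair_in[OF c(1)]) (simp add: m)
    define V1 where "V1 = V - lext tdiff W"
    have low: "pmap (Pair p) (lext (hor p) c) \<in> ?A P" if "P = Suc p" for p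
      by (rule Lin_pmap[OF hor_in[OF c(1)]]) (auto simp: tdeg_def that m)
    have "V1 = V - pmap (Pair P) (col P V) - (case P of 0 \<Rightarrow> 0 | Suc p \<Rightarrow> pmap (Pair p) (lext (hor p) c))"
      unfolding V1_def W_def tdiff_Pair c(2) v_def by simp
    also have "\<dots> \<in> ?A P"
      by (rule Lin_diff, rule Lin_Suc[OF Suc.prems(1)]) (use low in \<open>auto split: nat.splits\<close>)
    finally have V1: "V1 \<in> ?A P" .
    have DV1: "lext tdiff V1 = 0"
      unfolding V1_def W_def lext_diff tdiff_tdiff[OF c(1)] c(2) vv Suc.prems(3) by simp
    have ft: "lext f (lext t c) = lext f c"
      unfolding lext_lext by (rule lext_cong_on[OF c(1)]) (auto simp: f_t)
    have fb: "lext f (lext b c) = lext DQ (lext f c)"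
      unfolding lext_lext by (rule lext_cong_on[OF c(1)]) (auto simp: chain)
    have "lext (smap f) (lext tdiff W) = lext (sdiff DQ) (lext (smap f) W)"
      unfolding W_def tdiff_Pair smap_Pair lext_add
      by (auto simp: smap_Pair sdiff_Pair lext_vert lext_hor fb lext_diff ft split: nat.splits)
    then have "lext (smap f) V1 = lext (sdiff DQ) (Y - lext (smap f) (pmap (Pair P) c) - lext (sdiff DQ) y')"
      by (simp add: V1_def lext_diff Suc.prems(4) y'(2)) (simp add: W_def)
    from Suc.IH[OF V1 Y1 DV1 this] Suc.prems(5)
    obtain a2 b2 where 2: "a2 \<in> Lin {x \<in> UNIV \<times> S. tdeg x = n}" "b2 \<in> Lin {y \<in> UNIV \<times> Q. sdeg dgQ y = Suc n}"
      "lext tdiff a2 = V1" "Y - lext (smap f) (pmap (Pair P) c) - lext (sdiff DQ) y' = lext (smap f) a2 + lext (sdiff DQ) b2"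
      by auto
    have "Y = lext (smap f) (W + a2) + lext (sdiff DQ) (y' + b2)"
      using 2(4) unfolding W_def[symmetric] by (simp add: lext_add algebra_simps)
    moreover have "lext tdiff (W + a2) = V"
      by (simp add: lext_add 2(3) V1_def)
    ultimately show ?case
      using 2(1,2) W y'(1) by (intro bexI[of _ "W + a2"] bexI[of _ "y' + b2"]) (auto intro: Lin_add)
  qed
  show "?goal V Y"
    by (rule claim[of _ "Suc n"])
      (use V Y DV fV in \<open>auto elim!: Lin_mono simp: tdeg_def sdeg_def\<close>)
qed

text \<open>For the case where the columns are not resolutions. Since \<open>n + 1\<close> is
  invertible, the rows are exact in all columns but column 0, so a cycle can be pushed into higher
  and higher columns by subtracting boundaries, until its degree leaves no room. Only column 0 needs
  more: there the row leaves the coinvariants of \<open>t\<close>, and \<open>coinv\<close> says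
  that these form a resolution.\<close>

lemma tot_aug_acyclic:
  assumes bb: "\<And>x. x \<in> S \<Longrightarrow> lext b (b x) = 0" "\<And>x. x \<in> S \<Longrightarrow> lext b' (b' x) = 0"
    and char: "\<And>n. of_nat (Suc n) \<noteq> (0 :: 'b)"
    and coinv: "\<And>n a z. a \<in> Lin {x \<in> S. dg x = n} \<Longrightarrow> z \<in> Lin {x \<in> S. Suc (dg x) = n} \<Longrightarrow>
       lext b a = z - lext t z \<Longrightarrow> (n = 0 \<Longrightarrow> lext e a = 0) \<Longrightarrow>
       \<exists>c \<in> Lin {x \<in> S. dg x = Suc n}. \<exists>z' \<in> Lin {x \<in> S. dg x = n}. a = lext b c + (z' - lext t z')"
    and eb: "\<And>x. x \<in> S \<Longrightarrow> dg x = 1 \<Longrightarrow> lext e (b x) = 0"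
    and et: "\<And>x. x \<in> S \<Longrightarrow> dg x = 0 \<Longrightarrow> e (tau x) = e x"
  shows "aug_acyclic (UNIV \<times> S) tdeg tdiff (\<lambda>z. if fst z = 0 then e (snd z) else 0)"
  unfolding aug_acyclic_def
proof (intro allI ballI impI)
  interpret T: based_complex "UNIV \<times> S" tdeg tdiff by (rule tot_based_complex[OF bb])
  fix n U assume U: "U \<in> Lin {x \<in> UNIV \<times> S. tdeg x = n}" and DX: "lext tdiff U = 0"
    and eX: "n = 0 \<longrightarrow> lext (\<lambda>z. if fst z = 0 then e (snd z) else 0) U = 0"
  let ?A = "\<lambda>P. Lin {z. (z \<in> UNIV \<times> S \<and> tdeg z = n) \<and> fst z \<ge> P}"
  have "\<exists>Y\<in>Lin {x \<in> UNIV \<times> S. tdeg x = Suc n}. U - lext tdiff Y \<in> ?A P" if "P \<le> Suc n" for P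
    using that
  proof (induction P)
    case 0
    show ?case using U by (intro bexI[of _ 0]) auto
  next
    case (Suc P)
    then obtain Y where Y: "Y \<in> Lin {x \<in> UNIV \<times> S. tdeg x = Suc n}" "U - lext tdiff Y \<in> ?A P" by auto
    define X1 where "X1 = U - lext tdiff Y"
    have X1: "X1 \<in> ?A P" using Y(2) by (simp add: X1_def)
    have DX1: "lext tdiff X1 = 0"
      using T.lext_DD[of Y] Lin_mono[OF Y(1)] by (auto simp: X1_def lext_diff DX)
    define m where "m = n - P"
    have m: "n = P + m" using Suc.prems by (simp add: m_def)
    define x where "x = col P X1"
    have x: "x \<in> Lin {y \<in> S. dg y = m}"
      unfolding x_def by (rule Lin_mono[OF col_in[OF X1]]) (auto simp: tdeg_def m)
    have "\<exists>Z\<in>Lin {x \<in> UNIV \<times> S. tdeg x = Suc n}. lext tdiff Z \<in> ?A P \<and> col P (lext tdiff Z) = x"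
    proof (cases P)
      case 0
      \<comment> \<open>Column 0 of \<open>lext tdiff X1 = 0\<close> reads
        \<open>b x + (1 - t) (col 1 X1) = 0\<close>; this is the premise of \<open>coinv\<close>
        with \<open>z = - col 1 X1\<close>.\<close>
      have z: "- col 1 X1 \<in> Lin {y \<in> S. Suc (dg y) = m}"
        by (rule Lin_uminus, rule Lin_mono[OF col_in[OF X1]]) (auto simp: tdeg_def m 0)
      have bx: "lext b x = - col 1 X1 - lext t (- col 1 X1)"
        using col_tdiff[of 0 X1] unfolding DX1 x_def 0
        by (simp add: col_lin lext_vert lext_hor lext_uminus eq_neg_iff_add_eq_0 algebra_simps)
      have ex: "lext e x = 0" if "m = 0"
      proof -
        have n0: "n = 0" using m 0 that by simp
        have e: "lext (\<lambda>z. if fst z = 0 then e (snd z) else 0) W = lext e (col 0 W)" for W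
          unfolding col_def lext_lext by (rule lext_cong) auto
        have "X1 = U - lext tdiff Y" by (simp add: X1_def)
        moreover have "lext e (col 0 (lext tdiff Y)) = 0"
        proof -
          have "col 0 Y \<in> Lin {x \<in> S. dg x = 1}" "col (Suc 0) Y \<in> Lin {x \<in> S. dg x = 0}"
            by (rule Lin_mono[OF col_in[OF Y(1)]], auto simp: tdeg_def n0)+
          note c = this
          have "lext e (lext b (col 0 Y)) = 0"
            unfolding lext_lext by (rule lext_eqI[OF _ c(1)]) (auto simp: eb)
          moreover have "lext e (lext t (col (Suc 0) Y)) = lext e (col (Suc 0) Y)"
            unfolding lext_lext by (rule lext_cong_on[OF c(2)]) (auto simp: t_def et)
          ultimately show ?thesis
            by (simp add: col_tdiff lext_vert lext_hor lext_add lext_diff)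
        qed
        ultimately show ?thesis
          using eX n0 e[of U] by (simp add: x_def 0 col_lin lext_diff)
      qed
      from coinv[OF x z bx ex] obtain c z' where
        c: "c \<in> Lin {y \<in> S. dg y = Suc m}" "z' \<in> Lin {y \<in> S. dg y = m}" "x = lext b c + (z' - lext t z')"
        by blast
      let ?Z = "pmap (Pair 0) c + pmap (Pair 1) z'"
      have Z: "?Z \<in> Lin {x \<in> UNIV \<times> S. tdeg x = Suc n}"
        by (intro Lin_add Pair_in[OF c(1)] Pair_in[OF c(2)]) (auto simp: m 0)
      have "col P (lext tdiff ?Z) = x"
        unfolding col_tdiff 0 by (simp add: col_lin col_Pair lext_vert lext_hor c(3))
      moreover have "lext tdiff ?Z \<in> ?A P"
        using lext_tdiff_in[OF Z] by (auto simp: 0)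
      ultimately show ?thesis using Z by blast
    next
      case S: (Suc p)
      \<comment> \<open>\<open>X1\<close> has no entry in column \<open>p\<close>, so column
        \<open>p\<close> of its boundary is the horizontal image of \<open>x\<close> alone. It
        remains to see that a kernel element of one horizontal map is in the image of the
        next.\<close>
      have "col p X1 = 0"
        using col_in[OF X1, of p] by (simp add: S)
      then have hx: "lext (hor p) x = 0"
        using col_tdiff[of p X1] by (simp add: DX1 col_lin x_def S)
      have "\<exists>y\<in>Lin {y \<in> S. dg y = m}. lext (hor P) y = x"
      proof (cases "even p")
        case True
        then have tx: "lext t x = x" using hx by (simp add: lext_hor)
        have "(lext t ^^ i) x = x" for i by (induction i) (auto simp: tx)
        then have Nx: "lext N x = cmul (of_nat (Suc m)) x"
          using lext_N[OF x] by (simp flip: cmul_sum_left[of "\<lambda>_. 1", simplified])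
        show ?thesis
          using True x char[of m] by (intro bexI[of _ "cmul (inverse (of_nat (Suc m))) x"])
            (auto simp: S lext_hor lext_cmul Nx Lin_cmul simp del: of_nat_Suc)
      next
        case False
        then have Nx: "(\<Sum>i\<le>m. (lext t ^^ i) x) = 0" using hx lext_N[OF x] by (simp add: lext_hor)
        have tel: "(\<Sum>j<i. (lext t ^^ j) x) - lext t (\<Sum>j<i. (lext t ^^ j) x) = x - (lext t ^^ i) x" for i
        proof (induction i)
          case (Suc i)
          have "(\<Sum>j<Suc i. (lext t ^^ j) x) - lext t (\<Sum>j<Suc i. (lext t ^^ j) x)
            = ((\<Sum>j<i. (lext t ^^ j) x) - lext t (\<Sum>j<i. (lext t ^^ j) x)) + ((lext t ^^ i) x - (lext t ^^ Suc i) x)"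
            by (simp add: lext_add)
          then show ?case unfolding Suc by simp
        qed simp
        \<comment> \<open>By \<open>tel\<close>, \<open>1 - t\<close> sends the \<open>i\<close>-th
          partial sum to \<open>x\<close> minus its \<open>i\<close>-th translate. Summed over
          \<open>i\<close> this is \<open>(m + 1) x\<close> minus the norm of \<open>x\<close>, and
          the norm vanishes; so \<open>y\<close> divided by \<open>m + 1\<close> is a preimage of
          \<open>x\<close>.\<close>
        define y where "y = (\<Sum>i\<le>m. \<Sum>j<i. (lext t ^^ j) x)"
        have "y - lext t y = (\<Sum>i\<le>m. x - (lext t ^^ i) x)"
          unfolding y_def lext_sum[of _ _ "{..m}"] sum_subtractf[symmetric] tel ..
        also have "\<dots> = cmul (of_nat (Suc m)) x"
          using Nx by (simp add: sum_subtractf flip: cmul_sum_left[of "\<lambda>_. 1", simplified])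
        finally have y: "y - lext t y = cmul (of_nat (Suc m)) x" .
        have "y \<in> Lin {y \<in> S. dg y = m}"
          unfolding y_def by (intro Lin_sum t_pow_in[OF x])
        then show ?thesis
          using False y char[of m] by (intro bexI[of _ "cmul (inverse (of_nat (Suc m))) y"])
            (auto simp: S lext_hor lext_cmul Lin_cmul simp del: of_nat_Suc simp flip: cmul_diff)
      qed
      then obtain y where y: "y \<in> Lin {y \<in> S. dg y = m}" "lext (hor P) y = x" by blast
      let ?Z = "pmap (Pair (Suc P)) y"
      have Z: "?Z \<in> Lin {x \<in> UNIV \<times> S. tdeg x = Suc n}"
        by (rule Pair_in[OF y(1)]) (simp add: m)
      have "pmap (Pair (Suc P)) (lext (vert (Suc P)) y) \<in> ?A P"
        by (rule Lin_pmap[OF vert_in[OF y(1)]]) (auto simp: tdeg_def m)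
      moreover have "pmap (Pair P) x \<in> ?A P"
        by (rule Lin_pmap[OF x]) (auto simp: tdeg_def m)
      ultimately have "lext tdiff ?Z \<in> ?A P"
        unfolding tdiff_Pair_Suc y(2) by (rule Lin_add)
      moreover have "col P (lext tdiff ?Z) = x"
        by (simp add: tdiff_Pair_Suc y(2) col_lin col_Pair)
      ultimately show ?thesis using Z by blast
    qed
    then obtain Z where Z: "Z \<in> Lin {x \<in> UNIV \<times> S. tdeg x = Suc n}" "lext tdiff Z \<in> ?A P"
      "col P (lext tdiff Z) = x" by blast
    have "X1 - lext tdiff Z \<in> ?A (Suc P)"
      by (rule Lin_ge_Suc[OF Lin_diff[OF X1 Z(2)]]) (simp add: col_lin Z(3) x_def)
    then show ?case
      using Y(1) Z(1) by (intro bexI[of _ "Y + Z"]) (auto simp: X1_def lext_add diff_diff_eq intro: Lin_add)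
  qed
  from this[of "Suc n"] obtain Y where Y: "Y \<in> Lin {x \<in> UNIV \<times> S. tdeg x = Suc n}"
    "U - lext tdiff Y \<in> ?A (Suc n)" by auto
  have "{z. (z \<in> UNIV \<times> S \<and> tdeg z = n) \<and> fst z \<ge> Suc n} = {}" by (auto simp: tdeg_def)
  then have "U - lext tdiff Y = 0" using Y(2) unfolding Lin_empty[symmetric] by (simp only:)
  then show "\<exists>b\<in>Lin {x \<in> UNIV \<times> S. tdeg x = Suc n}. lext tdiff b = U"
    using Y(1) by auto
qed

end

section \<open>Homogeneous chains\<close>

definition omit :: "nat \<Rightarrow> 'h list \<Rightarrow> 'h list" where
  "omit i xs = take i xs @ drop (Suc i) xs"

text \<open>The twist \<open>u\<close> is right multiplication by the loop on free tuples, and the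
  identity on tuples of composable morphisms and on tuples of group elements.\<close>

definition rot :: "('h \<Rightarrow> 'h) \<Rightarrow> 'h list \<Rightarrow> 'h list" where
  "rot u xs = u (last xs) # butlast xs"

abbreviation cycl :: "'h list \<Rightarrow> 'h list" where "cycl \<equiv> rot (\<lambda>x. x)"

definition ldg :: "'h list \<Rightarrow> nat" where "ldg xs = length xs - 1"

definition nelists :: "'h set \<Rightarrow> 'h list set" where "nelists H = {xs \<in> lists H. xs \<noteq> []}"

lemma omit_simps [simp]: "omit 0 (x # xs) = xs" "omit (Suc i) (x # xs) = x # omit i xs" "omit i [] = []"
  by (simp_all add: omit_def)

lemma length_omit: "i < length xs \<Longrightarrow> length (omit i xs) = length xs - 1"
  by (simp add: omit_def)

lemma omit_in_lists: "xs \<in> lists H \<Longrightarrow> omit i xs \<in> lists H"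
  by (auto simp: omit_def in_set_conv_decomp dest!: in_set_takeD in_set_dropD)

lemma map_omit: "map g (omit i xs) = omit i (map g xs)"
  by (simp add: omit_def take_map drop_map)

lemma omit_butlast: "i < length xs - 1 \<Longrightarrow> omit i (butlast xs) = butlast (omit i xs) \<and> last (omit i xs) = last xs"
proof (induction i arbitrary: xs)
  case 0
  then show ?case by (cases xs) auto
next
  case (Suc i)
  then obtain y ys where y: "xs = y # ys" "i < length ys - 1" by (cases xs) auto
  then have "length (omit i ys) \<noteq> 0" "length ys \<noteq> 0"
    using length_omit[of i ys] by linarith+
  then have "ys \<noteq> []" "omit i ys \<noteq> []" by auto
  then show ?case using Suc.IH[OF y(2)] y(1) by simp
qed

lemma omit_Suc_rot: "i < length xs - 1 \<Longrightarrow> omit (Suc i) (rot u xs) = rot u (omit i xs)"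
  using omit_butlast[of i xs] by (simp add: rot_def)

lemma omit_0_rot: "xs \<noteq> [] \<Longrightarrow> omit 0 (rot u xs) = omit (length xs - 1) xs"
  by (cases xs rule: rev_cases) (simp_all add: omit_def rot_def)

lemma length_rot: "xs \<noteq> [] \<Longrightarrow> length (rot u xs) = length xs"
  by (simp add: rot_def)

lemma rot_in: "xs \<in> nelists H \<Longrightarrow> (\<And>x. x \<in> H \<Longrightarrow> u x \<in> H) \<Longrightarrow> rot u xs \<in> nelists H"
  by (auto simp: nelists_def rot_def dest: in_set_butlastD)

definition hface :: "nat \<Rightarrow> 'h list \<Rightarrow> ('h list, 'k::field) chain" where
  "hface i xs = bas (omit i xs)"

lemma precyclic_lists:
  assumes "\<And>x. x \<in> H \<Longrightarrow> u x \<in> H"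
  shows "precyclic (nelists H) ldg (hface :: nat \<Rightarrow> 'h list \<Rightarrow> ('h list, 'k::field) chain) (rot u)"
proof
  fix xs :: "'h list" and i assume xs: "xs \<in> nelists H"
  show "rot u xs \<in> nelists H" by (rule rot_in[OF xs assms])
  show "ldg (rot u xs) = ldg xs" using xs by (simp add: ldg_def length_rot nelists_def)
  show "(hface i xs :: ('h list, 'k) chain) \<in> Lin {y \<in> nelists H. Suc (ldg y) = ldg xs}" if "i \<le> ldg xs" "0 < ldg xs"
  proof -
    have "i < length xs" using that by (simp add: ldg_def)
    then show ?thesis
      using xs that length_omit[of i xs] omit_in_lists[of xs H i] by (auto simp: hface_def nelists_def ldg_def)
  qed
  show "(hface (Suc i) (rot u xs) :: ('h list, 'k) chain) = pmap (rot u) (hface i xs)" if "i < ldg xs"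
    using that by (simp add: hface_def omit_Suc_rot ldg_def)
  show "(hface 0 (rot u xs) :: ('h list, 'k) chain) = hface (ldg xs) xs"
    using xs by (simp add: hface_def omit_0_rot ldg_def nelists_def)
qed

text \<open>The augmented differential, with the empty list in degree \<open>-1\<close>.\<close>

definition adel :: "'h list \<Rightarrow> ('h list, 'k::field) chain" where
  "adel xs = (\<Sum>i<length xs. cmul ((-1) ^ i) (bas (omit i xs)))"

lemma adel_Nil [simp]: "adel [] = 0"
  by (simp add: adel_def)

text \<open>This join formula says that prepending \<open>h\<close> contracts the augmented complex,
  and it reduces later statements on \<open>adel\<close> to inductions.\<close>

lemma adel_Cons [simp]: "adel (h # xs) = bas xs - pmap (Cons h) (adel xs)"
  unfolding adel_def length_Cons sum.lessThan_Suc_shift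
  by (simp add: pmap_sum pmap_cmul cmul_uminus_left sum_negf)

lemma adel_in: "xs \<in> lists H \<Longrightarrow> adel xs \<in> Lin {ys \<in> lists H. Suc (length ys) = length xs}"
  unfolding adel_def using omit_in_lists[of xs H] length_omit[of _ xs] by (intro Lin_sum Lin_cmul) auto

lemma lext_adel_Cons: "lext adel (pmap (Cons h) p) = p - pmap (Cons h) (lext adel p)"
  by (simp add: lext_pmap lext_fun_diff pmap_lext)

lemma adel_adel: "lext adel (adel xs) = 0"
  by (induction xs) (simp_all add: lext_diff lext_adel_Cons)

text \<open>As constants exported from \<open>precyclic\<close> these depend on the degree and the
  faces only. The same differential therefore serves every vertex set and every twist.\<close>

abbreviation hdel :: "'h list \<Rightarrow> ('h list, 'k::field) chain" where
  "hdel \<equiv> precyclic.b ldg hface"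

abbreviation hdel' :: "'h list \<Rightarrow> ('h list, 'k::field) chain" where
  "hdel' \<equiv> precyclic.b' ldg hface"

context
  fixes H :: "'h set" and u :: "'h \<Rightarrow> 'h"
  assumes u: "\<And>x. x \<in> H \<Longrightarrow> u x \<in> H"
begin

interpretation L: precyclic "nelists H" ldg "hface :: nat \<Rightarrow> 'h list \<Rightarrow> ('h list, 'k::field) chain" "rot u"
  by (rule precyclic_lists[OF u])

lemma hdel_eq: "(hdel xs :: ('h list, 'k::field) chain) = (if length xs \<le> 1 then 0 else adel xs)"
proof (cases "length xs \<le> 1")
  case False
  then have "{..ldg xs} = {..<length xs}" by (auto simp: ldg_def)
  then show ?thesis using False by (simp add: L.b_def adel_def hface_def ldg_def)
qed (simp add: L.b_def ldg_def)

lemma hdel'_Cons: "(hdel' (h # xs) :: ('h list, 'k::field) chain) = (if xs = [] then 0 else bas xs - pmap (Cons h) (hdel' xs))"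
proof (cases "xs = []")
  case False
  then obtain m where m: "length xs = Suc m" by (cases xs) auto
  have "(hdel' (h # xs) :: ('h list, 'k::field) chain) = (\<Sum>i<Suc m. cmul ((-1) ^ i) (bas (omit i (h # xs))))"
    using False by (simp add: L.b'_def hface_def ldg_def m)
  also have "\<dots> = bas xs - pmap (Cons h) (\<Sum>i<m. cmul ((-1) ^ i) (bas (omit i xs)))"
    unfolding sum.lessThan_Suc_shift by (simp add: pmap_sum pmap_cmul cmul_uminus_left sum_negf)
  also have "(\<Sum>i<m. cmul ((-1) ^ i) (bas (omit i xs))) = (hdel' xs :: ('h list, 'k::field) chain)"
    by (simp add: L.b'_def hface_def ldg_def m)
  finally show ?thesis using False by simp
qed (simp add: L.b'_def ldg_def)

lemma lext_hdel'_Cons: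
  assumes "(p :: ('h list, 'k::field) chain) \<in> Lin (nelists H)"
  shows "lext hdel' (pmap (Cons h) p) = p - pmap (Cons h) (lext hdel' p)"
proof -
  have "lext hdel' (pmap (Cons h) p) = lext (\<lambda>xs. bas xs - pmap (Cons h) (hdel' xs)) p"
    unfolding lext_pmap by (rule lext_cong_on[OF assms]) (auto simp: hdel'_Cons nelists_def)
  then show ?thesis by (simp add: lext_fun_diff pmap_lext)
qed

lemma hdel'_hdel': "xs \<in> nelists H \<Longrightarrow> lext hdel' (hdel' xs) = (0 :: ('h list, 'k::field) chain)"
proof (induction xs)
  case (Cons h xs)
  show ?case
  proof (cases "xs = []")
    case False
    then have xs: "xs \<in> nelists H" using Cons.prems by (auto simp: nelists_def)
    then have "(hdel' xs :: ('h list, 'k::field) chain) \<in> Lin (nelists H)"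
      using Lin_mono[OF L.b'_in[OF xs]] by auto
    then show ?thesis
      using Cons.IH[OF xs] False by (simp add: hdel'_Cons lext_diff lext_hdel'_Cons)
  qed (simp add: hdel'_Cons)
qed (simp add: nelists_def)

lemma lext_hdel:
  assumes "(a :: ('h list, 'k::field) chain) \<in> Lin {xs \<in> nelists H. ldg xs = Suc n}"
  shows "lext hdel a = lext adel a"
  by (rule lext_cong_on[OF assms]) (auto simp: hdel_eq ldg_def)

lemma based_complex_lists: "based_complex (nelists H) ldg (hdel :: 'h list \<Rightarrow> ('h list, 'k::field) chain)"
proof
  fix xs :: "'h list" assume xs: "xs \<in> nelists H"
  show "(hdel xs :: ('h list, 'k::field) chain) \<in> Lin {y \<in> nelists H. Suc (ldg y) = ldg xs}" by (rule L.b_in[OF xs])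
  note in' = L.b_in[OF xs]
  show "lext hdel (hdel xs :: ('h list, 'k::field) chain) = 0"
  proof (cases "length xs \<le> 2")
    case True
    then show ?thesis
      using in' by (intro lext_eqI[OF _ in']) (auto simp: hdel_eq ldg_def)
  next
    case False
    then have "ldg xs = Suc (Suc (ldg xs - 2))" by (simp add: ldg_def)
    then have "(hdel xs :: ('h list, 'k::field) chain) \<in> Lin {y \<in> nelists H. ldg y = Suc (ldg xs - 2)}"
      using in' by (auto elim!: Lin_mono)
    then show ?thesis
      using False by (subst lext_hdel) (simp_all add: hdel_eq adel_adel)
  qed
qed

text \<open>The full simplex on a nonempty vertex set is contracted by prepending a fixed vertex. In
  degree 0 the vanishing augmentation is what makes \<open>lext adel a = 0\<close>.\<close>

lemma aug_acyclic_lists: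
  assumes h: "h \<in> H"
  shows "aug_acyclic (nelists H) ldg (hdel :: 'h list \<Rightarrow> ('h list, 'k::field) chain) (\<lambda>_. bas ())"
  unfolding aug_acyclic_def
proof (intro allI ballI impI)
  fix n and a :: "('h list, 'k::field) chain" assume a: "a \<in> Lin {xs \<in> nelists H. ldg xs = n}" and 0: "lext hdel a = 0"
    and e: "n = 0 \<longrightarrow> lext (\<lambda>_. bas ()) a = 0"
  have "lext adel a = 0"
  proof (cases n)
    case 0
    have "lext adel a = lext (\<lambda>_. bas []) a"
      using a unfolding 0 by (intro lext_cong_on[OF a]) (auto simp: nelists_def ldg_def 0 length_Suc_conv neq_Nil_conv)
    also have "\<dots> = lext (\<lambda>_. bas []) (lext (\<lambda>_. bas ()) a)" by (simp add: lext_lext)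
    finally show ?thesis using e 0 by simp
  next
    case (Suc m)
    then show ?thesis using lext_hdel[of a m] a 0 by simp
  qed
  moreover have c: "pmap (Cons h) a \<in> Lin {xs \<in> nelists H. ldg xs = Suc n}"
    using h by (intro Lin_pmap[OF a]) (auto simp: nelists_def ldg_def)
  ultimately have "lext hdel (pmap (Cons h) a) = a"
    unfolding lext_hdel[OF c] lext_adel_Cons by simp
  then show "\<exists>b\<in>Lin {xs \<in> nelists H. ldg xs = Suc n}. lext hdel b = a"
    using c by blast
qed

text \<open>Without the last face, prepending a vertex is a contraction already in degree 0, with no
  augmentation.\<close>

lemma hdel'_contractible:
  assumes h: "h \<in> H" and a: "(a :: ('h list, 'k::field) chain) \<in> Lin {xs \<in> nelists H. ldg xs = n}" and 0: "lext hdel' a = 0"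
  shows "\<exists>c\<in>Lin {xs \<in> nelists H. ldg xs = Suc n}. lext hdel' c = a"
proof (intro bexI)
  show "pmap (Cons h) a \<in> Lin {xs \<in> nelists H. ldg xs = Suc n}"
    using h by (intro Lin_pmap[OF a]) (auto simp: nelists_def ldg_def)
  show "lext hdel' (pmap (Cons h) a) = a"
    using 0 by (subst lext_hdel'_Cons[OF Lin_mono[OF a]]) auto
qed

end

lemma augment_hdel:
  assumes "ldg xs = 1"
  shows "lext (\<lambda>_. bas ()) (hdel xs :: ('h list, 'k::field) chain) = (0 :: unit \<Rightarrow>\<^sub>0 'k)"
proof -
  obtain x y where "xs = [x, y]" using assms by (auto simp: ldg_def length_Suc_conv eval_nat_numeral Suc_diff_le diff_Suc split: nat.splits)
  moreover from this have "(hdel xs :: ('h list, 'k) chain) = bas [y] - bas [x]"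
    using hdel_eq[of UNIV "\<lambda>x. x" xs] by simp
  ultimately show ?thesis by (simp add: lext_diff)
qed

section \<open>Antisymmetrization\<close>

text \<open>A recursive description: join the mean of the vertices of a simplex to the antisymmetrization of
  its boundary. It gives an equivariant chain map that is invariant under the cyclic operator.\<close>

primrec alt_deg :: "nat \<Rightarrow> 'h list \<Rightarrow> ('h list, 'k::field) chain" where
  "alt_deg 0 = bas"
| "alt_deg (Suc n) = (\<lambda>xs. cmul (1 / of_nat (length xs))
     (\<Sum>h\<leftarrow>xs. pmap (Cons h) (lext (alt_deg n) (adel xs))))"

definition alt :: "'h list \<Rightarrow> ('h list, 'k::field) chain" where
  "alt xs = alt_deg (length xs) xs"

lemma lext_sum_list: "lext \<phi> (\<Sum>x\<leftarrow>xs. f x) = (\<Sum>x\<leftarrow>xs. lext \<phi> (f x))"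
  by (induction xs) (simp_all add: lext_add)

lemma pmap_sum_list: "pmap g (\<Sum>x\<leftarrow>xs. f x) = (\<Sum>x\<leftarrow>xs. pmap g (f x))"
  by (simp add: pmap_def lext_sum_list)

lemma alt_Nil [simp]: "alt [] = bas []"
  by (simp add: alt_def)

lemma alt_eq:
  assumes "xs \<noteq> []"
  shows "(alt xs :: ('h list, 'k::field) chain) = cmul (1 / of_nat (length xs)) (\<Sum>h\<leftarrow>xs. pmap (Cons h) (lext alt (adel xs)))"
proof -
  obtain n where n: "length xs = Suc n" using assms by (cases xs) auto
  have "lext (alt_deg n) (adel xs) = lext alt (adel xs :: ('h list, 'k) chain)"
    by (rule lext_cong_on[OF adel_in[of xs UNIV]]) (auto simp: alt_def n)
  then show ?thesis by (simp add: alt_def n)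
qed

lemma Lin_sum_list: "(\<And>z. z \<in> set zs \<Longrightarrow> f z \<in> Lin A) \<Longrightarrow> (\<Sum>z\<leftarrow>zs. f z) \<in> Lin A"
  by (induction zs) (auto intro: Lin_add)

lemma alt_in: "xs \<in> lists H \<Longrightarrow> (alt xs :: ('h list, 'k::field) chain) \<in> Lin {ys \<in> lists H. length ys = length xs}"
proof (induction "length xs" arbitrary: xs)
  case (Suc n)
  then have "xs \<noteq> []" by auto
  have y: "lext alt (adel xs :: ('h list, 'k) chain) \<in> Lin {ys \<in> lists H. length ys = n}"
  proof (rule Lin_lext[OF adel_in[OF Suc.prems]])
    fix ys assume "ys \<in> {ys \<in> lists H. Suc (length ys) = length xs}"
    then have "n = length ys" "ys \<in> lists H" using Suc.hyps(2) by auto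
    from Suc.hyps(1)[OF this] show "(alt ys :: ('h list, 'k) chain) \<in> Lin {ys \<in> lists H. length ys = n}"
      by (simp add: \<open>n = length ys\<close>)
  qed
  have "(\<Sum>h\<leftarrow>xs. pmap (Cons h) (lext alt (adel xs :: ('h list, 'k) chain))) \<in> Lin {ys \<in> lists H. length ys = length xs}"
  proof (rule Lin_sum_list)
    fix z assume "z \<in> set xs"
    then have "z \<in> H" using Suc.prems by auto
    then show "pmap (Cons z) (lext alt (adel xs :: ('h list, 'k) chain)) \<in> Lin {ys \<in> lists H. length ys = length xs}"
      by (intro Lin_pmap[OF y]) (use Suc.hyps(2) in auto)
  qed
  then show ?case unfolding alt_eq[OF \<open>xs \<noteq> []\<close>] by (rule Lin_cmul)
qed simp

text \<open>By induction the antisymmetrized boundary is a cycle. Then the join of each vertex with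
  it has this cycle as its boundary, and so does the mean of the joins; dividing by the number of
  vertices needs characteristic zero.\<close>

lemma alt_chain: "lext adel (alt xs :: ('h list, 'k::field_char_0) chain) = lext alt (adel xs)"
proof (induction "length xs" arbitrary: xs)
  case (Suc n)
  then have ne: "xs \<noteq> []" by auto
  let ?y = "lext alt (adel xs) :: ('h list, 'k) chain"
  have "lext adel ?y = lext (\<lambda>x. lext alt (adel x)) (adel xs)"
    unfolding lext_lext by (rule lext_cong_on[OF adel_in[of xs UNIV]]) (use Suc in auto)
  also have "\<dots> = 0" by (simp flip: lext_lext add: adel_adel)
  finally have "lext adel (pmap (Cons h) ?y) = ?y" for h
    by (simp add: lext_adel_Cons)
  then have "lext adel (alt xs) = cmul (1 / of_nat (length xs)) (\<Sum>h\<leftarrow>xs. ?y)"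
    by (simp add: alt_eq[OF ne] lext_cmul lext_sum_list)
  also have "(\<Sum>h\<leftarrow>zs. ?y) = cmul (of_nat (length zs)) ?y" for zs :: "'h list"
    by (induction zs) (simp_all add: cmul_add_left)
  finally show ?case using ne by simp
qed simp

lemma adel_map: "adel (map g xs) = pmap (map g) (adel xs)"
  by (simp add: adel_def pmap_sum pmap_cmul map_omit)

lemma alt_map: "alt (map g xs) = pmap (map g) (alt xs :: ('h list, 'k::field) chain)"
proof (induction "length xs" arbitrary: xs)
  case (Suc n)
  then have ne: "xs \<noteq> []" by auto
  have "lext alt (adel (map g xs)) = lext (\<lambda>ys. pmap (map g) (alt ys)) (adel xs :: ('h list, 'k) chain)"
    unfolding adel_map lext_pmap by (rule lext_cong_on[OF adel_in[of xs UNIV]]) (use Suc in auto)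
  then have "lext alt (adel (map g xs)) = pmap (map g) (lext alt (adel xs :: ('h list, 'k) chain))"
    by (simp add: pmap_lext)
  then show ?case
    using ne by (simp add: alt_eq pmap_cmul pmap_sum_list pmap_pmap o_def)
qed simp

text \<open>The mean over the vertices does not see their order, so only the antisymmetrized
  boundaries of \<open>xs\<close> and its rotation must agree up to sign. By \<open>b_t\<close> the
  two boundaries differ by \<open>1 - t\<close> applied to \<open>b'\<close>, and there
  antisymmetrization vanishes by induction.\<close>

lemma alt_rot: "xs \<noteq> [] \<Longrightarrow> cmul ((-1) ^ ldg xs) (alt (cycl xs)) = (alt xs :: ('h list, 'k::field) chain)"
proof (induction "length xs" arbitrary: xs)
  case (Suc n)
  interpret L: precyclic "nelists UNIV" ldg "hface :: nat \<Rightarrow> 'h list \<Rightarrow> ('h list, 'k) chain" cycl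
    by (rule precyclic_lists) simp
  show ?case
  proof (cases "length xs = 1")
    case True
    then obtain x where "xs = [x]" by (auto simp: length_Suc_conv)
    then show ?thesis by (simp add: rot_def ldg_def)
  next
    case False
    have xs: "xs \<in> nelists UNIV" using Suc.prems by (simp add: nelists_def)
    have len: "length (cycl xs) = length xs" using length_rot[of xs "\<lambda>x. x"] Suc.prems by simp
    have l2: "\<not> length xs \<le> Suc 0" using False Suc.prems Suc.hyps(2) by linarith
    have b: "hdel xs = (adel xs :: ('h list, 'k) chain)" "hdel (cycl xs) = (adel (cycl xs) :: ('h list, 'k) chain)"
      using hdel_eq[of UNIV "\<lambda>x. x" xs] hdel_eq[of UNIV "\<lambda>x. x" "cycl xs"] len l2 by auto
    have b': "(hdel' xs :: ('h list, 'k) chain) \<in> Lin {y \<in> nelists UNIV. Suc (ldg y) = ldg xs}"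
      by (rule L.b'_in[OF xs])
    have "adel xs - cmul ((-1) ^ ldg xs) (adel (cycl xs)) = hdel' xs - lext L.t (hdel' xs :: ('h list, 'k) chain)"
      using L.b_t[OF xs] by (simp add: lext_diff L.t_def lext_cmul b)
    then have "lext alt (adel xs - cmul ((-1) ^ ldg xs) (adel (cycl xs))) = lext alt (hdel' xs :: ('h list, 'k) chain) - lext alt (lext L.t (hdel' xs))"
      by (simp add: lext_diff)
    also have "lext alt (lext L.t (hdel' xs)) = lext alt (hdel' xs :: ('h list, 'k) chain)"
      unfolding lext_lext
    proof (rule lext_cong_on[OF b'])
      fix ys :: "'h list" assume "ys \<in> {y \<in> nelists UNIV. Suc (ldg y) = ldg xs}"
      then have "ys \<noteq> []" "n = length ys" using Suc.hyps(2) by (auto simp: nelists_def ldg_def)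
      then show "lext alt (L.t ys) = alt ys"
        using Suc.hyps(1)[of ys] by (simp add: L.t_def lext_cmul)
    qed
    finally have eq: "lext alt (adel xs :: ('h list, 'k) chain) = cmul ((-1) ^ ldg xs) (lext alt (adel (cycl xs)))"
      by (simp add: lext_diff lext_cmul)
    have sl: "sum_list (map f (cycl xs)) = sum_list (map f xs)" for f :: "'h \<Rightarrow> ('h list, 'k) chain"
    proof -
      have "sum_list (map f xs) = sum_list (map f (butlast xs @ [last xs]))"
        using Suc.prems by simp
      also have "\<dots> = sum_list (map f (cycl xs))"
        unfolding rot_def by (simp only: map_append sum_list_append) (simp add: add.commute)
      finally show ?thesis ..
    qed
    have sc: "cmul ((-1) ^ ldg xs) (sum_list (map (\<lambda>h. pmap (Cons h) p) zs)) = (\<Sum>h\<leftarrow>zs. pmap (Cons h) (cmul ((-1) ^ ldg xs) p))"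
      for p :: "('h list, 'k) chain" and zs
      by (induction zs) (simp_all add: cmul_add pmap_cmul)
    have ne: "cycl xs \<noteq> []" by (simp add: rot_def)
    have "cmul ((-1) ^ ldg xs) (alt (cycl xs) :: ('h list, 'k) chain)
        = cmul (1 / of_nat (length xs)) (cmul ((-1) ^ ldg xs) (\<Sum>h\<leftarrow>cycl xs. pmap (Cons h) (lext alt (adel (cycl xs)))))"
      unfolding alt_eq[OF ne] len by (simp add: mult.commute)
    also have "\<dots> = cmul (1 / of_nat (length xs)) (\<Sum>h\<leftarrow>cycl xs. pmap (Cons h) (lext alt (adel xs)))"
      unfolding sc eq ..
    finally have "cmul ((-1) ^ ldg xs) (alt (cycl xs) :: ('h list, 'k) chain)
        = cmul (1 / of_nat (length xs)) (\<Sum>h\<leftarrow>cycl xs. pmap (Cons h) (lext alt (adel xs)))" .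
    then show ?thesis unfolding alt_eq[OF Suc.prems] sl .
  qed
qed simp

section \<open>The bar complex as a quotient of homogeneous chains\<close>

text \<open>Passage from homogeneous to inhomogeneous (bar) notation. It forgets precisely a
  simultaneous right translation.\<close>

fun quotients :: "('a, 'c) monoid_scheme \<Rightarrow> 'a list \<Rightarrow> 'a list" where
  "quotients K (x # y # zs) = (x \<otimes>\<^bsub>K\<^esub> inv\<^bsub>K\<^esub> y) # quotients K (y # zs)"
| "quotients K _ = []"

definition bar_del :: "('a, 'c) monoid_scheme \<Rightarrow> 'a list \<Rightarrow> ('a list, 'k::field) chain" where
  "bar_del K ys = (if ys = [] then 0
     else \<Sum>i\<le>length ys. cmul ((-1) ^ i) (bas (bar_face_tuple K (length ys) i ys)))"

lemma length_quotients [simp]: "length (quotients K zs) = length zs - 1"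
  by (induction K zs rule: quotients.induct) auto

lemma nth_quotients: "Suc i < length zs \<Longrightarrow> quotients K zs ! i = zs ! i \<otimes>\<^bsub>K\<^esub> inv\<^bsub>K\<^esub> (zs ! Suc i)"
proof (induction K zs arbitrary: i rule: quotients.induct)
  case (1 K x y zs)
  then show ?case by (cases i) auto
qed auto

lemma nth_omit: "i < length xs \<Longrightarrow> j < length xs - 1 \<Longrightarrow> omit i xs ! j = (if j < i then xs ! j else xs ! Suc j)"
  by (simp add: omit_def nth_append)

lemma hdel_adel: "hdel xs = (if length xs \<le> 1 then 0 else adel xs)"
  by (rule hdel_eq[of UNIV "\<lambda>x. x"]) simp

lemma hdel_map: "hdel (map g xs) = pmap (map g) (hdel xs)"
  by (simp add: hdel_adel adel_map)

lemma nelists_map: "xs \<in> nelists A \<Longrightarrow> (\<And>x. x \<in> A \<Longrightarrow> g x \<in> B) \<Longrightarrow> map g xs \<in> nelists B"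
  by (auto simp: nelists_def)

lemma ldg_map [simp]: "ldg (map g xs) = ldg xs"
  by (simp add: ldg_def)

lemma nelists_nth: "xs \<in> nelists A \<Longrightarrow> i < length xs \<Longrightarrow> xs ! i \<in> A"
  by (auto simp: nelists_def)

context group
begin

lemma quotients_in: "zs \<in> lists (carrier G) \<Longrightarrow> quotients G zs \<in> lists (carrier G)"
  by (induction zs rule: induct_list012) auto

text \<open>An inner vertex occurs in two adjacent quotients, which telescope when it is omitted; an
  end vertex occurs in one quotient, which is dropped.\<close>

lemma bar_face_quotients:
  assumes zs: "zs \<in> nelists (carrier G)" and i: "i \<le> ldg zs" and pos: "0 < ldg zs"
  shows "bar_face_tuple G (ldg zs) i (quotients G zs) = quotients G (omit i zs)"
proof -
  have il: "i < length zs" using i pos by (simp add: ldg_def)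
  have l2: "2 \<le> length zs" using pos by (simp add: ldg_def)
  have c: "j < length zs \<Longrightarrow> zs ! j \<in> carrier G" for j using zs by (rule nelists_nth)
  have len: "length (bar_face_tuple G (ldg zs) i (quotients G zs)) = length zs - 2"
    using il l2 by (auto simp: bar_face_tuple_def ldg_def)
  show ?thesis
  proof (rule nth_equalityI)
    show "length (bar_face_tuple G (ldg zs) i (quotients G zs)) = length (quotients G (omit i zs))"
      using len length_omit[OF il] by simp
    fix j assume "j < length (bar_face_tuple G (ldg zs) i (quotients G zs))"
    then have j: "Suc (Suc j) < length zs" using len by linarith
    have R: "quotients G (omit i zs) ! j = omit i zs ! j \<otimes> inv (omit i zs ! Suc j)"
      using j length_omit[OF il] by (intro nth_quotients) simp
    have o: "omit i zs ! j = (if j < i then zs ! j else zs ! Suc j)"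
      "omit i zs ! Suc j = (if Suc j < i then zs ! Suc j else zs ! Suc (Suc j))"
      using j il by (auto simp: nth_omit)
    consider "i = 0" | "0 < i" "i < ldg zs" | "i = ldg zs" "0 < i" using i by linarith
    then show "bar_face_tuple G (ldg zs) i (quotients G zs) ! j = quotients G (omit i zs) ! j"
    proof cases
      case 1
      then show ?thesis unfolding R o using j by (simp add: bar_face_tuple_def nth_tl nth_quotients)
    next
      case 3
      then have "Suc j < i" "j < i" using j by (auto simp: ldg_def)
      then show ?thesis unfolding R o using j 3 pos by (simp add: bar_face_tuple_def nth_butlast nth_quotients ldg_def)
    next
      case 2
      have si: "Suc i < length zs" using 2 by (simp add: ldg_def)
      consider "Suc j < i" | "Suc j = i" | "i \<le> j" by linarith
      then show ?thesis
      proof cases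
        case 1
        then have "j < i - 1" "j < i" by auto
        then show ?thesis unfolding R o using 1 j 2 si by (simp add: bar_face_tuple_def nth_append nth_quotients)
      next
        case b: 2
        have "(zs ! j \<otimes> inv (zs ! Suc j)) \<otimes> (zs ! Suc j \<otimes> inv (zs ! Suc (Suc j))) = zs ! j \<otimes> inv (zs ! Suc (Suc j))"
          using j c by (simp add: m_assoc inv_solve_left')
        then show ?thesis unfolding R o using j 2 b si
          by (auto simp: bar_face_tuple_def nth_append nth_quotients)
      next
        case 3
        then show ?thesis unfolding R o using j 2 si
          by (auto simp: bar_face_tuple_def nth_append nth_quotients nth_Cons' min_def)
      qed
    qed
  qed
qed

lemma bar_del_quotients:
  assumes "zs \<in> nelists (carrier G)"
  shows "bar_del G (quotients G zs) = pmap (quotients G) (hdel zs :: ('a list, 'k::field) chain)"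
proof (cases "ldg zs = 0")
  case False
  have "quotients G zs \<noteq> []" using False length_quotients[of G zs] by (metis ldg_def list.size(3))
  moreover have "(hdel zs :: ('a list, 'k) chain) = (\<Sum>i\<le>ldg zs. cmul ((-1) ^ i) (bas (omit i zs)))"
    using precyclic.b_def[OF precyclic_lists, of UNIV "\<lambda>x. x" zs] False by (simp add: hface_def)
  moreover have "length (quotients G zs) = ldg zs" by (simp add: ldg_def)
  ultimately show ?thesis
    using False by (simp add: bar_del_def pmap_sum pmap_cmul bar_face_quotients[OF assms])
next
  case True
  have "quotients G zs = []" using True length_quotients[of G zs] by (simp add: ldg_def del: length_quotients)
  then show ?thesis
    using True by (simp add: bar_del_def ldg_def hdel_adel)
qed

lemma quotients_orbit:
  assumes zs: "zs \<in> nelists (carrier G)" and zs': "zs' \<in> nelists (carrier G)" and eq: "quotients G zs = quotients G zs'"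
  shows "\<exists>g\<in>carrier G. zs' = map (\<lambda>z. z \<otimes> g) zs"
proof
  have "length zs - 1 = length zs' - 1" using arg_cong[OF eq, of length] by simp
  then have len: "length zs' = length zs" using zs zs' by (cases zs; cases zs') (auto simp: nelists_def)
  have c: "j < length zs \<Longrightarrow> zs ! j \<in> carrier G \<and> zs' ! j \<in> carrier G" for j
    using nelists_nth zs zs' len by metis
  have ne: "0 < length zs" using zs by (simp add: nelists_def)
  define g where "g = inv (zs ! 0) \<otimes> zs' ! 0"
  show g: "g \<in> carrier G" using c[OF ne] by (simp add: g_def)
  have "j < length zs \<Longrightarrow> zs' ! j = zs ! j \<otimes> g" for j
  proof (induction j)
    case 0
    then show ?case using c[OF ne] by (simp add: g_def inv_solve_left' m_assoc[symmetric])
  next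
    case (Suc j)
    have cc: "zs ! j \<in> carrier G" "zs' ! j \<in> carrier G" "zs ! Suc j \<in> carrier G" "zs' ! Suc j \<in> carrier G"
      using c Suc.prems by auto
    have "zs ! j \<otimes> inv (zs ! Suc j) = zs' ! j \<otimes> inv (zs' ! Suc j)"
      using arg_cong[OF eq, of "\<lambda>l. l ! j"] Suc.prems len by (simp add: nth_quotients)
    also have "\<dots> = zs ! j \<otimes> (g \<otimes> inv (zs' ! Suc j))"
      using Suc cc g by (simp add: m_assoc)
    finally have "inv (zs ! Suc j) = g \<otimes> inv (zs' ! Suc j)" using cc g by simp
    then have "zs ! Suc j = inv (g \<otimes> inv (zs' ! Suc j))" using cc by (metis inv_inv)
    also have "\<dots> = zs' ! Suc j \<otimes> inv g" using cc g by (simp add: inv_mult_group)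
    finally show ?case using cc g by (simp add: m_assoc)
  qed
  then show "zs' = map (\<lambda>z. z \<otimes> g) zs"
    by (intro nth_equalityI) (auto simp: len)
qed

lemma quotients_translate:
  assumes "g \<in> carrier G"
  shows "zs \<in> lists (carrier G) \<Longrightarrow> quotients G (map (\<lambda>z. z \<otimes> g) zs) = quotients G zs"
proof (induction zs rule: induct_list012)
  case (3 x y zs)
  then have c: "x \<in> carrier G" "y \<in> carrier G" by auto
  have "(x \<otimes> g) \<otimes> inv (y \<otimes> g) = x \<otimes> ((g \<otimes> inv g) \<otimes> inv y)"
    using c assms by (simp only: inv_mult_group m_assoc m_closed inv_closed)
  then have "(x \<otimes> g) \<otimes> inv (y \<otimes> g) = x \<otimes> inv y"
    using c assms by simp
  then show ?case using 3 c assms by simp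
qed auto

text \<open>A section of \<open>quotients\<close>, with the last vertex normalized to the
  unit.\<close>

primrec suffix_prods :: "'a list \<Rightarrow> 'a list" where
  "suffix_prods [] = [\<one>]"
| "suffix_prods (y # ys) = (y \<otimes> hd (suffix_prods ys)) # suffix_prods ys"

lemma suffix_prods: "ys \<in> lists (carrier G) \<Longrightarrow>
  suffix_prods ys \<in> lists (carrier G) \<and> length (suffix_prods ys) = Suc (length ys) \<and> quotients G (suffix_prods ys) = ys"
proof (induction ys)
  case (Cons y ys)
  obtain a as where a: "suffix_prods ys = a # as" using Cons by (cases "suffix_prods ys") auto
  then show ?case using Cons by (auto simp: m_assoc)
qed auto

lemma quotients_image: "quotients G ` nelists (carrier G) = lists (carrier G)"
proof
  show "quotients G ` nelists (carrier G) \<subseteq> lists (carrier G)"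
    using quotients_in by (auto simp: nelists_def)
  show "lists (carrier G) \<subseteq> quotients G ` nelists (carrier G)"
  proof
    fix ys assume "ys \<in> lists (carrier G)"
    from suffix_prods[OF this] show "ys \<in> quotients G ` nelists (carrier G)"
      by (intro image_eqI[of _ _ "suffix_prods ys"]) (auto simp: nelists_def)
  qed
qed

text \<open>The group that acts is \<open>Z\<close>, through a surjection onto \<open>G\<close>: the
  identity of the centralizer for Hochschild homology, the projection to its quotient for cyclic
  homology. The same group then acts on source and target of the comparison maps. The kernel of
  \<open>\<pi>\<close> acts trivially, which is why only pseudo-freeness is available.\<close>

lemma bar_orbit_complex:
  assumes Z: "group Z" and \<pi>: "\<pi> \<in> hom Z G" "\<pi> ` carrier Z = carrier G"
  shows "orbit_complex (nelists (carrier G)) ldg (hdel :: 'a list \<Rightarrow> ('a list, 'k::field) chain) (quotients G) (carrier Z)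
      (\<lambda>h. map (\<lambda>z. z \<otimes> \<pi> h)) (bar_del G)"
proof -
  interpret Z: group Z by fact
  have pc: "h \<in> carrier Z \<Longrightarrow> \<pi> h \<in> carrier G" for h using \<pi> by auto
  interpret based_complex "nelists (carrier G)" ldg "hdel :: 'a list \<Rightarrow> ('a list, 'k) chain"
    by (rule based_complex_lists[of _ "\<lambda>x. x"])
  show ?thesis
  proof
    fix h xs assume h: "h \<in> carrier Z" and xs: "xs \<in> nelists (carrier G)"
    show "map (\<lambda>z. z \<otimes> \<pi> h) xs \<in> nelists (carrier G)"
      by (rule nelists_map[OF xs]) (use pc[OF h] in auto)
    show "quotients G (map (\<lambda>z. z \<otimes> \<pi> h) xs) = quotients G xs"
      using xs by (intro quotients_translate[OF pc[OF h]]) (simp add: nelists_def)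
    show "(hdel (map (\<lambda>z. z \<otimes> \<pi> h) xs) :: ('a list, 'k) chain) = pmap (map (\<lambda>z. z \<otimes> \<pi> h)) (hdel xs)"
      by (rule hdel_map)
  next
    fix g h assume gh: "g \<in> carrier Z" "h \<in> carrier Z"
    show "\<exists>k\<in>carrier Z. \<forall>x\<in>nelists (carrier G). map (\<lambda>z. z \<otimes> \<pi> g) (map (\<lambda>z. z \<otimes> \<pi> h) x) = map (\<lambda>z. z \<otimes> \<pi> k) x"
      using gh pc hom_mult[OF \<pi>(1)] by (intro bexI[of _ "h \<otimes>\<^bsub>Z\<^esub> g"]) (auto simp: nelists_def m_assoc)
  next
    fix g h x y assume gh: "g \<in> carrier Z" "h \<in> carrier Z" and x: "x \<in> nelists (carrier G)"
      and eq: "map (\<lambda>z. z \<otimes> \<pi> g) x = map (\<lambda>z. z \<otimes> \<pi> h) x"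
    obtain a as where "x = a # as" "a \<in> carrier G" using x by (cases x) (auto simp: nelists_def)
    then have "\<pi> g = \<pi> h" using eq pc gh by simp
    then show "map (\<lambda>z. z \<otimes> \<pi> g) y = map (\<lambda>z. z \<otimes> \<pi> h) y" by simp
  next
    fix x y assume "x \<in> nelists (carrier G)" "y \<in> nelists (carrier G)" "quotients G x = quotients G y"
    from quotients_orbit[OF this] obtain g where g: "g \<in> carrier G" "y = map (\<lambda>z. z \<otimes> g) x" by blast
    then obtain h where "h \<in> carrier Z" "g = \<pi> h" using \<pi>(2) by blast
    then show "\<exists>g\<in>carrier Z. y = map (\<lambda>z. z \<otimes> \<pi> g) x" using g by blast
  qed (simp_all add: bar_del_quotients)
qed

end

section \<open>The cyclic nerve of a groupoid\<close>

lemma nth_rot: "k < length xs \<Longrightarrow> rot u xs ! k = (if k = 0 then u (xs ! (length xs - 1)) else xs ! (k - 1))"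
  by (auto simp: rot_def nth_Cons' nth_butlast last_conv_nth)

lemma length_rot' [simp]: "xs \<noteq> [] \<Longrightarrow> length (rot u xs) = length xs"
  by (rule length_rot)

lemma rot_funpow_append: "(cycl ^^ length B) (A @ B) = B @ A"
proof (induction B arbitrary: A rule: rev_induct)
  case (snoc z B)
  have "(cycl ^^ length (B @ [z])) (A @ B @ [z]) = (cycl ^^ length B) (cycl (A @ B @ [z]))"
    by (simp add: funpow_swap1)
  also have "cycl (A @ B @ [z]) = (z # A) @ B"
    by (simp add: rot_def butlast_append)
  finally show ?case using snoc[of "z # A"] by simp
qed simp

definition nxt :: "'m list \<Rightarrow> nat \<Rightarrow> 'm" where
  "nxt xs i = xs ! (if Suc i = length xs then 0 else Suc i)"

definition face_list :: "('o, 'm) groupoid_data \<Rightarrow> nat \<Rightarrow> 'm list \<Rightarrow> 'm list" where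
  "face_list G i xs = (if i < ldg xs then take i xs @ comp_mor G (xs ! i) (xs ! Suc i) # drop (i + 2) xs
     else comp_mor G (xs ! ldg xs) (xs ! 0) # butlast (tl xs))"

definition gface :: "('o, 'm) groupoid_data \<Rightarrow> nat \<Rightarrow> 'm list \<Rightarrow> ('m list, 'k::field) chain" where
  "gface G i xs = (if src G (xs ! i) = tgt G (nxt xs i) then bas (face_list G i xs) else 0)"

lemma length_face_list: "0 < ldg xs \<Longrightarrow> length (face_list G i xs) = ldg xs"
  by (auto simp: face_list_def ldg_def)

lemma nth_face_list:
  assumes "i \<le> ldg xs" "k < ldg xs"
  shows "face_list G i xs ! k =
    (if i < ldg xs then if k < i then xs ! k else if k = i then comp_mor G (xs ! i) (xs ! Suc i) else xs ! Suc k
     else if k = 0 then comp_mor G (xs ! i) (xs ! 0) else xs ! k)"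
proof (cases "i < ldg xs")
  case True
  then have "length (take i xs) = i" by (simp add: ldg_def)
  then show ?thesis using True assms
    by (auto simp: face_list_def nth_append nth_Cons' ldg_def)
next
  case False
  then have "i = ldg xs" using assms by simp
  then show ?thesis using assms
    by (auto simp: face_list_def nth_Cons' nth_butlast nth_tl ldg_def)
qed

section \<open>Faces and rotation on tuples of morphisms\<close>

context groupoid
begin

abbreviation cells :: "'m list set" where "cells \<equiv> nelists (mors G)"

abbreviation comp (infixl \<open>\<bullet>\<close> 70) where "g \<bullet> h \<equiv> comp_mor G g h"

lemma face_list_in:
  assumes xs: "xs \<in> cells" and i: "i \<le> ldg xs" "0 < ldg xs" and c: "src G (xs ! i) = tgt G (nxt xs i)"
  shows "face_list G i xs \<in> cells"
proof -
  have m: "k < length xs \<Longrightarrow> xs ! k \<in> mors G" for k using xs by (rule nelists_nth)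
  have "face_list G i xs ! k \<in> mors G" if "k < ldg xs" for k
    unfolding nth_face_list[OF i(1) that]
    using c i that by (auto simp: nxt_def ldg_def intro!: comp_closed m split: if_splits)
  then have "set (face_list G i xs) \<subseteq> mors G"
    by (auto simp: set_conv_nth length_face_list i)
  moreover have "face_list G i xs \<noteq> []" using length_face_list[OF i(2), of G i] i by auto
  ultimately show ?thesis by (auto simp: nelists_def)
qed

lemma face_list_rot:
  assumes "i < ldg xs"
  shows "face_list G (Suc i) (cycl xs) = cycl (face_list G i xs)"
proof -
  have ne: "xs \<noteq> []" using assms by (auto simp: ldg_def)
  have l: "ldg (cycl xs) = ldg xs" "0 < ldg xs" "length (cycl xs) = length xs"
    using assms ne by (auto simp: ldg_def)
  have len: "length (face_list G i xs) = ldg xs" by (rule length_face_list[OF l(2)])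
  then have ne': "face_list G i xs \<noteq> []" using l(2) by auto
  have L: "length xs = Suc (ldg xs)" using ne by (simp add: ldg_def)
  show ?thesis
  proof (rule nth_equalityI)
    show "length (face_list G (Suc i) (cycl xs)) = length (cycl (face_list G i xs))"
      using length_face_list[of "cycl xs" G "Suc i"] l len ne' by simp
    fix k assume "k < length (face_list G (Suc i) (cycl xs))"
    then have k: "k < ldg xs" using length_face_list[of "cycl xs" G "Suc i"] l by simp
    have 1: "face_list G (Suc i) (cycl xs) ! k =
      (if Suc i < ldg xs then if k < Suc i then cycl xs ! k else if k = Suc i
        then comp_mor G (cycl xs ! Suc i) (cycl xs ! Suc (Suc i)) else cycl xs ! Suc k
     else if k = 0 then comp_mor G (cycl xs ! Suc i) (cycl xs ! 0) else cycl xs ! k)"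
      using nth_face_list[of "Suc i" "cycl xs" k G] assms k l by simp
    have r: "j < length xs \<Longrightarrow> cycl xs ! j = (if j = 0 then xs ! ldg xs else xs ! (j - 1))" for j
      using nth_rot[of j xs "\<lambda>x. x"] by (simp add: ldg_def)
    have 2: "cycl (face_list G i xs) ! k = (if k = 0 then face_list G i xs ! (ldg xs - 1) else face_list G i xs ! (k - 1))"
      using nth_rot[of k "face_list G i xs" "\<lambda>x. x"] k by (simp add: len)
    show "face_list G (Suc i) (cycl xs) ! k = cycl (face_list G i xs) ! k"
      unfolding 1 2 using k assms L
      by (cases "k = 0"; cases "Suc i < ldg xs") (auto simp: r nth_face_list)
  qed
qed

lemma gface_rot:
  assumes "i < ldg xs"
  shows "gface G (Suc i) (cycl xs) = pmap cycl (gface G i xs)"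
proof -
  have ne: "xs \<noteq> []" using assms by (auto simp: ldg_def)
  have "cycl xs ! Suc i = xs ! i" using assms by (simp add: nth_rot ldg_def)
  moreover have "nxt (cycl xs) (Suc i) = nxt xs i"
    using assms ne by (auto simp: nxt_def nth_rot ldg_def intro!: arg_cong[of _ _ "(!) xs"])
  ultimately show ?thesis by (simp add: gface_def face_list_rot[OF assms])
qed

lemma gface_0_rot:
  assumes "0 < ldg xs"
  shows "gface G 0 (cycl xs) = gface G (ldg xs) xs"
proof -
  have ne: "xs \<noteq> []" using assms by (auto simp: ldg_def)
  have a: "cycl xs ! 0 = xs ! ldg xs" using ne by (simp add: nth_rot ldg_def)
  have b: "nxt (cycl xs) 0 = nxt xs (ldg xs)"
    using assms ne by (auto simp: nxt_def nth_rot ldg_def)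
  have l: "ldg (cycl xs) = ldg xs" using ne by (simp add: ldg_def)
  have "face_list G 0 (cycl xs) = face_list G (ldg xs) xs"
  proof (rule nth_equalityI)
    show "length (face_list G 0 (cycl xs)) = length (face_list G (ldg xs) xs)"
      using assms l by (simp add: length_face_list)
    fix k assume "k < length (face_list G 0 (cycl xs))"
    then have k: "k < ldg xs" using assms l by (simp add: length_face_list)
    then show "face_list G 0 (cycl xs) ! k = face_list G (ldg xs) xs ! k"
      using assms l a ne by (auto simp: nth_face_list nth_rot ldg_def)
  qed
  then show ?thesis by (simp add: gface_def a b)
qed

lemma nerve_cyclic_basis: "cyclic_basis cells ldg (gface G :: nat \<Rightarrow> 'm list \<Rightarrow> ('m list, 'k::field) chain) cycl"
proof
  fix xs assume xs: "xs \<in> cells"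
  show "cycl xs \<in> cells" by (rule rot_in[OF xs])
  show "ldg (cycl xs) = ldg xs" using xs by (simp add: ldg_def nelists_def)
  show "(cycl ^^ Suc (ldg xs)) xs = xs"
    using rot_funpow_append[of xs "[]"] xs by (simp add: ldg_def nelists_def del: funpow.simps)
  show "(gface G i xs :: ('m list, 'k) chain) \<in> Lin {y \<in> cells. Suc (ldg y) = ldg xs}"
    if "i \<le> ldg xs" "0 < ldg xs" for i
    using face_list_in[OF xs that] length_face_list[OF that(2), of G i] that
    by (auto simp: gface_def ldg_def)
qed (simp_all add: gface_rot gface_0_rot)

abbreviation gb :: "'m list \<Rightarrow> ('m list, 'k::field) chain" where
  "gb \<equiv> precyclic.b ldg (gface G)"

abbreviation gb' :: "'m list \<Rightarrow> ('m list, 'k::field) chain" where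
  "gb' \<equiv> precyclic.b' ldg (gface G)"

abbreviation gtdeg :: "nat \<times> 'm list \<Rightarrow> nat" where "gtdeg \<equiv> precyclic.tdeg ldg"
abbreviation gtdiff :: "nat \<times> 'm list \<Rightarrow> nat \<times> 'm list \<Rightarrow>\<^sub>0 'k::field" where
  "gtdiff \<equiv> precyclic.tdiff ldg (gface G) cycl"

lemmas gb_def = precyclic.b_def[OF cyclic_basis.axioms(1)[OF nerve_cyclic_basis]]
lemmas gb'_def = precyclic.b'_def[OF cyclic_basis.axioms(1)[OF nerve_cyclic_basis]]

section \<open>Tuples with a non-composable cyclic pair\<close>

definition brk :: "'m list \<Rightarrow> nat \<Rightarrow> bool" where
  "brk xs j \<longleftrightarrow> j < length xs \<and> src G (xs ! j) \<noteq> tgt G (nxt xs j)"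

definition first_brk :: "'m list \<Rightarrow> nat" where
  "first_brk xs = (LEAST j. brk xs j)"

definition ins :: "nat \<Rightarrow> 'm list \<Rightarrow> 'm list" where
  "ins j xs = take (Suc j) xs @ ident G (src G (xs ! j)) # drop (Suc j) xs"

definition broken :: "'m list set" where
  "broken = {xs \<in> cells. \<exists>j. brk xs j}"

lemma length_ins: "j < length xs \<Longrightarrow> length (ins j xs) = Suc (length xs)"
  by (simp add: ins_def)

lemma nth_ins: "j < length xs \<Longrightarrow> k \<le> length xs \<Longrightarrow>
   ins j xs ! k = (if k \<le> j then xs ! k else if k = Suc j then ident G (src G (xs ! j)) else xs ! (k - 1))"
  by (auto simp: ins_def nth_append nth_Cons' min_def intro!: arg_cong[of _ _ "(!) xs"])

text \<open>A face merges two entries that match, so the breaks of the remaining pairs persist.\<close>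

lemma brk_face_list:
  assumes xs: "xs \<in> cells" and i: "i \<le> ldg xs" and k: "k < ldg xs"
    and c: "src G (xs ! i) = tgt G (nxt xs i)"
  shows "src G (face_list G i xs ! k) = src G (xs ! (if k < i then k else Suc k))"
    and "tgt G (nxt (face_list G i xs) k) = tgt G (nxt xs (if k < i then k else Suc k))"
    and "brk (face_list G i xs) k \<longleftrightarrow> brk xs (if k < i then k else Suc k)"
proof -
  have m: "k < length xs \<Longrightarrow> xs ! k \<in> mors G" for k using xs by (rule nelists_nth)
  have L: "length xs = Suc (ldg xs)" using k by (simp add: ldg_def)
  have len: "length (face_list G i xs) = ldg xs" using k by (simp add: length_face_list)
  have st: "src G (comp_mor G (xs ! i) (nxt xs i)) = src G (nxt xs i)"
    "tgt G (comp_mor G (xs ! i) (nxt xs i)) = tgt G (xs ! i)"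
    using src_comp[OF _ _ c] tgt_comp[OF _ _ c] m i L by (auto simp: nxt_def)
  show 1: "src G (face_list G i xs ! k) = src G (xs ! (if k < i then k else Suc k))"
    using st(1) i k L unfolding nth_face_list[OF i k] by (auto simp: nxt_def)
  have t: "tgt G (face_list G i xs ! j) = tgt G (if i < ldg xs then (if j \<le> i then xs ! j else xs ! Suc j)
      else if j = 0 then xs ! i else xs ! j)" if "j < ldg xs" for j
    using st(2) i L that unfolding nth_face_list[OF i that] by (auto simp: nxt_def)
  have n: "nxt (face_list G i xs) k = face_list G i xs ! (if Suc k = ldg xs then 0 else Suc k)"
    by (simp add: nxt_def len)
  show 2: "tgt G (nxt (face_list G i xs) k) = tgt G (nxt xs (if k < i then k else Suc k))"
    unfolding n using k i by (subst t) (auto simp: nxt_def L)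
  show "brk (face_list G i xs) k \<longleftrightarrow> brk xs (if k < i then k else Suc k)"
    unfolding brk_def 1 2 len L using k by auto
qed

lemma first_brk: "xs \<in> broken \<Longrightarrow> brk xs (first_brk xs)"
  unfolding first_brk_def broken_def by (auto intro: LeastI)

lemma not_brk_less: "j < first_brk xs \<Longrightarrow> \<not> brk xs j"
  unfolding first_brk_def by (rule not_less_Least)

text \<open>A nonzero face merges a matching pair, so it never acts at the first break. A merge
  before the break moves the break down by one, and a later merge leaves it in place; the signs in
  \<open>hbrk\<close> depend on this.\<close>

lemma face_list_broken:
  assumes xs: "xs \<in> broken" and i: "i \<le> ldg xs" "0 < ldg xs"
    and c: "src G (xs ! i) = tgt G (nxt xs i)"
  shows "face_list G i xs \<in> broken"
    and "first_brk (face_list G i xs) = (if i < first_brk xs then first_brk xs - 1 else first_brk xs)"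
    and "i \<noteq> first_brk xs"
proof -
  let ?j = "first_brk xs"
  have xm: "xs \<in> cells" using xs by (simp add: broken_def)
  have j: "brk xs ?j" by (rule first_brk[OF xs])
  then show ij: "i \<noteq> ?j" using c by (auto simp: brk_def)
  have L: "length xs = Suc (ldg xs)" using i by (simp add: ldg_def)
  have jl: "?j < Suc (ldg xs)" using j L by (simp add: brk_def)
  define j' where "j' = (if i < ?j then ?j - 1 else ?j)"
  have j': "j' < ldg xs" using jl ij i by (auto simp: j'_def)
  have b': "brk (face_list G i xs) j'"
    unfolding brk_face_list(3)[OF xm i(1) j' c] using j ij by (auto simp: j'_def)
  then show "face_list G i xs \<in> broken"
    using face_list_in[OF xm i c] by (auto simp: broken_def)
  have "\<not> brk (face_list G i xs) k" if "k < j'" for k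
    unfolding brk_face_list(3)[OF xm i(1) less_trans[OF that j'] c]
    using that ij by (intro not_brk_less) (auto simp: j'_def split: if_splits)
  then show "first_brk (face_list G i xs) = (if i < ?j then ?j - 1 else ?j)"
    unfolding first_brk_def[of "face_list G i xs"] j'_def[symmetric]
    by (intro Least_equality[where P = "brk (face_list G i xs)"] b') (meson not_less)
qed

lemma face_list_ins_less:
  assumes xs: "xs \<in> cells" and i: "i < j" and j: "j < length xs"
    and c: "src G (xs ! i) = tgt G (nxt xs i)"
  shows "gface G i (ins j xs) = bas (ins (j - 1) (face_list G i xs))"
proof -
  have L: "length xs = Suc (ldg xs)" using j by (simp add: ldg_def)
  have l: "ldg (ins j xs) = Suc (ldg xs)" using j by (simp add: ldg_def length_ins)
  have len: "length (face_list G i xs) = ldg xs" using i j by (intro length_face_list) (simp add: ldg_def)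
  have "src G (ins j xs ! i) = tgt G (nxt (ins j xs) i)"
    using c i j L by (simp add: nxt_def length_ins nth_ins)
  moreover have "face_list G i (ins j xs) = ins (j - 1) (face_list G i xs)"
  proof (rule nth_equalityI)
    show "length (face_list G i (ins j xs)) = length (ins (j - 1) (face_list G i xs))"
      using i j L l by (simp add: length_ins length_face_list)
    fix k assume "k < length (face_list G i (ins j xs))"
    then have k: "k < Suc (ldg xs)" using l by (simp add: length_face_list)
    have id: "src G (face_list G i xs ! (j - 1)) = src G (xs ! j)"
      using brk_face_list(1)[OF xs, of i "j - 1"] i j c L by auto
    have R: "ins (j - 1) (face_list G i xs) ! k = (if k \<le> j - 1 then face_list G i xs ! k
        else if k = Suc (j - 1) then ident G (src G (xs ! j)) else face_list G i xs ! (k - 1))"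
      using nth_ins[of "j - 1" "face_list G i xs" k] i j k L id by (simp add: len)
    show "face_list G i (ins j xs) ! k = ins (j - 1) (face_list G i xs) ! k"
      unfolding R using i j L k by (subst nth_face_list) (auto simp: l nth_ins nth_face_list)
  qed
  ultimately show ?thesis by (simp add: gface_def)
qed

lemma face_list_ins_greater:
  assumes xs: "xs \<in> cells" and i: "j < i" and j: "i < length xs"
  shows "gface G (Suc i) (ins j xs) = (if src G (xs ! i) = tgt G (nxt xs i) then bas (ins j (face_list G i xs)) else 0)"
proof -
  have L: "length xs = Suc (ldg xs)" using j by (simp add: ldg_def)
  have l: "ldg (ins j xs) = Suc (ldg xs)" using j i by (simp add: ldg_def length_ins)
  have len: "length (face_list G i xs) = ldg xs" using i j by (intro length_face_list) (simp add: ldg_def)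
  have "ins j xs ! Suc i = xs ! i" "nxt (ins j xs) (Suc i) = nxt xs i"
    using i j L by (auto simp: nxt_def length_ins nth_ins)
  moreover have "face_list G (Suc i) (ins j xs) = ins j (face_list G i xs)"
    if c: "src G (xs ! i) = tgt G (nxt xs i)"
  proof (rule nth_equalityI)
    show "length (face_list G (Suc i) (ins j xs)) = length (ins j (face_list G i xs))"
      using i j L l by (simp add: length_ins length_face_list)
    fix k assume "k < length (face_list G (Suc i) (ins j xs))"
    then have k: "k < Suc (ldg xs)" using l by (simp add: length_face_list)
    have id: "src G (face_list G i xs ! j) = src G (xs ! j)"
      using brk_face_list(1)[OF xs, of i j] i j c L by auto
    have R: "ins j (face_list G i xs) ! k = (if k \<le> j then face_list G i xs ! k
        else if k = Suc j then ident G (src G (xs ! j)) else face_list G i xs ! (k - 1))"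
      using nth_ins[of j "face_list G i xs" k] i j k L id by (simp add: len)
    show "face_list G (Suc i) (ins j xs) ! k = ins j (face_list G i xs) ! k"
      unfolding R using i j L k by (subst nth_face_list) (auto simp: l nth_ins nth_face_list intro!: arg_cong[of _ _ "(!) xs"])
  qed
  ultimately show ?thesis by (simp add: gface_def)
qed

lemma gface_ins_same:
  assumes xs: "xs \<in> cells" and j: "j < length xs"
  shows "gface G j (ins j xs) = bas xs"
proof -
  have m: "xs ! j \<in> mors G" using nelists_nth[OF xs j] .
  have l: "ldg (ins j xs) = length xs" using j by (simp add: ldg_def length_ins)
  have "src G (ins j xs ! j) = tgt G (nxt (ins j xs) j)"
    using j m by (auto simp: nxt_def length_ins nth_ins tgt_ident src_closed)
  moreover have "face_list G j (ins j xs) = xs"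
  proof (rule nth_equalityI)
    show len: "length (face_list G j (ins j xs)) = length xs"
      using l j by (subst length_face_list) auto
    fix k assume "k < length (face_list G j (ins j xs))"
    then have k: "k < length xs" using len by simp
    show "face_list G j (ins j xs) ! k = xs ! k"
      using j k l m by (subst nth_face_list) (auto simp: nth_ins comp_ident_right)
  qed
  ultimately show ?thesis by (simp add: gface_def)
qed

lemma gface_ins_brk:
  assumes "xs \<in> cells" "brk xs j"
  shows "gface G (Suc j) (ins j xs) = 0"
proof -
  have j: "j < length xs" "src G (xs ! j) \<noteq> tgt G (nxt xs j)" using assms(2) by (auto simp: brk_def)
  have m: "xs ! j \<in> mors G" using nelists_nth[OF assms(1) j(1)] .
  have "ins j xs ! Suc j = ident G (src G (xs ! j))" "nxt (ins j xs) (Suc j) = nxt xs j"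
    using j by (auto simp: nxt_def length_ins nth_ins)
  then show ?thesis using j m by (simp add: gface_def src_ident src_closed)
qed

text \<open>The contraction inserts an identity behind the first break. Its sign is that of face
  \<open>first_brk xs\<close>, which removes the identity again.\<close>

definition hbrk :: "'m list \<Rightarrow> ('m list, 'k::field) chain" where
  "hbrk xs = cmul ((-1) ^ first_brk xs) (bas (ins (first_brk xs) xs))"

lemma ins_broken:
  assumes xs: "xs \<in> broken"
  shows "ins (first_brk xs) xs \<in> {ys \<in> broken. ldg ys = Suc (ldg xs)}"
proof -
  let ?j = "first_brk xs"
  have j: "brk xs ?j" by (rule first_brk[OF xs])
  then have jl: "?j < length xs" by (simp add: brk_def)
  have xm: "xs \<in> cells" using xs by (simp add: broken_def)
  have m: "xs ! ?j \<in> mors G" using nelists_nth[OF xm jl] .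
  have "ins ?j xs ! Suc ?j = ident G (src G (xs ! ?j))" "nxt (ins ?j xs) (Suc ?j) = nxt xs ?j"
    using jl by (auto simp: nxt_def length_ins nth_ins)
  then have "brk (ins ?j xs) (Suc ?j)"
    using j jl m by (auto simp: brk_def length_ins src_ident src_closed)
  moreover have "ins ?j xs \<in> cells"
    using xm m by (auto simp: nelists_def ins_def ident_closed src_closed dest!: in_set_takeD in_set_dropD)
  ultimately show ?thesis using jl by (auto simp: broken_def ldg_def length_ins)
qed

text \<open>Let \<open>j\<close> be the first break. Face \<open>j\<close> of the enlarged tuple
  gives back \<open>xs\<close>, and face \<open>Suc j\<close> is 0, as the break now lies behind the
  identity. A face \<open>i < j\<close> corresponds to face \<open>i\<close> of \<open>xs\<close>,
  and face \<open>Suc i\<close> for \<open>i > j\<close> to face \<open>i\<close> of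
  \<open>xs\<close>, each with opposite sign in the other summand. Face \<open>j\<close> of
  \<open>xs\<close> itself is 0.\<close>

lemma hbrk_homotopy:
  assumes xs: "xs \<in> broken"
  shows "lext gb (hbrk xs) + lext hbrk (gb xs) = (bas xs :: ('m list, 'k::field) chain)"
proof -
  define j where "j = first_brk xs"
  define n where "n = ldg xs"
  have xm: "xs \<in> cells" using xs by (simp add: broken_def)
  have bj: "brk xs j" unfolding j_def by (rule first_brk[OF xs])
  have L: "length xs = Suc n" using xm by (simp add: n_def ldg_def nelists_def)
  have jn: "j \<le> n" using bj L by (simp add: brk_def)
  have cj: "src G (xs ! j) \<noteq> tgt G (nxt xs j)" using bj by (simp add: brk_def)
  have l: "ldg (ins j xs) = Suc n" using jn L by (simp add: ldg_def length_ins)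
  define F where "F i = lext hbrk (gface G i xs :: ('m list, 'k) chain)" for i
  \<comment> \<open>No break precedes \<open>j\<close>, so these faces are nonzero. Each lowers the
    first break by one, whence the sign exponent \<open>j - 1\<close>.\<close>
  have less: "gface G i (ins j xs) = cmul ((-1) ^ (j - 1)) (F i)" if "i < j" for i
  proof -
    have c: "src G (xs ! i) = tgt G (nxt xs i)"
      using not_brk_less[of i xs] that L jn by (simp add: brk_def j_def)
    have "0 < ldg xs" "i \<le> ldg xs" using that jn by (auto simp: n_def)
    note f = face_list_broken(2)[OF xs this(2,1) c]
    have "F i = cmul ((-1) ^ (j - 1)) (bas (ins (j - 1) (face_list G i xs)))"
      using c that f by (simp add: F_def gface_def hbrk_def j_def)
    then show ?thesis
      using face_list_ins_less[OF xm that _ c] jn L by (simp flip: power_add mult_2)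
  qed
  have greater: "gface G (Suc i) (ins j xs) = cmul ((-1) ^ j) (F i)" if "j < i" "i \<le> n" for i
  proof (cases "src G (xs ! i) = tgt G (nxt xs i)")
    case c: True
    have "0 < ldg xs" "i \<le> ldg xs" using that jn by (auto simp: n_def)
    note f = face_list_broken(2)[OF xs this(2,1) c]
    have "F i = cmul ((-1) ^ j) (bas (ins j (face_list G i xs)))"
      using c that f by (simp add: F_def gface_def hbrk_def j_def)
    then show ?thesis
      using face_list_ins_greater[OF xm that(1)] that L c by (simp flip: power_add mult_2)
  next
    case False
    then have "F i = 0" by (simp add: F_def gface_def)
    then show ?thesis
      using face_list_ins_greater[OF xm that(1)] that L False by simp
  qed
  have im: "Suc ` {j<..n} = {Suc j<..Suc n}" using image_Suc_atLeastAtMost[of "Suc j" n]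
    by (simp add: atLeastSucAtMost_greaterThanAtMost del: image_Suc_atLeastAtMost)
  have split: "{..Suc n} = {..<j} \<union> {j, Suc j} \<union> Suc ` {j<..n}"
    unfolding im using jn by auto
  have "gb (ins j xs) = (\<Sum>i\<le>Suc n. cmul ((-1) ^ i) (gface G i (ins j xs) :: ('m list, 'k) chain))"
    by (simp add: gb_def l)
  also have "\<dots> = (\<Sum>i<j. cmul ((-1) ^ i) (gface G i (ins j xs)))
     + (cmul ((-1) ^ j) (gface G j (ins j xs)) + cmul ((-1) ^ Suc j) (gface G (Suc j) (ins j xs)))
     + (\<Sum>i\<in>Suc ` {j<..n}. cmul ((-1) ^ i) (gface G i (ins j xs)))"
    unfolding split by (subst sum.union_disjoint; force)+
  also have "(\<Sum>i\<in>Suc ` {j<..n}. cmul ((-1) ^ i) (gface G i (ins j xs)))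
     = (\<Sum>i\<in>{j<..n}. cmul ((-1) ^ Suc i) (gface G (Suc i) (ins j xs) :: ('m list, 'k) chain))"
    by (subst sum.reindex) auto
  also have "\<dots> = (\<Sum>i\<in>{j<..n}. cmul ((-1) ^ j) (- cmul ((-1) ^ i) (F i)))"
    by (intro sum.cong) (auto simp: greater cmul_uminus_left cmul_uminus mult.commute)
  also have "(\<Sum>i<j. cmul ((-1) ^ i) (gface G i (ins j xs) :: ('m list, 'k) chain)) = (\<Sum>i<j. cmul ((-1) ^ j) (- cmul ((-1) ^ i) (F i)))"
    by (intro sum.cong, simp)
      (auto simp: less cmul_uminus_left cmul_uminus mult.commute gr0_conv_Suc dest!: less_imp_Suc_add)
  also have "gface G j (ins j xs) = (bas xs :: ('m list, 'k) chain)" by (rule gface_ins_same[OF xm]) (use jn L in simp)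
  also have "gface G (Suc j) (ins j xs) = (0 :: ('m list, 'k) chain)" by (rule gface_ins_brk[OF xm bj])
  finally have g: "gb (ins j xs) = cmul ((-1) ^ j) (bas xs - (\<Sum>i<j. cmul ((-1) ^ i) (F i)) - (\<Sum>i\<in>{j<..n}. cmul ((-1) ^ i) (F i)))"
    by (simp add: cmul_diff cmul_sum cmul_uminus sum_negf)
  have sq: "(-1 :: 'k) ^ j * (-1) ^ j = 1" by (simp flip: power_add mult_2)
  have 1: "lext gb (hbrk xs) = bas xs - (\<Sum>i<j. cmul ((-1) ^ i) (F i)) - (\<Sum>i\<in>{j<..n}. cmul ((-1) ^ i) (F i))"
    unfolding hbrk_def lext_cmul lext_bas j_def[symmetric] g by (simp add: sq)
  have "lext hbrk (gb xs) = (\<Sum>i<j. cmul ((-1) ^ i) (F i)) + (\<Sum>i\<in>{j<..n}. cmul ((-1) ^ i) (F i))"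
  proof (cases "n = 0")
    case True
    then show ?thesis using jn by (simp add: gb_def n_def)
  next
    case False
    have s: "{..n} = {..<j} \<union> {j} \<union> {j<..n}" using jn by auto
    have "lext hbrk (gb xs) = (\<Sum>i\<le>n. cmul ((-1) ^ i) (F i))"
      using False by (simp add: gb_def n_def lext_sum lext_cmul F_def)
    also have "\<dots> = (\<Sum>i<j. cmul ((-1) ^ i) (F i)) + cmul ((-1) ^ j) (F j) + (\<Sum>i\<in>{j<..n}. cmul ((-1) ^ i) (F i))"
      unfolding s by (subst sum.union_disjoint; force)+
    also have "F j = 0" using cj by (simp add: F_def gface_def)
    finally show ?thesis by simp
  qed
  then show ?thesis using 1 by simp
qed

text \<open>Joining an identity in front contracts \<open>gb'\<close>, since the algebra is unital.\<close>

definition add_ident :: "'m list \<Rightarrow> 'm list" where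
  "add_ident xs = ident G (tgt G (hd xs)) # xs"

lemma add_ident_in: "xs \<in> cells \<Longrightarrow> add_ident xs \<in> cells"
  by (cases xs) (auto simp: nelists_def add_ident_def tgt_closed ident_closed)

lemma brk_add_ident:
  assumes xs: "xs \<in> cells"
  shows "(\<exists>j. brk (add_ident xs) j) \<longleftrightarrow> (\<exists>j. brk xs j)"
proof -
  have m: "hd xs \<in> mors G" "xs \<noteq> []" using xs by (cases xs; auto simp: nelists_def)+
  have 0: "\<not> brk (add_ident xs) 0"
    using m by (auto simp: brk_def nxt_def add_ident_def src_ident tgt_closed hd_conv_nth)
  have S: "brk (add_ident xs) (Suc j) \<longleftrightarrow> brk xs j" for j
    using m by (auto simp: brk_def nxt_def add_ident_def tgt_ident tgt_closed hd_conv_nth)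
  show ?thesis using 0 S by (metis nat.exhaust)
qed

lemma gface_add_ident:
  assumes xs: "xs \<in> cells"
  shows "gface G 0 (add_ident xs) = bas xs"
    and "i < ldg xs \<Longrightarrow> gface G (Suc i) (add_ident xs) = pmap add_ident (gface G i xs)"
proof -
  have m: "hd xs \<in> mors G" "xs \<noteq> []" using xs by (cases xs; auto simp: nelists_def)+
  have l: "ldg (add_ident xs) = length xs" by (simp add: ldg_def add_ident_def)
  show "gface G 0 (add_ident xs) = bas xs"
  proof -
    have "face_list G 0 (add_ident xs) = xs"
      using m by (cases xs) (auto simp: face_list_def add_ident_def comp_ident_left ldg_def)
    moreover have "src G (add_ident xs ! 0) = tgt G (nxt (add_ident xs) 0)"
      using m by (cases xs) (auto simp: nxt_def add_ident_def src_ident tgt_closed)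
    ultimately show ?thesis by (simp add: gface_def)
  qed
  assume i: "i < ldg xs"
  then have il: "Suc i < length xs" by (simp add: ldg_def)
  have "face_list G (Suc i) (add_ident xs) = add_ident (face_list G i xs)" if c: "src G (xs ! i) = tgt G (nxt xs i)"
  proof -
    have f: "face_list G (Suc i) (add_ident xs) = ident G (tgt G (hd xs)) # face_list G i xs"
      using il i by (simp add: face_list_def l) (simp add: add_ident_def)
    have ne: "face_list G i xs \<noteq> []" using i by (simp add: face_list_def)
    have "tgt G (hd (face_list G i xs)) = tgt G (hd xs)"
      using tgt_comp[OF _ _ c] nelists_nth[OF xs, of i] nelists_nth[OF xs, of "Suc i"] il i m ne
      by (subst hd_conv_nth) (auto simp: nth_face_list hd_conv_nth nxt_def)
    then show ?thesis unfolding f by (simp add: add_ident_def)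
  qed
  then show "gface G (Suc i) (add_ident xs) = pmap add_ident (gface G i xs)"
    using il by (auto simp: gface_def nxt_def add_ident_def)
qed

text \<open>Stated for any set of tuples stable under \<open>add_ident\<close>, so that it covers
  the broken tuples as well as the tuples belonging to one orbit of loops.\<close>

lemma gb'_contractible:
  assumes S: "S \<subseteq> cells" "\<And>xs. xs \<in> S \<Longrightarrow> add_ident xs \<in> S"
    and a: "(a :: ('m list, 'k::field) chain) \<in> Lin {xs \<in> S. ldg xs = n}" and 0: "lext gb' a = 0"
  shows "\<exists>c\<in>Lin {xs \<in> S. ldg xs = Suc n}. lext gb' c = a"
proof (intro bexI)
  show "pmap add_ident a \<in> Lin {xs \<in> S. ldg xs = Suc n}"
  proof (rule Lin_pmap[OF a])
    fix xs assume "xs \<in> {xs \<in> S. ldg xs = n}"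
    moreover then have "xs \<noteq> []" using S(1) by (auto simp: nelists_def)
    ultimately show "add_ident xs \<in> {xs \<in> S. ldg xs = Suc n}"
      using S(2)[of xs] by (auto simp: ldg_def add_ident_def)
  qed
  have "lext gb' (pmap add_ident a) = lext (\<lambda>xs. bas xs - pmap add_ident (gb' xs)) a"
    unfolding lext_pmap
  proof (rule lext_cong_on[OF a])
    fix xs assume "xs \<in> {xs \<in> S. ldg xs = n}"
    then have xs: "xs \<in> cells" using S(1) by auto
    then have l: "ldg (add_ident xs) = Suc (ldg xs)" by (auto simp: ldg_def add_ident_def nelists_def)
    have "gb' (add_ident xs) = (\<Sum>i<Suc (ldg xs). cmul ((-1) ^ i) (gface G i (add_ident xs) :: ('m list, 'k) chain))"
      by (simp add: gb'_def l)
    also have "\<dots> = bas xs - pmap add_ident (\<Sum>i<ldg xs. cmul ((-1) ^ i) (gface G i xs))"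
      unfolding sum.lessThan_Suc_shift
      by (simp add: gface_add_ident[OF xs] pmap_sum pmap_cmul cmul_uminus_left sum_negf)
    also have "(\<Sum>i<ldg xs. cmul ((-1) ^ i) (gface G i xs :: ('m list, 'k) chain)) = gb' xs" by (simp add: gb'_def)
    finally show "gb' (add_ident xs) = bas xs - pmap add_ident (gb' xs :: ('m list, 'k) chain)" .
  qed
  also have "\<dots> = a"
    using 0 by (simp add: lext_fun_diff flip: pmap_lext)
  finally show "lext gb' (pmap add_ident a) = a" .
qed

end

lemma hdel_sum: "hdel xs = (if ldg xs = 0 then 0 else \<Sum>i\<le>ldg xs. cmul ((-1) ^ i) (bas (omit i xs)))"
  unfolding precyclic.b_def[OF precyclic_lists[of UNIV "\<lambda>x. x", OF UNIV_I]] hface_def ..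

section \<open>Inverses and cancellation in a groupoid\<close>

context groupoid
begin

abbreviation iv where "iv g \<equiv> inverse_mor G g"

lemma iv_unique:
  assumes g: "g \<in> mors G" and h: "h \<in> mors G" "src G h = tgt G g" "tgt G h = src G g" "h \<bullet> g = ident G (src G g)"
    and h': "h' \<in> mors G" "src G h' = tgt G g" "tgt G h' = src G g" "g \<bullet> h' = ident G (tgt G g)"
  shows "h = h'"
proof -
  have "h = h \<bullet> (g \<bullet> h')" using h h' comp_ident_right[OF h(1)] by simp
  also have "\<dots> = (h \<bullet> g) \<bullet> h'" using comp_assoc[OF h(1) g h'(1)] h h' by simp
  also have "\<dots> = h'" using h h' comp_ident_left[OF h'(1)] by simp
  finally show ?thesis .
qed

lemma iv:
  assumes g: "g \<in> mors G"
  shows "iv g \<in> mors G" "src G (iv g) = tgt G g" "tgt G (iv g) = src G g"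
    "iv g \<bullet> g = ident G (src G g)" "g \<bullet> iv g = ident G (tgt G g)"
proof -
  obtain h where h: "h \<in> mors G" "src G h = tgt G g" "tgt G h = src G g"
      "h \<bullet> g = ident G (src G g)" "g \<bullet> h = ident G (tgt G g)"
    using ex_inverse[OF g] by blast
  have "iv g = h"
    unfolding inverse_mor_def using h by (intro the_equality) (auto intro: iv_unique[OF g])
  then show "iv g \<in> mors G" "src G (iv g) = tgt G g" "tgt G (iv g) = src G g"
    "iv g \<bullet> g = ident G (src G g)" "g \<bullet> iv g = ident G (tgt G g)" using h by simp_all
qed

lemma iv_eqI:
  assumes "g \<in> mors G" "h \<in> mors G" "src G h = tgt G g" "tgt G h = src G g" "h \<bullet> g = ident G (src G g)"
  shows "iv g = h"
  by (rule iv_unique[OF assms(1-5), symmetric]) (use iv[OF assms(1)] in auto)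

lemma iv_cancel1: "\<lbrakk>g \<in> mors G; h \<in> mors G; src G g = tgt G h\<rbrakk> \<Longrightarrow> iv g \<bullet> (g \<bullet> h) = h"
  using comp_assoc[of "iv g" g h] comp_ident_left[of h] iv[of g] by simp

lemma iv_cancel2: "\<lbrakk>g \<in> mors G; h \<in> mors G; tgt G g = tgt G h\<rbrakk> \<Longrightarrow> g \<bullet> (iv g \<bullet> h) = h"
  using comp_assoc[of g "iv g" h] comp_ident_left[of h] iv[of g] by simp

lemma iv_iv: "g \<in> mors G \<Longrightarrow> iv (iv g) = g"
  by (rule iv_eqI) (simp_all add: iv)

lemma iv_comp: "\<lbrakk>g \<in> mors G; h \<in> mors G; src G g = tgt G h\<rbrakk> \<Longrightarrow> iv (g \<bullet> h) = iv h \<bullet> iv g"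
  by (rule iv_eqI) (simp_all add: iv comp_closed src_comp tgt_comp comp_assoc iv_cancel1)

lemmas gpd_simps = iv comp_closed src_comp tgt_comp comp_assoc iv_cancel1 iv_cancel2 iv_comp iv_iv
  comp_ident_left comp_ident_right src_ident tgt_ident ident_closed src_closed tgt_closed

lemma comp_left_cancel:
  assumes "g \<in> mors G" "h \<in> mors G" "h' \<in> mors G" "src G g = tgt G h" "src G g = tgt G h'" "g \<bullet> h = g \<bullet> h'"
  shows "h = h'"
proof -
  have "h = iv g \<bullet> (g \<bullet> h)" by (rule iv_cancel1[OF assms(1,2,4), symmetric])
  also have "\<dots> = iv g \<bullet> (g \<bullet> h')" by (simp only: assms(6))
  also have "\<dots> = h'" by (rule iv_cancel1[OF assms(1,3,5)])
  finally show ?thesis .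
qed

end

section \<open>Free tuples over the centralizer of a loop\<close>

locale pointed_groupoid = groupoid +
  fixes l :: 'b
  assumes l: "l \<in> loops G"
begin

lemma l_mor: "l \<in> mors G" and tgt_l: "tgt G l = src G l"
  using l by (auto simp: loops_def)

text \<open>A free right \<open>Z\<close>-set. Two of its elements lie in the same
  \<open>Z\<close>-orbit exactly when they conjugate \<open>l\<close> to the same loop.\<close>

definition H :: "'b set" where "H = {h \<in> mors G. src G h = src G l}"
definition u :: "'b \<Rightarrow> 'b" where "u h = h \<bullet> l"
abbreviation Z :: "'b monoid" where "Z \<equiv> centralizer G l"

lemma HD: "h \<in> H \<Longrightarrow> h \<in> mors G" "h \<in> H \<Longrightarrow> src G h = src G l"
  by (simp_all add: H_def)

lemma u_in: "h \<in> H \<Longrightarrow> u h \<in> H"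
  by (simp add: H_def u_def l_mor tgt_l gpd_simps)

lemma tgt_u: "h \<in> H \<Longrightarrow> tgt G (u h) = tgt G h"
  by (simp add: H_def u_def l_mor tgt_l gpd_simps)

lemma carrier_Z: "carrier Z = {z \<in> mors G. src G z = src G l \<and> tgt G z = src G l \<and> z \<bullet> l = l \<bullet> z}"
proof -
  have "z \<bullet> l \<bullet> iv z = l \<longleftrightarrow> z \<bullet> l = l \<bullet> z" if "z \<in> mors G" "src G z = src G l" "tgt G z = src G l" for z
  proof
    assume "z \<bullet> l \<bullet> iv z = l"
    then have "l \<bullet> z = z \<bullet> l \<bullet> iv z \<bullet> z" by simp
    then show "z \<bullet> l = l \<bullet> z" using that by (simp add: gpd_simps l_mor tgt_l)
  next
    assume "z \<bullet> l = l \<bullet> z"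
    then show "z \<bullet> l \<bullet> iv z = l" using that by (simp add: gpd_simps l_mor tgt_l)
  qed
  then show ?thesis
    by (auto simp: centralizer_def loops_def)
qed

lemma ZD: "z \<in> carrier Z \<Longrightarrow> z \<in> mors G" "z \<in> carrier Z \<Longrightarrow> src G z = src G l" "z \<in> carrier Z \<Longrightarrow> tgt G z = src G l"
    "z \<in> carrier Z \<Longrightarrow> z \<bullet> l = l \<bullet> z"
  by (simp_all add: carrier_Z)

lemma mult_Z [simp]: "monoid.mult Z = comp_mor G" and one_Z [simp]: "monoid.one Z = ident G (src G l)"
  by (simp_all add: centralizer_def loop_group_def)

lemma iv_Z: "z \<in> carrier Z \<Longrightarrow> iv z \<in> carrier Z"
proof -
  assume z: "z \<in> carrier Z"
  have "iv z \<bullet> (z \<bullet> l) \<bullet> iv z = iv z \<bullet> (l \<bullet> z) \<bullet> iv z" using ZD(4)[OF z] by simp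
  then have "l \<bullet> iv z = iv z \<bullet> l"
    using ZD(1-3)[OF z] by (simp add: gpd_simps l_mor tgt_l)
  then show ?thesis using ZD(1-3)[OF z] by (simp add: carrier_Z iv)
qed

lemma mult_Z_closed: "x \<in> carrier Z \<Longrightarrow> y \<in> carrier Z \<Longrightarrow> x \<bullet> y \<in> carrier Z"
proof -
  assume x: "x \<in> carrier Z" and y: "y \<in> carrier Z"
  note xy = ZD(1-3)[OF x] ZD(1-3)[OF y] l_mor tgt_l
  have "x \<bullet> y \<bullet> l = x \<bullet> (y \<bullet> l)" using xy by (simp add: gpd_simps)
  also have "\<dots> = (x \<bullet> l) \<bullet> y" using xy ZD(4)[OF y] by (simp add: gpd_simps)
  also have "\<dots> = l \<bullet> (x \<bullet> y)" using xy ZD(4)[OF x] by (simp add: gpd_simps)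
  finally show ?thesis using xy by (simp add: carrier_Z gpd_simps)
qed

lemma ident_Z: "ident G (src G l) \<in> carrier Z"
  using comp_ident_left[OF l_mor] comp_ident_right[OF l_mor] tgt_l
  by (simp add: carrier_Z gpd_simps l_mor)

lemma group_Z: "group Z"
proof (rule groupI)
  fix x assume x: "x \<in> carrier Z"
  show "\<one>\<^bsub>Z\<^esub> \<otimes>\<^bsub>Z\<^esub> x = x" using comp_ident_left[OF ZD(1)[OF x]] ZD[OF x] by simp
  show "\<exists>y\<in>carrier Z. y \<otimes>\<^bsub>Z\<^esub> x = \<one>\<^bsub>Z\<^esub>" using iv_Z[OF x] iv(4)[OF ZD(1)[OF x]] ZD[OF x] by auto
next
  fix x y z assume "x \<in> carrier Z" "y \<in> carrier Z" "z \<in> carrier Z"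
  then show "x \<otimes>\<^bsub>Z\<^esub> y \<otimes>\<^bsub>Z\<^esub> z = x \<otimes>\<^bsub>Z\<^esub> (y \<otimes>\<^bsub>Z\<^esub> z)" using ZD by (simp add: gpd_simps)
qed (simp_all add: mult_Z_closed ident_Z)

sublocale Z: group Z by (rule group_Z)

lemma l_Z: "l \<in> carrier Z"
  by (simp add: carrier_Z l_mor tgt_l)

lemma H_mult_Z: "h \<in> H \<Longrightarrow> z \<in> carrier Z \<Longrightarrow> h \<bullet> z \<in> H"
  using ZD[of z] by (simp add: H_def gpd_simps)

lemma u_mult: "h \<in> H \<Longrightarrow> z \<in> carrier Z \<Longrightarrow> u (h \<bullet> z) = u h \<bullet> z"
  using ZD[of z] HD[of h] by (simp add: u_def gpd_simps l_mor tgt_l)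

lemma H_free: "h \<in> H \<Longrightarrow> z \<in> carrier Z \<Longrightarrow> z' \<in> carrier Z \<Longrightarrow> h \<bullet> z = h \<bullet> z' \<Longrightarrow> z = z'"
  using comp_left_cancel[of h z z'] ZD[of z] ZD[of z'] HD[of h] by simp

text \<open>The tuple \<open>(h\<^sub>0, \<dots>, h\<^sub>n)\<close> goes to \<open>(h\<^sub>n l h\<^sub>0\<^sup>-\<^sup>1, h\<^sub>0 h\<^sub>1\<^sup>-\<^sup>1, \<dots>, h\<^sub>n\<^sub>-\<^sub>1 h\<^sub>n\<^sup>-\<^sup>1)\<close>.\<close>

definition qH :: "'b list \<Rightarrow> 'b list" where
  "qH hs = map2 (\<lambda>a h. a \<bullet> iv h) (rot u hs) hs"

lemma length_qH [simp]: "hs \<noteq> [] \<Longrightarrow> length (qH hs) = length hs"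
  by (simp add: qH_def)

lemma nth_qH: "j < length hs \<Longrightarrow> qH hs ! j = (if j = 0 then u (hs ! ldg hs) else hs ! (j - 1)) \<bullet> iv (hs ! j)"
  by (cases "hs = []") (simp_all add: qH_def nth_rot ldg_def)

lemma ldg_qH: "hs \<noteq> [] \<Longrightarrow> ldg (qH hs) = ldg hs"
  by (simp add: ldg_def)

lemma nelists_length: "hs \<in> nelists A \<Longrightarrow> length hs = Suc (ldg hs)"
  by (simp add: nelists_def ldg_def)

lemma qH_nth_props:
  assumes hs: "hs \<in> nelists H" and j: "j < length hs"
  shows "qH hs ! j \<in> mors G" "src G (qH hs ! j) = tgt G (hs ! j)"
    "tgt G (qH hs ! j) = tgt G (hs ! (if j = 0 then ldg hs else j - 1))"
proof -
  have m: "i < length hs \<Longrightarrow> hs ! i \<in> H" for i by (rule nelists_nth[OF hs])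
  have n: "ldg hs < length hs" using nelists_length[OF hs] by simp
  have "(if j = 0 then u (hs ! ldg hs) else hs ! (j - 1)) \<in> H"
    using m n j u_in by auto
  note a = HD[OF this] HD[OF m[OF j]]
  have t: "tgt G (if j = 0 then u (hs ! ldg hs) else hs ! (j - 1)) = tgt G (hs ! (if j = 0 then ldg hs else j - 1))"
    using tgt_u[OF m[OF n]] by simp
  show "qH hs ! j \<in> mors G" "src G (qH hs ! j) = tgt G (hs ! j)"
    "tgt G (qH hs ! j) = tgt G (hs ! (if j = 0 then ldg hs else j - 1))"
    unfolding nth_qH[OF j] t[symmetric] using a by (simp_all add: gpd_simps)
qed

lemma qH_in: "hs \<in> nelists H \<Longrightarrow> qH hs \<in> cells"
proof -
  assume hs: "hs \<in> nelists H"
  then have "hs \<noteq> []" by (simp add: nelists_def)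
  then have "length (qH hs) = length hs" "qH hs \<noteq> []" using length_qH[of hs] by (auto simp del: length_qH)
  then show ?thesis using qH_nth_props(1)[OF hs] by (auto simp: nelists_def in_set_conv_nth)
qed

lemma qH_closed:
  assumes hs: "hs \<in> nelists H" and j: "j < length hs"
  shows "src G (qH hs ! j) = tgt G (nxt (qH hs) j)"
proof -
  have ne: "hs \<noteq> []" using hs by (simp add: nelists_def)
  show ?thesis
    using qH_nth_props[OF hs, of j] qH_nth_props[OF hs, of 0] qH_nth_props[OF hs, of "Suc j"] j ne
    by (auto simp: nxt_def ldg_def intro!: arg_cong[of _ _ "\<lambda>i. tgt G (hs ! i)"])
qed

lemma face_list_qH:
  assumes hs: "hs \<in> nelists H" and i: "i \<le> ldg hs" and pos: "0 < ldg hs"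
  shows "face_list G i (qH hs) = qH (omit i hs)"
proof -
  have m: "k < length hs \<Longrightarrow> hs ! k \<in> H" for k by (rule nelists_nth[OF hs])
  have L: "length hs = Suc (ldg hs)" by (rule nelists_length[OF hs])
  have ne: "hs \<noteq> []" using hs by (simp add: nelists_def)
  have lo: "length (omit i hs) = ldg hs" using i L by (simp add: length_omit)
  have ldo: "ldg (omit i hs) = ldg hs - 1" by (simp add: ldg_def lo)
  have o: "k < ldg hs \<Longrightarrow> omit i hs ! k = (if k < i then hs ! k else hs ! Suc k)" for k
    using i L by (simp add: nth_omit)
  have lq: "ldg (qH hs) = ldg hs" by (rule ldg_qH[OF ne])
  have telesc: "(a \<bullet> iv b) \<bullet> (b \<bullet> iv c) = a \<bullet> iv c" if "a \<in> H" "b \<in> H" "c \<in> H" for a b c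
    using HD[OF that(1)] HD[OF that(2)] HD[OF that(3)] by (simp add: gpd_simps)
  \<comment> \<open>Needed for the last face: the twist sits in entry 0, and when the last vertex
    disappears it passes to the vertex before it.\<close>
  have telesc': "(a \<bullet> iv b) \<bullet> (u b \<bullet> iv c) = u a \<bullet> iv c" if "a \<in> H" "b \<in> H" "c \<in> H" for a b c
    using HD[OF that(1)] HD[OF that(2)] HD[OF that(3)] by (simp add: gpd_simps u_def l_mor tgt_l)
  show ?thesis
  proof (rule nth_equalityI)
    have "omit i hs \<noteq> []" using lo pos by auto
    then show "length (face_list G i (qH hs)) = length (qH (omit i hs))"
      using pos lq by (simp add: length_face_list lo)
    fix k assume "k < length (face_list G i (qH hs))"
    then have k: "k < ldg hs" using pos lq by (simp add: length_face_list)
    have R: "qH (omit i hs) ! k = (if k = 0 then u (omit i hs ! (ldg hs - 1)) else omit i hs ! (k - 1)) \<bullet> iv (omit i hs ! k)"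
      using nth_qH[of k "omit i hs"] k by (simp add: lo ldo)
    show "face_list G i (qH hs) ! k = qH (omit i hs) ! k"
    proof (cases "i < ldg hs")
      case True
      have last: "omit i hs ! (ldg hs - 1) = hs ! ldg hs" using True pos o[of "ldg hs - 1"] by auto
      consider "k < i" | "k = i" | "i < k" by linarith
      then show ?thesis
      proof cases
        case 1
        then have "face_list G i (qH hs) ! k = qH hs ! k"
          using nth_face_list[of i "qH hs" k G] True k lq by simp
        then show ?thesis unfolding R last using nth_qH[of k hs] 1 k L o[of k] o[of "k - 1"] by auto
      next
        case 2
        then have "face_list G i (qH hs) ! k = qH hs ! i \<bullet> qH hs ! Suc i"
          using nth_face_list[of i "qH hs" k G] True k lq by simp
        also have "\<dots> = ((if i = 0 then u (hs ! ldg hs) else hs ! (i - 1)) \<bullet> iv (hs ! i)) \<bullet> (hs ! i \<bullet> iv (hs ! Suc i))"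
          using nth_qH[of i hs] nth_qH[of "Suc i" hs] True L by simp
        also have "\<dots> = (if i = 0 then u (hs ! ldg hs) else hs ! (i - 1)) \<bullet> iv (hs ! Suc i)"
          by (rule telesc) (use m L True u_in in auto)
        finally show ?thesis unfolding R last using 2 o[of k] o[of "k - 1"] k by auto
      next
        case 3
        then have "face_list G i (qH hs) ! k = qH hs ! Suc k"
          using nth_face_list[of i "qH hs" k G] True k lq by simp
        then show ?thesis unfolding R last using nth_qH[of "Suc k" hs] 3 k L o[of k] o[of "k - 1"] by auto
      qed
    next
      case False
      then have i: "i = ldg hs" using i by simp
      show ?thesis
      proof (cases "k = 0")
        case True
        then have "face_list G i (qH hs) ! k = qH hs ! ldg hs \<bullet> qH hs ! 0"
          using nth_face_list[of i "qH hs" k G] i k lq by simp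
        also have "\<dots> = (hs ! (ldg hs - 1) \<bullet> iv (hs ! ldg hs)) \<bullet> (u (hs ! ldg hs) \<bullet> iv (hs ! 0))"
          using nth_qH[of "ldg hs" hs] nth_qH[of 0 hs] L pos by simp
        also have "\<dots> = u (hs ! (ldg hs - 1)) \<bullet> iv (hs ! 0)"
          by (rule telesc') (use m L in auto)
        finally show ?thesis unfolding R using True o[of 0] o[of "ldg hs - 1"] i pos by simp
      next
        case False
        then have "face_list G i (qH hs) ! k = qH hs ! k"
          using nth_face_list[of i "qH hs" k G] i k lq by simp
        then show ?thesis unfolding R using nth_qH[of k hs] False k L o[of k] o[of "k - 1"] i by auto
      qed
    qed
  qed
qed

lemma gface_qH:
  assumes hs: "hs \<in> nelists H" and i: "i \<le> ldg hs" and pos: "0 < ldg hs"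
  shows "gface G i (qH hs) = bas (qH (omit i hs))"
  using qH_closed[OF hs, of i] face_list_qH[OF assms] nelists_length[OF hs] i by (simp add: gface_def)

lemma rot_qH:
  assumes hs: "hs \<in> nelists H"
  shows "cycl (qH hs) = qH (rot u hs)"
proof -
  have m: "k < length hs \<Longrightarrow> hs ! k \<in> H" for k by (rule nelists_nth[OF hs])
  have L: "length hs = Suc (ldg hs)" by (rule nelists_length[OF hs])
  have ne: "hs \<noteq> []" "qH hs \<noteq> []" "rot u hs \<noteq> []" using hs qH_in[OF hs] by (auto simp: nelists_def rot_def)
  have e: "u a \<bullet> iv (u b) = a \<bullet> iv b" if "a \<in> H" "b \<in> H" for a b
    using HD[OF that(1)] HD[OF that(2)] by (simp add: gpd_simps u_def l_mor tgt_l)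
  show ?thesis
  proof (rule nth_equalityI)
    show "length (cycl (qH hs)) = length (qH (rot u hs))" using ne by simp
    fix k assume "k < length (cycl (qH hs))"
    then have k: "k < length hs" using ne by simp
    have ld: "ldg (rot u hs) = ldg hs" using ne by (simp add: ldg_def)
    have r: "j < length hs \<Longrightarrow> rot u hs ! j = (if j = 0 then u (hs ! ldg hs) else hs ! (j - 1))" for j
      by (simp add: nth_rot ldg_def)
    have R: "qH (rot u hs) ! k = (if k = 0 then u (rot u hs ! ldg hs) else rot u hs ! (k - 1)) \<bullet> iv (rot u hs ! k)"
      using nth_qH[of k "rot u hs"] k ne by (simp add: ld)
    have Lf: "cycl (qH hs) ! k = (if k = 0 then qH hs ! ldg hs else qH hs ! (k - 1))"
      using nth_rot[of k "qH hs"] k ne by (simp add: ldg_def)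
    show "cycl (qH hs) ! k = qH (rot u hs) ! k"
    proof (cases "k = 0")
      case True
      have "(if ldg hs = 0 then u (hs ! ldg hs) else hs ! (ldg hs - 1)) \<in> H" using m L u_in by auto
      from e[OF this m[of "ldg hs"]] show ?thesis
        unfolding R Lf using True L by (simp add: r nth_qH)
    next
      case False
      then show ?thesis unfolding R Lf using k by (simp add: r nth_qH)
    qed
  qed
qed

lemma qH_translate:
  assumes hs: "hs \<in> nelists H" and z: "z \<in> carrier Z"
  shows "qH (map (\<lambda>h. h \<bullet> z) hs) = qH hs"
proof -
  have m: "k < length hs \<Longrightarrow> hs ! k \<in> H" for k by (rule nelists_nth[OF hs])
  have L: "length hs = Suc (ldg hs)" by (rule nelists_length[OF hs])
  have ne: "hs \<noteq> []" using hs by (simp add: nelists_def)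
  have e: "(a \<bullet> z) \<bullet> iv (b \<bullet> z) = a \<bullet> iv b" if "a \<in> H" "b \<in> H" for a b
    using HD[OF that(1)] HD[OF that(2)] ZD[OF z] by (simp add: gpd_simps)
  show ?thesis
  proof (rule nth_equalityI)
    show "length (qH (map (\<lambda>h. h \<bullet> z) hs)) = length (qH hs)" using ne by simp
    fix k assume "k < length (qH (map (\<lambda>h. h \<bullet> z) hs))"
    then have k: "k < length hs" using ne by simp
    have "(if k = 0 then u (hs ! ldg hs) else hs ! (k - 1)) \<in> H" using m L k u_in by auto
    from e[OF this m[OF k]] show "qH (map (\<lambda>h. h \<bullet> z) hs) ! k = qH hs ! k"
      using k L m by (auto simp: nth_qH u_mult z)
  qed
qed

text \<open>The first vertices determine the only candidate \<open>z\<close>. The entries after the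
  first force \<open>hs'\<close> to be the translate of \<open>hs\<close> by \<open>z\<close>, one
  vertex after another; the first entry, which contains \<open>l\<close>, then forces
  \<open>z\<close> to commute with \<open>l\<close>.\<close>

lemma qH_orbit:
  assumes hs: "hs \<in> nelists H" and hs': "hs' \<in> nelists H" and eq: "qH hs = qH hs'"
  shows "\<exists>z\<in>carrier Z. hs' = map (\<lambda>h. h \<bullet> z) hs"
proof -
  have ne: "hs \<noteq> []" "hs' \<noteq> []" using hs hs' by (auto simp: nelists_def)
  have len: "length hs' = length hs" using arg_cong[OF eq, of length] ne by simp
  then have ld: "ldg hs' = ldg hs" by (simp add: ldg_def)
  have L: "length hs = Suc (ldg hs)" by (rule nelists_length[OF hs])
  have m: "k < length hs \<Longrightarrow> hs ! k \<in> H" "k < length hs \<Longrightarrow> hs' ! k \<in> H" for k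
    using nelists_nth[OF hs] nelists_nth[OF hs'] len by auto
  have t: "tgt G (hs ! k) = tgt G (hs' ! k)" if "k < length hs" for k
    using qH_nth_props(2)[OF hs that] qH_nth_props(2)[OF hs'] that len eq by simp
  define z where "z = iv (hs ! 0) \<bullet> hs' ! 0"
  have h0: "hs ! 0 \<in> H" "hs' ! 0 \<in> H" using m L by auto
  have z: "z \<in> mors G" "src G z = src G l" "tgt G z = src G l"
    using HD[OF h0(1)] HD[OF h0(2)] t[of 0] L by (auto simp: z_def gpd_simps)
  have hz: "k < length hs \<Longrightarrow> hs' ! k = hs ! k \<bullet> z" for k
  proof (induction k)
    case 0
    then show ?case using HD[OF h0(1)] HD[OF h0(2)] t[of 0] by (simp add: z_def gpd_simps)
  next
    case (Suc k)
    have mk: "hs ! k \<in> H" "hs' ! k \<in> H" "hs ! Suc k \<in> H" "hs' ! Suc k \<in> H" using m Suc.prems by auto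
    note p = HD[OF mk(1)] HD[OF mk(2)] HD[OF mk(3)] HD[OF mk(4)] z
    have "hs ! k \<bullet> iv (hs ! Suc k) = hs' ! k \<bullet> iv (hs' ! Suc k)"
      using arg_cong[OF eq, of "\<lambda>xs. xs ! Suc k"] Suc.prems len by (simp add: nth_qH)
    also have "\<dots> = hs ! k \<bullet> (z \<bullet> iv (hs' ! Suc k))"
      using Suc p by (simp add: gpd_simps)
    finally have e: "hs ! k \<bullet> iv (hs ! Suc k) = hs ! k \<bullet> (z \<bullet> iv (hs' ! Suc k))" .
    have "iv (hs ! Suc k) = z \<bullet> iv (hs' ! Suc k)"
      by (rule comp_left_cancel[OF _ _ _ _ _ e]) (use p in \<open>simp_all add: gpd_simps\<close>)
    then have "hs ! Suc k \<bullet> (iv (hs ! Suc k) \<bullet> hs' ! Suc k) = hs ! Suc k \<bullet> ((z \<bullet> iv (hs' ! Suc k)) \<bullet> hs' ! Suc k)"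
      by simp
    moreover have "hs ! Suc k \<bullet> (iv (hs ! Suc k) \<bullet> hs' ! Suc k) = hs' ! Suc k"
      using p t[OF Suc.prems] by (simp add: gpd_simps)
    moreover have "(z \<bullet> iv (hs' ! Suc k)) \<bullet> hs' ! Suc k = z"
      using p comp_ident_right[OF z(1)] by (simp add: gpd_simps)
    ultimately show ?case by simp
  qed
  have mn: "hs ! ldg hs \<in> H" using m L by simp
  note p = HD[OF h0(1)] HD[OF mn] z l_mor tgt_l
  have "u (hs ! ldg hs) \<bullet> iv (hs ! 0) = u (hs ! ldg hs \<bullet> z) \<bullet> iv (hs ! 0 \<bullet> z)"
    using arg_cong[OF eq, of "\<lambda>xs. xs ! 0"] ne len hz L by (simp add: nth_qH ld)
  then have "hs ! ldg hs \<bullet> (l \<bullet> iv (hs ! 0)) = hs ! ldg hs \<bullet> (z \<bullet> l \<bullet> iv z \<bullet> iv (hs ! 0))"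
    using p by (simp add: u_def gpd_simps)
  then have "l \<bullet> iv (hs ! 0) = z \<bullet> l \<bullet> iv z \<bullet> iv (hs ! 0)"
    by (rule comp_left_cancel[rotated -1]) (use p in \<open>simp_all add: gpd_simps\<close>)
  then have "l \<bullet> iv (hs ! 0) \<bullet> (hs ! 0 \<bullet> z) = z \<bullet> l \<bullet> iv z \<bullet> iv (hs ! 0) \<bullet> (hs ! 0 \<bullet> z)" by simp
  then have "z \<bullet> l = l \<bullet> z"
    using p comp_ident_right[OF l_mor] by (simp add: gpd_simps)
  then have "z \<in> carrier Z" using z by (simp add: carrier_Z)
  moreover have "hs' = map (\<lambda>h. h \<bullet> z) hs"
    by (rule nth_equalityI) (simp_all add: len hz)
  ultimately show ?thesis by blast
qed

lemma gb_qH: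
  assumes hs: "hs \<in> nelists H"
  shows "gb (qH hs) = pmap qH (hdel hs)"
proof -
  have "hs \<noteq> []" using hs by (simp add: nelists_def)
  then show ?thesis
    by (auto simp: gb_def hdel_sum ldg_qH gface_qH[OF hs] pmap_sum pmap_cmul intro!: sum.cong)
qed

lemma translate_in: "hs \<in> nelists H \<Longrightarrow> z \<in> carrier Z \<Longrightarrow> map (\<lambda>h. h \<bullet> z) hs \<in> nelists H"
  by (rule nelists_map) (auto simp: H_mult_Z)

lemma translate_translate:
  "hs \<in> nelists H \<Longrightarrow> z \<in> carrier Z \<Longrightarrow> w \<in> carrier Z \<Longrightarrow> map (\<lambda>h. h \<bullet> z) (map (\<lambda>h. h \<bullet> w) hs) = map (\<lambda>h. h \<bullet> (w \<bullet> z)) hs"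
  using ZD[of z] ZD[of w] by (auto simp: nelists_def H_def gpd_simps)

lemma translate_cancel:
  assumes "hs \<in> nelists H" "z \<in> carrier Z" "w \<in> carrier Z" "map (\<lambda>h. h \<bullet> z) hs = map (\<lambda>h. h \<bullet> w) hs"
  shows "z = w"
proof -
  obtain h hs' where "hs = h # hs'" "h \<in> H" using assms(1) by (cases hs) (auto simp: nelists_def)
  then show ?thesis using H_free[of h z w] assms by simp
qed

lemma homogeneous_orbit_complex:
  "orbit_complex (nelists H) ldg (hdel :: 'b list \<Rightarrow> ('b list, 'k::field) chain) qH (carrier Z) (\<lambda>z. map (\<lambda>h. h \<bullet> z)) gb"
proof -
  interpret based_complex "nelists H" ldg "hdel :: 'b list \<Rightarrow> ('b list, 'k) chain"
    by (rule based_complex_lists[OF u_in])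
  show ?thesis
  proof
    fix z w assume "z \<in> carrier Z" "w \<in> carrier Z"
    then show "\<exists>k\<in>carrier Z. \<forall>x\<in>nelists H. map (\<lambda>h. h \<bullet> z) (map (\<lambda>h. h \<bullet> w) x) = map (\<lambda>h. h \<bullet> k) x"
      by (intro bexI[of _ "w \<bullet> z"]) (simp_all only: translate_translate mult_Z_closed ball_triv, blast intro: translate_translate)
  next
    fix z w hs ys assume "z \<in> carrier Z" "w \<in> carrier Z" "hs \<in> nelists H" "map (\<lambda>h. h \<bullet> z) hs = map (\<lambda>h. h \<bullet> w) hs"
    then have "z = w" using translate_cancel by blast
    then show "map (\<lambda>h. h \<bullet> z) ys = map (\<lambda>h. h \<bullet> w) ys" by simp
  qed (simp_all only: translate_in ldg_map hdel_map qH_orbit qH_translate gb_qH)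
qed

definition orb_rep :: "'b \<Rightarrow> 'b" where
  "orb_rep x = (SOME h. h \<in> H \<and> h \<bullet> l \<bullet> iv h = x)"

text \<open>A \<open>Z\<close>-equivariant map from \<open>H\<close> to \<open>Z\<close>: each
  \<open>Z\<close>-orbit, labelled by a conjugate of \<open>l\<close>, is identified with
  \<open>Z\<close> through a chosen base point \<open>orb_rep\<close>.\<close>

definition psi :: "'b \<Rightarrow> 'b" where
  "psi h = iv (orb_rep (h \<bullet> l \<bullet> iv h)) \<bullet> h"

lemma orb_rep: "h \<in> H \<Longrightarrow> orb_rep (h \<bullet> l \<bullet> iv h) \<in> H \<and> orb_rep (h \<bullet> l \<bullet> iv h) \<bullet> l \<bullet> iv (orb_rep (h \<bullet> l \<bullet> iv h)) = h \<bullet> l \<bullet> iv h"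
  unfolding orb_rep_def by (rule someI_ex) blast

lemma conj_tgt: "h \<in> H \<Longrightarrow> tgt G (h \<bullet> l \<bullet> iv h) = tgt G h"
  by (simp add: H_def gpd_simps l_mor tgt_l)

lemma psi_Z:
  assumes h: "h \<in> H"
  shows "psi h \<in> carrier Z"
proof -
  define k where "k = orb_rep (h \<bullet> l \<bullet> iv h)"
  have k: "k \<in> H" "k \<bullet> l \<bullet> iv k = h \<bullet> l \<bullet> iv h" using orb_rep[OF h] by (simp_all add: k_def)
  have t: "tgt G k = tgt G h" using conj_tgt[OF h] conj_tgt[OF k(1)] k(2) by simp
  note p = HD[OF h] HD[OF k(1)] l_mor tgt_l t
  have "iv k \<bullet> (k \<bullet> l \<bullet> iv k) \<bullet> h = iv k \<bullet> (h \<bullet> l \<bullet> iv h) \<bullet> h" using k(2) by simp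
  then have "l \<bullet> (iv k \<bullet> h) = (iv k \<bullet> h) \<bullet> l"
    using p comp_ident_right[OF l_mor] by (simp add: gpd_simps)
  then have "iv k \<bullet> h \<in> carrier Z" using p by (simp add: carrier_Z gpd_simps)
  then show ?thesis by (simp only: psi_def k_def)
qed

lemma psi_mult:
  assumes h: "h \<in> H" and z: "z \<in> carrier Z"
  shows "psi (h \<bullet> z) = psi h \<bullet> z"
proof -
  note p = HD[OF h] ZD[OF z] l_mor tgt_l
  have "(h \<bullet> z) \<bullet> l \<bullet> iv (h \<bullet> z) = h \<bullet> (z \<bullet> l) \<bullet> iv (h \<bullet> z)" using p(1-5,7,8) by (simp add: gpd_simps)
  also have "\<dots> = h \<bullet> l \<bullet> iv h" using p by (simp add: gpd_simps)
  finally have e: "(h \<bullet> z) \<bullet> l \<bullet> iv (h \<bullet> z) = h \<bullet> l \<bullet> iv h" .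
  have k: "orb_rep (h \<bullet> l \<bullet> iv h) \<in> H" "tgt G (orb_rep (h \<bullet> l \<bullet> iv h)) = tgt G h"
    using orb_rep[OF h] conj_tgt[OF h] conj_tgt[of "orb_rep (h \<bullet> l \<bullet> iv h)"] by auto
  show ?thesis unfolding psi_def e using p HD[OF k(1)] k(2) by (simp add: gpd_simps)
qed

definition lift :: "'b list \<Rightarrow> 'b list" where
  "lift y = (SOME hs. hs \<in> nelists H \<and> qH hs = y)"

lemma lift:
  assumes "hs \<in> nelists H"
  obtains z where "z \<in> carrier Z" "lift (qH hs) = map (\<lambda>h. h \<bullet> z) hs"
proof -
  have "lift (qH hs) \<in> nelists H \<and> qH (lift (qH hs)) = qH hs"
    unfolding lift_def by (rule someI_ex) (use assms in blast)
  then show thesis using qH_orbit[OF assms, of "lift (qH hs)"] that by auto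
qed

definition nerve_part :: "'b list set" where "nerve_part = qH ` nelists H"

definition hh_map :: "'b list \<Rightarrow> ('b list, 'k::field) chain" where
  "hh_map y = bas (quotients Z (map psi (lift y)))"

lemma ident_H: "ident G (src G l) \<in> H"
  by (simp add: H_def gpd_simps l_mor)

text \<open>The lift in \<open>hh_map\<close> is unique up to right translation by \<open>Z\<close>,
  which \<open>psi\<close> preserves and \<open>quotients\<close> forgets.\<close>

lemma hh_map_qH:
  assumes hs: "hs \<in> nelists H"
  shows "hh_map (qH hs) = bas (quotients Z (map psi hs))"
proof -
  obtain z where z: "z \<in> carrier Z" "lift (qH hs) = map (\<lambda>h. h \<bullet> z) hs" by (rule lift[OF hs])
  have "map psi (lift (qH hs)) = map (\<lambda>x. x \<otimes>\<^bsub>Z\<^esub> z) (map psi hs)"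
    unfolding z(2) using hs z(1) by (auto simp: nelists_def psi_mult)
  then have "quotients Z (map psi (lift (qH hs))) = quotients Z (map (\<lambda>x. x \<otimes>\<^bsub>Z\<^esub> z) (map psi hs))" by simp
  also have "\<dots> = quotients Z (map psi hs)"
    by (rule Z.quotients_translate[OF z(1)]) (use hs psi_Z in \<open>auto simp: nelists_def\<close>)
  finally show ?thesis by (simp add: hh_map_def)
qed

text \<open>Upstairs, \<open>psi\<close> maps the full simplex on \<open>H\<close> to the full
  simplex on \<open>Z\<close>, and both are resolutions of the ground field. The exact cone is then
  divided by \<open>Z\<close>.\<close>

lemma hh_cone_exact:
  "cone_exact nerve_part ldg (gb :: 'b list \<Rightarrow> ('b list, 'k::field) chain) (lists (carrier Z)) length (bar_del Z) hh_map"
proof -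
  have id_hom: "(\<lambda>x. x) \<in> hom Z Z" by (rule homI) auto
  note P = homogeneous_orbit_complex[where 'k = 'k]
  note Q = Z.bar_orbit_complex[OF group_Z id_hom, where 'k = 'k, simplified]
  let ?f = "\<lambda>hs. bas (map psi hs) :: ('b list, 'k) chain"
  have map_in: "map psi hs \<in> nelists (carrier Z)" if "hs \<in> nelists H" for hs
    by (rule nelists_map[OF that psi_Z])
  have f_in: "?f hs \<in> Lin {y \<in> nelists (carrier Z). ldg y = ldg hs}" if "hs \<in> nelists H" for hs
    using map_in[OF that] by simp
  have chain: "lext ?f (hdel hs) = lext hdel (?f hs)" for hs :: "'b list"
    by (simp add: hdel_map flip: pmap_def)
  have ex: "cone_exact (nelists H) ldg hdel (nelists (carrier Z)) ldg hdel ?f"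
  proof (rule cone_exact_augmented[where e = "\<lambda>_. bas ()" and e' = "\<lambda>_. bas ()"])
    show "based_complex (nelists H) ldg (hdel :: 'b list \<Rightarrow> ('b list, 'k) chain)"
      by (rule based_complex_lists[OF u_in])
    show "based_complex (nelists (carrier Z)) ldg (hdel :: 'b list \<Rightarrow> ('b list, 'k) chain)"
      by (rule based_complex_lists[of _ "\<lambda>x. x"])
    show "aug_acyclic (nelists H) ldg (hdel :: 'b list \<Rightarrow> ('b list, 'k) chain) (\<lambda>_. bas ())"
      by (rule aug_acyclic_lists[OF u_in ident_H])
    show "aug_acyclic (nelists (carrier Z)) ldg (hdel :: 'b list \<Rightarrow> ('b list, 'k) chain) (\<lambda>_. bas ())"
      by (rule aug_acyclic_lists[of _ "\<lambda>x. x", OF _ ident_Z])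
    show "bas [ident G (src G l)] \<in> Lin {x \<in> nelists H. ldg x = 0}"
      using ident_H by (simp add: nelists_def ldg_def)
  qed (use f_in chain augment_hdel in auto)
  have "cone_exact (qH ` nelists H) ldg gb (quotients Z ` nelists (carrier Z)) length (bar_del Z) (hh_map :: 'b list \<Rightarrow> ('b list, 'k) chain)"
  proof (rule cone_exact_quotient[OF P Q _ _ _ _ _ _ _ _ _ ex])
    fix g h assume "g \<in> carrier Z" "h \<in> carrier Z"
    note gh = this
    have "map (\<lambda>z. z \<bullet> g) (map (\<lambda>z. z \<bullet> h) y) = map (\<lambda>z. z \<bullet> (h \<bullet> g)) y" if "y \<in> nelists (carrier Z)" for y
      using that Z.m_assoc[OF _ gh(2,1)] by (auto simp: nelists_def)
    then show "\<exists>k\<in>carrier Z. (\<forall>x\<in>nelists H. map (\<lambda>h. h \<bullet> g) (map (\<lambda>z. z \<bullet> h) x) = map (\<lambda>h. h \<bullet> k) x) \<and>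
           (\<forall>y\<in>nelists (carrier Z). map (\<lambda>z. z \<bullet> g) (map (\<lambda>z. z \<bullet> h) y) = map (\<lambda>z. z \<bullet> k) y)"
      using translate_translate[OF _ gh] mult_Z_closed[OF gh(2,1)] by blast
  next
    fix g h x y assume "g \<in> carrier Z" "h \<in> carrier Z" "x \<in> nelists H" "map (\<lambda>z. z \<bullet> g) x = map (\<lambda>z. z \<bullet> h) x"
    then have "g = h" using translate_cancel by blast
    then show "map (\<lambda>z. z \<bullet> g) y = map (\<lambda>z. z \<bullet> h) y" by simp
  next
    fix g h x y assume gh: "g \<in> carrier Z" "h \<in> carrier Z" and y: "y \<in> nelists (carrier Z)" "map (\<lambda>z. z \<bullet> g) y = map (\<lambda>z. z \<bullet> h) y"
    obtain a as where "y = a # as" "a \<in> carrier Z" using y(1) by (cases y) (auto simp: nelists_def)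
    then have "g = h" using y(2) gh Z.l_cancel[of a g h] by simp
    then show "map (\<lambda>z. z \<bullet> g) x = map (\<lambda>z. z \<bullet> h) x" by simp
  next
    fix g x assume "g \<in> carrier Z" "x \<in> nelists H"
    then have "map psi (map (\<lambda>h. h \<bullet> g) x) = map (\<lambda>z. z \<bullet> g) (map psi x)"
      using psi_mult by (auto simp: nelists_def)
    then show "bas (map psi (map (\<lambda>h. h \<bullet> g) x)) = pmap (map (\<lambda>z. z \<bullet> g)) (bas (map psi x))"
      by (simp only: pmap_bas)
  qed (use f_in chain hh_map_qH ldg_qH in \<open>auto simp: nelists_def ldg_def\<close>)
  then show ?thesis by (simp add: nerve_part_def Z.quotients_image)
qed

end

text \<open>Used three times: for passing from tuples to their classes modulo \<open>L\<close>, for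
  the action of \<open>Z\<close> on these classes, and for the map from classes to tuples of
  morphisms.\<close>

lemma precyclic_morphism:
  fixes face :: "nat \<Rightarrow> 'x \<Rightarrow> 'x \<Rightarrow>\<^sub>0 'k::field" and face' :: "nat \<Rightarrow> 'y \<Rightarrow> 'y \<Rightarrow>\<^sub>0 'k"
  assumes P: "precyclic S dg face tau" and Q: "precyclic S' dg' face' tau'"
    and S: "\<And>x. x \<in> S \<Longrightarrow> \<phi> x \<in> S'" and dg: "\<And>x. x \<in> S \<Longrightarrow> dg' (\<phi> x) = dg x"
    and face: "\<And>x i. x \<in> S \<Longrightarrow> i \<le> dg x \<Longrightarrow> 0 < dg x \<Longrightarrow> face' i (\<phi> x) = pmap \<phi> (face i x)"
    and tau: "\<And>x. x \<in> S \<Longrightarrow> tau' (\<phi> x) = \<phi> (tau x)" and x: "x \<in> S"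
  shows "precyclic.b dg' face' (\<phi> x) = pmap \<phi> (precyclic.b dg face x)"
    and "precyclic.b' dg' face' (\<phi> x) = pmap \<phi> (precyclic.b' dg face x)"
    and "precyclic.t dg' tau' (\<phi> x) = pmap \<phi> (precyclic.t dg tau x :: 'x \<Rightarrow>\<^sub>0 'k)"
    and "precyclic.N dg' tau' (\<phi> x) = pmap \<phi> (precyclic.N dg tau x :: 'x \<Rightarrow>\<^sub>0 'k)"
    and "precyclic.tdeg dg' (p, \<phi> x) = precyclic.tdeg dg (p, x)"
    and "precyclic.tdiff dg' face' tau' (p, \<phi> x) = pmap (map_prod id \<phi>) (precyclic.tdiff dg face tau (p, x))"
proof -
  interpret P: precyclic S dg face tau by fact
  interpret Q: precyclic S' dg' face' tau' by fact
  show b: "Q.b (\<phi> x) = pmap \<phi> (P.b x)" and b': "Q.b' (\<phi> x) = pmap \<phi> (P.b' x)"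
    using x by (auto simp: Q.b_def P.b_def Q.b'_def P.b'_def dg face pmap_sum pmap_cmul)
  show t: "Q.t (\<phi> x) = pmap \<phi> (P.t x)" by (simp add: Q.t_def P.t_def dg tau x pmap_cmul)
  have "(tau' ^^ i) (\<phi> x) = \<phi> ((tau ^^ i) x)" for i
    by (induction i) (simp_all add: tau P.tau_pow_in x)
  then show N: "Q.N (\<phi> x) = pmap \<phi> (P.N x)"
    by (simp add: Q.N_eq[OF S[OF x]] P.N_eq[OF x] pmap_sum pmap_cmul dg x)
  show "Q.tdeg (p, \<phi> x) = P.tdeg (p, x)" by (simp add: P.tdeg_def Q.tdeg_def dg x)
  have v: "Q.vert i (\<phi> x) = pmap \<phi> (P.vert i x)" and h: "Q.hor i (\<phi> x) = pmap \<phi> (P.hor i x)" for i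
    using b b' t N by (auto simp: Q.vert_def P.vert_def Q.hor_def P.hor_def pmap_lin)
  have pp: "pmap (Pair i) (pmap \<phi> a) = pmap (map_prod id \<phi>) (pmap (Pair i) a)" for i :: nat and a :: "'x \<Rightarrow>\<^sub>0 'k"
    by (simp add: pmap_pmap)
  show "Q.tdiff (p, \<phi> x) = pmap (map_prod id \<phi>) (P.tdiff (p, x))"
    by (cases p) (simp_all add: Q.tdiff_def P.tdiff_def pmap_add v h pp)
qed

section \<open>The cyclic subgroup of a loop and free tuples modulo it\<close>

context groupoid
begin

lemma group_loop_group: "x \<in> objs G \<Longrightarrow> group (loop_group G x)"
proof (rule groupI)
  fix g assume g: "g \<in> carrier (loop_group G x)"
  then have "iv g \<in> carrier (loop_group G x)" "iv g \<bullet> g = ident G x"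
    by (auto simp: loop_group_def loops_def iv)
  then show "\<exists>y\<in>carrier (loop_group G x). y \<otimes>\<^bsub>loop_group G x\<^esub> g = \<one>\<^bsub>loop_group G x\<^esub>"
    by (auto simp: loop_group_def)
  show "\<one>\<^bsub>loop_group G x\<^esub> \<otimes>\<^bsub>loop_group G x\<^esub> g = g"
    using g comp_ident_left[of g] by (auto simp: loop_group_def loops_def)
qed (auto simp: loop_group_def loops_def gpd_simps)

end

context pointed_groupoid
begin

abbreviation LG where "LG \<equiv> loop_group G (src G l)"

lemma src_l_obj: "src G l \<in> objs G"
  by (rule src_closed[OF l_mor])

sublocale LG: group LG by (rule group_loop_group[OF src_l_obj])

lemma l_LG: "l \<in> carrier LG"
  by (simp add: loop_group_def l)

lemma Z_eq: "Z = LG\<lparr>carrier := carrier Z\<rparr>"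
  by (simp add: centralizer_def)

lemma subgroup_Z: "subgroup (carrier Z) LG"
proof
  show "carrier Z \<subseteq> carrier LG" by (auto simp: carrier_Z loop_group_def loops_def)
  show "\<one>\<^bsub>LG\<^esub> \<in> carrier Z" using ident_Z by (simp add: loop_group_def)
  fix x assume x: "x \<in> carrier Z"
  have "inv\<^bsub>LG\<^esub> x = iv x"
    using x iv[of x] by (intro LG.inv_equality) (auto simp: carrier_Z loop_group_def loops_def)
  then show "inv\<^bsub>LG\<^esub> x \<in> carrier Z" using iv_Z[OF x] by simp
  fix y assume "y \<in> carrier Z"
  then show "x \<otimes>\<^bsub>LG\<^esub> y \<in> carrier Z" using mult_Z_closed[OF x] by (simp add: loop_group_def)
qed

abbreviation L where "L \<equiv> cyclic_subgroup G l"

lemma L_eq: "L = generate Z {l}"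
  unfolding cyclic_subgroup_def
  by (subst Z_eq, rule LG.generate_consistent[symmetric, OF _ subgroup_Z]) (simp add: l_Z)

lemma subgroup_L: "subgroup L Z"
  unfolding L_eq by (rule Z.generate_is_subgroup) (simp add: l_Z)

lemma L_Z: "x \<in> L \<Longrightarrow> x \<in> carrier Z"
  using subgroup.subset[OF subgroup_L] by blast

lemma l_L: "l \<in> L"
  unfolding L_eq by (rule generate.incl) simp

lemma ident_L: "ident G (src G l) \<in> L"
  using subgroup.one_closed[OF subgroup_L] by simp

lemma L_mult: "x \<in> L \<Longrightarrow> y \<in> L \<Longrightarrow> x \<bullet> y \<in> L"
  using subgroup.m_closed[OF subgroup_L] by simp

lemma L_inv: "x \<in> L \<Longrightarrow> inv\<^bsub>Z\<^esub> x \<in> L"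
  using subgroup.m_inv_closed[OF subgroup_L] by simp

lemma L_central: "x \<in> L \<Longrightarrow> z \<in> carrier Z \<Longrightarrow> x \<bullet> z = z \<bullet> x"
proof -
  assume z: "z \<in> carrier Z"
  have "x \<in> generate Z {l} \<Longrightarrow> x \<in> carrier Z \<and> x \<bullet> z = z \<bullet> x"
  proof (induction rule: generate.induct)
    case one
    then show ?case using Z.one_closed Z.r_one[OF z] Z.l_one[OF z] by simp
  next
    case (incl h)
    then show ?case using l_Z ZD(4)[OF z] by simp
  next
    case (inv h)
    then have h: "h = l" by simp
    have i: "inv\<^bsub>Z\<^esub> l \<in> carrier Z" using l_Z by simp
    have "inv\<^bsub>Z\<^esub> l \<otimes>\<^bsub>Z\<^esub> z = inv\<^bsub>Z\<^esub> l \<otimes>\<^bsub>Z\<^esub> (z \<otimes>\<^bsub>Z\<^esub> l) \<otimes>\<^bsub>Z\<^esub> inv\<^bsub>Z\<^esub> l"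
      using z l_Z i by (simp only: Z.m_assoc Z.m_closed Z.r_inv Z.r_one)
    also have "z \<otimes>\<^bsub>Z\<^esub> l = l \<otimes>\<^bsub>Z\<^esub> z" using ZD(4)[OF z] by simp
    also have "inv\<^bsub>Z\<^esub> l \<otimes>\<^bsub>Z\<^esub> (l \<otimes>\<^bsub>Z\<^esub> z) \<otimes>\<^bsub>Z\<^esub> inv\<^bsub>Z\<^esub> l = z \<otimes>\<^bsub>Z\<^esub> inv\<^bsub>Z\<^esub> l"
      using z l_Z i by (simp only: Z.m_assoc[symmetric] Z.m_closed Z.l_inv Z.l_one)
    finally show ?case unfolding h using i by simp
  next
    case (eng h1 h2)
    then have h: "h1 \<in> carrier Z" "h2 \<in> carrier Z" "h1 \<bullet> z = z \<bullet> h1" "h2 \<bullet> z = z \<bullet> h2" by auto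
    have "(h1 \<bullet> h2) \<bullet> z = h1 \<bullet> (h2 \<bullet> z)" using Z.m_assoc[OF h(1,2) z] by simp
    also have "\<dots> = (h1 \<bullet> z) \<bullet> h2" using Z.m_assoc[OF h(1) z h(2)] h by simp
    also have "\<dots> = z \<bullet> (h1 \<bullet> h2)" using Z.m_assoc[OF z h(1,2)] h by simp
    finally show ?case using mult_Z_closed[OF h(1,2)] by simp
  qed
  then show "x \<in> L \<Longrightarrow> x \<bullet> z = z \<bullet> x" unfolding L_eq by blast
qed

lemma normal_L: "L \<lhd> Z"
proof (rule Z.normal_invI[OF subgroup_L])
  fix h x assume "x \<in> carrier Z" "h \<in> L"
  then have "x \<otimes>\<^bsub>Z\<^esub> h \<otimes>\<^bsub>Z\<^esub> inv\<^bsub>Z\<^esub> x = h \<otimes>\<^bsub>Z\<^esub> (x \<otimes>\<^bsub>Z\<^esub> inv\<^bsub>Z\<^esub> x)"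
    using L_central[of h x] L_Z[of h] Z.m_assoc[of h x "inv\<^bsub>Z\<^esub> x"] by simp
  also have "\<dots> = h" using \<open>x \<in> carrier Z\<close> \<open>h \<in> L\<close> L_Z[of h] by (simp only: Z.r_inv Z.r_one)
  finally show "x \<otimes>\<^bsub>Z\<^esub> h \<otimes>\<^bsub>Z\<^esub> inv\<^bsub>Z\<^esub> x \<in> L" using \<open>h \<in> L\<close> by simp
qed

abbreviation N where "N \<equiv> Z Mod L"

sublocale N: group N by (rule normal.factorgroup_is_group[OF normal_L])

definition pr :: "'b \<Rightarrow> 'b set" where "pr z = L #>\<^bsub>Z\<^esub> z"

lemma pr_hom: "pr \<in> hom Z N"
  using normal.r_coset_hom_Mod[OF normal_L] unfolding pr_def[abs_def] .

lemma pr_surj: "pr ` carrier Z = carrier N"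
  by (auto simp: pr_def FactGroup_def RCOSETS_def)

lemma pr_mult: "x \<in> carrier Z \<Longrightarrow> y \<in> carrier Z \<Longrightarrow> pr (x \<bullet> y) = pr x \<otimes>\<^bsub>N\<^esub> pr y"
  using hom_mult[OF pr_hom] by simp

lemma pr_in: "z \<in> carrier Z \<Longrightarrow> pr z \<in> carrier N"
  using pr_surj by blast

lemma pr_L: "x \<in> L \<Longrightarrow> pr x = \<one>\<^bsub>N\<^esub>"
  using Z.coset_join2[OF L_Z subgroup_L] by (simp add: pr_def)

lemma pr_eqD:
  assumes g: "g \<in> carrier Z" "h \<in> carrier Z" "pr g = pr h"
  obtains x where "x \<in> L" "g = x \<bullet> h"
proof -
  have "g \<in> pr h" using Z.rcos_self[OF g(1) subgroup_L] g(3) by (simp add: pr_def)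
  then show thesis using that by (auto simp: pr_def r_coset_def)
qed

definition psiN :: "'b \<Rightarrow> 'b set" where "psiN h = pr (psi h)"

lemma psiN_in: "h \<in> H \<Longrightarrow> psiN h \<in> carrier N"
  by (simp add: psiN_def pr_in psi_Z)

lemma psiN_mult: "h \<in> H \<Longrightarrow> z \<in> carrier Z \<Longrightarrow> psiN (h \<bullet> z) = psiN h \<otimes>\<^bsub>N\<^esub> pr z"
  by (simp add: psiN_def psi_mult pr_mult psi_Z)

lemma psiN_L: "h \<in> H \<Longrightarrow> x \<in> L \<Longrightarrow> psiN (h \<bullet> x) = psiN h"
  using psiN_mult[of h x] L_Z[of x] pr_L[of x] N.r_one[OF psiN_in[of h]] by simp

definition orb :: "'b list \<Rightarrow> 'b list set" where
  "orb hs = (\<lambda>x. map (\<lambda>h. h \<bullet> x) hs) ` L"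

definition pick :: "'b list set \<Rightarrow> 'b list" where "pick A = (SOME hs. hs \<in> A)"

lemma translate_ident: "hs \<in> nelists H \<Longrightarrow> map (\<lambda>h. h \<bullet> ident G (src G l)) hs = hs"
  using comp_ident_right HD by (auto simp: nelists_def intro!: map_idI) (metis HD)

lemma self_orb: "hs \<in> nelists H \<Longrightarrow> hs \<in> orb hs"
  unfolding orb_def using translate_ident[of hs] ident_L by (metis imageI)

lemma orb_translate:
  assumes hs: "hs \<in> nelists H" and x: "x \<in> L"
  shows "orb (map (\<lambda>h. h \<bullet> x) hs) = orb hs"
proof
  show "orb (map (\<lambda>h. h \<bullet> x) hs) \<subseteq> orb hs"
    using translate_translate[OF hs L_Z L_Z[OF x]] L_mult[OF x] by (auto simp: orb_def simp del: map_map)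
  show "orb hs \<subseteq> orb (map (\<lambda>h. h \<bullet> x) hs)"
  proof
    fix ys assume "ys \<in> orb hs"
    then obtain y where y: "y \<in> L" "ys = map (\<lambda>h. h \<bullet> y) hs" by (auto simp: orb_def)
    have "x \<bullet> (inv\<^bsub>Z\<^esub> x \<bullet> y) = y"
      using Z.m_assoc[OF L_Z[OF x] L_Z[OF L_inv[OF x]] L_Z[OF y(1)]] Z.r_inv[OF L_Z[OF x]] Z.l_one[OF L_Z[OF y(1)]] by simp
    then have "ys = map (\<lambda>h. h \<bullet> (inv\<^bsub>Z\<^esub> x \<bullet> y)) (map (\<lambda>h. h \<bullet> x) hs)"
      using translate_translate[OF hs L_Z[OF L_mult[OF L_inv[OF x] y(1)]] L_Z[OF x]] y(2) by simp
    then show "ys \<in> orb (map (\<lambda>h. h \<bullet> x) hs)"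
      unfolding orb_def using L_mult[OF L_inv[OF x] y(1)] by blast
  qed
qed

lemma pick:
  assumes "hs \<in> nelists H"
  obtains x where "x \<in> L" "pick (orb hs) = map (\<lambda>h. h \<bullet> x) hs"
proof -
  have "pick (orb hs) \<in> orb hs" unfolding pick_def by (rule someI[of _ hs]) (rule self_orb[OF assms])
  then show thesis using that by (auto simp: orb_def)
qed

text \<open>The free tuples modulo \<open>L\<close>. Faces, cyclic operator and action are images of
  sets of tuples, hence need no representative; degree, \<open>qR\<close> and \<open>hcR\<close> are
  read off a chosen tuple, and are shown below to be independent of the choice.\<close>

definition R :: "'b list set set" where "R = orb ` nelists H"
definition ldgR :: "'b list set \<Rightarrow> nat" where "ldgR A = ldg (pick A)"
definition faceR :: "nat \<Rightarrow> 'b list set \<Rightarrow> ('b list set, 'k::field) chain" where "faceR i A = bas (omit i ` A)"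
definition tauR :: "'b list set \<Rightarrow> 'b list set" where "tauR A = rot u ` A"
definition actR :: "'b \<Rightarrow> 'b list set \<Rightarrow> 'b list set" where "actR z A = map (\<lambda>h. h \<bullet> z) ` A"
definition qR :: "'b list set \<Rightarrow> 'b list" where "qR A = qH (pick A)"
definition hcR :: "'b list set \<Rightarrow> ('b set list, 'k::field) chain" where "hcR A = alt (map psiN (pick A))"

lemma ldgR_orb: "hs \<in> nelists H \<Longrightarrow> ldgR (orb hs) = ldg hs"
  by (rule pick[of hs]) (auto simp: ldgR_def)

lemma faceR_orb: "faceR i (orb hs) = bas (orb (omit i hs))"
  by (simp add: faceR_def orb_def image_image map_omit)

lemma rot_translate: "hs \<in> nelists H \<Longrightarrow> z \<in> carrier Z \<Longrightarrow> rot u (map (\<lambda>h. h \<bullet> z) hs) = map (\<lambda>h. h \<bullet> z) (rot u hs)"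
  using u_mult[of "last hs" z] by (auto simp: rot_def nelists_def last_map map_butlast)

lemma tauR_orb: "hs \<in> nelists H \<Longrightarrow> tauR (orb hs) = orb (rot u hs)"
  by (auto simp: tauR_def orb_def image_image rot_translate L_Z)

lemma actR_orb: "hs \<in> nelists H \<Longrightarrow> z \<in> carrier Z \<Longrightarrow> actR z (orb hs) = orb (map (\<lambda>h. h \<bullet> z) hs)"
proof -
  assume hs: "hs \<in> nelists H" and z: "z \<in> carrier Z"
  have "map (\<lambda>h. h \<bullet> z) (map (\<lambda>h. h \<bullet> x) hs) = map (\<lambda>h. h \<bullet> x) (map (\<lambda>h. h \<bullet> z) hs)" if "x \<in> L" for x
    by (simp only: translate_translate[OF hs z L_Z[OF that]] translate_translate[OF hs L_Z[OF that] z] L_central[OF that z])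
  then show ?thesis unfolding actR_def orb_def image_image by (intro image_cong refl)
qed

lemma qR_orb: "hs \<in> nelists H \<Longrightarrow> qR (orb hs) = qH hs"
  by (rule pick[of hs]) (auto simp: qR_def qH_translate L_Z)

lemma hcR_orb: "hs \<in> nelists H \<Longrightarrow> hcR (orb hs) = alt (map psiN hs)"
proof -
  assume hs: "hs \<in> nelists H"
  obtain x where x: "x \<in> L" "pick (orb hs) = map (\<lambda>h. h \<bullet> x) hs" by (rule pick[OF hs])
  have "map psiN (pick (orb hs)) = map psiN hs"
    unfolding x(2) using hs psiN_L[OF _ x(1)] by (auto simp: nelists_def)
  then show ?thesis by (simp add: hcR_def)
qed

lemma rot_u_in: "hs \<in> nelists H \<Longrightarrow> rot u hs \<in> nelists H"
  by (rule rot_in) (auto simp: u_in)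

lemma omit_in: "hs \<in> nelists H \<Longrightarrow> i \<le> ldg hs \<Longrightarrow> 0 < ldg hs \<Longrightarrow> omit i hs \<in> nelists H \<and> Suc (ldg (omit i hs)) = ldg hs"
proof -
  assume hs: "hs \<in> nelists H" and i: "i \<le> ldg hs" "0 < ldg hs"
  then have "i < length hs" using nelists_length[OF hs] by simp
  then show ?thesis
    using length_omit[of i hs] omit_in_lists[of hs H i] hs i by (auto simp: nelists_def ldg_def)
qed

lemma translate_l: "map (\<lambda>h. h \<bullet> l) hs = map u hs"
  by (simp add: u_def)

text \<open>For \<open>A = []\<close> the full power of the twisted rotation is translation by
  \<open>l\<close>. So free tuples are merely precyclic, and become cyclic modulo
  \<open>L\<close>.\<close>

lemma rot_u_pow: "(rot u ^^ length B) (A @ B) = map u B @ A"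
proof (induction B arbitrary: A rule: rev_induct)
  case (snoc z B)
  have "(rot u ^^ length (B @ [z])) (A @ B @ [z]) = (rot u ^^ length B) (rot u (A @ B @ [z]))"
    by (simp add: funpow_swap1)
  also have "rot u (A @ B @ [z]) = (u z # A) @ B" by (simp add: rot_def butlast_append)
  finally show ?case using snoc[of "u z # A"] by simp
qed simp

lemma cyclic_basis_R: "cyclic_basis R ldgR (faceR :: nat \<Rightarrow> 'b list set \<Rightarrow> ('b list set, 'k::field) chain) tauR"
proof
  fix A assume "A \<in> R"
  then obtain hs where hs: "hs \<in> nelists H" and A: "A = orb hs" by (auto simp: R_def)
  note r = rot_u_in[OF hs]
  show "tauR A \<in> R" using r by (simp add: A tauR_orb hs R_def)
  have lr: "ldg (rot u hs) = ldg hs" using hs by (simp add: nelists_def ldg_def)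
  then show "ldgR (tauR A) = ldgR A" by (simp add: A tauR_orb hs ldgR_orb r)
  show "(faceR i A :: ('b list set, 'k) chain) \<in> Lin {y \<in> R. Suc (ldgR y) = ldgR A}" if "i \<le> ldgR A" "0 < ldgR A" for i
    using omit_in[OF hs, of i] that by (auto simp: A faceR_orb ldgR_orb hs R_def)
  show "(faceR (Suc i) (tauR A) :: ('b list set, 'k) chain) = pmap tauR (faceR i A)" if "i < ldgR A" for i
    using that omit_in[OF hs, of i] by (simp add: A tauR_orb hs faceR_orb ldgR_orb omit_Suc_rot ldg_def)
  show "(faceR 0 (tauR A) :: ('b list set, 'k) chain) = faceR (ldgR A) A"
    using hs by (simp add: A tauR_orb faceR_orb ldgR_orb omit_0_rot nelists_def ldg_def)
  have p: "(tauR ^^ k) (orb hs) = orb ((rot u ^^ k) hs) \<and> (rot u ^^ k) hs \<in> nelists H" for k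
    by (induction k) (simp_all add: hs tauR_orb rot_u_in)
  have "(tauR ^^ Suc (ldgR A)) A = orb (map (\<lambda>h. h \<bullet> l) hs)"
    using p[of "length hs"] rot_u_pow[of hs "[]"] nelists_length[OF hs]
    by (simp add: A ldgR_orb hs translate_l del: funpow.simps)
  then show "(tauR ^^ Suc (ldgR A)) A = A" by (simp only: orb_translate[OF hs l_L] A)
qed

lemma precyclic_nerve_part:
  "cyclic_basis nerve_part ldg (gface G :: nat \<Rightarrow> 'b list \<Rightarrow> ('b list, 'k::field) chain) cycl"
proof -
  interpret n: cyclic_basis cells ldg "gface G :: nat \<Rightarrow> 'b list \<Rightarrow> ('b list, 'k) chain" cycl
    by (rule nerve_cyclic_basis)
  have m: "y \<in> nerve_part \<Longrightarrow> y \<in> cells" for y by (auto simp: nerve_part_def qH_in)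
  show ?thesis
  proof
    fix y assume y: "y \<in> nerve_part"
    then obtain hs where hs: "hs \<in> nelists H" "y = qH hs" by (auto simp: nerve_part_def)
    have ne: "hs \<noteq> []" using hs by (simp add: nelists_def)
    show "cycl y \<in> nerve_part" using rot_u_in[OF hs(1)] by (simp add: hs(2) rot_qH[OF hs(1)] nerve_part_def)
    show "(gface G i y :: ('b list, 'k) chain) \<in> Lin {ya \<in> nerve_part. Suc (ldg ya) = ldg y}" if "i \<le> ldg y" "0 < ldg y" for i
    proof -
      have i: "i \<le> ldg hs" "0 < ldg hs" using that by (simp_all add: hs(2) ldg_qH ne)
      note o = omit_in[OF hs(1) i]
      then have "omit i hs \<noteq> []" by (simp add: nelists_def)
      then show ?thesis
        unfolding hs(2) gface_qH[OF hs(1) i] Lin_bas using o by (simp add: nerve_part_def ldg_qH ne)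
    qed
    show "ldg (cycl y) = ldg y" "(cycl ^^ Suc (ldg y)) y = y"
      using n.dg_tau n.tau_per m[OF y] by blast+
    show "i < ldg y \<Longrightarrow> (gface G (Suc i) (cycl y) :: ('b list, 'k) chain) = pmap cycl (gface G i y)" for i
      by (rule gface_rot)
    show "0 < ldg y \<Longrightarrow> (gface G 0 (cycl y) :: ('b list, 'k) chain) = gface G (ldg y) y"
      by (rule gface_0_rot)
  qed
qed

text \<open>In terms of vertices, an identity in front repeats the vertex that precedes
  \<open>hs ! 0\<close> in the twisted cyclic order, which is \<open>u\<close> of the last
  vertex.\<close>

lemma add_ident_nerve_part: "y \<in> nerve_part \<Longrightarrow> add_ident y \<in> nerve_part"
proof -
  assume "y \<in> nerve_part"
  then obtain hs where hs: "hs \<in> nelists H" "y = qH hs" by (auto simp: nerve_part_def)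
  have m: "k < length hs \<Longrightarrow> hs ! k \<in> H" for k by (rule nelists_nth[OF hs(1)])
  have L: "length hs = Suc (ldg hs)" by (rule nelists_length[OF hs(1)])
  have ne: "hs \<noteq> []" using hs by (simp add: nelists_def)
  let ?a = "u (hs ! ldg hs)"
  have a: "?a \<in> H" using u_in m L by simp
  have "qH hs \<noteq> []" using length_qH[OF ne] ne by (metis length_0_conv)
  then have "tgt G (hd (qH hs)) = tgt G (qH hs ! 0)" by (subst hd_conv_nth) auto
  also have "\<dots> = tgt G ?a" using qH_nth_props(3)[OF hs(1), of 0] tgt_u m L by simp
  finally have t: "tgt G (hd (qH hs)) = tgt G ?a" .
  have "add_ident (qH hs) = qH (?a # hs)"
  proof (rule nth_equalityI)
    show "length (add_ident (qH hs)) = length (qH (?a # hs))" using ne by (simp add: add_ident_def)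
    fix k assume "k < length (add_ident (qH hs))"
    then have k: "k < Suc (length hs)" using ne by (simp add: add_ident_def)
    have ld: "ldg (?a # hs) = Suc (ldg hs)" using L by (simp add: ldg_def)
    show "add_ident (qH hs) ! k = qH (?a # hs) ! k"
    proof (cases k)
      case 0
      have "ident G (tgt G ?a) = ?a \<bullet> iv ?a" using HD[OF a] by (simp add: iv)
      then show ?thesis using nth_qH[of 0 "?a # hs"] by (simp add: 0 ld add_ident_def t)
    next
      case (Suc k')
      then show ?thesis using nth_qH[of k "?a # hs"] nth_qH[of k' hs] k
        by (cases k') (auto simp: add_ident_def)
    qed
  qed
  moreover have "?a # hs \<in> nelists H" using a hs(1) by (auto simp: nelists_def)
  ultimately show ?thesis by (auto simp: hs(2) nerve_part_def)
qed

end

lemma cone_exact_relabel: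
  assumes ex: "cone_exact S dg D Q dgQ DQ f" and g: "inj_on g Q"
    and DQ: "\<And>y. y \<in> Q \<Longrightarrow> DQ y \<in> Lin Q" and f: "\<And>x. x \<in> S \<Longrightarrow> f x \<in> Lin Q"
    and dg': "\<And>y. y \<in> Q \<Longrightarrow> dg' (g y) = dgQ y" and D': "\<And>y. y \<in> Q \<Longrightarrow> D' (g y) = pmap g (DQ y)"
  shows "cone_exact S dg D (g ` Q) dg' D' (\<lambda>x. pmap g (f x))"
  unfolding cone_exact_def
proof (intro allI ballI impI)
  fix n a b assume a: "a \<in> Lin {x \<in> S. Suc (dg x) = n}" and b: "b \<in> Lin {y \<in> g ` Q. dg' y = n}"
    and Da: "lext D a = 0" and eq: "lext (\<lambda>x. pmap g (f x)) a = lext D' b"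
  have "{y \<in> g ` Q. dg' y = n} = g ` {y \<in> Q. dgQ y = n}" by (auto simp: dg')
  then have "b \<in> Lin (g ` {y \<in> Q. dgQ y = n})" using b by simp
  from pmap_surj[OF this] obtain b0 where b0: "b0 \<in> Lin {y \<in> Q. dgQ y = n}" "pmap g b0 = b"
    by blast
  define h where "h = the_inv_into Q g"
  have hg: "h (g y) = y" if "y \<in> Q" for y using that g by (simp add: h_def the_inv_into_f_f)
  have unmap: "pmap h (pmap g p) = p" if "p \<in> Lin Q" for p
    using pmap_cong_on[OF that, of "\<lambda>y. h (g y)" "\<lambda>y. y"] hg by (simp add: pmap_pmap)
  have b0Q: "b0 \<in> Lin Q" and aS: "a \<in> Lin S" using b0 a by (auto elim!: Lin_mono)
  have D'g: "lext D' (pmap g p) = pmap g (lext DQ p)" if "p \<in> Lin Q" for p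
    unfolding lext_pmap pmap_lext by (rule lext_cong_on[OF that]) (rule D')
  have "pmap g (lext f a) = pmap g (lext DQ b0)"
    using eq D'g[OF b0Q] b0(2) by (simp add: pmap_lext)
  then have "pmap h (pmap g (lext f a)) = pmap h (pmap g (lext DQ b0))" by simp
  then have feq: "lext f a = lext DQ b0"
    using unmap[OF Lin_lext[OF aS f]] unmap[OF Lin_lext[OF b0Q DQ]] by simp
  obtain a' b' where a': "a' \<in> Lin {x \<in> S. dg x = n}" and b': "b' \<in> Lin {y \<in> Q. dgQ y = Suc n}"
    and e: "lext D a' = a" "b0 = lext f a' + lext DQ b'"
    by (rule cone_exactD[OF ex a b0(1) Da feq])
  have "b' \<in> Lin Q" using b' by (auto elim!: Lin_mono)
  then have "b = lext (\<lambda>x. pmap g (f x)) a' + lext D' (pmap g b')"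
    using b0(2) D'g unfolding e(2) by (auto simp: pmap_add pmap_lext)
  moreover have "pmap g b' \<in> Lin {y \<in> g ` Q. dg' y = Suc n}"
    by (rule Lin_pmap[OF b']) (auto simp: dg')
  ultimately show "\<exists>a'\<in>Lin {x \<in> S. dg x = n}. \<exists>b'\<in>Lin {y \<in> g ` Q. dg' y = Suc n}.
          lext D a' = a \<and> b = lext (\<lambda>x. pmap g (f x)) a' + lext D' b'"
    using a' e(1) by blast
qed

lemma (in orbit_complex) based_complex_quotient:
  assumes "\<And>x. x \<in> S \<Longrightarrow> dgq (q x) = dg x"
  shows "based_complex (q ` S) dgq D'"
proof
  fix y assume "y \<in> q ` S"
  then obtain x where x: "x \<in> S" "y = q x" by blast
  show "D' y \<in> Lin {z \<in> q ` S. Suc (dgq z) = dgq y}"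
    unfolding x(2) q_D[OF x(1)] by (rule Lin_pmap[OF D_in[OF x(1)]]) (auto simp: assms x(1))
  have "lext D' (pmap q p) = pmap q (lext D p)" if "p \<in> Lin S" for p
    unfolding lext_pmap pmap_lext by (rule lext_cong_on[OF that]) (auto simp: q_D)
  from this[OF Lin_mono[OF D_in[OF x(1)]]] show "lext D' (D' y) = 0"
    unfolding x(2) q_D[OF x(1)] by (auto simp: DD[OF x(1)])
qed

lemma lookup_pmap_inj:
  assumes "inj_on g A" "p \<in> Lin A" "x \<in> A"
  shows "lookup (pmap g p) (g x) = lookup p x"
proof -
  have "lookup (pmap g p) (g x) = (\<Sum>y\<in>Poly_Mapping.keys p. if y = x then lookup p y else 0)"
    unfolding pmap_def lookup_lext
    using assms by (intro sum.cong) (auto simp: lookup_single Lin_def when_def inj_on_eq_iff subset_iff)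
  also have "\<dots> = lookup p x" by (simp add: sum.delta in_keys_iff)
  finally show ?thesis .
qed

lemma alt_singleton: "alt [w] = bas [w]"
  by (simp add: alt_eq)

lemma alt_hdel:
  assumes "ws \<noteq> []"
  shows "lext hdel (alt ws :: ('h list, 'k::field_char_0) chain) = lext alt (hdel ws)"
proof (cases "length ws \<le> 1")
  case True
  then obtain w where "ws = [w]" using assms by (cases ws) auto
  then show ?thesis by (simp add: alt_singleton hdel_adel)
next
  case False
  have "lext hdel (alt ws :: ('h list, 'k) chain) = lext adel (alt ws)"
    by (rule lext_cong_on[OF alt_in[of ws UNIV]]) (use False in \<open>auto simp: hdel_adel\<close>)
  then show ?thesis using False by (simp add: alt_chain hdel_adel)
qed

section \<open>Differentials and centralizer action on classes modulo the loop\<close>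

context pointed_groupoid
begin

lemma precyclic_H: "precyclic (nelists H) ldg (hface :: nat \<Rightarrow> 'b list \<Rightarrow> ('b list, 'k::field) chain) (rot u)"
  by (rule precyclic_lists[OF u_in])

lemma precyclic_R: "precyclic R ldgR (faceR :: nat \<Rightarrow> 'b list set \<Rightarrow> ('b list set, 'k::field) chain) tauR"
  by (rule cyclic_basis.axioms(1)[OF cyclic_basis_R])

lemma precyclic_np: "precyclic nerve_part ldg (gface G :: nat \<Rightarrow> 'b list \<Rightarrow> ('b list, 'k::field) chain) cycl"
  by (rule cyclic_basis.axioms(1)[OF precyclic_nerve_part])

abbreviation bR :: "'b list set \<Rightarrow> ('b list set, 'k::field) chain" where "bR \<equiv> precyclic.b ldgR faceR"
abbreviation b'R :: "'b list set \<Rightarrow> ('b list set, 'k::field) chain" where "b'R \<equiv> precyclic.b' ldgR faceR"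
abbreviation tR :: "'b list set \<Rightarrow> ('b list set, 'k::field) chain" where "tR \<equiv> precyclic.t ldgR tauR"
abbreviation tH :: "'b list \<Rightarrow> ('b list, 'k::field) chain" where "tH \<equiv> precyclic.t ldg (rot u)"

lemma orb_in: "hs \<in> nelists H \<Longrightarrow> orb hs \<in> R"
  by (simp add: R_def)

lemma R_cases: assumes "A \<in> R" obtains hs where "hs \<in> nelists H" "A = orb hs"
  using assms by (auto simp: R_def)

lemma R_orb:
  assumes hs: "hs \<in> nelists H"
  shows "bR (orb hs) = pmap orb (hdel hs :: ('b list, 'k::field) chain)"
    and "b'R (orb hs) = pmap orb (hdel' hs :: ('b list, 'k) chain)"
    and "tR (orb hs) = pmap orb (tH hs :: ('b list, 'k) chain)"
proof -
  note m = precyclic_morphism[OF precyclic_H precyclic_R, of orb hs, where 'k = 'k]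
  show "bR (orb hs) = pmap orb (hdel hs :: ('b list, 'k) chain)"
    by (rule m(1)) (auto simp: orb_in ldgR_orb faceR_orb hface_def tauR_orb hs)
  show "b'R (orb hs) = pmap orb (hdel' hs :: ('b list, 'k) chain)"
    by (rule m(2)) (auto simp: orb_in ldgR_orb faceR_orb hface_def tauR_orb hs)
  show "tR (orb hs) = pmap orb (tH hs :: ('b list, 'k) chain)"
    by (rule m(3)) (auto simp: orb_in ldgR_orb faceR_orb hface_def tauR_orb hs)
qed

lemma lext_R_orb:
  assumes p: "(p :: ('b list, 'k::field) chain) \<in> Lin (nelists H)"
  shows "lext bR (pmap orb p) = pmap orb (lext hdel p)"
    and "lext b'R (pmap orb p) = pmap orb (lext hdel' p)"
    and "lext tR (pmap orb p) = pmap orb (lext tH p)"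
  unfolding lext_pmap pmap_lext by (rule lext_cong_on[OF p], simp add: R_orb)+

lemma lift_R:
  assumes "a \<in> Lin {A \<in> R. ldgR A = n}"
  obtains p where "p \<in> Lin {hs \<in> nelists H. ldg hs = n}" "pmap orb p = a"
proof -
  have "{A \<in> R. ldgR A = n} = orb ` {hs \<in> nelists H. ldg hs = n}"
    by (auto simp: R_def ldgR_orb)
  then show thesis using assms pmap_surj[of a orb "{hs \<in> nelists H. ldg hs = n}"] that by auto
qed

lemma orb_chain: "p \<in> Lin {hs \<in> nelists H. ldg hs = n} \<Longrightarrow> pmap orb p \<in> Lin {A \<in> R. ldgR A = n}"
  by (erule Lin_pmap) (auto simp: orb_in ldgR_orb)

lemma bbR:
  assumes "A \<in> R"
  shows "lext bR (bR A) = (0 :: ('b list set, 'k::field) chain)" and "lext b'R (b'R A) = (0 :: ('b list set, 'k) chain)"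
proof -
  interpret P: precyclic "nelists H" ldg "hface :: nat \<Rightarrow> 'b list \<Rightarrow> ('b list, 'k) chain" "rot u" by (rule precyclic_H)
  obtain hs where hs: "hs \<in> nelists H" "A = orb hs" by (rule R_cases[OF assms])
  have dd: "lext hdel (hdel hs) = (0 :: ('b list, 'k) chain)" "lext hdel' (hdel' hs) = (0 :: ('b list, 'k) chain)"
    by (rule based_complex.DD[OF based_complex_lists[of H u, OF u_in] hs(1)], assumption)
      (rule hdel'_hdel'[of H u, OF u_in hs(1)], assumption)
  have "(hdel hs :: ('b list, 'k) chain) \<in> Lin (nelists H)" "(hdel' hs :: ('b list, 'k) chain) \<in> Lin (nelists H)"
    using P.b_in[OF hs(1)] P.b'_in[OF hs(1)] by (auto elim!: Lin_mono)
  then show "lext bR (bR A) = (0 :: ('b list set, 'k) chain)" "lext b'R (b'R A) = (0 :: ('b list set, 'k) chain)"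
    unfolding hs(2) R_orb[OF hs(1)]
    using dd by (simp_all add: lext_R_orb)
qed

lemma based_complex_R: "based_complex R ldgR (bR :: 'b list set \<Rightarrow> ('b list set, 'k::field) chain)"
  by unfold_locales (auto simp: bbR precyclic.b_in[OF precyclic_R])

lemma actR_in: "z \<in> carrier Z \<Longrightarrow> A \<in> R \<Longrightarrow> actR z A \<in> R \<and> ldgR (actR z A) = ldgR A"
  by (erule R_cases) (simp add: actR_orb orb_in translate_in ldgR_orb)

lemma R_act:
  assumes z: "z \<in> carrier Z" and A: "A \<in> R"
  shows "bR (actR z A) = pmap (actR z) (bR A :: ('b list set, 'k::field) chain)"
    and "precyclic.tdiff ldgR faceR tauR (p, actR z A) = pmap (map_prod id (actR z)) (precyclic.tdiff ldgR faceR tauR (p, A) :: nat \<times> 'b list set \<Rightarrow>\<^sub>0 'k)"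
    and "precyclic.tdeg ldgR (p, actR z A) = precyclic.tdeg ldgR (p, A)"
proof -
  have f: "faceR i (actR z x) = pmap (actR z) (faceR i x :: ('b list set, 'k) chain)" if x: "x \<in> R" "i \<le> ldgR x" "0 < ldgR x" for i x
  proof -
    obtain hs where hs: "hs \<in> nelists H" "x = orb hs" by (rule R_cases[OF x(1)])
    then have "omit i hs \<in> nelists H" using omit_in[of hs i] x by (simp add: ldgR_orb)
    then show ?thesis using hs z by (simp add: actR_orb faceR_orb map_omit)
  qed
  have t: "tauR (actR z x) = actR z (tauR x)" if "x \<in> R" for x
    using that by (rule R_cases) (simp add: actR_orb tauR_orb z translate_in rot_u_in rot_translate)
  note m = precyclic_morphism[OF precyclic_R precyclic_R, of "actR z" A, where 'k = 'k]
  show "bR (actR z A) = pmap (actR z) (bR A :: ('b list set, 'k) chain)"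
    by (rule m(1)) (use actR_in z A f t in auto)
  show "precyclic.tdiff ldgR faceR tauR (p, actR z A) = pmap (map_prod id (actR z)) (precyclic.tdiff ldgR faceR tauR (p, A) :: nat \<times> 'b list set \<Rightarrow>\<^sub>0 'k)"
    by (rule m(6)) (use actR_in z A f t in auto)
  show "precyclic.tdeg ldgR (p, actR z A) = precyclic.tdeg ldgR (p, A)"
    by (rule m(5)) (use actR_in z A f t in auto)
qed

lemma R_q:
  assumes A: "A \<in> R"
  shows "gb (qR A) = pmap qR (bR A :: ('b list set, 'k::field) chain)"
    and "gtdiff (p, qR A) = pmap (map_prod id qR) (precyclic.tdiff ldgR faceR tauR (p, A) :: nat \<times> 'b list set \<Rightarrow>\<^sub>0 'k)"
    and "gtdeg (p, qR A) = precyclic.tdeg ldgR (p, A)"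
    and "precyclic.t ldg cycl (qR A) = pmap qR (tR A :: ('b list set, 'k) chain)"
proof -
  have s: "qR x \<in> nerve_part" "ldg (qR x) = ldgR x" if "x \<in> R" for x
    using that by (auto elim!: R_cases simp: qR_orb ldgR_orb nerve_part_def nelists_def intro!: ldg_qH)
  have f: "gface G i (qR x) = pmap qR (faceR i x :: ('b list set, 'k) chain)" if x: "x \<in> R" "i \<le> ldgR x" "0 < ldgR x" for i x
  proof -
    obtain hs where hs: "hs \<in> nelists H" "x = orb hs" by (rule R_cases[OF x(1)])
    then have "omit i hs \<in> nelists H" using omit_in[of hs i] x by (simp add: ldgR_orb)
    then show ?thesis using hs x by (simp add: qR_orb faceR_orb gface_qH ldgR_orb)
  qed
  have t: "cycl (qR x) = qR (tauR x)" if "x \<in> R" for x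
    using that by (rule R_cases) (simp add: qR_orb tauR_orb rot_u_in rot_qH)
  note m = precyclic_morphism[OF precyclic_R precyclic_np, of qR A, where 'k = 'k]
  show "gb (qR A) = pmap qR (bR A :: ('b list set, 'k) chain)"
    by (rule m(1)) (use s A f t in auto)
  show "gtdiff (p, qR A) = pmap (map_prod id qR) (precyclic.tdiff ldgR faceR tauR (p, A) :: nat \<times> 'b list set \<Rightarrow>\<^sub>0 'k)"
    by (rule m(6)) (use s A f t in auto)
  show "precyclic.t ldg cycl (qR A) = pmap qR (tR A :: ('b list set, 'k) chain)"
    by (rule m(3)) (use s A f t in auto)
  show "gtdeg (p, qR A) = precyclic.tdeg ldgR (p, A)"
    by (rule m(5)) (use s A f t in auto)
qed

lemma qR_image: "qR ` R = nerve_part"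
  by (auto simp: R_def nerve_part_def image_image qR_orb)

lemma actR_actR: "z \<in> carrier Z \<Longrightarrow> w \<in> carrier Z \<Longrightarrow> A \<in> R \<Longrightarrow> actR z (actR w A) = actR (w \<bullet> z) A"
  by (erule R_cases) (simp only: actR_orb translate_in translate_translate mult_Z_closed)

text \<open>On classes \<open>Z\<close> acts through a free action of \<open>N\<close>. The
  right-hand side does not mention \<open>A\<close>, so agreement at one class implies agreement at
  all, as \<open>pseudo_free\<close> demands.\<close>

lemma actR_pr:
  assumes g: "g \<in> carrier Z" and h: "h \<in> carrier Z" and A: "A \<in> R"
  shows "actR g A = actR h A \<longleftrightarrow> pr g = pr h"
proof -
  obtain hs where hs: "hs \<in> nelists H" "A = orb hs" by (rule R_cases[OF A])
  show ?thesis
  proof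
    assume "actR g A = actR h A"
    then have "map (\<lambda>x. x \<bullet> g) hs \<in> orb (map (\<lambda>x. x \<bullet> h) hs)"
      using self_orb[OF translate_in[OF hs(1) g]] by (simp add: hs(2) actR_orb[OF hs(1)] g h)
    then obtain x where x: "x \<in> L" "map (\<lambda>x. x \<bullet> g) hs = map (\<lambda>y. y \<bullet> x) (map (\<lambda>x. x \<bullet> h) hs)"
      unfolding orb_def by blast
    then have "map (\<lambda>x. x \<bullet> g) hs = map (\<lambda>y. y \<bullet> (h \<bullet> x)) hs"
      by (simp only: translate_translate[OF hs(1) L_Z[OF x(1)] h])
    then have "g = h \<bullet> x" by (rule translate_cancel[OF hs(1) g mult_Z_closed[OF h L_Z[OF x(1)]]])
    then show "pr g = pr h" using pr_mult[OF h L_Z[OF x(1)]] pr_L[OF x(1)] N.r_one[OF pr_in[OF h]] by simp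
  next
    assume "pr g = pr h"
    then obtain x where x: "x \<in> L" "g = x \<bullet> h" by (rule pr_eqD[OF g h])
    have "map (\<lambda>y. y \<bullet> g) hs = map (\<lambda>y. y \<bullet> x) (map (\<lambda>y. y \<bullet> h) hs)"
      unfolding x(2) L_central[OF x(1) h] by (simp only: translate_translate[OF hs(1) L_Z[OF x(1)] h])
    then show "actR g A = actR h A"
      using orb_translate[OF translate_in[OF hs(1) h] x(1)] by (simp only: hs(2) actR_orb[OF hs(1)] g h)
  qed
qed

lemma qR_orbit: "A \<in> R \<Longrightarrow> B \<in> R \<Longrightarrow> qR A = qR B \<Longrightarrow> \<exists>g\<in>carrier Z. B = actR g A"
proof -
  assume "A \<in> R" "B \<in> R" and eq: "qR A = qR B"
  then obtain hs hs' where hs: "hs \<in> nelists H" "A = orb hs" "hs' \<in> nelists H" "B = orb hs'"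
    by (auto elim!: R_cases)
  then obtain z where "z \<in> carrier Z" "hs' = map (\<lambda>h. h \<bullet> z) hs"
    using qH_orbit[OF hs(1,3)] eq by (auto simp: qR_orb)
  then show ?thesis using hs by (auto simp: actR_orb)
qed

lemma qR_act: "z \<in> carrier Z \<Longrightarrow> A \<in> R \<Longrightarrow> qR (actR z A) = qR A"
  by (erule R_cases) (simp add: actR_orb qR_orb translate_in qH_translate)

lemma orbit_complex_R:
  "orbit_complex R ldgR (bR :: 'b list set \<Rightarrow> ('b list set, 'k::field) chain) qR (carrier Z) actR gb"
proof -
  interpret based_complex R ldgR "bR :: 'b list set \<Rightarrow> ('b list set, 'k) chain" by (rule based_complex_R)
  show ?thesis
  proof
    fix g h assume gh: "g \<in> carrier Z" "h \<in> carrier Z"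
    show "\<exists>k\<in>carrier Z. \<forall>x\<in>R. actR g (actR h x) = actR k x"
      using actR_actR[OF gh] mult_Z_closed[OF gh(2,1)] by blast
    fix x y assume "x \<in> R" "actR g x = actR h x" "y \<in> R"
    then show "actR g y = actR h y" using actR_pr[OF gh] by simp
  qed (simp_all add: actR_in R_act qR_orbit qR_act R_q)
qed

lemma orbit_complex_tot:
  "orbit_complex (UNIV \<times> R) (precyclic.tdeg ldgR) (precyclic.tdiff ldgR faceR tauR :: nat \<times> 'b list set \<Rightarrow> nat \<times> 'b list set \<Rightarrow>\<^sub>0 'k::field)
     (map_prod id qR) (carrier Z) (\<lambda>z. map_prod id (actR z)) gtdiff"
proof -
  interpret R: cyclic_basis R ldgR "faceR :: nat \<Rightarrow> 'b list set \<Rightarrow> ('b list set, 'k) chain" tauR by (rule cyclic_basis_R)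
  interpret based_complex "UNIV \<times> R" R.tdeg R.tdiff by (rule R.tot_based_complex[OF bbR])
  show ?thesis
  proof
    fix g h assume gh: "g \<in> carrier Z" "h \<in> carrier Z"
    show "\<exists>k\<in>carrier Z. \<forall>x\<in>UNIV \<times> R. map_prod id (actR g) (map_prod id (actR h) x) = map_prod id (actR k) x"
      using actR_actR[OF gh] mult_Z_closed[OF gh(2,1)] by (intro bexI[of _ "h \<bullet> g"]) auto
    fix x y assume "x \<in> UNIV \<times> R" "map_prod id (actR g) x = map_prod id (actR h) x" "y \<in> UNIV \<times> R"
    then show "map_prod id (actR g) y = map_prod id (actR h) y" using actR_pr[OF gh] by auto
  next
    fix x y assume "x \<in> UNIV \<times> R" "y \<in> UNIV \<times> R" "map_prod id qR x = map_prod id qR y"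
    then show "\<exists>g\<in>carrier Z. y = map_prod id (actR g) x" using qR_orbit by fastforce
  qed (auto simp: actR_in R_act qR_act R_q simp del: surjective_pairing)
qed

section \<open>Orbits of a loop of finite order\<close>

text \<open>A tuple modulo \<open>L\<close> is lifted to the mean of its representatives; this splits the quotient map.\<close>

definition transfer :: "'b list set \<Rightarrow> ('b list, 'k::field) chain" where
  "transfer A = cmul (1 / of_nat (card L)) (\<Sum>x\<in>L. bas (map (\<lambda>h. h \<bullet> x) (pick A)))"

text \<open>Another representative of the class only reindexes the sum over the group
  \<open>L\<close>.\<close>

lemma transfer_orb:
  assumes hs: "hs \<in> nelists H"
  shows "transfer (orb hs) = cmul (1 / of_nat (card L)) (\<Sum>x\<in>L. bas (map (\<lambda>h. h \<bullet> x) hs) :: ('b list, 'k::field) chain)"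
proof -
  obtain x0 where x0: "x0 \<in> L" "pick (orb hs) = map (\<lambda>h. h \<bullet> x0) hs" by (rule pick[OF hs])
  have inj: "inj_on (\<lambda>x. x0 \<bullet> x) L"
    by (rule inj_onI) (use Z.l_cancel[of x0] L_Z x0 in auto)
  have im: "(\<lambda>x. x0 \<bullet> x) ` L = L"
  proof
    show "L \<subseteq> (\<lambda>x. x0 \<bullet> x) ` L"
    proof
      fix y assume y: "y \<in> L"
      have "y = x0 \<bullet> (inv\<^bsub>Z\<^esub> x0 \<bullet> y)"
        using Z.m_assoc[OF L_Z[OF x0(1)] L_Z[OF L_inv[OF x0(1)]] L_Z[OF y]] Z.r_inv[OF L_Z[OF x0(1)]] Z.l_one[OF L_Z[OF y]] by simp
      then show "y \<in> (\<lambda>x. x0 \<bullet> x) ` L" using L_mult[OF L_inv[OF x0(1)] y] by blast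
    qed
  qed (use L_mult[OF x0(1)] in auto)
  have "(\<Sum>x\<in>L. bas (map (\<lambda>h. h \<bullet> x) (pick (orb hs)))) = (\<Sum>x\<in>L. bas (map (\<lambda>h. h \<bullet> (x0 \<bullet> x)) hs) :: ('b list, 'k) chain)"
    unfolding x0(2) by (rule sum.cong) (simp_all only: translate_translate[OF hs L_Z L_Z[OF x0(1)]])
  also have "\<dots> = (\<Sum>x\<in>(\<lambda>x. x0 \<bullet> x) ` L. bas (map (\<lambda>h. h \<bullet> x) hs))"
    by (simp add: sum.reindex[OF inj])
  finally show ?thesis by (simp add: transfer_def im)
qed

text \<open>\<open>transfer\<close> commutes with the differentials, because faces commute with
  translations, and it is a right inverse of the projection, because \<open>card L\<close> is
  invertible. A cycle of classes therefore lifts to a cycle of free tuples with the same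
  augmentation; the lift bounds, and its filling is projected back.\<close>

lemma aug_acyclic_R:
  assumes fin: "finite L"
  shows "aug_acyclic R ldgR (bR :: 'b list set \<Rightarrow> ('b list set, 'k::field_char_0) chain) (\<lambda>_. bas ())"
  unfolding aug_acyclic_def
proof (intro allI ballI impI)
  fix n and a :: "('b list set, 'k) chain" assume a: "a \<in> Lin {A \<in> R. ldgR A = n}" and 0: "lext bR a = 0"
    and e: "n = 0 \<longrightarrow> lext (\<lambda>_. bas ()) a = 0"
  have L0: "(of_nat (card L) :: 'k) \<noteq> 0" using fin ident_L by auto
  let ?c = "1 / of_nat (card L) :: 'k"
  have tp: "lext transfer (pmap orb p) = cmul ?c (\<Sum>x\<in>L. pmap (map (\<lambda>h. h \<bullet> x)) p)" if "p \<in> Lin (nelists H)" for p :: "('b list, 'k) chain"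
  proof -
    have "lext transfer (pmap orb p) = lext (\<lambda>hs. cmul ?c (\<Sum>x\<in>L. bas (map (\<lambda>h. h \<bullet> x) hs))) p"
      unfolding lext_pmap by (rule lext_cong_on[OF that]) (rule transfer_orb)
    then show ?thesis by (simp add: lext_fun_cmul lext_fun_sum pmap_def)
  qed
  define p where "p = (lext transfer a :: ('b list, 'k) chain)"
  have p: "p \<in> Lin {hs \<in> nelists H. ldg hs = n}"
    unfolding p_def
  proof (rule Lin_lext[OF a])
    fix A assume "A \<in> {A \<in> R. ldgR A = n}"
    then obtain hs where hs: "hs \<in> nelists H" "A = orb hs" "ldg hs = n" by (auto simp: R_def ldgR_orb)
    show "(transfer A :: ('b list, 'k) chain) \<in> Lin {hs \<in> nelists H. ldg hs = n}"
      unfolding hs(2) transfer_orb[OF hs(1)]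
      using translate_in[OF hs(1) L_Z] hs(3) by (intro Lin_cmul Lin_sum) (simp del: map_map)
  qed
  have pS: "p \<in> Lin (nelists H)" using p by (auto elim!: Lin_mono)
  have op: "pmap orb p = a"
  proof -
    have "pmap orb p = lext bas a"
      unfolding p_def pmap_lext
    proof (rule lext_cong_on[OF a])
      fix A assume "A \<in> {A \<in> R. ldgR A = n}"
      then obtain hs where hs: "hs \<in> nelists H" "A = orb hs" by (auto simp: R_def)
      have "pmap orb (transfer A :: ('b list, 'k) chain) = cmul ?c (\<Sum>x\<in>L. bas (orb hs))"
        unfolding hs(2) transfer_orb[OF hs(1)] pmap_cmul pmap_sum pmap_bas
        by (intro arg_cong[of _ _ "cmul ?c"] sum.cong) (simp_all only: orb_translate[OF hs(1)])
      also have "(\<Sum>x\<in>L. bas (orb hs)) = cmul (of_nat (card L)) (bas (orb hs) :: _ \<Rightarrow>\<^sub>0 'k)"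
        using cmul_sum_left[of "\<lambda>_. 1" L "bas (orb hs) :: _ \<Rightarrow>\<^sub>0 'k"] by simp
      finally show "pmap orb (transfer A :: ('b list, 'k) chain) = bas A" using L0 hs(2) by simp
    qed
    then show ?thesis by simp
  qed
  have "lext hdel p = lext (\<lambda>A. lext transfer (bR A)) a"
    unfolding p_def lext_lext
  proof (rule lext_cong_on[OF a])
    fix A assume "A \<in> {A \<in> R. ldgR A = n}"
    then obtain hs where hs: "hs \<in> nelists H" "A = orb hs" by (auto simp: R_def)
    have "(hdel hs :: ('b list, 'k) chain) \<in> Lin (nelists H)"
      using precyclic.b_in[OF precyclic_H hs(1)] by (auto elim!: Lin_mono)
    then show "lext hdel (transfer A) = lext transfer (bR A :: ('b list set, 'k) chain)"
      unfolding hs(2) R_orb[OF hs(1)] tp by (simp add: tp transfer_orb[OF hs(1)] lext_cmul lext_sum hdel_map)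
  qed
  then have Dp: "lext hdel p = 0" using 0 by (simp flip: lext_lext)
  have ep: "lext (\<lambda>_. bas ()) p = (0 :: unit \<Rightarrow>\<^sub>0 'k)" if "n = 0"
  proof -
    have "lext (\<lambda>_. bas ()) p = (lext (\<lambda>_. bas ()) (pmap orb p) :: unit \<Rightarrow>\<^sub>0 'k)" by (simp add: lext_pmap)
    then show ?thesis using e that op by simp
  qed
  obtain c where c: "c \<in> Lin {hs \<in> nelists H. ldg hs = Suc n}" "lext hdel c = p"
    by (rule aug_acyclicD[OF aug_acyclic_lists[OF u_in ident_H] p Dp ep])
  have "c \<in> Lin (nelists H)" using c by (auto elim!: Lin_mono)
  then have "lext bR (pmap orb c) = a" by (simp add: lext_R_orb c(2) op)
  then show "\<exists>b\<in>Lin {A \<in> R. ldgR A = Suc n}. lext bR b = a"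
    using orb_chain[OF c(1)] by blast
qed

end

section \<open>Orbits of a loop of infinite order\<close>

context pointed_groupoid
begin

lemma tH_pow:
  assumes "hs \<in> nelists H" "ldg hs = m"
  shows "(lext tH ^^ Suc m) (bas hs :: ('b list, 'k::field) chain) = bas (map (\<lambda>h. h \<bullet> l) hs)"
proof -
  interpret P: precyclic "nelists H" ldg "hface :: nat \<Rightarrow> 'b list \<Rightarrow> ('b list, 'k) chain" "rot u" by (rule precyclic_H)
  have "(-1 :: 'k) ^ (m * Suc m) = 1" by (simp add: minus_one_power_iff)
  moreover have "(rot u ^^ Suc m) hs = map (\<lambda>h. h \<bullet> l) hs"
    using rot_u_pow[of hs "[]"] nelists_length[OF assms(1)] assms(2) by (simp add: translate_l del: funpow.simps)
  ultimately show ?thesis using P.t_pow_bas[OF assms(1), of "Suc m"] assms(2) by (simp del: funpow.simps)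
qed

text \<open>Translation by \<open>l\<close> is the power \<open>m + 1\<close> of \<open>tH\<close>,
  so for \<open>x = l\<close> the difference telescopes into the image of \<open>1 - tH\<close>.
  Inverses and products extend this to all of \<open>L\<close>.\<close>

lemma bas_diff_coinvariant:
  assumes x: "x \<in> L" and hs: "hs \<in> nelists H" "ldg hs = m"
  shows "\<exists>y \<in> Lin {hs \<in> nelists H. ldg hs = m}. bas hs - bas (map (\<lambda>h. h \<bullet> x) hs) = y - lext tH (y :: ('b list, 'k::field) chain)"
proof -
  interpret P: precyclic "nelists H" ldg "hface :: nat \<Rightarrow> 'b list \<Rightarrow> ('b list, 'k) chain" "rot u" by (rule precyclic_H)
  let ?C = "Lin {hs \<in> nelists H. ldg hs = m} :: (('b list, 'k) chain) set"
  have base: "\<exists>y\<in>?C. bas hs - bas (map (\<lambda>h. h \<bullet> l) hs) = y - lext tH y" if hs: "hs \<in> nelists H" "ldg hs = m" for hs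
  proof -
    define y where "y i = (\<Sum>j<i. (lext tH ^^ j) (bas hs :: ('b list, 'k) chain))" for i
    have "y i - lext tH (y i) = bas hs - (lext tH ^^ i) (bas hs)" for i
    proof (induction i)
      case (Suc i)
      have "y (Suc i) - lext tH (y (Suc i)) = (y i - lext tH (y i)) + ((lext tH ^^ i) (bas hs) - (lext tH ^^ Suc i) (bas hs))"
        by (simp add: y_def lext_add)
      then show ?case unfolding Suc by simp
    qed (simp add: y_def)
    from this[of "Suc m"] have "bas hs - bas (map (\<lambda>h. h \<bullet> l) hs) = y (Suc m) - lext tH (y (Suc m))"
      unfolding tH_pow[OF hs] by simp
    moreover have "bas hs \<in> ?C" using hs by simp
    then have "y (Suc m) \<in> ?C" unfolding y_def by (intro Lin_sum P.t_pow_in)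
    ultimately show ?thesis by blast
  qed
  have "x \<in> generate Z {l} \<Longrightarrow> x \<in> carrier Z \<and> (\<forall>hs. hs \<in> nelists H \<longrightarrow> ldg hs = m \<longrightarrow>
      (\<exists>y\<in>?C. bas hs - bas (map (\<lambda>h. h \<bullet> x) hs) = y - lext tH y))" for x
  proof (induction rule: generate.induct)
    case one
    show ?case using translate_ident Z.one_closed by (auto intro!: bexI[of _ 0] simp del: map_map)
  next
    case (incl h)
    then show ?case using base l_Z by auto
  next
    case (inv h)
    then have h: "h = l" by simp
    have i: "inv\<^bsub>Z\<^esub> l \<in> carrier Z" using l_Z by simp
    show ?case
    proof (intro conjI allI impI)
      show "inv\<^bsub>Z\<^esub> h \<in> carrier Z" using i h by simp
      fix hs assume hs: "hs \<in> nelists H" "ldg hs = m"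
      let ?hs' = "map (\<lambda>h. h \<bullet> inv\<^bsub>Z\<^esub> l) hs"
      have hs': "?hs' \<in> nelists H" "ldg ?hs' = m" using translate_in[OF hs(1) i] hs(2) by (simp_all del: map_map)
      have "map (\<lambda>h. h \<bullet> l) ?hs' = map (\<lambda>h. h \<bullet> (inv\<^bsub>Z\<^esub> l \<bullet> l)) hs" by (rule translate_translate[OF hs(1) l_Z i])
      also have "inv\<^bsub>Z\<^esub> l \<bullet> l = ident G (src G l)" using Z.l_inv[OF l_Z] by simp
      also have "map (\<lambda>h. h \<bullet> ident G (src G l)) hs = hs" by (rule translate_ident[OF hs(1)])
      finally obtain y where y: "y \<in> ?C" "bas ?hs' - bas hs = y - lext tH y" using base[OF hs'] by auto
      then have "bas hs - bas ?hs' = - y - lext tH (- y)" by (simp add: lext_uminus algebra_simps)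
      then show "\<exists>y\<in>?C. bas hs - bas (map (\<lambda>ha. ha \<bullet> inv\<^bsub>Z\<^esub> h) hs) = y - lext tH y"
        unfolding h using Lin_uminus[OF y(1)] by blast
    qed
  next
    case (eng h1 h2)
    then have h: "h1 \<in> carrier Z" "h2 \<in> carrier Z" by auto
    show ?case
    proof (intro conjI allI impI)
      show "h1 \<otimes>\<^bsub>Z\<^esub> h2 \<in> carrier Z" using h by (rule Z.m_closed)
      fix hs assume hs: "hs \<in> nelists H" "ldg hs = m"
      let ?hs' = "map (\<lambda>h. h \<bullet> h1) hs"
      have hs': "?hs' \<in> nelists H" "ldg ?hs' = m" using translate_in[OF hs(1) h(1)] hs(2) by (simp_all del: map_map)
      obtain y where y: "y \<in> ?C" "bas hs - bas ?hs' = y - lext tH y"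
        using eng.IH(1) hs by blast
      obtain y' where y': "y' \<in> ?C" "bas ?hs' - bas (map (\<lambda>h. h \<bullet> h2) ?hs') = y' - lext tH y'"
        using eng.IH(2) hs' by blast
      have "bas hs - bas (map (\<lambda>h. h \<bullet> h2) ?hs') = (y + y') - lext tH (y + y')"
      proof -
        have "bas hs - bas (map (\<lambda>h. h \<bullet> h2) ?hs') = (bas hs - bas ?hs') + (bas ?hs' - bas (map (\<lambda>h. h \<bullet> h2) ?hs') :: ('b list, 'k) chain)"
          by (simp del: map_map)
        then show ?thesis unfolding y(2) y'(2) by (simp add: lext_add)
      qed
      then show "\<exists>y\<in>?C. bas hs - bas (map (\<lambda>h. h \<bullet> (h1 \<otimes>\<^bsub>Z\<^esub> h2)) hs) = y - lext tH y"
        unfolding translate_translate[OF hs(1) h(2,1)] mult_Z using Lin_add[OF y(1) y'(1)] by blast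
    qed
  qed
  then show ?thesis using x hs unfolding L_eq by blast
qed

text \<open>Every tuple differs from the chosen member of its class by an element of the image of
  \<open>1 - tH\<close>. If \<open>w\<close> projects to 0, the chosen members cancel in the
  sum.\<close>

lemma ker_orb:
  assumes w: "w \<in> Lin {hs \<in> nelists H. ldg hs = m}" and 0: "pmap orb w = 0"
  shows "\<exists>y \<in> Lin {hs \<in> nelists H. ldg hs = m}. w = y - lext tH (y :: ('b list, 'k::field) chain)"
proof -
  let ?C = "Lin {hs \<in> nelists H. ldg hs = m} :: (('b list, 'k) chain) set"
  have "\<forall>hs. \<exists>y. hs \<in> nelists H \<longrightarrow> ldg hs = m \<longrightarrow> y \<in> ?C \<and> bas hs - bas (pick (orb hs)) = y - lext tH y"
  proof
    fix hs
    show "\<exists>y. hs \<in> nelists H \<longrightarrow> ldg hs = m \<longrightarrow> y \<in> ?C \<and> bas hs - bas (pick (orb hs)) = y - lext tH y"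
    proof (cases "hs \<in> nelists H \<and> ldg hs = m")
      case True
      then have hs: "hs \<in> nelists H" "ldg hs = m" by auto
      obtain x where x: "x \<in> L" "pick (orb hs) = map (\<lambda>h. h \<bullet> x) hs" by (rule pick[OF hs(1)])
      show ?thesis unfolding x(2) using bas_diff_coinvariant[OF x(1) hs, where 'k = 'k] by blast
    qed auto
  qed
  from choice[OF this] obtain Y where Y: "\<forall>hs. hs \<in> nelists H \<longrightarrow> ldg hs = m \<longrightarrow> Y hs \<in> ?C \<and> bas hs - bas (pick (orb hs)) = Y hs - lext tH (Y hs)" ..
  have "w = w - pmap pick (pmap orb w)" by (simp add: 0)
  also have "\<dots> = lext (\<lambda>hs. bas hs - bas (pick (orb hs))) w"
    by (simp add: lext_fun_diff pmap_pmap) (simp add: pmap_def)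
  also have "\<dots> = lext (\<lambda>hs. Y hs - lext tH (Y hs)) w"
    by (rule lext_cong_on[OF w]) (use Y in auto)
  also have "\<dots> = lext Y w - lext tH (lext Y w)" by (simp add: lext_fun_diff lext_lext)
  finally have "w = lext Y w - lext tH (lext Y w)" .
  moreover have "lext Y w \<in> ?C" by (rule Lin_lext[OF w]) (use Y in blast)
  ultimately show ?thesis by blast
qed

text \<open>A chain fixed by \<open>tH\<close> is invariant under translation by \<open>l\<close>.
  If \<open>l\<close> has infinite order, the translates of a tuple are pairwise distinct, and a
  nonzero invariant chain would have infinite support.\<close>

lemma tH_injective:
  assumes inf: "loop_ord G l = 0" and y: "y \<in> Lin {hs \<in> nelists H. ldg hs = m}"
    and ty: "lext tH y = (y :: ('b list, 'k::field) chain)"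
  shows "y = 0"
proof (rule ccontr)
  assume "y \<noteq> 0"
  then obtain hs where hs: "hs \<in> Poly_Mapping.keys y" by (metis Lin_empty LinI equals0I subsetI empty_iff)
  have yH: "y \<in> Lin (nelists H)" using y by (auto elim!: Lin_mono)
  let ?g = "map (\<lambda>h. h \<bullet> l)"
  have gin: "xs \<in> nelists H \<Longrightarrow> ?g xs \<in> nelists H" for xs by (rule translate_in[OF _ l_Z])
  have "(lext tH ^^ i) y = y" for i by (induction i) (simp_all add: ty)
  then have "y = lext (\<lambda>xs. (lext tH ^^ Suc m) (bas xs)) y"
    using funpow_lext[of "Suc m" "tH :: 'b list \<Rightarrow> ('b list, 'k) chain" y] by (simp del: funpow.simps)
  also have "\<dots> = pmap ?g y"
    unfolding pmap_def by (rule lext_cong_on[OF y]) (use tH_pow in blast)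
  finally have gy: "pmap ?g y = y" ..
  have inj: "inj_on ?g (nelists H)"
  proof (rule inj_onI)
    fix xs ys assume xy: "xs \<in> nelists H" "ys \<in> nelists H" "?g xs = ?g ys"
    have undo: "map (\<lambda>h. h \<bullet> inv\<^bsub>Z\<^esub> l) (?g zs) = zs" if "zs \<in> nelists H" for zs
    proof -
      have "map (\<lambda>h. h \<bullet> inv\<^bsub>Z\<^esub> l) (?g zs) = map (\<lambda>h. h \<bullet> (l \<bullet> inv\<^bsub>Z\<^esub> l)) zs"
        by (rule translate_translate[OF that _ l_Z]) (use l_Z in simp)
      also have "l \<bullet> inv\<^bsub>Z\<^esub> l = ident G (src G l)" using Z.r_inv[OF l_Z] by simp
      finally show ?thesis using translate_ident[OF that] by simp
    qed
    show "xs = ys" using undo[OF xy(1)] undo[OF xy(2)] xy(3) by metis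
  qed
  have hH: "hs \<in> nelists H" using hs yH by (auto simp: Lin_def)
  have it: "(?g ^^ k) hs \<in> Poly_Mapping.keys y \<and> (?g ^^ k) hs \<in> nelists H" for k
  proof (induction k)
    case (Suc k)
    then have "lookup y (?g ((?g ^^ k) hs)) = lookup y ((?g ^^ k) hs)"
      using lookup_pmap_inj[OF inj yH, of "(?g ^^ k) hs"] by (simp only: gy)
    then show ?case using Suc gin[of "(?g ^^ k) hs"] by (simp add: in_keys_iff)
  qed (simp add: hs hH)
  have pw: "l [^]\<^bsub>LG\<^esub> k \<in> carrier Z \<and> (?g ^^ k) hs = map (\<lambda>h. h \<bullet> l [^]\<^bsub>LG\<^esub> k) hs" for k :: nat
  proof (induction k)
    case 0
    then show ?case using ident_Z translate_ident[OF hH] by (simp add: loop_group_def)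
  next
    case (Suc k)
    have p: "l [^]\<^bsub>LG\<^esub> Suc k = l [^]\<^bsub>LG\<^esub> k \<bullet> l" by (simp add: loop_group_def)
    have "(?g ^^ Suc k) hs = ?g (map (\<lambda>h. h \<bullet> l [^]\<^bsub>LG\<^esub> k) hs)" using Suc by simp
    also have "\<dots> = map (\<lambda>h. h \<bullet> (l [^]\<^bsub>LG\<^esub> k \<bullet> l)) hs"
      by (rule translate_translate[OF hH l_Z]) (use Suc in simp)
    finally show ?case using Suc mult_Z_closed[OF _ l_Z] unfolding p by blast
  qed
  have "inj (\<lambda>k. (?g ^^ k) hs)"
  proof (rule injI)
    fix i j assume "(?g ^^ i) hs = (?g ^^ j) hs"
    then have "map (\<lambda>h. h \<bullet> l [^]\<^bsub>LG\<^esub> i) hs = map (\<lambda>h. h \<bullet> l [^]\<^bsub>LG\<^esub> j) hs" using pw by simp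
    then have "l [^]\<^bsub>LG\<^esub> i = l [^]\<^bsub>LG\<^esub> j" using translate_cancel[OF hH] pw by blast
    then have "l [^]\<^bsub>LG\<^esub> int i = l [^]\<^bsub>LG\<^esub> int j" by (simp add: int_pow_int)
    then have "int (LG.ord l) dvd int j - int i" using LG.int_pow_eq[OF l_LG] by blast
    then show "i = j" using inf by (simp add: loop_ord_def)
  qed
  then have "infinite (range (\<lambda>k. (?g ^^ k) hs))" using finite_imageD by blast
  moreover have "range (\<lambda>k. (?g ^^ k) hs) \<subseteq> Poly_Mapping.keys y" using it by auto
  ultimately show False using finite_subset finite_keys by blast
qed

text \<open>To check \<open>coinv\<close>, lift \<open>a\<close> to a chain \<open>x\<close> of free
  tuples. Its boundary has the form \<open>z1 - t z1\<close>, by \<open>ker_orb\<close>; injectivity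
  of \<open>1 - t\<close> shows that \<open>z1\<close> is a cycle for \<open>b'\<close>, and
  contractibility of \<open>b'\<close> writes it as \<open>b' w\<close>. Then
  \<open>x - (w - t w)\<close> is a cycle of free tuples, so it bounds, and projecting the filling
  gives the required decomposition of \<open>a\<close>.\<close>

lemma aug_acyclic_tot:
  assumes inf: "loop_ord G l = 0"
  shows "aug_acyclic (UNIV \<times> R) (precyclic.tdeg ldgR) (precyclic.tdiff ldgR faceR tauR :: nat \<times> 'b list set \<Rightarrow> nat \<times> 'b list set \<Rightarrow>\<^sub>0 'k::field_char_0)
     (\<lambda>z. if fst z = 0 then bas () else 0)"
proof -
  interpret R: cyclic_basis R ldgR "faceR :: nat \<Rightarrow> 'b list set \<Rightarrow> ('b list set, 'k) chain" tauR by (rule cyclic_basis_R)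
  interpret P: precyclic "nelists H" ldg "hface :: nat \<Rightarrow> 'b list \<Rightarrow> ('b list, 'k) chain" "rot u" by (rule precyclic_H)
  let ?C = "\<lambda>m. Lin {hs \<in> nelists H. ldg hs = m} :: (('b list, 'k) chain) set"
  show ?thesis
  proof (rule R.tot_aug_acyclic[OF bbR, where e = "\<lambda>_. bas ()"])
    show "of_nat (Suc n) \<noteq> (0 :: 'k)" for n by (rule of_nat_neq_0)
    fix A assume A: "A \<in> R"
    then obtain hs where hs: "hs \<in> nelists H" "A = orb hs" by (rule R_cases)
    show "lext (\<lambda>_. bas ()) (bR A) = (0 :: unit \<Rightarrow>\<^sub>0 'k)" if "ldgR A = 1"
      using augment_hdel[of hs, where 'k = 'k] that unfolding hs(2) R_orb[OF hs(1)] by (simp add: lext_pmap ldgR_orb hs(1))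
  next
    fix n a z assume a: "a \<in> Lin {A \<in> R. ldgR A = n}" and z: "z \<in> Lin {A \<in> R. Suc (ldgR A) = n}"
      and ba: "lext bR a = z - lext tR z" and e: "n = 0 \<Longrightarrow> lext (\<lambda>_. bas ()) a = (0 :: unit \<Rightarrow>\<^sub>0 'k)"
    obtain x where x: "x \<in> ?C n" "pmap orb x = a" by (rule lift_R[OF a])
    have inH: "p \<in> ?C m \<Longrightarrow> p \<in> Lin (nelists H)" for p m by (auto elim!: Lin_mono)
    \<comment> \<open>In degree 0 no correction is made, so the augmentation of \<open>x\<close> is
      unchanged.\<close>
    have "\<exists>w\<in>?C n. lext hdel (x - (w - lext tH w)) = 0 \<and> (n = 0 \<longrightarrow> w = 0)"
    proof (cases n)
      case 0
      have "lext hdel x \<in> Lin {hs \<in> nelists H. Suc (ldg hs) = n}" by (rule P.lext_b_in[OF x(1)])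
      then show ?thesis using 0 by (intro bexI[of _ 0]) auto
    next
      case (Suc m)
      have "z \<in> Lin {A \<in> R. ldgR A = m}" using z Suc by simp
      then obtain z0 where z0: "z0 \<in> ?C m" "pmap orb z0 = z" by (rule lift_R)
      have hx: "lext hdel x \<in> ?C m" using P.lext_b_in[OF x(1)] Suc by simp
      have "lext hdel x - (z0 - lext tH z0) \<in> ?C m"
        by (intro Lin_diff hx z0(1) P.lext_t_in)
      moreover have "pmap orb (lext hdel x - (z0 - lext tH z0)) = 0"
        using ba by (simp add: pmap_diff lext_R_orb[OF inH[OF x(1)], symmetric] lext_R_orb[OF inH[OF z0(1)], symmetric] x(2) z0(2))
      ultimately obtain y where y: "y \<in> ?C m" "lext hdel x - (z0 - lext tH z0) = y - lext tH y"
        using ker_orb by blast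
      define z1 where "z1 = z0 + y"
      have z1: "z1 \<in> ?C m" unfolding z1_def by (rule Lin_add[OF z0(1) y(1)])
      have hz: "lext hdel x = z1 - lext tH z1" using y(2) by (simp add: z1_def lext_add algebra_simps)
      \<comment> \<open>\<open>b (1 - t) = (1 - t) b'\<close> turns the vanishing of the double
        boundary of \<open>x\<close> into the invariance of \<open>b' z1\<close> under
        \<open>t\<close>; then \<open>tH_injective\<close> applies.\<close>
      have "lext hdel' z1 - lext tH (lext hdel' z1) = lext hdel (z1 - lext tH z1)"
        by (rule P.lext_b_t[OF inH[OF z1], symmetric])
      also have "\<dots> = 0"
        unfolding hz[symmetric] by (rule based_complex.lext_DD[OF based_complex_lists[of H u, OF u_in] inH[OF x(1)]])
      finally have tb: "lext tH (lext hdel' z1) = lext hdel' z1" by simp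
      have b'z: "lext hdel' z1 = 0"
      proof (cases m)
        case 0
        then show ?thesis using P.lext_b'_in[OF z1] by simp
      next
        case (Suc m')
        then have "lext hdel' z1 \<in> ?C m'" using P.lext_b'_in[OF z1] by simp
        from tH_injective[OF inf this tb] show ?thesis .
      qed
      obtain w where w: "w \<in> ?C (Suc m)" "lext hdel' w = z1"
        using hdel'_contractible[of H u, OF u_in ident_H z1 b'z] by blast
      have "lext hdel (x - (w - lext tH w)) = 0"
        using P.lext_b_t[OF inH[OF w(1)]] by (simp add: lext_diff[of _ x] hz w(2))
      then show ?thesis using w(1) Suc by blast
    qed
    then obtain w where w: "w \<in> ?C n" "lext hdel (x - (w - lext tH w)) = 0" "n = 0 \<longrightarrow> w = 0" by blast
    have c1: "x - (w - lext tH w) \<in> ?C n" by (intro Lin_diff x(1) w(1) P.lext_t_in)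
    have e0: "lext (\<lambda>_. bas ()) (x - (w - lext tH w)) = (0 :: unit \<Rightarrow>\<^sub>0 'k)" if "n = 0"
    proof -
      have "lext (\<lambda>_. bas ()) x = (lext (\<lambda>_. bas ()) (pmap orb x) :: unit \<Rightarrow>\<^sub>0 'k)" by (simp add: lext_pmap)
      then show ?thesis using e[OF that] w(3) that x(2) by simp
    qed
    obtain c where c: "c \<in> ?C (Suc n)" "lext hdel c = x - (w - lext tH w)"
      by (rule aug_acyclicD[OF aug_acyclic_lists[OF u_in ident_H] c1 w(2) e0])
    have "a = lext bR (pmap orb c) + (pmap orb w - lext tR (pmap orb w))"
      unfolding lext_R_orb[OF inH[OF c(1)]] lext_R_orb[OF inH[OF w(1)]] c(2) by (simp add: pmap_diff x(2))
    then show "\<exists>c\<in>Lin {x \<in> R. ldgR x = Suc n}. \<exists>z'\<in>Lin {x \<in> R. ldgR x = n}. a = lext bR c + (z' - lext tR z')"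
      using orb_chain[OF c(1)] orb_chain[OF w(1)] by blast
  qed (assumption | rule refl)+
qed

section \<open>The comparison map for cyclic homology\<close>

definition hc_map :: "'b list \<Rightarrow> ('b set list, 'k::field) chain" where
  "hc_map y = pmap (quotients N) (alt (map psiN (lift y)))"

lemma hcR_in:
  assumes "A \<in> R"
  shows "(hcR A :: ('b set list, 'k::field) chain) \<in> Lin {y \<in> nelists (carrier N). ldg y = ldgR A}"
proof -
  obtain hs where hs: "hs \<in> nelists H" "A = orb hs" by (rule R_cases[OF assms])
  have "map psiN hs \<in> lists (carrier N)" using hs(1) psiN_in by (auto simp: nelists_def)
  from alt_in[OF this] show ?thesis
    unfolding hs(2) hcR_orb[OF hs(1)] by (rule Lin_mono) (use hs in \<open>auto simp: nelists_def ldg_def ldgR_orb\<close>)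
qed

lemma lext_hcR:
  "p \<in> Lin (nelists H) \<Longrightarrow> lext hcR (pmap orb p) = lext alt (pmap (map psiN) p)"
  unfolding lext_pmap by (rule lext_cong_on) (auto simp: hcR_orb)

lemma hcR_chain:
  assumes "A \<in> R"
  shows "lext hcR (bR A) = (lext hdel (hcR A) :: ('b set list, 'k::field_char_0) chain)"
proof -
  obtain hs where hs: "hs \<in> nelists H" "A = orb hs" by (rule R_cases[OF assms])
  have "(hdel hs :: ('b list, 'k) chain) \<in> Lin (nelists H)"
    using precyclic.b_in[OF precyclic_H hs(1)] by (auto elim!: Lin_mono)
  moreover have "map psiN hs \<noteq> []" using hs(1) by (simp add: nelists_def)
  ultimately show ?thesis
    unfolding hs(2) R_orb[OF hs(1)] hcR_orb[OF hs(1)] by (simp add: lext_hcR alt_hdel hdel_map)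
qed

lemma hcR_act:
  assumes "g \<in> carrier Z" "A \<in> R"
  shows "hcR (actR g A) = pmap (map (\<lambda>n. n \<otimes>\<^bsub>N\<^esub> pr g)) (hcR A)"
proof -
  obtain hs where hs: "hs \<in> nelists H" "A = orb hs" by (rule R_cases[OF assms(2)])
  have "map psiN (map (\<lambda>h. h \<bullet> g) hs) = map (\<lambda>n. n \<otimes>\<^bsub>N\<^esub> pr g) (map psiN hs)"
    using hs(1) psiN_mult[OF _ assms(1)] by (auto simp: nelists_def)
  then show ?thesis
    by (simp only: hs(2) actR_orb[OF hs(1) assms(1)] hcR_orb[OF hs(1)] hcR_orb[OF translate_in[OF hs(1) assms(1)]] alt_map)
qed

text \<open>\<open>psiN\<close> does not distinguish \<open>u h\<close> from \<open>h\<close>, since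
  \<open>l\<close> is trivial in \<open>N\<close>. The twisted rotation becomes the plain one, under
  which antisymmetrized tuples are invariant.\<close>

lemma hcR_t:
  assumes "A \<in> R"
  shows "lext hcR (tR A) = (hcR A :: ('b set list, 'k::field) chain)"
proof -
  obtain hs where hs: "hs \<in> nelists H" "A = orb hs" by (rule R_cases[OF assms])
  have ne: "hs \<noteq> []" using hs(1) by (simp add: nelists_def)
  have "psiN (u (last hs)) = psiN (last hs)"
    unfolding u_def by (rule psiN_L[OF _ l_L]) (use hs ne in \<open>auto simp: nelists_def\<close>)
  then have r: "map psiN (rot u hs) = cycl (map psiN hs)"
    using ne by (simp add: rot_def last_map map_butlast)
  show ?thesis
    using alt_rot[of "map psiN hs", where 'k = 'k] ne
    by (simp add: precyclic.t_def[OF precyclic_R] lext_cmul hs(2) ldgR_orb[OF hs(1)] tauR_orb[OF hs(1)] hcR_orb rot_u_in hs(1) r)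
qed

lemma hcR_qR:
  assumes "A \<in> R"
  shows "hc_map (qR A) = pmap (quotients N) (hcR A)"
proof -
  obtain hs where hs: "hs \<in> nelists H" "A = orb hs" by (rule R_cases[OF assms])
  obtain z where z: "z \<in> carrier Z" "lift (qH hs) = map (\<lambda>h. h \<bullet> z) hs" by (rule lift[OF hs(1)])
  have m: "map psiN hs \<in> lists (carrier N)" using hs(1) psiN_in by (auto simp: nelists_def)
  have "map psiN (map (\<lambda>h. h \<bullet> z) hs) = map (\<lambda>n. n \<otimes>\<^bsub>N\<^esub> pr z) (map psiN hs)"
    using hs(1) psiN_mult[OF _ z(1)] by (auto simp: nelists_def)
  then have "hc_map (qH hs) = pmap (\<lambda>ns. quotients N (map (\<lambda>n. n \<otimes>\<^bsub>N\<^esub> pr z) ns)) (alt (map psiN hs))"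
    by (simp only: hc_map_def z(2) alt_map pmap_pmap)
  also have "\<dots> = pmap (quotients N) (alt (map psiN hs))"
    by (rule pmap_cong_on[OF alt_in[OF m]], elim CollectE conjE) (rule N.quotients_translate[OF pr_in[OF z(1)]])
  finally show ?thesis by (simp only: hs(2) qR_orb[OF hs(1)] hcR_orb[OF hs(1)])
qed

lemma bar_based_complex: "based_complex (lists (carrier N)) length (bar_del N :: 'b set list \<Rightarrow> ('b set list, 'k::field) chain)"
proof -
  interpret Q: orbit_complex "nelists (carrier N)" ldg "hdel :: 'b set list \<Rightarrow> ('b set list, 'k) chain" "quotients N" "carrier Z"
    "\<lambda>h. map (\<lambda>z. z \<otimes>\<^bsub>N\<^esub> pr h)" "bar_del N" by (rule N.bar_orbit_complex[OF group_Z pr_hom pr_surj])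
  show ?thesis using Q.based_complex_quotient[of length] by (simp add: N.quotients_image ldg_def)
qed

text \<open>The second part gives the same criterion as \<open>actR_pr\<close>; together they supply
  the two compatibility conditions of \<open>cone_exact_quotient\<close>.\<close>

lemma hc_conditions:
  assumes "g \<in> carrier Z" "h \<in> carrier Z"
  shows "\<And>y. y \<in> nelists (carrier N) \<Longrightarrow> map (\<lambda>z. z \<otimes>\<^bsub>N\<^esub> pr g) (map (\<lambda>z. z \<otimes>\<^bsub>N\<^esub> pr h) y) = map (\<lambda>z. z \<otimes>\<^bsub>N\<^esub> pr (h \<bullet> g)) y"
    and "\<And>y. y \<in> nelists (carrier N) \<Longrightarrow> map (\<lambda>z. z \<otimes>\<^bsub>N\<^esub> pr g) y = map (\<lambda>z. z \<otimes>\<^bsub>N\<^esub> pr h) y \<longleftrightarrow> pr g = pr h"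
proof -
  fix y assume y: "y \<in> nelists (carrier N)"
  have "n \<otimes>\<^bsub>N\<^esub> pr h \<otimes>\<^bsub>N\<^esub> pr g = n \<otimes>\<^bsub>N\<^esub> pr (h \<bullet> g)" if "n \<in> carrier N" for n
    unfolding pr_mult[OF assms(2,1)] by (rule N.m_assoc[OF that pr_in[OF assms(2)] pr_in[OF assms(1)]])
  then show "map (\<lambda>z. z \<otimes>\<^bsub>N\<^esub> pr g) (map (\<lambda>z. z \<otimes>\<^bsub>N\<^esub> pr h) y) = map (\<lambda>z. z \<otimes>\<^bsub>N\<^esub> pr (h \<bullet> g)) y"
    using y by (auto simp: nelists_def simp del: mult_FactGroup)
  obtain a as where a: "y = a # as" "a \<in> carrier N" using y by (cases y) (auto simp: nelists_def)
  show "map (\<lambda>z. z \<otimes>\<^bsub>N\<^esub> pr g) y = map (\<lambda>z. z \<otimes>\<^bsub>N\<^esub> pr h) y \<longleftrightarrow> pr g = pr h"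
  proof
    assume "map (\<lambda>z. z \<otimes>\<^bsub>N\<^esub> pr g) y = map (\<lambda>z. z \<otimes>\<^bsub>N\<^esub> pr h) y"
    then have "a \<otimes>\<^bsub>N\<^esub> pr g = a \<otimes>\<^bsub>N\<^esub> pr h" unfolding a(1) by (simp only: list.map list.inject)
    then show "pr g = pr h" by (rule N.l_cancel[OF _ pr_in[OF assms(1)] pr_in[OF assms(2)] a(2)])
  qed simp
qed

text \<open>The argument of \<open>hh_cone_exact\<close> with classes modulo \<open>L\<close> as
  source, which are a resolution because \<open>L\<close> is finite, and with the full simplex on
  \<open>N\<close> as target.\<close>

lemma hc_cone_exact_finite:
  assumes fin: "finite L"
  shows "cone_exact nerve_part ldg (gb :: 'b list \<Rightarrow> ('b list, 'k::field_char_0) chain) (lists (carrier N)) length (bar_del N) hc_map"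
proof -
  note P = orbit_complex_R[where 'k = 'k]
  note Q = N.bar_orbit_complex[OF group_Z pr_hom pr_surj, where 'k = 'k]
  have e: "lext (\<lambda>_. bas ()) (hcR A) = (bas () :: unit \<Rightarrow>\<^sub>0 'k)" if A: "A \<in> R" "ldgR A = 0" for A
  proof -
    obtain hs where hs: "hs \<in> nelists H" "A = orb hs" by (rule R_cases[OF A(1)])
    then obtain h where "hs = [h]" using A nelists_length[OF hs(1)] by (auto simp: ldgR_orb length_Suc_conv)
    then show ?thesis using hs by (simp add: hcR_orb alt_singleton)
  qed
  have o1: "[ident G (src G l)] \<in> nelists H" using ident_H by (simp add: nelists_def)
  have ex: "cone_exact R ldgR bR (nelists (carrier N)) ldg hdel (hcR :: 'b list set \<Rightarrow> ('b set list, 'k) chain)"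
  proof (rule cone_exact_augmented[where e = "\<lambda>_. bas ()" and e' = "\<lambda>_. bas ()"])
    show "based_complex (nelists (carrier N)) ldg (hdel :: 'b set list \<Rightarrow> ('b set list, 'k) chain)"
      by (rule based_complex_lists[of _ "\<lambda>x. x"])
    show "aug_acyclic (nelists (carrier N)) ldg (hdel :: 'b set list \<Rightarrow> ('b set list, 'k) chain) (\<lambda>_. bas ())"
      by (rule aug_acyclic_lists[of _ "\<lambda>x. x", OF _ N.one_closed])
    show "bas (orb [ident G (src G l)]) \<in> Lin {x \<in> R. ldgR x = 0}"
      using orb_in[OF o1] ldgR_orb[OF o1] by (simp add: ldg_def)
  qed (use based_complex_R aug_acyclic_R[OF fin] augment_hdel hcR_in hcR_chain e in auto)
  have "cone_exact (qR ` R) ldg gb (quotients N ` nelists (carrier N)) length (bar_del N) (hc_map :: 'b list \<Rightarrow> ('b set list, 'k) chain)"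
  proof (rule cone_exact_quotient[OF P Q _ _ _ _ _ _ _ _ _ ex])
    fix g h assume gh: "g \<in> carrier Z" "h \<in> carrier Z"
    show "\<exists>k\<in>carrier Z. (\<forall>x\<in>R. actR g (actR h x) = actR k x) \<and>
           (\<forall>y\<in>nelists (carrier N). map (\<lambda>z. z \<otimes>\<^bsub>N\<^esub> pr g) (map (\<lambda>z. z \<otimes>\<^bsub>N\<^esub> pr h) y) = map (\<lambda>z. z \<otimes>\<^bsub>N\<^esub> pr k) y)"
      using actR_actR[OF gh] hc_conditions(1)[OF gh] mult_Z_closed[OF gh(2,1)] by blast
    fix x y
    show "x \<in> R \<Longrightarrow> actR g x = actR h x \<Longrightarrow> y \<in> nelists (carrier N) \<Longrightarrow> map (\<lambda>z. z \<otimes>\<^bsub>N\<^esub> pr g) y = map (\<lambda>z. z \<otimes>\<^bsub>N\<^esub> pr h) y"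
      using actR_pr[OF gh] by simp
    show "y \<in> nelists (carrier N) \<Longrightarrow> map (\<lambda>z. z \<otimes>\<^bsub>N\<^esub> pr g) y = map (\<lambda>z. z \<otimes>\<^bsub>N\<^esub> pr h) y \<Longrightarrow> x \<in> R \<Longrightarrow> actR g x = actR h x"
      using actR_pr[OF gh] hc_conditions(2)[OF gh] by blast
  next
    show "x \<in> R \<Longrightarrow> ldg (qR x) = ldgR x" for x
      by (erule R_cases) (simp add: qR_orb ldgR_orb ldg_qH nelists_def)
  qed (use hcR_in hcR_chain hcR_act hcR_qR in \<open>auto simp: ldg_def\<close>)
  then show ?thesis by (simp add: N.quotients_image qR_image)
qed

lemma nerve_part_cases:
  assumes "y \<in> nerve_part" obtains A where "A \<in> R" "y = qR A"
  using assms qR_image by auto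

lemma hc_map_in:
  assumes "y \<in> nerve_part"
  shows "(hc_map y :: ('b set list, 'k::field) chain) \<in> Lin {ys \<in> lists (carrier N). length ys = ldg y}"
proof -
  obtain A where A: "A \<in> R" "y = qR A" by (rule nerve_part_cases[OF assms])
  have ld: "ldg (qR A) = ldgR A" using A(1) by (rule R_cases) (simp add: qR_orb ldgR_orb ldg_qH nelists_def)
  show ?thesis
    unfolding A(2) hcR_qR[OF A(1)] ld
  proof (rule Lin_pmap[OF hcR_in[OF A(1)]])
    fix zs assume "zs \<in> {ys \<in> nelists (carrier N). ldg ys = ldgR A}"
    then show "quotients N zs \<in> {ys \<in> lists (carrier N). length ys = ldgR A}"
      using N.quotients_in[of zs] by (simp add: nelists_def ldg_def)
  qed
qed

lemma lext_hc_map: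
  "p \<in> Lin R \<Longrightarrow> lext hc_map (pmap qR p) = pmap (quotients N) (lext hcR p)"
  unfolding lext_pmap pmap_lext by (rule lext_cong_on) (auto simp: hcR_qR)

lemma hc_map_chain:
  assumes "y \<in> nerve_part"
  shows "lext hc_map (gb y) = (lext (bar_del N) (hc_map y) :: ('b set list, 'k::field_char_0) chain)"
proof -
  obtain A where A: "A \<in> R" "y = qR A" by (rule nerve_part_cases[OF assms])
  have 1: "(bR A :: ('b list set, 'k) chain) \<in> Lin R"
    using precyclic.b_in[OF precyclic_R A(1)] by (auto elim!: Lin_mono)
  have 2: "(hcR A :: ('b set list, 'k) chain) \<in> Lin (nelists (carrier N))"
    using hcR_in[OF A(1)] by (auto elim!: Lin_mono)
  have "lext (bar_del N) (pmap (quotients N) p) = pmap (quotients N) (lext hdel p)"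
    if "p \<in> Lin (nelists (carrier N))" for p :: "('b set list, 'k) chain"
    unfolding lext_pmap pmap_lext by (rule lext_cong_on[OF that]) (rule N.bar_del_quotients)
  then show ?thesis
    unfolding A(2) R_q(1)[OF A(1)] lext_hc_map[OF 1] hcR_qR[OF A(1)] hcR_chain[OF A(1)] using 2 by simp
qed

lemma hc_map_t:
  assumes "y \<in> nerve_part"
  shows "lext hc_map (precyclic.t ldg cycl y) = (hc_map y :: ('b set list, 'k::field) chain)"
proof -
  obtain A where A: "A \<in> R" "y = qR A" by (rule nerve_part_cases[OF assms])
  have 1: "(tR A :: ('b list set, 'k) chain) \<in> Lin R"
    using precyclic.t_in[OF precyclic_R A(1)] by (auto elim!: Lin_mono)
  show ?thesis
    unfolding A(2) R_q(4)[OF A(1)] lext_hc_map[OF 1] hcR_qR[OF A(1)] hcR_t[OF A(1)] ..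
qed

lemma nerve_part_in: "nerve_part \<subseteq> cells"
  by (auto simp: nerve_part_def qH_in)

lemma hc_tot_finite:
  assumes fin: "finite L"
  shows "cone_exact (UNIV \<times> nerve_part) gtdeg
      (gtdiff :: nat \<times> 'b list \<Rightarrow> nat \<times> 'b list \<Rightarrow>\<^sub>0 'k::field_char_0)
      (UNIV \<times> lists (carrier N)) (sdeg length) (sdiff (bar_del N)) (smap hc_map)"
proof (rule cyclic_basis.cone_exact_columns[OF precyclic_nerve_part bar_based_complex hc_cone_exact_finite[OF fin]])
  fix n and a :: "('b list, 'k) chain" assume a: "a \<in> Lin {x \<in> nerve_part. ldg x = n}" "lext gb' a = 0"
  show "\<exists>c\<in>Lin {x \<in> nerve_part. ldg x = Suc n}. lext gb' c = a"
    by (rule gb'_contractible[OF nerve_part_in _ a]) (rule add_ident_nerve_part)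
qed (rule hc_map_in hc_map_chain hc_map_t, assumption)+

text \<open>No single column is a resolution before dividing by \<open>Z\<close>, but the whole
  double complex of classes is one. It is compared with one copy of the simplex on \<open>N\<close>,
  by \<open>hcR\<close> on column 0 and by zero on all other columns.\<close>

lemma hc_tot_infinite:
  assumes inf: "loop_ord G l = 0"
  shows "cone_exact (UNIV \<times> nerve_part) gtdeg
      (gtdiff :: nat \<times> 'b list \<Rightarrow> nat \<times> 'b list \<Rightarrow>\<^sub>0 'k::field_char_0)
      ({0} \<times> lists (carrier N)) (sdeg length) (sdiff (bar_del N)) (\<lambda>z. if fst z = 0 then pmap (Pair 0) (hc_map (snd z)) else 0)"
proof -
  interpret R: cyclic_basis R ldgR "faceR :: nat \<Rightarrow> 'b list set \<Rightarrow> ('b list set, 'k) chain" tauR by (rule cyclic_basis_R)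
  note P = orbit_complex_tot[where 'k = 'k]
  note Q = N.bar_orbit_complex[OF group_Z pr_hom pr_surj, where 'k = 'k]
  define f where "f z = (if fst z = 0 then hcR (snd z) else 0 :: ('b set list, 'k) chain)" for z :: "nat \<times> 'b list set"
  define fq where "fq z = (if fst z = 0 then hc_map (snd z) else 0 :: ('b set list, 'k) chain)" for z :: "nat \<times> 'b list"
  have f_Pair: "lext f (pmap (Pair p) a) = (if p = 0 then lext hcR a else 0)" for p a
    by (simp add: lext_pmap f_def)
  have f_in: "f z \<in> Lin {y \<in> nelists (carrier N). ldg y = R.tdeg z}" if "z \<in> UNIV \<times> R" for z
    using hcR_in[of "snd z", where 'k = 'k] that by (auto simp: f_def R.tdeg_def)
  have chain: "lext f (R.tdiff z) = lext hdel (f z)" if zR: "z \<in> UNIV \<times> R" for z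
  proof -
    obtain p A where z: "z = (p, A)" "A \<in> R" using zR by auto
    \<comment> \<open>Only columns 0 and 1 have boundary components in column 0: the first gives the
      chain map property of \<open>hcR\<close>, the second its invariance under
      \<open>t\<close>.\<close>
    consider "p = 0" | "p = 1" | q where "p = Suc (Suc q)" by (cases p; cases "p - 1") auto
    then show ?thesis
    proof cases
      case 1
      then show ?thesis using hcR_chain[OF z(2), where 'k = 'k]
        by (simp add: z(1) R.tdiff_def f_Pair R.vert_def) (simp add: f_def)
    next
      case 2
      then show ?thesis using hcR_t[OF z(2), where 'k = 'k]
        by (simp add: z(1) R.tdiff_def f_Pair R.vert_def R.hor_def lext_add lext_diff) (simp add: f_def)
    next
      case 3
      then show ?thesis by (simp add: z(1) R.tdiff_def f_Pair lext_add) (simp add: f_def)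
    qed
  qed
  have e: "lext (\<lambda>_. bas ()) (f z) = (if fst z = 0 then bas () else 0 :: unit \<Rightarrow>\<^sub>0 'k)" if z: "z \<in> UNIV \<times> R" "R.tdeg z = 0" for z
  proof -
    have A: "fst z = 0" "snd z \<in> R" "ldgR (snd z) = 0" using z by (auto simp: R.tdeg_def)
    obtain hs where hs: "hs \<in> nelists H" "snd z = orb hs" by (rule R_cases[OF A(2)])
    then obtain h where "hs = [h]" using A nelists_length[OF hs(1)] by (auto simp: ldgR_orb length_Suc_conv)
    then show ?thesis using hs A by (simp add: f_def hcR_orb alt_singleton)
  qed
  have o1: "[ident G (src G l)] \<in> nelists H" using ident_H by (simp add: nelists_def)
  have ex: "cone_exact (UNIV \<times> R) R.tdeg R.tdiff (nelists (carrier N)) ldg hdel f"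
  proof (rule cone_exact_augmented[where e = "\<lambda>z. if fst z = 0 then bas () else 0" and e' = "\<lambda>_. bas ()"])
    show "based_complex (UNIV \<times> R) R.tdeg R.tdiff" by (rule R.tot_based_complex[OF bbR])
    show "aug_acyclic (UNIV \<times> R) R.tdeg R.tdiff (\<lambda>z. if fst z = 0 then bas () else 0)" by (rule aug_acyclic_tot[OF inf])
    show "based_complex (nelists (carrier N)) ldg (hdel :: 'b set list \<Rightarrow> ('b set list, 'k) chain)"
      by (rule based_complex_lists[of _ "\<lambda>x. x"])
    show "aug_acyclic (nelists (carrier N)) ldg (hdel :: 'b set list \<Rightarrow> ('b set list, 'k) chain) (\<lambda>_. bas ())"
      by (rule aug_acyclic_lists[of _ "\<lambda>x. x", OF _ N.one_closed])
    show "bas (0, orb [ident G (src G l)]) \<in> Lin {z \<in> UNIV \<times> R. R.tdeg z = 0}"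
      using orb_in[OF o1] ldgR_orb[OF o1] by (simp add: ldg_def R.tdeg_def)
  qed (use augment_hdel f_in chain e in auto)
  have "cone_exact (map_prod id qR ` (UNIV \<times> R)) gtdeg gtdiff
      (quotients N ` nelists (carrier N)) length (bar_del N) fq"
  proof (rule cone_exact_quotient[OF P Q f_in chain _ _ _ _ _ _ _ ex])
    fix g h assume gh: "g \<in> carrier Z" "h \<in> carrier Z"
    show "\<exists>k\<in>carrier Z. (\<forall>x\<in>UNIV \<times> R. map_prod id (actR g) (map_prod id (actR h) x) = map_prod id (actR k) x) \<and>
           (\<forall>y\<in>nelists (carrier N). map (\<lambda>z. z \<otimes>\<^bsub>N\<^esub> pr g) (map (\<lambda>z. z \<otimes>\<^bsub>N\<^esub> pr h) y) = map (\<lambda>z. z \<otimes>\<^bsub>N\<^esub> pr k) y)"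
    proof (intro bexI conjI ballI)
      show "h \<bullet> g \<in> carrier Z" by (rule mult_Z_closed[OF gh(2,1)])
      show "x \<in> UNIV \<times> R \<Longrightarrow> map_prod id (actR g) (map_prod id (actR h) x) = map_prod id (actR (h \<bullet> g)) x" for x
        using actR_actR[OF gh] by (cases x) auto
    qed (rule hc_conditions(1)[OF gh])
    fix x y
    show "x \<in> UNIV \<times> R \<Longrightarrow> map_prod id (actR g) x = map_prod id (actR h) x \<Longrightarrow> y \<in> nelists (carrier N) \<Longrightarrow> map (\<lambda>z. z \<otimes>\<^bsub>N\<^esub> pr g) y = map (\<lambda>z. z \<otimes>\<^bsub>N\<^esub> pr h) y"
      using actR_pr[OF gh] by (cases x) auto
    show "y \<in> nelists (carrier N) \<Longrightarrow> map (\<lambda>z. z \<otimes>\<^bsub>N\<^esub> pr g) y = map (\<lambda>z. z \<otimes>\<^bsub>N\<^esub> pr h) y \<Longrightarrow> x \<in> UNIV \<times> R \<Longrightarrow> map_prod id (actR g) x = map_prod id (actR h) x"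
      unfolding hc_conditions(2)[OF gh] using actR_pr[OF gh] by (cases x) auto
  next
    fix g and z :: "nat \<times> 'b list set" assume "g \<in> carrier Z" "z \<in> UNIV \<times> R"
    then show "f (map_prod id (actR g) z) = pmap (map (\<lambda>z. z \<otimes>\<^bsub>N\<^esub> pr g)) (f z)"
      by (cases z) (auto simp: f_def hcR_act simp del: mult_FactGroup)
  next
    fix z :: "nat \<times> 'b list set" assume z: "z \<in> UNIV \<times> R"
    then show "fq (map_prod id qR z) = pmap (quotients N) (f z)"
      by (cases z) (auto simp: f_def fq_def hcR_qR)
    show "gtdeg (map_prod id qR z) = R.tdeg z"
      using R_q(3)[of "snd z"] z by (cases z) simp
  qed (auto simp: ldg_def)
  moreover have "map_prod id qR ` (UNIV \<times> R) = (UNIV :: nat set) \<times> nerve_part"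
    unfolding qR_image[symmetric] by (auto simp: image_iff)
  ultimately have ex2: "cone_exact (UNIV \<times> nerve_part) gtdeg gtdiff
      (lists (carrier N)) length (bar_del N) fq" by (simp add: N.quotients_image)
  \<comment> \<open>Attaching the copy index 0 gives the target the same type as in the case of
    finite order, so that all orbits can be assembled.\<close>
  have "cone_exact (UNIV \<times> nerve_part) gtdeg gtdiff
      (Pair 0 ` lists (carrier N)) (sdeg length) (sdiff (bar_del N)) (\<lambda>z. pmap (Pair 0) (fq z))"
  proof (rule cone_exact_relabel[OF ex2])
    fix y assume "y \<in> lists (carrier N)"
    then show "(bar_del N y :: ('b set list, 'k) chain) \<in> Lin (lists (carrier N))"
      by (rule Lin_mono[OF based_complex.D_in[OF bar_based_complex]]) auto
  next
    fix z :: "nat \<times> 'b list" assume "z \<in> UNIV \<times> nerve_part"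
    then show "fq z \<in> Lin (lists (carrier N))"
      by (cases z) (auto simp: fq_def intro: Lin_mono[OF hc_map_in])
  qed (auto simp: sdeg_def sdiff_def intro: inj_onI)
  moreover have "Pair (0::nat) ` lists (carrier N) = {0} \<times> lists (carrier N)" by auto
  moreover have "(\<lambda>z. pmap (Pair (0::nat)) (fq z)) = (\<lambda>z. if fst z = 0 then pmap (Pair 0) (hc_map (snd z)) else 0)"
    by (rule ext) (simp add: fq_def)
  ultimately show ?thesis by simp
qed

end

section \<open>Decomposition of the cyclic nerve\<close>

lemma cone_exact_cong:
  assumes "cone_exact S dg D S' dg' D' f" "\<And>x. x \<in> S \<Longrightarrow> f' x = f x"
  shows "cone_exact S dg D S' dg' D' f'"
proof -
  have "lext f' p = lext f p" if "p \<in> Lin {x \<in> S. P x}" for p P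
    by (rule lext_cong_on[OF that]) (simp add: assms(2))
  then show ?thesis using assms(1) unfolding cone_exact_def by simp
qed

lemma cone_exact_to_empty:
  assumes "\<And>n a. a \<in> Lin {x \<in> S. Suc (dg x) = n} \<Longrightarrow> lext D a = 0 \<Longrightarrow> \<exists>a' \<in> Lin {x \<in> S. dg x = n}. lext D a' = a"
  shows "cone_exact S dg D {} dg' D' (\<lambda>_. 0)"
  unfolding cone_exact_def using assms by simp

text \<open>Exactness of the cone alone does not say that \<open>f\<close> is a chain map of degree
  0; both are needed to obtain an isomorphism in homology.\<close>

definition quasi_iso ::
    "'x set \<Rightarrow> ('x \<Rightarrow> nat) \<Rightarrow> ('x \<Rightarrow> 'x \<Rightarrow>\<^sub>0 'k::field) \<Rightarrow>
     'y set \<Rightarrow> ('y \<Rightarrow> nat) \<Rightarrow> ('y \<Rightarrow> 'y \<Rightarrow>\<^sub>0 'k) \<Rightarrow> ('x \<Rightarrow> 'y \<Rightarrow>\<^sub>0 'k) \<Rightarrow> bool" where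
  "quasi_iso S dg D S' dg' D' f \<longleftrightarrow> cone_exact S dg D S' dg' D' f \<and>
     (\<forall>x\<in>S. f x \<in> Lin {y \<in> S'. dg' y = dg x} \<and> lext f (D x) = lext D' (f x))"

lemma quasi_iso_cong:
  assumes "quasi_iso S dg D S' dg' D' f" "\<And>x. x \<in> S \<Longrightarrow> D x \<in> Lin S" "\<And>x. x \<in> S \<Longrightarrow> f' x = f x"
  shows "quasi_iso S dg D S' dg' D' f'"
proof -
  have "lext f' (D x) = lext f (D x)" if "x \<in> S" for x
    by (rule lext_cong_on[OF assms(2)[OF that] assms(3)])
  moreover have "cone_exact S dg D S' dg' D' f'"
    using assms(1) by (intro cone_exact_cong[OF _ assms(3)]) (simp add: quasi_iso_def)
  ultimately show ?thesis using assms(1,3) by (simp add: quasi_iso_def)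
qed

lemma quasi_iso_empty: "S = {} \<Longrightarrow> S' = {} \<Longrightarrow> quasi_iso S dg D S' dg' D' f"
  unfolding quasi_iso_def cone_exact_def by auto

lemma quasi_iso_relabel:
  assumes q: "quasi_iso S dg D Q dgQ DQ f" and g: "inj_on g Q"
    and DQ: "\<And>y. y \<in> Q \<Longrightarrow> DQ y \<in> Lin Q"
    and dg': "\<And>y. y \<in> Q \<Longrightarrow> dg' (g y) = dgQ y" and D': "\<And>y. y \<in> Q \<Longrightarrow> D' (g y) = pmap g (DQ y)"
  shows "quasi_iso S dg D (g ` Q) dg' D' (\<lambda>x. pmap g (f x))"
  unfolding quasi_iso_def
proof (intro conjI ballI)
  have f: "f x \<in> Lin {y \<in> Q. dgQ y = dg x}" "f x \<in> Lin Q" "lext f (D x) = lext DQ (f x)" if "x \<in> S" for x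
    using q that by (auto simp: quasi_iso_def elim!: Lin_mono)
  show "cone_exact S dg D (g ` Q) dg' D' (\<lambda>x. pmap g (f x))"
  proof (rule cone_exact_relabel[OF _ g])
    show "cone_exact S dg D Q dgQ DQ f" using q by (simp add: quasi_iso_def)
  qed (fact DQ f(2) dg' D')+
  fix x assume x: "x \<in> S"
  show "pmap g (f x) \<in> Lin {y \<in> g ` Q. dg' y = dg x}"
    by (rule Lin_pmap[OF f(1)[OF x]]) (auto simp: dg')
  have "lext D' (pmap g (f x)) = pmap g (lext DQ (f x))"
    unfolding lext_pmap pmap_lext by (rule lext_cong_on[OF f(2)[OF x] D'])
  then show "lext (\<lambda>x. pmap g (f x)) (D x) = lext D' (pmap g (f x))"
    by (simp add: f(3)[OF x] flip: pmap_lext)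
qed

lemma quasi_iso_Union:
  assumes D: "\<And>x. x \<in> S \<Longrightarrow> D x \<in> Lin {z. idx z = idx x}"
    and D': "\<And>y. y \<in> S' \<Longrightarrow> D' y \<in> Lin {z. idx' z = idx' y}"
    and q: "\<And>j. quasi_iso {x \<in> S. idx x = j} dg D {y \<in> S'. idx' y = j} dg' D' f"
  shows "quasi_iso S dg D S' dg' D' f"
  unfolding quasi_iso_def
proof (intro conjI ballI)
  have f: "f x \<in> Lin {y \<in> {y \<in> S'. idx' y = idx x}. dg' y = dg x}" if "x \<in> S" for x
    using q[of "idx x"] that by (simp add: quasi_iso_def)
  show "cone_exact S dg D S' dg' D' f"
  proof (rule cone_exact_Union[OF D D'])
    show "f x \<in> Lin {y. idx' y = idx x}" if "x \<in> S" for x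
      by (rule Lin_mono[OF f[OF that]]) auto
    show "cone_exact {x \<in> S. idx x = j} dg D {y \<in> S'. idx' y = j} dg' D' f" for j
      using q[of j] by (simp add: quasi_iso_def)
  qed
  fix x assume x: "x \<in> S"
  show "f x \<in> Lin {y \<in> S'. dg' y = dg x}" by (rule Lin_mono[OF f[OF x]]) auto
  show "lext f (D x) = lext D' (f x)" using q[of "idx x"] x by (simp add: quasi_iso_def)
qed

text \<open>A direct sum of bar complexes as a single based complex. \<open>sh\<close> in
  \<open>bar_deg\<close> raises the degrees of a summand: by 0 for Hochschild homology, by twice the
  copy index for cyclic homology.\<close>

definition bar_basis :: "'j set \<Rightarrow> ('j \<Rightarrow> 'g monoid) \<Rightarrow> ('j \<times> 'g list) set" where
  "bar_basis I K = Sigma I (\<lambda>j. lists (carrier (K j)))"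

definition bar_deg :: "('j \<Rightarrow> nat) \<Rightarrow> 'j \<times> 'g list \<Rightarrow> nat" where
  "bar_deg sh z = sh (fst z) + length (snd z)"

definition bar_sum_del :: "('j \<Rightarrow> 'g monoid) \<Rightarrow> 'j \<times> 'g list \<Rightarrow> 'j \<times> 'g list \<Rightarrow>\<^sub>0 'k::field" where
  "bar_sum_del K z = pmap (Pair (fst z)) (bar_del (K (fst z)) (snd z))"

lemma bar_sum_del_in: "bar_sum_del K z \<in> Lin {w. fst w = fst z}"
  unfolding bar_sum_del_def by (rule Lin_pmap[where A = UNIV]) (auto simp: Lin_def)

context groupoid
begin

lemma precyclic_broken:
  "cyclic_basis broken ldg (gface G :: nat \<Rightarrow> 'm list \<Rightarrow> ('m list, 'k::field) chain) cycl"
proof -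
  interpret n: cyclic_basis cells ldg "gface G :: nat \<Rightarrow> 'm list \<Rightarrow> ('m list, 'k) chain" cycl
    by (rule nerve_cyclic_basis)
  have m: "y \<in> broken \<Longrightarrow> y \<in> cells" for y by (simp add: broken_def)
  show ?thesis
  proof
    fix y assume y: "y \<in> broken"
    then obtain j where j: "brk y j" by (auto simp: broken_def)
    have ne: "y \<noteq> []" using y by (simp add: broken_def nelists_def)
    have jl: "j < length y" using j by (simp add: brk_def)
    have "brk (cycl y) (if Suc j = length y then 0 else Suc j)"
    proof (cases "Suc j = length y")
      case True
      then have "cycl y ! 0 = y ! j" "nxt (cycl y) 0 = nxt y j"
        using ne jl by (auto simp: nth_rot nxt_def intro!: arg_cong[of _ _ "(!) y"])
      then show ?thesis using j True ne by (simp add: brk_def)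
    next
      case False
      then have "cycl y ! Suc j = y ! j" "nxt (cycl y) (Suc j) = nxt y j"
        using ne jl by (auto simp: nth_rot nxt_def intro!: arg_cong[of _ _ "(!) y"])
      then show ?thesis using j False ne jl by (simp add: brk_def)
    qed
    then show "cycl y \<in> broken" using n.tau_in[OF m[OF y]] by (auto simp: broken_def)
    show "(gface G i y :: ('m list, 'k) chain) \<in> Lin {x \<in> broken. Suc (ldg x) = ldg y}" if "i \<le> ldg y" "0 < ldg y" for i
      using face_list_broken(1)[OF y that] length_face_list[OF that(2), of G i] that
      by (auto simp: gface_def ldg_def)
    show "ldg (cycl y) = ldg y" "(cycl ^^ Suc (ldg y)) y = y"
      using n.dg_tau n.tau_per m[OF y] by blast+
    show "i < ldg y \<Longrightarrow> (gface G (Suc i) (cycl y) :: ('m list, 'k) chain) = pmap cycl (gface G i y)" for i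
      by (rule gface_rot)
    show "0 < ldg y \<Longrightarrow> (gface G 0 (cycl y) :: ('m list, 'k) chain) = gface G (ldg y) y"
      by (rule gface_0_rot)
  qed
qed

lemma broken_cone_exact:
  "cone_exact broken ldg (gb :: 'm list \<Rightarrow> ('m list, 'k::field) chain) {} dg' D' (\<lambda>_. 0)"
proof (rule cone_exact_to_empty)
  fix n a assume a: "a \<in> Lin {x \<in> broken. Suc (ldg x) = n}" and 0: "lext gb a = (0 :: ('m list, 'k) chain)"
  show "\<exists>a'\<in>Lin {x \<in> broken. ldg x = n}. lext gb a' = a"
  proof
    show "lext hbrk a \<in> Lin {x \<in> broken. ldg x = n}"
      by (rule Lin_lext[OF a]) (use ins_broken in \<open>auto simp: hbrk_def intro!: Lin_cmul\<close>)
    have "lext (\<lambda>xs. lext gb (hbrk xs) + lext hbrk (gb xs)) a = lext bas a"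
      by (rule lext_cong_on[OF a]) (use hbrk_homotopy in auto)
    then show "lext gb (lext hbrk a) = a"
      by (simp add: lext_fun_add 0 flip: lext_lext)
  qed
qed

lemma broken_tot_cone_exact:
  "cone_exact (UNIV \<times> broken) gtdeg
     (gtdiff :: nat \<times> 'm list \<Rightarrow> nat \<times> 'm list \<Rightarrow>\<^sub>0 'k::field) {} dg' D' (\<lambda>_. 0)"
proof -
  let ?f = "\<lambda>_ :: 'm list. 0 :: ('m list, 'k) chain"
  have "cone_exact (UNIV \<times> broken) gtdeg
     (gtdiff :: nat \<times> 'm list \<Rightarrow> nat \<times> 'm list \<Rightarrow>\<^sub>0 'k) (UNIV \<times> {}) (sdeg ldg) (sdiff ?f) (smap ?f)"
  proof (rule cyclic_basis.cone_exact_columns[OF precyclic_broken _ broken_cone_exact])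
    show "based_complex {} ldg ?f" by unfold_locales auto
    fix n and a :: "('m list, 'k) chain" assume a: "a \<in> Lin {x \<in> broken. ldg x = n}" "lext gb' a = 0"
    show "\<exists>c\<in>Lin {x \<in> broken. ldg x = Suc n}. lext gb' c = a"
      by (rule gb'_contractible[OF _ _ a]) (auto simp: broken_def add_ident_in brk_add_ident)
  qed simp_all
  moreover have "smap ?f = (\<lambda>_. 0 :: nat \<times> 'm list \<Rightarrow>\<^sub>0 'k)" by (rule ext) (simp add: smap_def)
  ultimately have ex: "cone_exact (UNIV \<times> broken) gtdeg
     (gtdiff :: nat \<times> 'm list \<Rightarrow> nat \<times> 'm list \<Rightarrow>\<^sub>0 'k) {} (sdeg ldg) (sdiff ?f)
     (\<lambda>_. 0 :: nat \<times> 'm list \<Rightarrow>\<^sub>0 'k)" by simp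
  \<comment> \<open>The target is empty, so its degree and differential may be replaced by arbitrary
    ones; only exactness of the source is extracted.\<close>
  show ?thesis
  proof (rule cone_exact_to_empty)
    fix n and a :: "nat \<times> 'm list \<Rightarrow>\<^sub>0 'k"
    assume a: "a \<in> Lin {x \<in> UNIV \<times> broken. Suc (gtdeg x) = n}"
      "lext gtdiff a = 0"
    obtain a' where "a' \<in> Lin {x \<in> UNIV \<times> broken. gtdeg x = n}"
      "lext gtdiff a' = a"
      by (rule cone_exactD[OF ex a(1) Lin_zero a(2)]) simp_all
    then show "\<exists>a'\<in>Lin {x \<in> UNIV \<times> broken. gtdeg x = n}.
        lext gtdiff a' = a" by (rule rev_bexI)
  qed
qed

lemma loopsD: "l \<in> loops G \<Longrightarrow> l \<in> mors G" "l \<in> loops G \<Longrightarrow> tgt G l = src G l"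
  by (simp_all add: loops_def)

lemma loop_orbit_eq:
  assumes l: "l \<in> loops G" and l': "l' \<in> loop_orbit G l"
  shows "l' \<in> loops G" "loop_orbit G l' = loop_orbit G l" "l \<in> loop_orbit G l'"
proof -
  obtain g where g: "g \<in> mors G" "src G g = src G l" "l' = g \<bullet> l \<bullet> iv g" using l' by (auto simp: loop_orbit_def)
  note p = loopsD[OF l] g(1,2)
  show l'l: "l' \<in> loops G" using p by (simp add: g(3) loops_def gpd_simps)
  have sl': "src G l' = tgt G g" using p by (simp add: g(3) gpd_simps)
  have 1: "h \<bullet> l' \<bullet> iv h = (h \<bullet> g) \<bullet> l \<bullet> iv (h \<bullet> g)" "h \<bullet> g \<in> mors G" "src G (h \<bullet> g) = src G l"
    if "h \<in> mors G" "src G h = src G l'" for h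
    using that p by (simp_all add: g(3) sl'[unfolded g(3)] gpd_simps)
  have 2: "k \<bullet> l \<bullet> iv k = (k \<bullet> iv g) \<bullet> l' \<bullet> iv (k \<bullet> iv g)" "k \<bullet> iv g \<in> mors G" "src G (k \<bullet> iv g) = src G l'"
    if "k \<in> mors G" "src G k = src G l" for k
    using that p by (simp_all add: g(3) gpd_simps)
  show eq: "loop_orbit G l' = loop_orbit G l"
  proof (intro equalityI subsetI)
    fix m assume "m \<in> loop_orbit G l'"
    then obtain h where h: "h \<in> mors G" "src G h = src G l'" "m = h \<bullet> l' \<bullet> iv h" unfolding loop_orbit_def by blast
    show "m \<in> loop_orbit G l" unfolding loop_orbit_def h(3) 1(1)[OF h(1,2)] using 1(2,3)[OF h(1,2)] by blast
  next
    fix m assume "m \<in> loop_orbit G l"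
    then obtain k where k: "k \<in> mors G" "src G k = src G l" "m = k \<bullet> l \<bullet> iv k" unfolding loop_orbit_def by blast
    show "m \<in> loop_orbit G l'" unfolding loop_orbit_def k(3) 2(1)[OF k(1,2)] using 2(2,3)[OF k(1,2)] by blast
  qed
  have "ident G (src G l) \<bullet> l \<bullet> iv (ident G (src G l)) = l"
  proof -
    have "iv (ident G (src G l)) = ident G (src G l)"
      by (rule iv_eqI) (use p comp_ident_left[of "ident G (src G l)"] in \<open>simp_all add: gpd_simps\<close>)
    then show ?thesis using comp_ident_left[OF p(1)] comp_ident_right[OF p(1)] p(2) by simp
  qed
  then have "l \<in> loop_orbit G l"
    unfolding loop_orbit_def using p(1) by (intro CollectI exI[of _ "ident G (src G l)"]) (simp add: gpd_simps)
  then show "l \<in> loop_orbit G l'" using eq by simp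
qed

text \<open>\<open>build [g\<^sub>1, \<dots>, g\<^sub>n] k\<close> consists of the products \<open>g\<^sub>i\<^sub>+\<^sub>1 \<dots> g\<^sub>n k\<close> for \<open>0 \<le> i \<le> n\<close>.\<close>

primrec build :: "'m list \<Rightarrow> 'm \<Rightarrow> 'm list" where
  "build [] k = [k]"
| "build (g # gs) k = (g \<bullet> hd (build gs k)) # build gs k"

text \<open>For a tuple without a break this is the loop obtained by composing all entries, based at
  the source of the last one. It is formed through \<open>build\<close>, because the partial
  products are the vertices from which the tuple is reconstructed.\<close>

definition tuple_prod :: "'m list \<Rightarrow> 'm" where
  "tuple_prod y = hd y \<bullet> hd (build (tl y) (ident G (src G (last y))))"

lemma length_build [simp]: "length (build gs k) = Suc (length gs)"
  by (induction gs) auto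

lemma build_ne [simp]: "build gs k \<noteq> []"
  by (cases gs) auto

lemma last_build [simp]: "last (build gs k) = k"
  by (induction gs) auto

lemma build_quotients:
  assumes "set hs \<subseteq> mors G" "\<And>h. h \<in> set hs \<Longrightarrow> src G h = x" "length hs = Suc (length gs)"
    "\<And>i. i < length gs \<Longrightarrow> gs ! i = hs ! i \<bullet> iv (hs ! Suc i)"
  shows "build gs (last hs) = hs"
  using assms
proof (induction gs arbitrary: hs)
  case Nil
  then show ?case by (auto simp: length_Suc_conv)
next
  case (Cons g gs)
  obtain h0 h1 hs' where hs: "hs = h0 # h1 # hs'" using Cons.prems(3) by (cases hs; cases "tl hs") auto
  have "build gs (last (h1 # hs')) = h1 # hs'"
  proof (rule Cons.IH)
    show "gs ! i = (h1 # hs') ! i \<bullet> iv ((h1 # hs') ! Suc i)" if "i < length gs" for i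
      using Cons.prems(4)[of "Suc i"] that by (simp add: hs)
  qed (use Cons.prems hs in auto)
  moreover have "g \<bullet> h1 = h0"
    using Cons.prems(4)[of 0] Cons.prems(1,2) comp_ident_right[of h0] by (simp add: hs gpd_simps)
  ultimately show ?case by (simp add: hs)
qed

text \<open>Converse to \<open>build_quotients\<close>: partial products of a composable list have a
  common source, and their successive quotients give back the list.\<close>

lemma build_props:
  assumes "set gs \<subseteq> mors G" "k \<in> mors G" "\<And>i. Suc i < length gs \<Longrightarrow> src G (gs ! i) = tgt G (gs ! Suc i)"
    "gs \<noteq> [] \<Longrightarrow> src G (last gs) = tgt G k"
  shows "set (build gs k) \<subseteq> mors G \<and> (\<forall>h\<in>set (build gs k). src G h = src G k) \<and>
    tgt G (hd (build gs k)) = (if gs = [] then tgt G k else tgt G (hd gs)) \<and>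
    (\<forall>i<length gs. gs ! i = build gs k ! i \<bullet> iv (build gs k ! Suc i))"
  using assms
proof (induction gs)
  case (Cons g gs)
  have IH: "set (build gs k) \<subseteq> mors G" "\<And>h. h \<in> set (build gs k) \<Longrightarrow> src G h = src G k"
    "tgt G (hd (build gs k)) = (if gs = [] then tgt G k else tgt G (hd gs))"
    "\<And>i. i < length gs \<Longrightarrow> gs ! i = build gs k ! i \<bullet> iv (build gs k ! Suc i)"
  proof -
    have "set (build gs k) \<subseteq> mors G \<and> (\<forall>h\<in>set (build gs k). src G h = src G k) \<and>
      tgt G (hd (build gs k)) = (if gs = [] then tgt G k else tgt G (hd gs)) \<and>
      (\<forall>i<length gs. gs ! i = build gs k ! i \<bullet> iv (build gs k ! Suc i))"
    proof (rule Cons.IH)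
      show "src G (gs ! i) = tgt G (gs ! Suc i)" if "Suc i < length gs" for i
        using Cons.prems(3)[of "Suc i"] that by simp
    qed (use Cons.prems in auto)
    then show "set (build gs k) \<subseteq> mors G" "\<And>h. h \<in> set (build gs k) \<Longrightarrow> src G h = src G k"
      "tgt G (hd (build gs k)) = (if gs = [] then tgt G k else tgt G (hd gs))"
      "\<And>i. i < length gs \<Longrightarrow> gs ! i = build gs k ! i \<bullet> iv (build gs k ! Suc i)" by blast+
  qed
  define w where "w = hd (build gs k)"
  have w: "w \<in> mors G" "src G w = src G k" using IH(1,2) hd_in_set[OF build_ne[of gs k]] by (auto simp: w_def)
  have t: "src G g = tgt G w"
    using IH(3) Cons.prems(3)[of 0] Cons.prems(4) by (cases gs) (auto simp: w_def)
  have g: "g \<in> mors G" using Cons.prems by simp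
  have b0: "build gs k ! 0 = w" by (simp add: w_def hd_conv_nth)
  have "g = (g \<bullet> w) \<bullet> iv w" using g w t comp_ident_right[OF g] by (simp add: gpd_simps)
  then have "(g # gs) ! i = build (g # gs) k ! i \<bullet> iv (build (g # gs) k ! Suc i)" if "i < length (g # gs)" for i
    using that IH(4) by (cases i) (auto simp: w_def[symmetric] b0)
  then show ?case
    using IH(1,2) w t g by (auto simp: w_def[symmetric] gpd_simps)
qed simp

end

section \<open>Tuples without a break and the orbit of their product\<close>

context pointed_groupoid
begin

text \<open>Translating the vertices by the inverse of the last one makes that vertex an identity,
  so the vertices become the partial products formed by \<open>build\<close>. The full product
  telescopes and leaves the twist, conjugated by the last vertex.\<close>

lemma tuple_prod_qH:
  assumes hs: "hs \<in> nelists H"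
  shows "tuple_prod (qH hs) = last hs \<bullet> l \<bullet> iv (last hs)"
proof -
  have m: "k < length hs \<Longrightarrow> hs ! k \<in> H" for k by (rule nelists_nth[OF hs])
  have L: "length hs = Suc (ldg hs)" by (rule nelists_length[OF hs])
  have ne: "hs \<noteq> []" using hs by (simp add: nelists_def)
  have qne: "qH hs \<noteq> []" using length_qH[OF ne] ne by (metis length_0_conv)
  define a where "a = last hs"
  have an: "a = hs ! ldg hs" using ne by (simp add: a_def last_conv_nth ldg_def)
  have a: "a \<in> mors G" "src G a = src G l" using HD[OF m[of "ldg hs"]] L by (simp_all add: an)
  define ks where "ks = map (\<lambda>h. h \<bullet> iv a) hs"
  have e: "(b \<bullet> iv a) \<bullet> iv (c \<bullet> iv a) = b \<bullet> iv c" if "b \<in> H" "c \<in> H" for b c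
    using HD[OF that(1)] HD[OF that(2)] a by (simp add: gpd_simps)
  have lq: "last (qH hs) = qH hs ! ldg hs" using qne ne by (simp add: last_conv_nth ldg_def)
  have src: "src G (last (qH hs)) = tgt G a" unfolding lq an using qH_nth_props(2)[OF hs, of "ldg hs"] L by simp
  have "build (tl (qH hs)) (last ks) = ks"
  proof (rule build_quotients)
    show "set ks \<subseteq> mors G" using hs a HD by (auto simp: ks_def nelists_def gpd_simps)
    show "h \<in> set ks \<Longrightarrow> src G h = tgt G a" for h using hs a HD by (auto simp: ks_def nelists_def gpd_simps)
    show "length ks = Suc (length (tl (qH hs)))" using ne by (simp add: ks_def)
    fix i assume "i < length (tl (qH hs))"
    then have i: "Suc i < length hs" using ne by simp
    then show "tl (qH hs) ! i = ks ! i \<bullet> iv (ks ! Suc i)"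
      using nth_qH[of "Suc i" hs] e[OF m[of i] m[of "Suc i"]] ne by (simp add: ks_def nth_tl)
  qed
  moreover have "last ks = ident G (tgt G a)" using ne a by (simp add: ks_def last_map a_def[symmetric] gpd_simps)
  ultimately have "tuple_prod (qH hs) = hd (qH hs) \<bullet> hd ks" by (simp add: tuple_prod_def src)
  also have "hd (qH hs) = u a \<bullet> iv (hs ! 0)" using qne nth_qH[of 0 hs] L by (simp add: hd_conv_nth an)
  also have "hd ks = hs ! 0 \<bullet> iv a" using ne by (simp add: ks_def hd_map hd_conv_nth)
  also have "(u a \<bullet> iv (hs ! 0)) \<bullet> (hs ! 0 \<bullet> iv a) = a \<bullet> l \<bullet> iv a"
    using a HD[OF m[of 0]] L l_mor tgt_l by (simp add: u_def gpd_simps)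
  finally show ?thesis by (simp add: a_def)
qed

text \<open>The partial products of \<open>y\<close> already have the right quotients, but their
  twist is the full product \<open>p\<close> instead of \<open>l\<close>. Writing \<open>l\<close>
  as the conjugate of \<open>p\<close> by \<open>k\<close>, translation by the inverse of
  \<open>k\<close> repairs this.\<close>

lemma nerve_part_if:
  assumes y: "y \<in> cells" and nb: "\<nexists>j. brk y j" and lo: "l \<in> loop_orbit G (tuple_prod y)"
  shows "y \<in> nerve_part"
proof -
  have m: "k < length y \<Longrightarrow> y ! k \<in> mors G" for k by (rule nelists_nth[OF y])
  have L: "length y = Suc (ldg y)" by (rule nelists_length[OF y])
  have ne: "y \<noteq> []" using y by (simp add: nelists_def)
  define x where "x = src G (last y)"
  have lm: "last y \<in> mors G" using y ne by (auto simp: nelists_def)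
  then have x: "x \<in> objs G" by (simp add: x_def src_closed)
  have cl: "src G (y ! i) = tgt G (nxt y i)" if "i < length y" for i using nb that by (auto simp: brk_def)
  have ly: "last y = y ! ldg y" using ne by (simp add: last_conv_nth ldg_def)
  have tx: "tgt G (y ! 0) = x" using cl[of "ldg y"] L by (simp add: nxt_def x_def ly)
  define ks where "ks = build (tl y) (ident G x)"
  have "set ks \<subseteq> mors G \<and> (\<forall>h\<in>set ks. src G h = src G (ident G x)) \<and>
    tgt G (hd ks) = (if tl y = [] then tgt G (ident G x) else tgt G (hd (tl y))) \<and>
    (\<forall>i<length (tl y). tl y ! i = ks ! i \<bullet> iv (ks ! Suc i))"
    unfolding ks_def
  proof (rule build_props)
    show "set (tl y) \<subseteq> mors G" using y by (auto simp: nelists_def dest: list.set_sel(2))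
    show "ident G x \<in> mors G" using x by (rule ident_closed)
    show "src G (tl y ! i) = tgt G (tl y ! Suc i)" if "Suc i < length (tl y)" for i
    proof -
      have "Suc (Suc i) < length y" using that by simp
      then show ?thesis using cl[of "Suc i"] by (simp add: nth_tl nxt_def)
    qed
    show "tl y \<noteq> [] \<Longrightarrow> src G (last (tl y)) = tgt G (ident G x)"
      using x by (simp add: x_def last_tl tgt_ident)
  qed
  then have ks: "set ks \<subseteq> mors G" "\<And>h. h \<in> set ks \<Longrightarrow> src G h = x"
    "tgt G (hd ks) = (if tl y = [] then x else tgt G (hd (tl y)))"
    "\<And>i. i < length (tl y) \<Longrightarrow> tl y ! i = ks ! i \<bullet> iv (ks ! Suc i)"
    using x by (auto simp: src_ident tgt_ident)
  have lk: "length ks = length y" "ks \<noteq> []" using ne by (auto simp: ks_def)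
  define w where "w = hd ks"
  have "w \<in> set ks" using lk(2) by (simp add: w_def)
  then have w: "w \<in> mors G" "src G w = x" "ks ! 0 = w" using ks(1,2) lk by (auto simp: w_def hd_conv_nth)
  have tw: "src G (y ! 0) = tgt G w"
  proof (cases "tl y = []")
    case True
    then have "length y = 1" using ne by (cases y) auto
    then show ?thesis using ks(3) True cl[of 0] tx by (simp add: w_def nxt_def)
  next
    case False
    then have "1 < length y" by (cases y) auto
    then show ?thesis using ks(3) False ne cl[of 0] by (simp add: w_def nxt_def hd_conv_nth nth_tl)
  qed
  define p where "p = y ! 0 \<bullet> w"
  have y0: "y ! 0 \<in> mors G" using m L by simp
  have p: "p \<in> mors G" "src G p = x" "tgt G p = x" using y0 w tw tx by (simp_all add: p_def gpd_simps)
  have "tuple_prod y = p" using ne by (simp add: tuple_prod_def p_def w_def ks_def x_def hd_conv_nth)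
  then obtain k where k: "k \<in> mors G" "src G k = x" "l = k \<bullet> p \<bullet> iv k"
    using lo p(2) by (auto simp: loop_orbit_def)
  have sl: "src G l = tgt G k" using k p by (simp add: gpd_simps)
  \<comment> \<open>Translation keeps the quotients, moves the common source to that of
    \<open>l\<close>, and turns the last vertex into \<open>iv k\<close>; so entry 0 receives the
    twist \<open>iv k \<bullet> l\<close>, which is \<open>p \<bullet> iv k\<close>.\<close>
  define hs where "hs = map (\<lambda>h. h \<bullet> iv k) ks"
  have kin: "h \<in> mors G" "src G h = src G k" if "h \<in> set ks" for h using ks(1,2) k(2) that by auto
  have hsH: "hs \<in> nelists H"
    using kin lk k(1) by (auto simp: hs_def nelists_def H_def sl gpd_simps)
  have e: "(b \<bullet> iv k) \<bullet> iv (c \<bullet> iv k) = b \<bullet> iv c" if "b \<in> set ks" "c \<in> set ks" for b c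
    using kin[OF that(1)] kin[OF that(2)] k(1) by (simp add: gpd_simps)
  have "qH hs = y"
  proof (rule nth_equalityI)
    show len: "length (qH hs) = length y" using lk by (simp add: hs_def)
    fix j assume "j < length (qH hs)"
    then have j: "j < length hs" "j < length y" using len lk by (auto simp: hs_def)
    show "qH hs ! j = y ! j"
    proof (cases j)
      case 0
      have "hs ! ldg hs = last hs" using lk by (simp add: last_conv_nth ldg_def hs_def)
      also have "\<dots> = ident G x \<bullet> iv k" using lk by (simp add: hs_def last_map) (simp add: ks_def)
      also have "\<dots> = iv k" using k(1,2) comp_ident_left[of "iv k"] by (simp add: iv)
      finally have "qH hs ! j = u (iv k) \<bullet> iv (w \<bullet> iv k)"
        using nth_qH[OF j(1)] 0 lk ne w(3) by (simp add: hs_def)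
      also have "\<dots> = p \<bullet> iv w" unfolding u_def unfolding k(3) using k(1,2) p w by (simp add: gpd_simps)
      also have "\<dots> = y ! 0" using y0 w tw comp_ident_right[OF y0] by (simp add: p_def gpd_simps)
      finally show ?thesis using 0 by simp
    next
      case (Suc i)
      then show ?thesis
        using nth_qH[OF j(1)] ks(4)[of i] e[of "ks ! i" "ks ! Suc i"] j lk by (simp add: hs_def nth_tl)
    qed
  qed
  then show ?thesis using hsH by (auto simp: nerve_part_def)
qed

lemma not_brk_nerve_part:
  assumes "y \<in> nerve_part"
  shows "\<not> brk y j"
proof -
  obtain hs where hs: "hs \<in> nelists H" "y = qH hs" using assms by (auto simp: nerve_part_def)
  have "length (qH hs) = length hs" using hs(1) by (simp add: nelists_def)
  then show ?thesis using qH_closed[OF hs(1), of j] hs(2) by (auto simp: brk_def)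
qed

lemma tuple_prod_nerve_part:
  assumes "y \<in> nerve_part"
  shows "tuple_prod y \<in> loop_orbit G l"
proof -
  obtain hs where hs: "hs \<in> nelists H" "y = qH hs" using assms by (auto simp: nerve_part_def)
  have h: "last hs \<in> H" using hs(1) by (auto simp: nelists_def)
  show ?thesis unfolding hs(2) tuple_prod_qH[OF hs(1)] loop_orbit_def using HD(1)[OF h] HD(2)[OF h] by blast
qed

lemma finite_L: "loop_ord G l \<noteq> 0 \<Longrightarrow> finite L"
proof -
  assume "loop_ord G l \<noteq> 0"
  then have "card L \<noteq> 0"
    using LG.generate_pow_card[OF l_LG] by (simp add: loop_ord_def cyclic_subgroup_def)
  then show ?thesis by (rule card_ge_0_finite[OF neq0_conv[THEN iffD1]])
qed

end

context pointed_groupoid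
begin

lemma hh_quasi_iso:
  "quasi_iso nerve_part ldg (gb :: 'b list \<Rightarrow> ('b list, 'k::field) chain) (lists (carrier Z)) length (bar_del Z) hh_map"
  unfolding quasi_iso_def
proof (intro conjI ballI hh_cone_exact)
  fix y assume "y \<in> nerve_part"
  then obtain hs where hs: "hs \<in> nelists H" "y = qH hs" by (auto simp: nerve_part_def)
  have m: "map psi hs \<in> nelists (carrier Z)" by (rule nelists_map[OF hs(1) psi_Z])
  show "(hh_map y :: ('b list, 'k) chain) \<in> Lin {y' \<in> lists (carrier Z). length y' = ldg y}"
    using Z.quotients_in[of "map psi hs"] m hs(1) by (simp add: hs(2) hh_map_qH ldg_qH nelists_def ldg_def)
  have h: "(hdel hs :: ('b list, 'k) chain) \<in> Lin (nelists H)"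
    using precyclic.b_in[OF precyclic_H hs(1)] by (auto elim!: Lin_mono)
  have "lext hh_map (gb y) = lext (\<lambda>hs. bas (quotients Z (map psi hs)) :: ('b list, 'k) chain) (hdel hs)"
    unfolding hs(2) gb_qH[OF hs(1)] lext_pmap by (rule lext_cong_on[OF h]) (rule hh_map_qH)
  also have "\<dots> = pmap (quotients Z) (hdel (map psi hs))"
    by (simp add: hdel_map pmap_pmap) (simp add: pmap_def)
  also have "\<dots> = lext (bar_del Z) (hh_map y)"
    unfolding hs(2) hh_map_qH[OF hs(1)] by (simp add: Z.bar_del_quotients[OF m])
  finally show "lext hh_map (gb y) = (lext (bar_del Z) (hh_map y) :: ('b list, 'k) chain)" .
qed

definition shifts :: "nat set" where "shifts = (if loop_ord G l = 0 then {0} else UNIV)"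

text \<open>The two orders call for different maps on the even columns above 0; on column 0 both are
  \<open>hc_map\<close>, and on odd columns both vanish.\<close>

definition hc_tot_map :: "nat \<times> 'b list \<Rightarrow> nat \<times> 'b set list \<Rightarrow>\<^sub>0 'k::field" where
  "hc_tot_map = (if loop_ord G l = 0 then (\<lambda>z. if fst z = 0 then pmap (Pair 0) (hc_map (snd z)) else 0) else smap hc_map)"

lemma hc_quasi_iso:
  "quasi_iso (UNIV \<times> nerve_part) gtdeg
      (gtdiff :: nat \<times> 'b list \<Rightarrow> nat \<times> 'b list \<Rightarrow>\<^sub>0 'k::field_char_0)
      (shifts \<times> lists (carrier N)) (sdeg length) (sdiff (bar_del N)) hc_tot_map"
proof -
  interpret S: cyclic_basis nerve_part ldg "gface G :: nat \<Rightarrow> 'b list \<Rightarrow> ('b list, 'k) chain" cycl by (rule precyclic_nerve_part)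
  note c = hc_map_chain[where 'k = 'k]
  note t = hc_map_t[where 'k = 'k]
  show ?thesis
    unfolding quasi_iso_def
  proof (intro conjI ballI)
    show "cone_exact (UNIV \<times> nerve_part) gtdeg
      (gtdiff :: nat \<times> 'b list \<Rightarrow> nat \<times> 'b list \<Rightarrow>\<^sub>0 'k)
      (shifts \<times> lists (carrier N)) (sdeg length) (sdiff (bar_del N)) hc_tot_map"
      by (cases "loop_ord G l = 0") (simp_all add: shifts_def hc_tot_map_def hc_tot_infinite hc_tot_finite finite_L)
    fix z :: "nat \<times> 'b list" assume "z \<in> UNIV \<times> nerve_part"
    then obtain p y where z: "z = (p, y)" "y \<in> nerve_part" by auto
    have i: "pmap (Pair i) (hc_map y :: ('b set list, 'k) chain) \<in> Lin {w \<in> shifts \<times> lists (carrier N). sdeg length w = 2 * i + ldg y}"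
      if "i \<in> shifts" for i
      by (rule Lin_pmap[OF hc_map_in[OF z(2)]]) (use that in \<open>auto simp: sdeg_def\<close>)
    show "(hc_tot_map z :: nat \<times> 'b set list \<Rightarrow>\<^sub>0 'k) \<in> Lin {w \<in> shifts \<times> lists (carrier N). sdeg length w = gtdeg z}"
      using i[of 0] i[of "p div 2"] by (auto simp: z(1) hc_tot_map_def smap_def S.tdeg_def shifts_def)
    show "lext hc_tot_map (S.tdiff z) = lext (sdiff (bar_del N)) (hc_tot_map z :: nat \<times> 'b set list \<Rightarrow>\<^sub>0 'k)"
    proof (cases "loop_ord G l = 0")
      case True
      then have h: "(hc_tot_map :: _ \<Rightarrow> _ \<Rightarrow>\<^sub>0 'k) = (\<lambda>z. if fst z = 0 then pmap (Pair 0) (hc_map (snd z)) else 0)"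
        by (simp add: hc_tot_map_def)
      have P: "lext (hc_tot_map :: _ \<Rightarrow> _ \<Rightarrow>\<^sub>0 'k) (pmap (Pair p) a) = (if p = 0 then pmap (Pair 0) (lext hc_map a) else 0)" for p a
        by (simp add: lext_pmap h pmap_lext)
      consider "p = 0" | "p = 1" | q where "p = Suc (Suc q)" by (cases p; cases "p - 1") auto
      then show ?thesis
      proof cases
        case 1
        then show ?thesis using c[OF z(2)]
          by (simp add: z(1) S.tdiff_def P S.vert_def) (simp add: h S.sdiff_Pair)
      next
        case 2
        then show ?thesis using t[OF z(2)]
          by (simp add: z(1) S.tdiff_def P S.vert_def S.hor_def lext_add lext_diff) (simp add: h)
      next
        case 3
        then show ?thesis by (simp add: z(1) S.tdiff_def P lext_add) (simp add: h)
      qed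
    next
      case False
      then have h: "(hc_tot_map :: _ \<Rightarrow> _ \<Rightarrow>\<^sub>0 'k) = smap hc_map" by (simp add: hc_tot_map_def)
      show ?thesis
      proof (cases p)
        case 0
        then show ?thesis using c[OF z(2)]
          by (simp add: z(1) S.tdiff_def h S.smap_Pair S.vert_def) (simp add: smap_def S.sdiff_Pair)
      next
        case (Suc q)
        then show ?thesis using c[OF z(2)] t[OF z(2)]
          by (simp add: z(1) S.tdiff_def h lext_add S.smap_Pair S.vert_def S.hor_def lext_diff) (simp add: smap_def S.sdiff_Pair)
      qed
    qed
  qed
qed

lemma hh_bar_based_complex: "based_complex (lists (carrier Z)) length (bar_del Z :: 'b list \<Rightarrow> ('b list, 'k::field) chain)"
proof -
  have id_hom: "(\<lambda>x. x) \<in> hom Z Z" by (rule homI) auto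
  interpret Q: orbit_complex "nelists (carrier Z)" ldg "hdel :: 'b list \<Rightarrow> ('b list, 'k) chain" "quotients Z" "carrier Z"
    "\<lambda>h. map (\<lambda>z. z \<bullet> h)" "bar_del Z" by (rule Z.bar_orbit_complex[OF group_Z id_hom, simplified])
  show ?thesis using Q.based_complex_quotient[of length] by (simp add: Z.quotients_image ldg_def)
qed

end

section \<open>Assembling all orbits of loops\<close>

locale groupoid_rep = groupoid +
  fixes rep :: "'b set \<Rightarrow> 'b"
  assumes rep: "c \<in> loop_orbits G \<Longrightarrow> rep c \<in> c"
begin

lemma rep_loop:
  assumes c: "c \<in> loop_orbits G"
  shows "rep c \<in> loops G \<and> loop_orbit G (rep c) = c"
proof -
  obtain l where l: "l \<in> loops G" "c = loop_orbit G l" using c by (auto simp: loop_orbits_def)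
  have "rep c \<in> loop_orbit G l" using rep[OF c] l(2) by simp
  from loop_orbit_eq(1,2)[OF l(1) this] show ?thesis using l(2) by simp
qed

lemma pointed:
  assumes "c \<in> loop_orbits G"
  shows "pointed_groupoid G (rep c)"
  by unfold_locales (simp add: rep_loop[OF assms])

text \<open>Broken tuples receive the index \<open>{}\<close>, which is not an orbit of loops; they
  become a summand of their own.\<close>

definition idx :: "'b list \<Rightarrow> 'b set" where
  "idx y = (if \<exists>j. brk y j then {} else loop_orbit G (tuple_prod y))"

abbreviation npart :: "'b set \<Rightarrow> 'b list set" where "npart c \<equiv> pointed_groupoid.nerve_part G (rep c)"

lemma orbit_ne: "c \<in> loop_orbits G \<Longrightarrow> c \<noteq> {}"
  using rep by blast

lemma tuple_prod_loop:
  assumes y: "y \<in> cells" and nb: "\<nexists>j. brk y j"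
  shows "tuple_prod y \<in> loops G"
proof -
  have ne: "y \<noteq> []" and L: "length y = Suc (ldg y)" using y by (auto simp: nelists_def ldg_def)
  have cl: "src G (y ! i) = tgt G (nxt y i)" if "i < length y" for i using nb that by (auto simp: brk_def)
  have lm: "last y \<in> mors G" "hd y \<in> mors G" using y ne by (auto simp: nelists_def)
  define x where "x = src G (last y)"
  have x: "x \<in> objs G" using lm by (simp add: x_def src_closed)
  define ks where "ks = build (tl y) (ident G x)"
  have "set ks \<subseteq> mors G \<and> (\<forall>h\<in>set ks. src G h = src G (ident G x)) \<and>
    tgt G (hd ks) = (if tl y = [] then tgt G (ident G x) else tgt G (hd (tl y))) \<and>
    (\<forall>i<length (tl y). tl y ! i = ks ! i \<bullet> iv (ks ! Suc i))"
    unfolding ks_def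
  proof (rule build_props)
    show "set (tl y) \<subseteq> mors G" using y by (auto simp: nelists_def dest: list.set_sel(2))
    show "ident G x \<in> mors G" using x by (rule ident_closed)
    show "src G (tl y ! i) = tgt G (tl y ! Suc i)" if "Suc i < length (tl y)" for i
    proof -
      have "Suc (Suc i) < length y" using that by simp
      then show ?thesis using cl[of "Suc i"] by (simp add: nth_tl nxt_def)
    qed
    show "tl y \<noteq> [] \<Longrightarrow> src G (last (tl y)) = tgt G (ident G x)"
      using x by (simp add: x_def last_tl tgt_ident)
  qed
  moreover have "hd ks \<in> set ks" by (simp add: ks_def)
  ultimately have k: "hd ks \<in> mors G" "src G (hd ks) = x" "tgt G (hd ks) = (if tl y = [] then x else tgt G (hd (tl y)))"
    using x by (auto simp: src_ident tgt_ident)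
  have ly: "last y = y ! ldg y" using ne by (simp add: last_conv_nth ldg_def)
  have tx: "tgt G (hd y) = x" using cl[of "ldg y"] L by (simp add: nxt_def x_def ly hd_conv_nth[OF ne])
  have "src G (hd y) = tgt G (hd ks)"
  proof (cases "tl y = []")
    case True
    then have "hd y = last y" using ne by (cases y) auto
    then show ?thesis using k True by (simp add: x_def)
  next
    case False
    then have "1 < length y" by (cases y) auto
    then show ?thesis using k(3) False cl[of 0] ne by (simp add: nxt_def hd_conv_nth nth_tl)
  qed
  then show ?thesis using k lm tx by (simp add: tuple_prod_def loops_def ks_def[symmetric] x_def[symmetric] gpd_simps)
qed

lemma idx_part:
  assumes c: "c \<in> loop_orbits G"
  shows "{y \<in> cells. idx y = c} = npart c"
proof -
  interpret P: pointed_groupoid G "rep c" by (rule pointed[OF c])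
  show ?thesis
  proof (intro equalityI subsetI)
    fix y assume "y \<in> {y \<in> cells. idx y = c}"
    then have y: "y \<in> cells" "idx y = c" by auto
    have nb: "\<nexists>j. brk y j"
    proof
      assume "\<exists>j. brk y j"
      then have "idx y = {}" by (simp add: idx_def)
      then show False using y(2) orbit_ne[OF c] by simp
    qed
    then have "loop_orbit G (tuple_prod y) = c" using y(2) by (simp add: idx_def)
    then have "rep c \<in> loop_orbit G (tuple_prod y)" using rep[OF c] by simp
    then show "y \<in> npart c" by (rule P.nerve_part_if[OF y(1) nb])
  next
    fix y assume y: "y \<in> npart c"
    have "loop_orbit G (tuple_prod y) = c"
      using loop_orbit_eq(2)[OF _ P.tuple_prod_nerve_part[OF y]] rep_loop[OF c] by simp
    then have "idx y = c" using P.not_brk_nerve_part[OF y] by (simp add: idx_def)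
    then show "y \<in> {y \<in> cells. idx y = c}" using subsetD[OF P.nerve_part_in y] by simp
  qed
qed

lemma idx_empty: "{y \<in> cells. idx y = {}} = broken"
proof -
  have "loop_orbit G (tuple_prod y) \<noteq> {}" if "y \<in> cells" "\<nexists>j. brk y j" for y
    using orbit_ne tuple_prod_loop[OF that] by (auto simp: loop_orbits_def)
  then show ?thesis by (auto simp: idx_def broken_def)
qed

lemma idx_in: "y \<in> cells \<Longrightarrow> idx y = {} \<or> idx y \<in> loop_orbits G"
  using tuple_prod_loop[of y] by (auto simp: idx_def loop_orbits_def)

text \<open>Each summand is closed under faces and rotation. Hence the differentials preserve
  \<open>idx\<close>, as \<open>quasi_iso_Union\<close> requires.\<close>

lemma part_precyclic:
  assumes "y \<in> cells"
  shows "cyclic_basis {z \<in> cells. idx z = idx y} ldg (gface G :: nat \<Rightarrow> 'b list \<Rightarrow> ('b list, 'k::field) chain) cycl"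
proof (cases "idx y = {}")
  case True
  show ?thesis unfolding True idx_empty by (rule precyclic_broken)
next
  case False
  then have c: "idx y \<in> loop_orbits G" using idx_in[OF assms] by simp
  show ?thesis unfolding idx_part[OF c] by (rule pointed_groupoid.precyclic_nerve_part[OF pointed[OF c]])
qed

lemma gb_in_part:
  assumes "y \<in> {y \<in> cells. idx y = j}"
  shows "(gb y :: ('b list, 'k::field) chain) \<in> Lin {y \<in> cells. idx y = j}"
proof -
  have y: "y \<in> cells" "idx y = j" using assms by auto
  have yS: "y \<in> {z \<in> cells. idx z = idx y}" using y by simp
  show ?thesis
    by (rule Lin_mono[OF precyclic.b_in[OF cyclic_basis.axioms(1)[OF part_precyclic[OF y(1)]] yS]]) (simp add: y(2) subset_iff)
qed

lemma tdiff_in_part: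
  assumes "z \<in> {z \<in> UNIV \<times> cells. idx (snd z) = j}"
  shows "(gtdiff z :: nat \<times> 'b list \<Rightarrow>\<^sub>0 'k::field) \<in> Lin {z \<in> UNIV \<times> cells. idx (snd z) = j}"
proof -
  have y: "snd z \<in> cells" "idx (snd z) = j" using assms by auto
  have zS: "z \<in> UNIV \<times> {w \<in> cells. idx w = idx (snd z)}" using y(1) by (cases z) simp
  show ?thesis
    by (rule Lin_mono[OF precyclic.tdiff_in[OF cyclic_basis.axioms(1)[OF part_precyclic[OF y(1)]] zS]]) (auto simp: y(2))
qed

lemma gb_idx:
  assumes "y \<in> cells"
  shows "(gb y :: ('b list, 'k::field) chain) \<in> Lin {z. idx z = idx y}"
  by (rule Lin_mono[OF gb_in_part[of y "idx y"]]) (simp_all add: assms subset_iff)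

lemma tdiff_idx:
  assumes "z \<in> UNIV \<times> cells"
  shows "(gtdiff z :: nat \<times> 'b list \<Rightarrow>\<^sub>0 'k::field) \<in> Lin {w. idx (snd w) = idx (snd z)}"
  by (rule Lin_mono[OF tdiff_in_part[of z "idx (snd z)"]]) (simp_all add: assms subset_iff)

abbreviation ZZ where "ZZ c \<equiv> centralizer G (rep c)"
abbreviation NN where "NN c \<equiv> centralizer G (rep c) Mod cyclic_subgroup G (rep c)"

definition hh_fun :: "'b list \<Rightarrow> 'b set \<times> 'b list \<Rightarrow>\<^sub>0 'k::field" where
  "hh_fun y = (if idx y = {} then 0 else pmap (Pair (idx y)) (pointed_groupoid.hh_map G (rep (idx y)) y))"

text \<open>Over the index \<open>{}\<close> the source is contractible and the target empty; over
  an orbit the result for its representative applies; over any other index both sides are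
  empty.\<close>

lemma hh_quasi_iso_total:
  "quasi_iso cells ldg (gb :: 'b list \<Rightarrow> ('b list, 'k::field) chain)
     (bar_basis (loop_orbits G) ZZ) (bar_deg (\<lambda>_. 0)) (bar_sum_del ZZ) hh_fun"
proof (rule quasi_iso_Union[where idx = idx and idx' = fst])
  fix j :: "'b set"
  let ?S = "{y \<in> cells. idx y = j}" and ?T = "{z \<in> bar_basis (loop_orbits G) ZZ. fst z = j}"
  consider "j = {}" | "j \<in> loop_orbits G" | "j \<noteq> {}" "j \<notin> loop_orbits G" by blast
  then show "quasi_iso ?S ldg gb ?T (bar_deg (\<lambda>_. 0)) (bar_sum_del ZZ) (hh_fun :: 'b list \<Rightarrow> 'b set \<times> 'b list \<Rightarrow>\<^sub>0 'k)"
  proof cases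
    case 1
    have T: "?T = {}" using 1 orbit_ne by (auto simp: bar_basis_def)
    have "quasi_iso ?S ldg gb ?T (bar_deg (\<lambda>_. 0)) (bar_sum_del ZZ) (\<lambda>_. 0 :: 'b set \<times> 'b list \<Rightarrow>\<^sub>0 'k)"
      unfolding T using broken_cone_exact by (simp add: quasi_iso_def 1 idx_empty)
    then show ?thesis by (rule quasi_iso_cong[OF _ gb_in_part]) (auto simp: 1 hh_fun_def)
  next
    case 2
    interpret P: pointed_groupoid G "rep j" by (rule pointed[OF 2])
    have T: "?T = Pair j ` lists (carrier (ZZ j))" using 2 by (auto simp: bar_basis_def)
    have "quasi_iso ?S ldg gb ?T (bar_deg (\<lambda>_. 0)) (bar_sum_del ZZ) (\<lambda>y. pmap (Pair j) (P.hh_map y) :: 'b set \<times> 'b list \<Rightarrow>\<^sub>0 'k)"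
      unfolding T idx_part[OF 2]
    proof (rule quasi_iso_relabel[OF P.hh_quasi_iso])
      show "y \<in> lists (carrier (ZZ j)) \<Longrightarrow> (bar_del (ZZ j) y :: ('b list, 'k) chain) \<in> Lin (lists (carrier (ZZ j)))" for y
        by (rule Lin_mono[OF based_complex.D_in[OF P.hh_bar_based_complex]]) auto
    qed (auto simp: bar_deg_def bar_sum_del_def intro: inj_onI)
    then show ?thesis by (rule quasi_iso_cong[OF _ gb_in_part]) (use orbit_ne[OF 2] in \<open>auto simp: hh_fun_def\<close>)
  next
    case 3
    show ?thesis by (rule quasi_iso_empty) (use 3 idx_in in \<open>auto simp: bar_basis_def\<close>)
  qed
qed (use gb_idx bar_sum_del_in in auto)

definition hc_fun :: "nat \<times> 'b list \<Rightarrow> ('b set \<times> nat) \<times> 'b set list \<Rightarrow>\<^sub>0 'k::field" where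
  "hc_fun z = (let j = idx (snd z) in if j = {} then 0
     else pmap (\<lambda>w. ((j, fst w), snd w)) (pointed_groupoid.hc_tot_map G (rep j) z))"

text \<open>The double sum over finite orders and the single sum over infinite orders as one index
  set of pairs; \<open>direct_sum_flatten\<close> separates them again.\<close>

definition hc_index :: "('b set \<times> nat) set" where
  "hc_index = {(c, i). c \<in> loop_orbits G \<and> (loop_ord G (rep c) \<noteq> 0 \<or> i = 0)}"

lemma hc_quasi_iso_total:
  "quasi_iso (UNIV \<times> cells) gtdeg
     (gtdiff :: nat \<times> 'b list \<Rightarrow> nat \<times> 'b list \<Rightarrow>\<^sub>0 'k::field_char_0)
     (bar_basis hc_index (\<lambda>j. NN (fst j))) (bar_deg (\<lambda>j. 2 * snd j)) (bar_sum_del (\<lambda>j. NN (fst j))) hc_fun"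
proof (rule quasi_iso_Union[where idx = "\<lambda>z. idx (snd z)" and idx' = "\<lambda>z. fst (fst z)"])
  fix j :: "'b set"
  let ?S = "{z \<in> UNIV \<times> cells. idx (snd z) = j}"
  let ?T = "{z \<in> bar_basis hc_index (\<lambda>j. NN (fst j)). fst (fst z) = j}"
  let ?D = "gtdiff :: nat \<times> 'b list \<Rightarrow> nat \<times> 'b list \<Rightarrow>\<^sub>0 'k"
  have S: "?S = UNIV \<times> {y \<in> cells. idx y = j}" by auto
  consider "j = {}" | "j \<in> loop_orbits G" | "j \<noteq> {}" "j \<notin> loop_orbits G" by blast
  then show "quasi_iso ?S gtdeg ?D ?T (bar_deg (\<lambda>j. 2 * snd j)) (bar_sum_del (\<lambda>j. NN (fst j)))
      (hc_fun :: nat \<times> 'b list \<Rightarrow> ('b set \<times> nat) \<times> 'b set list \<Rightarrow>\<^sub>0 'k)"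
  proof cases
    case 1
    have T: "?T = {}" using 1 orbit_ne by (auto simp: bar_basis_def hc_index_def)
    have "quasi_iso ?S gtdeg ?D ?T (bar_deg (\<lambda>j. 2 * snd j)) (bar_sum_del (\<lambda>j. NN (fst j)))
      (\<lambda>_. 0 :: ('b set \<times> nat) \<times> 'b set list \<Rightarrow>\<^sub>0 'k)"
      unfolding T S using broken_tot_cone_exact by (simp add: quasi_iso_def 1 idx_empty)
    then show ?thesis by (rule quasi_iso_cong[OF _ tdiff_in_part]) (auto simp: 1 hc_fun_def)
  next
    case 2
    interpret P: pointed_groupoid G "rep j" by (rule pointed[OF 2])
    let ?g = "\<lambda>w. ((j, fst w), snd w) :: ('b set \<times> nat) \<times> 'b set list"
    have T: "?T = ?g ` (P.shifts \<times> lists (carrier (NN j)))"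
      using 2 by (force simp: bar_basis_def hc_index_def P.shifts_def image_iff split: if_splits)
    have "quasi_iso ?S gtdeg ?D ?T (bar_deg (\<lambda>j. 2 * snd j)) (bar_sum_del (\<lambda>j. NN (fst j)))
      (\<lambda>y. pmap ?g (P.hc_tot_map y) :: ('b set \<times> nat) \<times> 'b set list \<Rightarrow>\<^sub>0 'k)"
      unfolding T S idx_part[OF 2]
    proof (rule quasi_iso_relabel[OF P.hc_quasi_iso])
      fix w :: "nat \<times> 'b set list" assume w: "w \<in> P.shifts \<times> lists (carrier (NN j))"
      then have y: "snd w \<in> lists (carrier (NN j))" by auto
      show "(sdiff (bar_del (NN j)) w :: nat \<times> 'b set list \<Rightarrow>\<^sub>0 'k) \<in> Lin (P.shifts \<times> lists (carrier (NN j)))"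
        unfolding sdiff_def by (rule Lin_pmap[OF based_complex.D_in[OF P.bar_based_complex y]]) (use w in auto)
    qed (auto simp: bar_deg_def bar_sum_del_def sdeg_def sdiff_def pmap_pmap intro: inj_onI)
    then show ?thesis by (rule quasi_iso_cong[OF _ tdiff_in_part]) (use orbit_ne[OF 2] in \<open>auto simp: hc_fun_def Let_def\<close>)
  next
    case 3
    show ?thesis by (rule quasi_iso_empty) (use 3 idx_in in \<open>auto simp: bar_basis_def hc_index_def\<close>)
  qed
next
  fix z :: "('b set \<times> nat) \<times> 'b set list"
  show "(bar_sum_del (\<lambda>j. NN (fst j)) z :: ('b set \<times> nat) \<times> 'b set list \<Rightarrow>\<^sub>0 'k) \<in> Lin {w. fst (fst w) = fst (fst z)}"
    by (rule Lin_mono[OF bar_sum_del_in]) auto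
qed (rule tdiff_idx)

end

section \<open>Presentations of vector spaces by chains\<close>

definition subspace_on :: "('x \<Rightarrow>\<^sub>0 'k::field) set \<Rightarrow> bool" where
  "subspace_on U \<longleftrightarrow> 0 \<in> U \<and> (\<forall>p\<in>U. \<forall>q\<in>U. p + q \<in> U) \<and> (\<forall>c. \<forall>p\<in>U. cmul c p \<in> U)"

definition linear_into :: "('x \<Rightarrow>\<^sub>0 'k::field) set \<Rightarrow> ('k, 'v) module \<Rightarrow> (('x \<Rightarrow>\<^sub>0 'k) \<Rightarrow> 'v) \<Rightarrow> bool" where
  "linear_into U V \<beta> \<longleftrightarrow> (\<forall>p\<in>U. \<forall>q\<in>U. \<beta> (p + q) = \<beta> p \<oplus>\<^bsub>V\<^esub> \<beta> q) \<and>
     (\<forall>c. \<forall>p\<in>U. \<beta> (cmul c p) = c \<odot>\<^bsub>V\<^esub> \<beta> p) \<and> \<beta> 0 = \<zero>\<^bsub>V\<^esub>"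

text \<open>\<open>M\<close> is \<open>U\<close> modulo \<open>Y\<close> by way of
  \<open>\<phi>\<close>. Modules of cosets, and sums of them, are handled only through such
  presentations, so that all computation takes place with chains.\<close>

definition presents :: "('k::field, 'v) module \<Rightarrow> (('x \<Rightarrow>\<^sub>0 'k) \<Rightarrow> 'v) \<Rightarrow> ('x \<Rightarrow>\<^sub>0 'k) set \<Rightarrow> ('x \<Rightarrow>\<^sub>0 'k) set \<Rightarrow> bool" where
  "presents M \<phi> U Y \<longleftrightarrow> subspace_on U \<and> linear_into U M \<phi> \<and> carrier M = \<phi> ` U \<and>
     (\<forall>p\<in>U. \<forall>q\<in>U. \<phi> p = \<phi> q \<longleftrightarrow> p - q \<in> Y)"

definition represents :: "('k::field, 'v) module \<Rightarrow> (('x \<Rightarrow>\<^sub>0 'k) \<Rightarrow> 'v) \<Rightarrow> 'x set \<Rightarrow> bool" where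
  "represents V \<beta> A \<longleftrightarrow> linear_into (Lin A) V \<beta> \<and> carrier V = \<beta> ` Lin A \<and> inj_on \<beta> (Lin A)"

lemma subspace_Lin: "subspace_on (Lin A)"
  by (auto simp: subspace_on_def intro: Lin_add Lin_cmul)

lemma subspaceD:
  assumes "subspace_on U"
  shows "0 \<in> U" "p \<in> U \<Longrightarrow> q \<in> U \<Longrightarrow> p + q \<in> U" "p \<in> U \<Longrightarrow> cmul c p \<in> U" "p \<in> U \<Longrightarrow> - p \<in> U"
    "p \<in> U \<Longrightarrow> q \<in> U \<Longrightarrow> p - q \<in> U"
proof -
  show 1: "0 \<in> U" "\<And>p q. p \<in> U \<Longrightarrow> q \<in> U \<Longrightarrow> p + q \<in> U" "\<And>c p. p \<in> U \<Longrightarrow> cmul c p \<in> U"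
    using assms by (auto simp: subspace_on_def)
  show 2: "\<And>p. p \<in> U \<Longrightarrow> - p \<in> U" using 1(3)[of _ "- 1"] by simp
  show "p \<in> U \<Longrightarrow> q \<in> U \<Longrightarrow> p - q \<in> U" using 1(2)[of p "- q"] 2[of q] by simp
qed

lemma linear_intoD:
  assumes "linear_into U V \<beta>"
  shows "p \<in> U \<Longrightarrow> q \<in> U \<Longrightarrow> \<beta> (p + q) = \<beta> p \<oplus>\<^bsub>V\<^esub> \<beta> q" "p \<in> U \<Longrightarrow> \<beta> (cmul c p) = c \<odot>\<^bsub>V\<^esub> \<beta> p" "\<beta> 0 = \<zero>\<^bsub>V\<^esub>"
  using assms by (auto simp: linear_into_def)

lemma presents_isomorphic:
  fixes f :: "'x \<Rightarrow> 'y \<Rightarrow>\<^sub>0 'k::field" and M :: "('k, 'v) module" and M' :: "('k, 'w) module"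
  assumes M: "presents M \<phi> U Y" and M': "presents M' \<phi>' X' Y'"
    and f: "\<And>x. x \<in> U \<Longrightarrow> lext f x \<in> X'"
    and inj: "\<And>x. x \<in> U \<Longrightarrow> lext f x \<in> Y' \<longleftrightarrow> x \<in> Y"
    and surj: "\<And>y. y \<in> X' \<Longrightarrow> \<exists>x\<in>U. y - lext f x \<in> Y'"
  shows "vs_isomorphic M M'"
proof -
  have s: "subspace_on U" "linear_into U M \<phi>" "carrier M = \<phi> ` U" "\<And>p q. p \<in> U \<Longrightarrow> q \<in> U \<Longrightarrow> \<phi> p = \<phi> q \<longleftrightarrow> p - q \<in> Y"
    using M by (auto simp: presents_def)
  have s': "linear_into X' M' \<phi>'" "carrier M' = \<phi>' ` X'" "\<And>p q. p \<in> X' \<Longrightarrow> q \<in> X' \<Longrightarrow> \<phi>' p = \<phi>' q \<longleftrightarrow> p - q \<in> Y'"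
    using M' by (auto simp: presents_def)
  note U = subspaceD[OF s(1)]
  have eq: "\<phi>' (lext f x) = \<phi>' (lext f y) \<longleftrightarrow> \<phi> x = \<phi> y" if "x \<in> U" "y \<in> U" for x y
    using s'(3)[OF f[OF that(1)] f[OF that(2)]] s(4)[OF that] inj[OF U(5)[OF that]] by (simp add: lext_diff)
  define g where "g m = \<phi>' (lext f (SOME x. x \<in> U \<and> \<phi> x = m))" for m
  have g: "g (\<phi> x) = \<phi>' (lext f x)" if x: "x \<in> U" for x
  proof -
    have "(SOME z. z \<in> U \<and> \<phi> z = \<phi> x) \<in> U \<and> \<phi> (SOME z. z \<in> U \<and> \<phi> z = \<phi> x) = \<phi> x"
      by (rule someI[of _ x]) (simp add: x)
    then show ?thesis unfolding g_def using eq x by blast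
  qed
  show ?thesis
    unfolding vs_isomorphic_def
  proof (intro exI[of _ g] conjI allI ballI bij_betwI')
    fix x y assume "x \<in> carrier M" "y \<in> carrier M"
    then obtain p q where p: "p \<in> U" "x = \<phi> p" and q: "q \<in> U" "y = \<phi> q" by (auto simp: s(3))
    show "(g x = g y) = (x = y)" using eq[OF p(1) q(1)] by (simp add: p q g)
    show "g (x \<oplus>\<^bsub>M\<^esub> y) = g x \<oplus>\<^bsub>M'\<^esub> g y"
      using linear_intoD(1)[OF s(2) p(1) q(1)] linear_intoD(1)[OF s'(1) f[OF p(1)] f[OF q(1)]] g[OF U(2)[OF p(1) q(1)]]
      by (simp add: p q g lext_add)
  next
    fix x assume "x \<in> carrier M"
    then obtain p where p: "p \<in> U" "x = \<phi> p" by (auto simp: s(3))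
    show "g x \<in> carrier M'" using f[OF p(1)] by (simp add: p g s'(2))
    show "g (k \<odot>\<^bsub>M\<^esub> x) = k \<odot>\<^bsub>M'\<^esub> g x" for k
      using linear_intoD(2)[OF s(2) p(1)] linear_intoD(2)[OF s'(1) f[OF p(1)]] g[OF U(3)[OF p(1)]]
      by (simp add: p g lext_cmul)
  next
    fix y assume "y \<in> carrier M'"
    then obtain y' where y': "y' \<in> X'" "y = \<phi>' y'" by (auto simp: s'(2))
    obtain x where x: "x \<in> U" "y' - lext f x \<in> Y'" using surj[OF y'(1)] by blast
    have "y = g (\<phi> x)" using s'(3)[OF y'(1) f[OF x(1)]] x(2) by (simp add: g[OF x(1)] y'(2))
    then show "\<exists>x\<in>carrier M. y = g x" using x(1) by (auto simp: s(3))
  qed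
qed

lemma quotient_coset:
  assumes \<beta>: "linear_into E V \<beta>" and Y: "Y \<subseteq> E" and p: "p \<in> E"
  shows "\<beta> ` Y +>\<^bsub>V\<^esub> \<beta> p = (\<lambda>q. \<beta> (q + p)) ` Y"
proof -
  have "\<beta> (q + p) = \<beta> q \<oplus>\<^bsub>V\<^esub> \<beta> p" if "q \<in> Y" for q using linear_intoD(1)[OF \<beta> _ p] Y that by blast
  then show ?thesis by (auto simp: a_r_coset_def' image_iff)
qed

text \<open>\<open>E\<close> is the ambient space on which \<open>\<beta>\<close> is linear and
  injective. It is kept apart from \<open>U\<close> since the homology record shrinks only the
  carrier of a chain space and retains its operations.\<close>

lemma quotient_presents:
  fixes V :: "('k::field, 'v) module"
  assumes \<beta>: "linear_into E V \<beta>" "inj_on \<beta> E" and E: "subspace_on E" and U: "subspace_on U" "U \<subseteq> E"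
    and Y: "subspace_on Y" "Y \<subseteq> E" and V: "carrier V = \<beta> ` U" and W: "W = \<beta> ` Y"
  shows "presents (quotient_module V W) (\<lambda>p. W +>\<^bsub>V\<^esub> \<beta> p) U Y"
proof -
  note cos = quotient_coset[OF \<beta>(1) Y(2)]
  note lin = linear_intoD[OF \<beta>(1)]
  note e0 = subspaceD[OF E] and y = subspaceD[OF Y(1)] and x = subspaceD[OF U(1)]
  have in0: "p \<in> E" if "p \<in> U \<or> p \<in> Y" for p using that U(2) Y(2) by auto
  have eq: "W +>\<^bsub>V\<^esub> \<beta> p = W +>\<^bsub>V\<^esub> \<beta> q \<longleftrightarrow> p - q \<in> Y" if pq: "p \<in> E" "q \<in> E" for p q
  proof
    assume "W +>\<^bsub>V\<^esub> \<beta> p = W +>\<^bsub>V\<^esub> \<beta> q"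
    then have "\<beta> (0 + p) \<in> (\<lambda>r. \<beta> (r + q)) ` Y" unfolding W cos[OF pq(1)] cos[OF pq(2)] using y(1) by blast
    then obtain r where r: "r \<in> Y" "\<beta> p = \<beta> (r + q)" by auto
    have "p = r + q" by (rule inj_onD[OF \<beta>(2) r(2) pq(1) e0(2)]) (use r in0 pq in auto)
    then show "p - q \<in> Y" using r by simp
  next
    assume d: "p - q \<in> Y"
    show "W +>\<^bsub>V\<^esub> \<beta> p = W +>\<^bsub>V\<^esub> \<beta> q"
      unfolding W cos[OF pq(1)] cos[OF pq(2)]
    proof (intro equalityI subsetI; elim imageE)
      fix z r assume "z = \<beta> (r + p)" "r \<in> Y"
      then show "z \<in> (\<lambda>q'. \<beta> (q' + q)) ` Y" using y(2)[OF _ d, of r] by (intro image_eqI[of _ _ "r + (p - q)"]) (auto simp: algebra_simps)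
    next
      fix z r assume "z = \<beta> (r + q)" "r \<in> Y"
      then show "z \<in> (\<lambda>q'. \<beta> (q' + p)) ` Y" using y(5)[OF _ d, of r] by (intro image_eqI[of _ _ "r - (p - q)"]) (auto simp: algebra_simps)
    qed
  qed
  have add: "W +>\<^bsub>V\<^esub> \<beta> (p + q) = (W +>\<^bsub>V\<^esub> \<beta> p) <+>\<^bsub>V\<^esub> (W +>\<^bsub>V\<^esub> \<beta> q)" if pq: "p \<in> E" "q \<in> E" for p q
  proof -
    have e: "\<beta> (r + p) \<oplus>\<^bsub>V\<^esub> \<beta> (r' + q) = \<beta> ((r + r') + (p + q))" if "r \<in> Y" "r' \<in> Y" for r r'
      using lin(1)[OF e0(2)[OF _ pq(1)] e0(2)[OF _ pq(2)], of r r'] that in0 by (simp add: algebra_simps)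
    show ?thesis
      unfolding W cos[OF pq(1)] cos[OF pq(2)] cos[OF e0(2)[OF pq]] set_add_def'
    proof (intro equalityI subsetI)
      fix z assume "z \<in> (\<lambda>r. \<beta> (r + (p + q))) ` Y"
      then obtain r where r: "r \<in> Y" "z = \<beta> (r + (p + q))" by blast
      have "z = \<beta> (r + p) \<oplus>\<^bsub>V\<^esub> \<beta> (0 + q)" unfolding e[OF r(1) y(1)] using r by simp
      then show "z \<in> (\<Union>h\<in>(\<lambda>q. \<beta> (q + p)) ` Y. \<Union>k\<in>(\<lambda>r. \<beta> (r + q)) ` Y. {h \<oplus>\<^bsub>V\<^esub> k})" using r(1) y(1) by blast
    next
      fix z assume "z \<in> (\<Union>h\<in>(\<lambda>q. \<beta> (q + p)) ` Y. \<Union>k\<in>(\<lambda>r. \<beta> (r + q)) ` Y. {h \<oplus>\<^bsub>V\<^esub> k})"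
      then obtain r r' where r: "r \<in> Y" "r' \<in> Y" "z = \<beta> (r + p) \<oplus>\<^bsub>V\<^esub> \<beta> (r' + q)" by blast
      show "z \<in> (\<lambda>r. \<beta> (r + (p + q))) ` Y" unfolding r(3) e[OF r(1,2)] using y(2)[OF r(1,2)] by blast
    qed
  qed
  have smult: "W +>\<^bsub>V\<^esub> \<beta> (cmul k p) = W <+>\<^bsub>V\<^esub> ((\<lambda>x. k \<odot>\<^bsub>V\<^esub> x) ` (W +>\<^bsub>V\<^esub> \<beta> p))" if p: "p \<in> E" for k p
  proof -
    have e: "\<beta> r \<oplus>\<^bsub>V\<^esub> (k \<odot>\<^bsub>V\<^esub> \<beta> (r' + p)) = \<beta> ((r + cmul k r') + cmul k p)" if r: "r \<in> Y" "r' \<in> Y" for r r'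
    proof -
      have 1: "r' + p \<in> E" using e0(2)[OF _ p] in0 r by blast
      have 2: "r \<in> E" using in0 r by blast
      show ?thesis using lin(1)[OF 2 e0(3)[OF 1], of k] lin(2)[OF 1, of k] by (simp add: cmul_add add.assoc)
    qed
    show ?thesis
      unfolding W cos[OF p] cos[OF e0(3)[OF p]] set_add_def'
    proof (intro equalityI subsetI)
      fix z assume "z \<in> (\<lambda>r. \<beta> (r + cmul k p)) ` Y"
      then obtain r where r: "r \<in> Y" "z = \<beta> (r + cmul k p)" by blast
      have "z = \<beta> r \<oplus>\<^bsub>V\<^esub> (k \<odot>\<^bsub>V\<^esub> \<beta> (0 + p))" unfolding e[OF r(1) y(1)] using r by simp
      then show "z \<in> (\<Union>h\<in>\<beta> ` Y. \<Union>k\<in>(\<lambda>x. k \<odot>\<^bsub>V\<^esub> x) ` (\<lambda>q. \<beta> (q + p)) ` Y. {h \<oplus>\<^bsub>V\<^esub> k})" using r(1) y(1) by blast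
    next
      fix z assume "z \<in> (\<Union>h\<in>\<beta> ` Y. \<Union>k\<in>(\<lambda>x. k \<odot>\<^bsub>V\<^esub> x) ` (\<lambda>q. \<beta> (q + p)) ` Y. {h \<oplus>\<^bsub>V\<^esub> k})"
      then obtain r r' where r: "r \<in> Y" "r' \<in> Y" "z = \<beta> r \<oplus>\<^bsub>V\<^esub> (k \<odot>\<^bsub>V\<^esub> \<beta> (r' + p))" by blast
      show "z \<in> (\<lambda>r. \<beta> (r + cmul k p)) ` Y" unfolding r(3) e[OF r(1,2)] using y(2)[OF r(1) y(3)[OF r(2)]] by blast
    qed
  qed
  have zero: "W +>\<^bsub>V\<^esub> \<beta> 0 = W" unfolding W cos[OF e0(1)] by simp
  show ?thesis
    unfolding presents_def linear_into_def quotient_module_def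
    using U(1) eq add smult zero in0 by (auto simp: A_RCOSETS_def' V)
qed

text \<open>If the relations are the kernel of a linear map onto \<open>Lin A\<close> that splits on
  basis elements by \<open>s\<close>, then \<open>A\<close> is a basis of the quotient. This is
  applied to tensor powers.\<close>

lemma presents_represents:
  assumes "presents M \<phi> U Y" and \<theta>: "\<And>p. p \<in> U \<Longrightarrow> lext \<theta> p \<in> Lin A"
    and Y: "\<And>p. p \<in> U \<Longrightarrow> p \<in> Y \<longleftrightarrow> lext \<theta> p = 0"
    and s: "\<And>x. x \<in> A \<Longrightarrow> bas (s x) \<in> U" "\<And>x. x \<in> A \<Longrightarrow> \<theta> (s x) = bas x"
  shows "represents M (\<lambda>r. \<phi> (pmap s r)) A" and "\<And>p. p \<in> U \<Longrightarrow> \<phi> p = \<phi> (pmap s (lext \<theta> p))"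
    and "\<And>r. r \<in> Lin A \<Longrightarrow> pmap s r \<in> U \<and> lext \<theta> (pmap s r) = r"
proof -
  have M: "subspace_on U" "linear_into U M \<phi>" "carrier M = \<phi> ` U" "\<And>p q. p \<in> U \<Longrightarrow> q \<in> U \<Longrightarrow> \<phi> p = \<phi> q \<longleftrightarrow> p - q \<in> Y"
    using assms(1) by (auto simp: presents_def)
  note x = subspaceD[OF M(1)]
  show sX: "pmap s r \<in> U \<and> lext \<theta> (pmap s r) = r" if r: "r \<in> Lin A" for r
  proof
    show "pmap s r \<in> U" using r
      by (induction rule: Lin_induct) (simp_all add: pmap_add pmap_cmul x s)
    have "lext \<theta> (pmap s r) = lext bas r" unfolding lext_pmap by (rule lext_cong_on[OF r s(2)])
    then show "lext \<theta> (pmap s r) = r" by simp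
  qed
  have eq: "\<phi> p = \<phi> q \<longleftrightarrow> lext \<theta> p = lext \<theta> q" if "p \<in> U" "q \<in> U" for p q
    using M(4)[OF that] Y[OF x(5)[OF that]] by (simp add: lext_diff)
  show r: "\<phi> p = \<phi> (pmap s (lext \<theta> p))" if "p \<in> U" for p
    using eq[OF that] sX[OF \<theta>[OF that]] by simp
  show "represents M (\<lambda>r. \<phi> (pmap s r)) A"
    unfolding represents_def linear_into_def
  proof (intro conjI ballI allI)
    show "carrier M = (\<lambda>r. \<phi> (pmap s r)) ` Lin A"
      unfolding M(3) using r \<theta> sX by blast
    show "inj_on (\<lambda>r. \<phi> (pmap s r)) (Lin A)"
      by (rule inj_onI) (use eq sX in force)
  qed (use sX in \<open>auto simp: pmap_add pmap_cmul linear_intoD[OF M(2)]\<close>)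
qed

text \<open>The definitions use \<open>finsum\<close> and additive inverses, whose rules require an
  abelian group; this property is inherited from the chains.\<close>

lemma represents_abelian_group:
  assumes "represents V \<beta> A"
  shows "abelian_group V"
proof -
  have b: "linear_into (Lin A) V \<beta>" "carrier V = \<beta> ` Lin A" using assms by (auto simp: represents_def)
  note lin = linear_intoD[OF b(1)]
  have a: "\<beta> p \<oplus>\<^bsub>V\<^esub> \<beta> q = \<beta> (p + q)" if "p \<in> Lin A" "q \<in> Lin A" for p q using lin(1)[OF that] by simp
  show ?thesis
  proof (rule abelian_groupI)
    fix x assume "x \<in> carrier V"
    then obtain p where p: "p \<in> Lin A" "x = \<beta> p" by (auto simp: b(2))
    show "\<exists>y\<in>carrier V. y \<oplus>\<^bsub>V\<^esub> x = \<zero>\<^bsub>V\<^esub>"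
      using a[OF Lin_uminus[OF p(1)] p(1)] Lin_uminus[OF p(1)] by (auto simp: b(2) p(2) lin(3) intro!: bexI[of _ "- p"])
  qed (auto simp: b(2) a Lin_add simp flip: lin(3) add.assoc; simp add: add.commute)+
qed

lemma represents_finsum:
  assumes V: "represents V \<beta> A" and I: "finite I"
    and g: "\<And>i. i \<in> I \<Longrightarrow> p i \<in> Lin A" "\<And>i. i \<in> I \<Longrightarrow> g i = \<beta> (p i)"
  shows "finsum V g I = \<beta> (\<Sum>i\<in>I. p i)"
proof -
  interpret abelian_group V by (rule represents_abelian_group[OF V])
  have b: "linear_into (Lin A) V \<beta>" "carrier V = \<beta> ` Lin A" using V by (auto simp: represents_def)
  show ?thesis
    using I g
  proof (induction I)
    case empty
    then show ?case using linear_intoD(3)[OF b(1)] by simp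
  next
    case (insert i I)
    have s: "(\<Sum>i\<in>I. p i) \<in> Lin A" by (rule Lin_sum) (use insert in auto)
    have "g \<in> I \<rightarrow> carrier V" "g i \<in> carrier V" using insert by (auto simp: b(2))
    then show ?case
      using insert s linear_intoD(1)[OF b(1) _ s, of "p i"] by (simp add: finsum_insert)
  qed
qed

lemma represents_uminus:
  assumes V: "represents V \<beta> A" and p: "p \<in> Lin A"
  shows "\<ominus>\<^bsub>V\<^esub> \<beta> p = \<beta> (- p)"
proof -
  interpret abelian_group V by (rule represents_abelian_group[OF V])
  have b: "linear_into (Lin A) V \<beta>" "carrier V = \<beta> ` Lin A" using V by (auto simp: represents_def)
  have n: "- p \<in> Lin A" by (rule Lin_uminus[OF p])
  show ?thesis
    using linear_intoD(1)[OF b(1) n p] linear_intoD(3)[OF b(1)] n p by (intro minus_equality) (auto simp: b(2))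
qed

lemma face_sum_represents:
  assumes V: "\<And>m. represents (C m) (\<beta> m) (A m)" and r: "r \<in> Lin (A n)"
    and \<delta>: "\<And>i. i \<le> n \<Longrightarrow> F i r \<in> Lin (A (n - 1)) \<and> \<delta> n i (\<beta> n r) = \<beta> (n - 1) (F i r)"
  shows "face_sum C \<delta> n (\<beta> n r) = \<beta> (n - 1) (\<Sum>i\<le>n. cmul ((-1) ^ i) (F i r))"
    and "face_sum' C \<delta> n (\<beta> n r) = \<beta> (n - 1) (\<Sum>i<n. cmul ((-1) ^ i) (F i r))"
proof -
  have b: "linear_into (Lin (A (n - 1))) (C (n - 1)) (\<beta> (n - 1))" using V by (auto simp: represents_def)
  show "face_sum C \<delta> n (\<beta> n r) = \<beta> (n - 1) (\<Sum>i\<le>n. cmul ((-1) ^ i) (F i r))"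
    unfolding face_sum_def
    by (rule represents_finsum[OF V]) (use \<delta> in \<open>auto simp: Lin_cmul linear_intoD(2)[OF b] simp del: One_nat_def\<close>)
  show "face_sum' C \<delta> n (\<beta> n r) = \<beta> (n - 1) (\<Sum>i<n. cmul ((-1) ^ i) (F i r))"
    unfolding face_sum'_def
    by (rule represents_finsum[OF V]) (use \<delta> in \<open>auto simp: Lin_cmul linear_intoD(2)[OF b] simp del: One_nat_def\<close>)
qed

lemma subspace_cycles: "subspace_on {p \<in> Lin A. lext D p = 0}"
  by (auto simp: subspace_on_def Lin_add Lin_cmul lext_lin)

lemma subspace_image: "subspace_on (lext D ` Lin A)"
  unfolding subspace_on_def
proof (intro conjI ballI allI; (elim imageE)?)
  show "0 \<in> lext D ` Lin A" using lext_zero[of D] Lin_zero by (metis image_eqI)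
  show "p + q \<in> lext D ` Lin A" if "p = lext D x" "x \<in> Lin A" "q = lext D y" "y \<in> Lin A" for p q x y
    using that by (auto simp: lext_add intro!: image_eqI[of _ _ "x + y"] Lin_add)
  show "cmul c p \<in> lext D ` Lin A" if "p = lext D x" "x \<in> Lin A" for c p x
    using that by (auto simp: lext_cmul intro!: image_eqI[of _ _ "cmul c x"] Lin_cmul)
qed

text \<open>\<open>D0\<close> reconciles the two conventions in degree 0: \<open>cycles\<close>
  takes the whole space there, while the presentation asks for the kernel of
  \<open>D\<close>.\<close>

lemma homology_presents:
  assumes V: "\<And>m. represents (C m) (\<beta> m) (A m)"
    and d: "\<And>m r. r \<in> Lin (A (Suc m)) \<Longrightarrow> lext D r \<in> Lin (A m) \<and> d (Suc m) (\<beta> (Suc m) r) = \<beta> m (lext D r)"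
    and D0: "\<And>r. r \<in> Lin (A 0) \<Longrightarrow> lext D r = 0"
  shows "\<exists>\<phi>. presents (homology C d n) \<phi> {p \<in> Lin (A n). lext D p = 0} (lext D ` Lin (A (Suc n)))"
proof -
  have b: "linear_into (Lin (A m)) (C m) (\<beta> m)" "carrier (C m) = \<beta> m ` Lin (A m)" "inj_on (\<beta> m) (Lin (A m))" for m
    using V[of m] by (auto simp: represents_def)
  have cyc: "cycles C d n = \<beta> n ` {p \<in> Lin (A n). lext D p = 0}"
  proof (cases n)
    case 0
    then show ?thesis using D0 b(2)[of 0] by (auto simp: cycles_def)
  next
    case (Suc m)
    have "\<beta> m (lext D r) = \<zero>\<^bsub>C m\<^esub> \<longleftrightarrow> lext D r = 0" if "r \<in> Lin (A (Suc m))" for r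
      using inj_onD[OF b(3)[of m], of "lext D r" 0] d[OF that] linear_intoD(3)[OF b(1)[of m]] by auto
    then show ?thesis using d[of _ m] b(2)[of "Suc m"] linear_intoD(3)[OF b(1)[of m]] by (auto simp: cycles_def Suc)
  qed
  have bd: "boundaries C d n = \<beta> n ` lext D ` Lin (A (Suc n))"
    using d[of _ n] b(2)[of "Suc n"] by (force simp: boundaries_def image_image)
  let ?V = "(C n)\<lparr>carrier := cycles C d n\<rparr>"
  have "presents (quotient_module ?V (boundaries C d n)) (\<lambda>p. boundaries C d n +>\<^bsub>?V\<^esub> \<beta> n p)
     {p \<in> Lin (A n). lext D p = 0} (lext D ` Lin (A (Suc n)))"
    by (rule quotient_presents[where E = "Lin (A n)"])
      (use b[of n] d[of _ n] in \<open>auto simp: linear_into_def subspace_Lin subspace_cycles subspace_image cyc bd\<close>)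
  then show ?thesis unfolding homology_def by blast
qed

section \<open>Free modules and group homology\<close>

lemma free_map_lookup: "free_map \<phi> (lookup p) = lookup (pmap \<phi> p)"
proof
  fix y
  have "{a. lookup p a \<noteq> 0 \<and> \<phi> a = y} = {a \<in> Poly_Mapping.keys p. \<phi> a = y}" by (auto simp: in_keys_iff)
  then have "free_map \<phi> (lookup p) y = (\<Sum>a\<in>Poly_Mapping.keys p. if \<phi> a = y then lookup p a else 0)"
    by (simp add: free_map_def sum.inter_filter)
  also have "\<dots> = lookup (pmap \<phi> p) y"
    unfolding pmap_def lookup_lext by (intro sum.cong) (auto simp: lookup_single when_def)
  finally show "free_map \<phi> (lookup p) y = lookup (pmap \<phi> p) y" .
qed

lemma represents_free: "represents (free_module A :: ('k::field, 'x \<Rightarrow> 'k) module) lookup A"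
  unfolding represents_def linear_into_def
proof (intro conjI ballI allI)
  show "carrier (free_module A) = lookup ` (Lin A :: ('x \<Rightarrow>\<^sub>0 'k) set)"
  proof (intro equalityI subsetI)
    fix f :: "'x \<Rightarrow> 'k" assume f: "f \<in> carrier (free_module A)"
    then have "lookup (Abs_poly_mapping f) = f" by (simp add: free_module_def Abs_poly_mapping_inverse)
    then show "f \<in> lookup ` Lin A"
      using f by (intro image_eqI[of _ _ "Abs_poly_mapping f"]) (auto simp: free_module_def Lin_def in_keys_iff)
  next
    fix f :: "'x \<Rightarrow> 'k" assume "f \<in> lookup ` Lin A"
    then show "f \<in> carrier (free_module A)"
      by (auto simp: free_module_def Lin_def in_keys_iff intro: finite_subset[OF _ finite_keys])
  qed
qed (auto simp: free_module_def lookup_add fun_eq_iff intro!: inj_onI poly_mapping_eqI)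

lemma bar_face_tuple_in:
  assumes closed: "\<And>x y. x \<in> carrier K \<Longrightarrow> y \<in> carrier K \<Longrightarrow> x \<otimes>\<^bsub>K\<^esub> y \<in> carrier K"
    and x: "x \<in> lists (carrier K)" "length x = Suc m" and i: "i \<le> Suc m"
  shows "bar_face_tuple K (Suc m) i x \<in> {ys \<in> lists (carrier K). length ys = m}"
proof -
  have "x ! j \<in> carrier K" if "j \<le> m" for j using x that by (auto simp: in_lists_conv_set)
  then show ?thesis
    using x i closed by (cases i) (auto simp: bar_face_tuple_def dest: in_set_takeD in_set_dropD in_set_butlastD list.set_sel(2)[rotated])
qed

lemma group_homology_presents:
  assumes closed: "\<And>x y. x \<in> carrier K \<Longrightarrow> y \<in> carrier K \<Longrightarrow> x \<otimes>\<^bsub>K\<^esub> y \<in> carrier K"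
  shows "\<exists>\<phi>. presents (group_homology K n :: ('k::field, ('a list \<Rightarrow> 'k) set) module) \<phi>
     {p \<in> Lin {ys \<in> lists (carrier K). length ys = n}. lext (bar_del K) p = 0}
     (lext (bar_del K) ` Lin {ys \<in> lists (carrier K). length ys = Suc n})"
  unfolding group_homology_def
proof (rule homology_presents)
  let ?A = "\<lambda>n. {ys \<in> lists (carrier K). length ys = n}"
  show r: "represents (bar_chain K m :: ('k, 'a list \<Rightarrow> 'k) module) lookup (?A m)" for m
    unfolding bar_chain_def by (rule represents_free)
  fix m and r :: "('a list, 'k) chain" assume r: "r \<in> Lin (?A (Suc m))"
  let ?F = "\<lambda>i. pmap (bar_face_tuple K (Suc m) i)"
  have F: "?F i r \<in> Lin (?A m)" if "i \<le> Suc m" for i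
    by (rule Lin_pmap[OF r]) (use bar_face_tuple_in[OF closed] that in auto)
  have "lext (bar_del K) r = lext (\<lambda>x. \<Sum>i\<le>Suc m. cmul ((-1) ^ i) (bas (bar_face_tuple K (Suc m) i x))) r"
    by (rule lext_cong_on[OF r]) (auto simp: bar_del_def)
  also have "\<dots> = (\<Sum>i\<le>Suc m. cmul ((-1) ^ i) (?F i r))"
    unfolding lext_fun_sum lext_fun_cmul pmap_def ..
  finally have e: "lext (bar_del K) r = (\<Sum>i\<le>Suc m. cmul ((-1) ^ i) (?F i r))" .
  have "face_sum (bar_chain K) (\<lambda>n i. free_map (bar_face_tuple K n i)) (Suc m) (lookup r) = lookup (\<Sum>i\<le>Suc m. cmul ((-1) ^ i) (?F i r))"
    using F by (intro face_sum_represents(1)[where \<beta> = "\<lambda>_. lookup" and A = ?A and n = "Suc m" and F = "\<lambda>i. pmap (bar_face_tuple K (Suc m) i)"])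
      (auto simp: represents_free bar_chain_def free_map_lookup r)
  moreover have "(\<Sum>i\<le>Suc m. cmul ((-1) ^ i) (?F i r)) \<in> Lin (?A m)"
    by (rule Lin_sum) (use F in \<open>auto intro: Lin_cmul\<close>)
  ultimately show "lext (bar_del K) r \<in> Lin (?A m) \<and>
     face_sum (bar_chain K) (\<lambda>n i. free_map (bar_face_tuple K n i)) (Suc m) (lookup r) = lookup (lext (bar_del K) r)"
    unfolding e by blast
next
  fix r :: "('a list, 'k) chain" assume "r \<in> Lin {ys \<in> lists (carrier K). length ys = 0}"
  then show "lext (bar_del K) r = 0" by (rule lext_eqI[rotated]) (auto simp: bar_del_def)
qed

section \<open>Direct sums\<close>

definition slice :: "'j \<Rightarrow> ('j \<times> 'x \<Rightarrow>\<^sub>0 'k::field) \<Rightarrow> 'x \<Rightarrow>\<^sub>0 'k" where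
  "slice j = lext (\<lambda>z. if fst z = j then bas (snd z) else 0)"

lemma slice_lin: "slice j (p + q) = slice j p + slice j q" "slice j (p - q) = slice j p - slice j q"
  "slice j (cmul c p) = cmul c (slice j p)" "slice j 0 = 0" "slice j (sum f I) = (\<Sum>i\<in>I. slice j (f i))"
  by (simp_all add: slice_def lext_lin)

lemma slice_Pair: "slice j (pmap (Pair i) a) = (if i = j then a else 0)"
  by (simp add: slice_def lext_pmap)

lemma slice_in: "p \<in> Lin A \<Longrightarrow> slice j p \<in> Lin {x. (j, x) \<in> A}"
  unfolding slice_def by (erule Lin_lext) auto

lemma Pair_slice: "pmap (Pair j) (slice j p) = part fst j p"
  unfolding slice_def part_def pmap_lext by (rule lext_cong) auto

lemma sum_slice:
  assumes "finite J" "fst ` Poly_Mapping.keys p \<subseteq> J"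
  shows "p = (\<Sum>j\<in>J. pmap (Pair j) (slice j p))"
  using sum_part[OF assms] by (simp add: Pair_slice)

lemma slice_outside: "j \<notin> fst ` Poly_Mapping.keys p \<Longrightarrow> slice j p = 0"
  unfolding slice_def by (rule lext_eqI[where A = "Poly_Mapping.keys p"]) (auto simp: Lin_def image_iff)

lemma slice_bar_sum_del: "slice j (lext (bar_sum_del K) p) = lext (bar_del (K j)) (slice j p)"
  unfolding slice_def lext_lext by (rule lext_cong) (auto simp: bar_sum_del_def lext_pmap)

lemma bar_sum_del_Pair: "lext (bar_sum_del K) (pmap (Pair j) a) = pmap (Pair j) (lext (bar_del (K j)) a)"
  by (simp add: lext_pmap bar_sum_del_def pmap_lext)

text \<open>The homology of the sum of shifted bar complexes in degree \<open>n\<close>. The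
  condition \<open>sh j \<le> n\<close> removes the summands that begin above degree
  \<open>n\<close>, where the truncated difference \<open>n - sh j\<close> would wrongly contribute
  homology of degree 0.\<close>

lemma direct_sum_presents:
  fixes K :: "'j \<Rightarrow> 'g monoid" and sh :: "'j \<Rightarrow> nat"
  assumes closed: "\<And>j x y. j \<in> I \<Longrightarrow> x \<in> carrier (K j) \<Longrightarrow> y \<in> carrier (K j) \<Longrightarrow> x \<otimes>\<^bsub>K j\<^esub> y \<in> carrier (K j)"
  shows "\<exists>\<phi>. presents (direct_sum {j \<in> I. sh j \<le> n} (\<lambda>j. group_homology (K j) (n - sh j)) :: ('k::field, 'j \<Rightarrow> ('g list \<Rightarrow> 'k) set) module) \<phi>
     {p \<in> Lin {z \<in> bar_basis I K. bar_deg sh z = n}. lext (bar_sum_del K) p = 0}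
     (lext (bar_sum_del K) ` Lin {z \<in> bar_basis I K. bar_deg sh z = Suc n})"
proof -
  define J where "J = {j \<in> I. sh j \<le> n}"
  define A where "A j m = {ys \<in> lists (carrier (K j)). length ys = m}" for j m
  define M :: "'j \<Rightarrow> ('k, ('g list \<Rightarrow> 'k) set) module" where "M j = group_homology (K j) (n - sh j)" for j
  define Uj where "Uj j = {p \<in> Lin (A j (n - sh j)). lext (bar_del (K j)) p = (0 :: ('g list, 'k) chain)}" for j
  define Yj where "Yj j = lext (bar_del (K j)) ` (Lin (A j (Suc (n - sh j))) :: (('g list, 'k) chain) set)" for j
  define U where "U = {p \<in> Lin {z \<in> bar_basis I K. bar_deg sh z = n}. lext (bar_sum_del K) p = (0 :: 'j \<times> 'g list \<Rightarrow>\<^sub>0 'k)}"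
  define Y where "Y = lext (bar_sum_del K) ` (Lin {z \<in> bar_basis I K. bar_deg sh z = Suc n} :: ('j \<times> 'g list \<Rightarrow>\<^sub>0 'k) set)"
  have "\<forall>j. \<exists>\<phi>. j \<in> J \<longrightarrow> presents (M j) \<phi> (Uj j) (Yj j)"
    unfolding M_def Uj_def Yj_def A_def using group_homology_presents[OF closed] by (auto simp: J_def)
  then obtain \<phi> where "\<forall>j. j \<in> J \<longrightarrow> presents (M j) (\<phi> j) (Uj j) (Yj j)" by (rule choice[THEN exE])
  then have \<phi>: "linear_into (Uj j) (M j) (\<phi> j)" "carrier (M j) = \<phi> j ` Uj j"
    "\<And>p q. p \<in> Uj j \<Longrightarrow> q \<in> Uj j \<Longrightarrow> \<phi> j p = \<phi> j q \<longleftrightarrow> p - q \<in> Yj j" if "j \<in> J" for j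
    using that by (auto simp: presents_def)
  note lin = linear_intoD[OF \<phi>(1)]
  have sl: "slice j p \<in> Uj j" if "p \<in> U" for p j
  proof -
    have p: "p \<in> Lin {z \<in> bar_basis I K. bar_deg sh z = n}" "lext (bar_sum_del K) p = 0" using that by (auto simp: U_def)
    have "slice j p \<in> Lin (A j (n - sh j))"
      by (rule Lin_mono[OF slice_in[OF p(1)]]) (auto simp: bar_basis_def bar_deg_def A_def)
    then show ?thesis using slice_bar_sum_del[of j K p] p(2) by (simp add: Uj_def slice_lin)
  qed
  have sU: "subspace_on U" unfolding U_def by (rule subspace_cycles)
  note u = subspaceD[OF sU]
  have keys: "fst ` Poly_Mapping.keys p \<subseteq> J" if "p \<in> U" for p
    using that by (auto simp: U_def Lin_def bar_basis_def bar_deg_def J_def)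
  define \<Phi> where "\<Phi> p = (\<lambda>j\<in>J. \<phi> j (slice j p))" for p
  have bd: "r \<in> Y \<longleftrightarrow> (\<forall>j\<in>J. slice j r \<in> Yj j)" if r: "r \<in> U" for r
  proof
    assume "r \<in> Y"
    then obtain s where s: "s \<in> Lin {z \<in> bar_basis I K. bar_deg sh z = Suc n}" "r = lext (bar_sum_del K) s"
      by (auto simp: Y_def)
    have "slice j s \<in> Lin (A j (Suc (n - sh j)))" if "j \<in> J" for j
      by (rule Lin_mono[OF slice_in[OF s(1)]]) (use that in \<open>auto simp: bar_basis_def bar_deg_def A_def J_def\<close>)
    then show "\<forall>j\<in>J. slice j r \<in> Yj j" by (auto simp: s(2) slice_bar_sum_del Yj_def)
  next
    assume "\<forall>j\<in>J. slice j r \<in> Yj j"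
    then have "\<forall>j. \<exists>s. j \<in> J \<longrightarrow> s \<in> Lin (A j (Suc (n - sh j))) \<and> slice j r = lext (bar_del (K j)) s"
      by (auto simp: Yj_def image_iff)
    then obtain s where "\<forall>j. j \<in> J \<longrightarrow> s j \<in> Lin (A j (Suc (n - sh j))) \<and> slice j r = lext (bar_del (K j)) (s j)"
      by (rule choice[THEN exE])
    then have s: "s j \<in> Lin (A j (Suc (n - sh j)))" "slice j r = lext (bar_del (K j)) (s j)" if "j \<in> J" for j
      using that by auto
    let ?F = "fst ` Poly_Mapping.keys r"
    have "lext (bar_sum_del K) (\<Sum>j\<in>?F. pmap (Pair j) (s j)) = (\<Sum>j\<in>?F. pmap (Pair j) (slice j r))"
      unfolding lext_sum bar_sum_del_Pair by (intro sum.cong refl) (use s(2) keys[OF r] in auto)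
    also have "\<dots> = r" by (rule sum_slice[symmetric]) auto
    finally have "r = lext (bar_sum_del K) (\<Sum>j\<in>?F. pmap (Pair j) (s j))" ..
    moreover have "(\<Sum>j\<in>?F. pmap (Pair j) (s j)) \<in> Lin {z \<in> bar_basis I K. bar_deg sh z = Suc n}"
    proof (rule Lin_sum)
      fix j assume "j \<in> ?F"
      then have j: "j \<in> J" using keys[OF r] by blast
      show "pmap (Pair j) (s j) \<in> Lin {z \<in> bar_basis I K. bar_deg sh z = Suc n}"
        by (rule Lin_pmap[OF s(1)[OF j]]) (use j in \<open>auto simp: A_def bar_basis_def bar_deg_def J_def\<close>)
    qed
    ultimately show "r \<in> Y" unfolding Y_def by blast
  qed
  have car: "carrier (direct_sum J M) = \<Phi> ` U"
  proof (intro equalityI subsetI)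
    fix g assume "g \<in> carrier (direct_sum J M)"
    then have g: "g \<in> (\<Pi>\<^sub>E i\<in>J. carrier (M i))" "finite {i \<in> J. g i \<noteq> \<zero>\<^bsub>M i\<^esub>}" by (auto simp: direct_sum_def)
    have "\<forall>j. \<exists>x. j \<in> J \<longrightarrow> x \<in> Uj j \<and> \<phi> j x = g j" using g(1) \<phi>(2) by (fastforce simp: PiE_iff)
    then obtain x where "\<forall>j. j \<in> J \<longrightarrow> x j \<in> Uj j \<and> \<phi> j (x j) = g j" by (rule choice[THEN exE])
    then have x: "x j \<in> Uj j" "\<phi> j (x j) = g j" if "j \<in> J" for j using that by auto
    let ?F = "{i \<in> J. g i \<noteq> \<zero>\<^bsub>M i\<^esub>}"
    define p where "p = (\<Sum>j\<in>?F. pmap (Pair j) (x j))"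
    have "lext (bar_sum_del K) p = 0"
      unfolding p_def lext_sum bar_sum_del_Pair by (rule sum.neutral) (use x(1) in \<open>auto simp: Uj_def\<close>)
    moreover have "p \<in> Lin {z \<in> bar_basis I K. bar_deg sh z = n}"
      unfolding p_def
    proof (rule Lin_sum)
      fix j assume "j \<in> ?F"
      then have j: "j \<in> J" by simp
      have "x j \<in> Lin (A j (n - sh j))" using x(1)[OF j] by (simp add: Uj_def)
      then show "pmap (Pair j) (x j) \<in> Lin {z \<in> bar_basis I K. bar_deg sh z = n}"
        by (rule Lin_pmap) (use j in \<open>auto simp: A_def bar_basis_def bar_deg_def J_def\<close>)
    qed
    ultimately have p: "p \<in> U" by (simp add: U_def)
    have s: "slice j p = (if j \<in> ?F then x j else 0)" for j
      unfolding p_def slice_lin slice_Pair using g(2) by (simp add: sum.delta')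
    have "\<Phi> p = g"
    proof (rule ext)
      fix j show "\<Phi> p j = g j"
        using g(1) x(2) lin(3) by (cases "j \<in> J") (auto simp: \<Phi>_def s PiE_def extensional_def)
    qed
    then show "g \<in> \<Phi> ` U" using p by blast
  next
    fix g assume "g \<in> \<Phi> ` U"
    then obtain p where p: "p \<in> U" "g = \<Phi> p" by blast
    have "{i \<in> J. g i \<noteq> \<zero>\<^bsub>M i\<^esub>} \<subseteq> fst ` Poly_Mapping.keys p"
      using slice_outside lin(3) by (fastforce simp: p(2) \<Phi>_def)
    then have "finite {i \<in> J. g i \<noteq> \<zero>\<^bsub>M i\<^esub>}" by (rule finite_subset) simp
    then show "g \<in> carrier (direct_sum J M)"
      using sl[OF p(1)] \<phi>(2) by (auto simp: direct_sum_def p(2) \<Phi>_def)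
  qed
  have "presents (direct_sum J M) \<Phi> U Y"
    unfolding presents_def linear_into_def
  proof (intro conjI ballI allI sU car)
    fix p q assume pq: "p \<in> U" "q \<in> U"
    show "\<Phi> (p + q) = \<Phi> p \<oplus>\<^bsub>direct_sum J M\<^esub> \<Phi> q"
      using lin(1)[OF _ sl[OF pq(1)] sl[OF pq(2)]] by (auto simp: direct_sum_def \<Phi>_def slice_lin intro!: restrict_ext)
    have "\<Phi> p = \<Phi> q \<longleftrightarrow> (\<forall>j\<in>J. \<phi> j (slice j p) = \<phi> j (slice j q))"
      unfolding \<Phi>_def by (auto simp: fun_eq_iff restrict_def split: if_splits)
    also have "\<dots> \<longleftrightarrow> (\<forall>j\<in>J. slice j (p - q) \<in> Yj j)"
      using \<phi>(3)[OF _ sl[OF pq(1)] sl[OF pq(2)]] by (auto simp: slice_lin)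
    also have "\<dots> \<longleftrightarrow> p - q \<in> Y" using bd[OF u(5)[OF pq]] by simp
    finally show "\<Phi> p = \<Phi> q \<longleftrightarrow> p - q \<in> Y" .
  next
    fix c p assume p: "p \<in> U"
    show "\<Phi> (cmul c p) = c \<odot>\<^bsub>direct_sum J M\<^esub> \<Phi> p"
      using lin(2)[OF _ sl[OF p]] by (auto simp: direct_sum_def \<Phi>_def slice_lin intro!: restrict_ext)
  next
    show "\<Phi> 0 = \<zero>\<^bsub>direct_sum J M\<^esub>"
      using lin(3) by (auto simp: direct_sum_def \<Phi>_def slice_lin intro!: restrict_ext)
  qed
  then show ?thesis unfolding J_def M_def U_def Y_def by blast
qed

text \<open>Exactness of the cone at a pair \<open>(x, b)\<close> with
  \<open>lext f x = lext D' b\<close> gives injectivity, and exactness at \<open>(0, y)\<close>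
  gives surjectivity.\<close>

lemma quasi_iso_homology:
  assumes q: "quasi_iso S dg D S' dg' D' f"
    and f': "presents M \<phi> {p \<in> Lin {x \<in> S. dg x = n}. lext D p = 0} (lext D ` Lin {x \<in> S. dg x = Suc n})"
    and g': "presents M' \<phi>' {p \<in> Lin {y \<in> S'. dg' y = n}. lext D' p = 0} (lext D' ` Lin {y \<in> S'. dg' y = Suc n})"
  shows "vs_isomorphic M M'"
proof (rule presents_isomorphic[OF f' g'])
  have ex: "cone_exact S dg D S' dg' D' f" using q by (simp add: quasi_iso_def)
  have f_in: "lext f p \<in> Lin {y \<in> S'. dg' y = m}" if "p \<in> Lin {x \<in> S. dg x = m}" for p m
    by (rule Lin_lext[OF that]) (use q in \<open>auto simp: quasi_iso_def\<close>)
  have ch: "lext D' (lext f p) = lext f (lext D p)" if "p \<in> Lin {x \<in> S. dg x = m}" for p m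
    unfolding lext_lext by (rule lext_cong_on[OF that]) (use q in \<open>auto simp: quasi_iso_def\<close>)
  fix x assume x: "x \<in> {p \<in> Lin {x \<in> S. dg x = n}. lext D p = 0}"
  then have x1: "x \<in> Lin {x \<in> S. dg x = n}" "lext D x = 0" by auto
  show "lext f x \<in> {p \<in> Lin {y \<in> S'. dg' y = n}. lext D' p = 0}" using f_in[OF x1(1)] ch[OF x1(1)] x1(2) by simp
  show "lext f x \<in> lext D' ` Lin {y \<in> S'. dg' y = Suc n} \<longleftrightarrow> x \<in> lext D ` Lin {x \<in> S. dg x = Suc n}"
  proof
    assume "lext f x \<in> lext D' ` Lin {y \<in> S'. dg' y = Suc n}"
    then obtain b where b: "b \<in> Lin {y \<in> S'. dg' y = Suc n}" "lext f x = lext D' b" by blast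
    have x2: "x \<in> Lin {x \<in> S. Suc (dg x) = Suc n}" using x1(1) by simp
    obtain a' b' where "a' \<in> Lin {x \<in> S. dg x = Suc n}" "lext D a' = x" by (rule cone_exactD[OF ex x2 b(1) x1(2) b(2)])
    then show "x \<in> lext D ` Lin {x \<in> S. dg x = Suc n}" by blast
  next
    assume "x \<in> lext D ` Lin {x \<in> S. dg x = Suc n}"
    then obtain y where y: "y \<in> Lin {x \<in> S. dg x = Suc n}" "x = lext D y" by blast
    show "lext f x \<in> lext D' ` Lin {y \<in> S'. dg' y = Suc n}" unfolding y(2) ch[OF y(1), symmetric] using f_in[OF y(1)] by blast
  qed
next
  have ex: "cone_exact S dg D S' dg' D' f" using q by (simp add: quasi_iso_def)
  fix y assume "y \<in> {p \<in> Lin {y \<in> S'. dg' y = n}. lext D' p = 0}"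
  then have y: "y \<in> Lin {y \<in> S'. dg' y = n}" "lext f 0 = lext D' y" by auto
  obtain a' b' where "a' \<in> Lin {x \<in> S. dg x = n}" "b' \<in> Lin {y \<in> S'. dg' y = Suc n}" "lext D a' = 0" "y = lext f a' + lext D' b'"
    by (rule cone_exactD[OF ex Lin_zero y(1) lext_zero y(2)])
  then show "\<exists>x\<in>{p \<in> Lin {x \<in> S. dg x = n}. lext D p = 0}. y - lext f x \<in> lext D' ` Lin {y \<in> S'. dg' y = Suc n}"
    by (intro bexI[of _ a']) auto
qed

section \<open>Tensor powers of a free module\<close>

lemma lext_swap: "lext (\<lambda>x. lext (\<lambda>y. f x y) q) p = lext (\<lambda>y. lext (\<lambda>x. f x y) p) q"
  unfolding lext_def cmul_sum cmul_cmul by (subst sum.swap) (simp add: mult.commute)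

lemma lext_if: "lext \<phi> (if c then a else b) = (if c then lext \<phi> a else lext \<phi> b)"
  by simp

lemma lext_fun_if: "lext (\<lambda>w. if c then f w else 0) p = (if c then lext f p else 0)"
  by simp

text \<open>Multilinear expansion of a tuple into words of basis elements. Elements of the algebra
  are plain functions, hence \<open>Abs_poly_mapping\<close>; those in the carrier are finitely
  supported and reach \<open>tens\<close> in the form \<open>lookup p\<close>.\<close>

primrec tens :: "('m \<Rightarrow> 'k::field) list \<Rightarrow> ('m list, 'k) chain" where
  "tens [] = bas []"
| "tens (a # as) = lext (\<lambda>x. pmap (Cons x) (tens as)) (Abs_poly_mapping a)"

lemma tens_Cons [simp]: "tens (lookup p # as) = lext (\<lambda>x. pmap (Cons x) (tens as)) p"
  by (simp add: lookup_inverse)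

declare tens.simps(2) [simp del]

lemma append_Cons_fun: "(@) (x # y) = (\<lambda>z. x # y @ z)"
  by auto

lemma tens_append: "tens (us @ ws) = lext (\<lambda>y. pmap ((@) y) (tens ws)) (tens us)"
proof (induction us)
  case Nil
  have "(@) [] = (\<lambda>x::'a list. x)" by auto
  then show ?case by simp
next
  case (Cons a us)
  then show ?case by (simp add: tens.simps(2) pmap_lext lext_lext lext_pmap pmap_pmap append_Cons_fun)
qed

lemma lookup_bas: "lookup (bas x) = delta x"
  by (auto simp: delta_def lookup_single when_def)

lemma tens_delta: "tens (map delta xs) = bas xs"
  by (induction xs) (simp_all add: lookup_bas[symmetric])

lemma represents_submodule:
  fixes V :: "('k::field, 'v) module"
  assumes V: "represents V \<beta> A" and U: "subspace_on U" "U \<subseteq> Lin A"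
  shows "submodule (\<beta> ` U) ring_of_type_algebra V"
proof -
  have b: "linear_into (Lin A) V \<beta>" "carrier V = \<beta> ` Lin A" using V by (auto simp: represents_def)
  note lin = linear_intoD[OF b(1)] and u = subspaceD[OF U(1)]
  show ?thesis
  proof (intro submodule.intro subgroup.intro submodule_axioms.intro)
    show "\<beta> ` U \<subseteq> carrier (add_monoid V)" using U(2) by (auto simp: b(2))
    show "x \<otimes>\<^bsub>add_monoid V\<^esub> y \<in> \<beta> ` U" if xy: "x \<in> \<beta> ` U" "y \<in> \<beta> ` U" for x y
    proof -
      obtain p q where p: "p \<in> U" "x = \<beta> p" and q: "q \<in> U" "y = \<beta> q" using xy by blast
      have "x \<otimes>\<^bsub>add_monoid V\<^esub> y = \<beta> (p + q)" using lin(1)[OF subsetD[OF U(2) p(1)] subsetD[OF U(2) q(1)]] p q by simp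
      then show ?thesis using u(2)[OF p(1) q(1)] by blast
    qed
    show "\<one>\<^bsub>add_monoid V\<^esub> \<in> \<beta> ` U" using lin(3) u(1) by (auto intro!: image_eqI[of _ _ 0])
    show "inv\<^bsub>add_monoid V\<^esub> x \<in> \<beta> ` U" if x: "x \<in> \<beta> ` U" for x
    proof -
      obtain p where p: "p \<in> U" "x = \<beta> p" using x by blast
      have "inv\<^bsub>add_monoid V\<^esub> x = \<beta> (- p)" using represents_uminus[OF V subsetD[OF U(2) p(1)]] p by (simp add: a_inv_def)
      then show ?thesis using u(4)[OF p(1)] by blast
    qed
    show "a \<odot>\<^bsub>V\<^esub> x \<in> \<beta> ` U" if x: "x \<in> \<beta> ` U" for a x
    proof -
      obtain p where p: "p \<in> U" "x = \<beta> p" using x by blast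
      have "a \<odot>\<^bsub>V\<^esub> x = \<beta> (cmul a p)" using lin(2)[OF subsetD[OF U(2) p(1)], of a] p by simp
      then show ?thesis using u(3)[OF p(1)] by blast
    qed
  qed
qed

lemma submodule_subspace:
  fixes V :: "('k::field, 'v) module"
  assumes V: "represents V \<beta> A" and W: "submodule W ring_of_type_algebra V"
  shows "subspace_on {p \<in> Lin A. \<beta> p \<in> W}"
proof -
  have b: "linear_into (Lin A) V \<beta>" using V by (auto simp: represents_def)
  note lin = linear_intoD[OF b]
  have g: "subgroup W (add_monoid V)" using W by (simp add: submodule_def)
  have s: "a \<odot>\<^bsub>V\<^esub> x \<in> W" if "x \<in> W" for a x
    by (rule submodule.smult_closed[OF W _ that]) (simp add: ring_of_type_algebra_def)
  show ?thesis
    using subgroup.one_closed[OF g] subgroup.m_closed[OF g] s lin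
    by (auto simp: subspace_on_def Lin_add Lin_cmul)
qed

text \<open>Only the vector space structure of \<open>B\<close> is fixed, with basis
  \<open>S\<close>. The product enters later, through the maps of tuples in
  \<open>tensor_map_trep\<close>.\<close>

locale free_tensor =
  fixes B :: "('k::field, 'm \<Rightarrow> 'k) module" and S :: "'m set"
  assumes carrier_B: "carrier B = lookup ` Lin S"
    and add_B: "lookup p \<oplus>\<^bsub>B\<^esub> lookup q = lookup (p + q)"
    and smult_B: "c \<odot>\<^bsub>B\<^esub> lookup p = lookup (cmul c p)"
begin

definition tuples :: "nat \<Rightarrow> ('m \<Rightarrow> 'k) list set" where "tuples n = {xs \<in> lists (carrier B). length xs = n}"
definition words :: "nat \<Rightarrow> 'm list set" where "words n = {xs \<in> lists S. length xs = n}"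

lemma B_cases:
  assumes "a \<in> carrier B" obtains p where "p \<in> Lin S" "a = lookup p"
  using assms by (auto simp: carrier_B)

lemma delta_B: "x \<in> S \<Longrightarrow> delta x \<in> carrier B"
  unfolding lookup_bas[symmetric] carrier_B by simp

lemma tens_in: "xs \<in> tuples n \<Longrightarrow> tens xs \<in> Lin (words n)"
proof (induction xs arbitrary: n)
  case Nil
  then show ?case by (auto simp: tuples_def words_def)
next
  case (Cons a xs)
  then obtain p where p: "p \<in> Lin S" "a = lookup p" by (auto simp: tuples_def elim!: B_cases)
  have n: "n = Suc (length xs)" "xs \<in> tuples (length xs)" using Cons.prems by (auto simp: tuples_def)
  show ?case
    unfolding p(2) tens_Cons
    by (rule Lin_lext[OF p(1)], rule Lin_pmap[OF Cons.IH[OF n(2)]]) (auto simp: words_def n(1))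
qed

lemma tens_add: "tens (us @ (lookup p \<oplus>\<^bsub>B\<^esub> lookup q) # ws) = tens (us @ lookup p # ws) + tens (us @ lookup q # ws)"
  by (simp add: add_B tens_append lext_add pmap_add lext_fun_add)

lemma tens_smult: "tens (us @ (c \<odot>\<^bsub>B\<^esub> lookup p) # ws) = cmul c (tens (us @ lookup p # ws))"
  by (simp add: smult_B tens_append lext_cmul pmap_cmul lext_fun_cmul)

definition tker :: "nat \<Rightarrow> (('m \<Rightarrow> 'k) list \<Rightarrow>\<^sub>0 'k) set" where
  "tker n = {p \<in> Lin (tuples n). lext tens p = 0}"

lemma gen_represents: "represents (tensor_gen B n) lookup (tuples n)"
  unfolding tensor_gen_def tuples_def by (rule represents_free)

text \<open>Expanding one factor at a time, every tuple is congruent to a combination of tuples of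
  basis vectors.\<close>

lemma expand_tuple:
  assumes W: "subspace_on W"
    and gen_add: "\<And>xs ys p q. xs \<in> lists (carrier B) \<Longrightarrow> ys \<in> lists (carrier B) \<Longrightarrow> length xs + length ys + 1 = n \<Longrightarrow>
      p \<in> Lin S \<Longrightarrow> q \<in> Lin S \<Longrightarrow>
      bas (xs @ lookup (p + q) # ys) - bas (xs @ lookup p # ys) - bas (xs @ lookup q # ys) \<in> W"
    and gen_smult: "\<And>xs ys p c. xs \<in> lists (carrier B) \<Longrightarrow> ys \<in> lists (carrier B) \<Longrightarrow> length xs + length ys + 1 = n \<Longrightarrow>
      p \<in> Lin S \<Longrightarrow> bas (xs @ lookup (cmul c p) # ys) - cmul c (bas (xs @ lookup p # ys)) \<in> W"
  shows "us \<in> lists (carrier B) \<Longrightarrow> ws \<in> lists (carrier B) \<Longrightarrow> length us + length ws = n \<Longrightarrow>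
    bas (us @ ws) - lext (\<lambda>ys. bas (us @ map delta ys)) (tens ws) \<in> W"
proof (induction ws arbitrary: us)
  case Nil
  then show ?case using subspaceD(1)[OF W] by simp
next
  case (Cons a ws)
  note w = subspaceD[OF W]
  have ws: "ws \<in> lists (carrier B)" and len: "length us + length ws + 1 = n" using Cons.prems by auto
  obtain p where p: "p \<in> Lin S" "a = lookup p" using Cons.prems by (auto elim: B_cases)
  have slot: "bas (us @ lookup p # ws) - lext (\<lambda>x. bas (us @ delta x # ws)) p \<in> W" using p(1)
  proof (induction rule: Lin_induct)
    case (add c x q)
    let ?b = "\<lambda>p. bas (us @ lookup p # ws) :: ('m \<Rightarrow> 'k) list \<Rightarrow>\<^sub>0 'k"
    have x: "bas x \<in> Lin S" "cmul c (bas x) \<in> Lin S" using add by (auto intro: Lin_cmul)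
    have "?b (cmul c (bas x) + q) - lext (\<lambda>x. bas (us @ delta x # ws)) (cmul c (bas x) + q) =
      (?b (cmul c (bas x) + q) - ?b (cmul c (bas x)) - ?b q) + (?b (cmul c (bas x)) - cmul c (?b (bas x)))
        + (?b q - lext (\<lambda>x. bas (us @ delta x # ws)) q)"
      by (simp add: lext_add lext_cmul lookup_bas)
    also have "\<dots> \<in> W"
      using gen_add[OF Cons.prems(1) ws len x(2) add(2)] gen_smult[OF Cons.prems(1) ws len x(1)] add(3)
      by (intro w(2))
    finally show ?case .
  next
    case bas
    \<comment> \<open>The relation for the scalar 0 says that a tuple with a zero entry lies in
      \<open>W\<close>.\<close>
    show ?case using gen_smult[OF Cons.prems(1) ws len Lin_zero, of 0] by (simp only: cmul_zero lext_zero)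
  qed
  have rest: "lext (\<lambda>x. bas (us @ delta x # ws) - lext (\<lambda>ys. bas (us @ map delta ys)) (pmap (Cons x) (tens ws))) p \<in> W" using p(1)
  proof (induction rule: Lin_induct)
    case (add c x q)
    have "bas ((us @ [delta x]) @ ws) - lext (\<lambda>ys. bas ((us @ [delta x]) @ map delta ys)) (tens ws) \<in> W"
      by (rule Cons.IH) (use Cons.prems delta_B[OF add(1)] in auto)
    then show ?case using add(3) by (simp add: lext_add lext_cmul lext_pmap w)
  qed (simp add: w)
  have "bas (us @ a # ws) - lext (\<lambda>ys. bas (us @ map delta ys)) (tens (a # ws)) =
    (bas (us @ lookup p # ws) - lext (\<lambda>x. bas (us @ delta x # ws)) p) +
    lext (\<lambda>x. bas (us @ delta x # ws) - lext (\<lambda>ys. bas (us @ map delta ys)) (pmap (Cons x) (tens ws))) p"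
    by (simp add: p(2) lext_fun_diff lext_lext)
  then show ?case using w(2)[OF slot rest] by simp
qed

text \<open>The relations span the kernel of the expansion \<open>tens\<close>. The generators
  expand to 0. Conversely, modulo a submodule that contains them every tuple is congruent to its
  expansion, so a chain with zero expansion belongs to that submodule.\<close>

lemma tensor_rel_eq: "tensor_rel B n = lookup ` tker n"
proof -
  note r = gen_represents[of n]
  define gens where "gens =
     ({(\<lambda>z. delta (xs @ (a \<oplus>\<^bsub>B\<^esub> b) # ys) z - delta (xs @ a # ys) z - delta (xs @ b # ys) z) |xs ys a b.
         xs \<in> lists (carrier B) \<and> ys \<in> lists (carrier B) \<and> length xs + length ys + 1 = n \<and>
         a \<in> carrier B \<and> b \<in> carrier B} \<union>
      {(\<lambda>z. delta (xs @ (k \<odot>\<^bsub>B\<^esub> a) # ys) z - k * delta (xs @ a # ys) z) |xs ys a k.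
         xs \<in> lists (carrier B) \<and> ys \<in> lists (carrier B) \<and> length xs + length ys + 1 = n \<and>
         a \<in> carrier B} :: (('m \<Rightarrow> 'k) list \<Rightarrow> 'k) set)"
  have e1: "(\<lambda>z. delta x z - delta y z - delta w z) = lookup (bas x - bas y - bas w :: ('m \<Rightarrow> 'k) list \<Rightarrow>\<^sub>0 'k)" for x y w
    by (rule ext) (simp add: lookup_minus lookup_bas)
  have e2: "(\<lambda>z. delta x z - k * delta y z) = lookup (bas x - cmul k (bas y) :: ('m \<Rightarrow> 'k) list \<Rightarrow>\<^sub>0 'k)" for x y k
    by (rule ext) (simp add: lookup_minus lookup_bas)
  have st: "subspace_on (tker n)" unfolding tker_def by (rule subspace_cycles)
  have car: "lookup p \<in> carrier B" if "p \<in> Lin S" for p using that by (simp add: carrier_B)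
  have in_t: "xs @ a # ys \<in> tuples n"
    if "xs \<in> lists (carrier B)" "ys \<in> lists (carrier B)" "length xs + length ys + 1 = n" "a \<in> carrier B" for xs ys a
    using that by (auto simp: tuples_def)
  have rel: "tensor_rel B n = \<Inter>{W. submodule W ring_of_type_algebra (tensor_gen B n) \<and> gens \<subseteq> W}"
    unfolding tensor_rel_def submodule_span_def gens_def ..
  have "gens \<subseteq> lookup ` tker n"
  proof
    fix g assume "g \<in> gens"
    then consider xs ys a b where "g = (\<lambda>z. delta (xs @ (a \<oplus>\<^bsub>B\<^esub> b) # ys) z - delta (xs @ a # ys) z - delta (xs @ b # ys) z)"
        "xs \<in> lists (carrier B)" "ys \<in> lists (carrier B)" "length xs + length ys + 1 = n" "a \<in> carrier B" "b \<in> carrier B"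
      | xs ys a k where "g = (\<lambda>z. delta (xs @ (k \<odot>\<^bsub>B\<^esub> a) # ys) z - k * delta (xs @ a # ys) z)"
        "xs \<in> lists (carrier B)" "ys \<in> lists (carrier B)" "length xs + length ys + 1 = n" "a \<in> carrier B"
      unfolding gens_def by blast
    then show "g \<in> lookup ` tker n"
    proof cases
      case 1
      obtain p q where p: "p \<in> Lin S" "a = lookup p" and q: "q \<in> Lin S" "b = lookup q"
        using 1 by (auto elim!: B_cases)
      have s: "a \<oplus>\<^bsub>B\<^esub> b \<in> carrier B" unfolding p(2) q(2) add_B by (rule car[OF Lin_add[OF p(1) q(1)]])
      show ?thesis
        unfolding 1(1) e1 using in_t[OF 1(2-4) s] in_t[OF 1(2-5)] in_t[OF 1(2-4,6)]
        by (intro imageI) (simp add: tker_def Lin_diff lext_diff tens_add p(2) q(2))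
    next
      case 2
      obtain p where p: "p \<in> Lin S" "a = lookup p" using 2 by (auto elim!: B_cases)
      have s: "k \<odot>\<^bsub>B\<^esub> a \<in> carrier B" unfolding p(2) smult_B by (rule car[OF Lin_cmul[OF p(1)]])
      show ?thesis
        unfolding 2(1) e2 using in_t[OF 2(2-4) s] in_t[OF 2(2-5)]
        by (intro imageI) (simp add: tker_def Lin_diff Lin_cmul lext_diff lext_cmul tens_smult p(2))
    qed
  qed
  moreover have "submodule (lookup ` tker n) ring_of_type_algebra (tensor_gen B n)"
    by (rule represents_submodule[OF r st]) (auto simp: tker_def)
  ultimately have 1: "tensor_rel B n \<subseteq> lookup ` tker n" unfolding rel by blast
  have "lookup ` tker n \<subseteq> W" if W: "submodule W ring_of_type_algebra (tensor_gen B n)" "gens \<subseteq> W" for W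
  proof
    fix g assume "g \<in> lookup ` tker n"
    then obtain p where p: "p \<in> Lin (tuples n)" "lext tens p = 0" "g = lookup p" by (auto simp: tker_def)
    define P where "P = {p \<in> Lin (tuples n). lookup p \<in> W}"
    have sP: "subspace_on P" unfolding P_def by (rule submodule_subspace[OF r W(1)])
    have ex: "bas xs - lext (\<lambda>ys. bas (map delta ys)) (tens xs) \<in> P" if "xs \<in> tuples n" for xs
    proof -
      have "bas ([] @ xs) - lext (\<lambda>ys. bas ([] @ map delta ys)) (tens xs) \<in> P"
      proof (rule expand_tuple[OF sP, where n = n])
        fix xs ys :: "('m \<Rightarrow> 'k) list" and p q :: "'m \<Rightarrow>\<^sub>0 'k" assume a: "xs \<in> lists (carrier B)" "ys \<in> lists (carrier B)" "length xs + length ys + 1 = n"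
          "p \<in> Lin S" "q \<in> Lin S"
        have "lookup (bas (xs @ lookup (p + q) # ys) - bas (xs @ lookup p # ys) - bas (xs @ lookup q # ys)) \<in> gens"
          unfolding gens_def e1[symmetric] add_B[symmetric] using a car by blast
        then show "bas (xs @ lookup (p + q) # ys) - bas (xs @ lookup p # ys) - bas (xs @ lookup q # ys) \<in> P"
          using W(2) in_t[OF a(1-3)] car[OF a(4)] car[OF a(5)] car[OF Lin_add[OF a(4,5)]]
          by (auto simp: P_def intro!: Lin_diff)
      next
        fix xs ys :: "('m \<Rightarrow> 'k) list" and p :: "'m \<Rightarrow>\<^sub>0 'k" and c :: 'k assume a: "xs \<in> lists (carrier B)" "ys \<in> lists (carrier B)" "length xs + length ys + 1 = n" "p \<in> Lin S"
        have "lookup (bas (xs @ lookup (cmul c p) # ys) - cmul c (bas (xs @ lookup p # ys))) \<in> gens"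
          unfolding gens_def e2[symmetric] smult_B[symmetric] using a car by blast
        then show "bas (xs @ lookup (cmul c p) # ys) - cmul c (bas (xs @ lookup p # ys)) \<in> P"
          using W(2) in_t[OF a(1-3)] car[OF a(4)] car[OF Lin_cmul[OF a(4)]]
          by (auto simp: P_def intro!: Lin_diff Lin_cmul)
      qed (use that in \<open>auto simp: tuples_def\<close>)
      then show ?thesis by simp
    qed
    have "p - lext (\<lambda>ys. bas (map delta ys)) (lext tens p) \<in> P" using p(1)
    proof (induction rule: Lin_induct)
      case (add c x q)
      have "cmul c (bas x - lext (\<lambda>ys. bas (map delta ys)) (tens x)) + (q - lext (\<lambda>ys. bas (map delta ys)) (lext tens q)) \<in> P"
        using subspaceD(2,3)[OF sP] ex[OF add(1)] add(3) by blast
      then show ?case by (simp add: lext_lin cmul_diff algebra_simps)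
    qed (simp add: subspaceD[OF sP])
    then show "g \<in> W" using p by (simp add: P_def)
  qed
  then have "lookup ` tker n \<subseteq> tensor_rel B n" unfolding rel by blast
  with 1 show ?thesis by blast
qed

definition tcos :: "nat \<Rightarrow> (('m \<Rightarrow> 'k) list \<Rightarrow>\<^sub>0 'k) \<Rightarrow> (('m \<Rightarrow> 'k) list \<Rightarrow> 'k) set" where
  "tcos n p = tensor_rel B n +>\<^bsub>tensor_gen B n\<^esub> lookup p"

definition trep :: "nat \<Rightarrow> (('m list, 'k) chain) \<Rightarrow> (('m \<Rightarrow> 'k) list \<Rightarrow> 'k) set" where
  "trep n r = tcos n (pmap (map delta) r)"

lemma tker_subspace: "subspace_on (tker n)" "tker n \<subseteq> Lin (tuples n)"
  by (auto simp: tker_def subspace_cycles)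

lemma tensor_presents: "presents (tensor_power B n) (tcos n) (Lin (tuples n)) (tker n)"
  unfolding tensor_power_def tcos_def
  by (rule quotient_presents[where E = "Lin (tuples n)"])
    (use gen_represents[of n] in \<open>auto simp: represents_def subspace_Lin tker_subspace tensor_rel_eq dest: subsetD[OF tker_subspace(2)]\<close>)

lemma map_delta_tuples: "xs \<in> words n \<Longrightarrow> map delta xs \<in> tuples n"
  using delta_B by (auto simp: words_def tuples_def)

lemma lext_tens_in: "p \<in> Lin (tuples n) \<Longrightarrow> lext tens p \<in> Lin (words n)"
  by (rule Lin_lext[OF _ tens_in])

lemma tensor_power_represents:
  fixes p :: "('m \<Rightarrow> 'k) list \<Rightarrow>\<^sub>0 'k" and r :: "('m list, 'k) chain"
  shows "represents (tensor_power B n) (trep n) (words n)"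
    and "p \<in> Lin (tuples n) \<Longrightarrow> tcos n p = trep n (lext tens p)"
    and "r \<in> Lin (words n) \<Longrightarrow> pmap (map delta) r \<in> Lin (tuples n) \<and> lext tens (pmap (map delta) r) = r"
proof -
  note * = presents_represents[OF tensor_presents, where \<theta> = tens and A = "words n" and s = "map delta"]
  show "represents (tensor_power B n) (trep n) (words n)"
    unfolding trep_def[abs_def] by (rule *(1)) (auto simp: lext_tens_in tker_def map_delta_tuples tens_delta)
  show "p \<in> Lin (tuples n) \<Longrightarrow> tcos n p = trep n (lext tens p)"
    unfolding trep_def by (rule *(2)) (auto simp: lext_tens_in tker_def map_delta_tuples tens_delta)
  show "r \<in> Lin (words n) \<Longrightarrow> pmap (map delta) r \<in> Lin (tuples n) \<and> lext tens (pmap (map delta) r) = r"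
    by (rule *(3)) (auto simp: lext_tens_in tker_def map_delta_tuples tens_delta)
qed

text \<open>\<open>tensor_map\<close> is a union over all members of a coset. Every member expands
  to the same \<open>r\<close>, and \<open>\<phi>\<close> acts on expansions as \<open>F\<close>, so
  all members contribute the same coset.\<close>

lemma tensor_map_trep:
  assumes \<phi>: "\<And>xs. xs \<in> tuples n \<Longrightarrow> \<phi> xs \<in> tuples m" "\<And>xs. xs \<in> tuples n \<Longrightarrow> tens (\<phi> xs) = lext F (tens xs)"
    and r: "r \<in> Lin (words n)"
  shows "tensor_map B m \<phi> (trep n r) = trep m (lext F r)"
proof -
  define p :: "('m \<Rightarrow> 'k) list \<Rightarrow>\<^sub>0 'k" where "p = pmap (map delta) r"
  have p: "p \<in> Lin (tuples n)" "lext tens p = r" using tensor_power_represents(3)[OF r] by (auto simp: p_def)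
  have lin: "linear_into (Lin (tuples n)) (tensor_gen B n) lookup" using gen_represents[of n] by (simp add: represents_def)
  have "trep n r = (\<lambda>q. lookup (q + p)) ` tker n"
    unfolding trep_def tcos_def p_def[symmetric] tensor_rel_eq by (rule quotient_coset[OF lin tker_subspace(2) p(1)])
  moreover have "tensor_rel B m +>\<^bsub>tensor_gen B m\<^esub> free_map \<phi> (lookup (q + p)) = trep m (lext F r)" if q: "q \<in> tker n" for q
  proof -
    have qp: "q + p \<in> Lin (tuples n)" using q p(1) by (auto simp: tker_def intro: Lin_add)
    have im: "pmap \<phi> (q + p) \<in> Lin (tuples m)" by (rule Lin_pmap[OF qp \<phi>(1)])
    have "lext tens (pmap \<phi> (q + p)) = lext (\<lambda>xs. lext F (tens xs)) (q + p)"
      unfolding lext_pmap by (rule lext_cong_on[OF qp \<phi>(2)])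
    also have "\<dots> = lext F (lext tens (q + p))" by (simp add: lext_lext)
    also have "lext tens (q + p) = r" using q p(2) by (simp add: tker_def lext_add)
    finally show ?thesis
      unfolding free_map_lookup using tensor_power_represents(2)[OF im] by (simp add: tcos_def)
  qed
  moreover have "tker n \<noteq> {}" using subspaceD(1)[OF tker_subspace(1)] by blast
  ultimately show ?thesis unfolding tensor_map_def coset_map_def by auto
qed

end

section \<open>Hochschild chains of a groupoid algebra\<close>

lemma free_tensor_algebra: "free_tensor (groupoid_algebra G :: ('k::field, 'm \<Rightarrow> 'k) module) (mors G)"
proof
  have "carrier (free_module (mors G) :: ('k, 'm \<Rightarrow> 'k) module) = lookup ` Lin (mors G)"
    using represents_free[of "mors G"] unfolding represents_def by blast
  then show "carrier (groupoid_algebra G :: ('k, 'm \<Rightarrow> 'k) module) = lookup ` Lin (mors G)"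
    by (simp add: groupoid_algebra_def)
qed (auto simp: groupoid_algebra_def free_module_def lookup_add)

definition pmul :: "('o, 'm) groupoid_data \<Rightarrow> ('m \<Rightarrow>\<^sub>0 'k::field) \<Rightarrow> ('m \<Rightarrow>\<^sub>0 'k) \<Rightarrow> 'm \<Rightarrow>\<^sub>0 'k" where
  "pmul G p q = lext (\<lambda>x. lext (\<lambda>y. if src G x = tgt G y then bas (comp_mor G x y) else 0) q) p"

lemma mult_algebra: "lookup p \<otimes>\<^bsub>groupoid_algebra G\<^esub> lookup q = lookup (pmul G p q)"
proof
  fix m
  let ?P = "\<lambda>z. src G (fst z) = tgt G (snd z) \<and> comp_mor G (fst z) (snd z) = m"
  let ?K = "Poly_Mapping.keys p \<times> Poly_Mapping.keys q"
  have "lookup (pmul G p q) m = (\<Sum>x\<in>Poly_Mapping.keys p. \<Sum>y\<in>Poly_Mapping.keys q.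
      if src G x = tgt G y \<and> comp_mor G x y = m then lookup p x * lookup q y else 0)"
    unfolding pmul_def lookup_lext sum_distrib_left by (intro sum.cong refl) (auto simp: lookup_single when_def)
  also have "\<dots> = (\<Sum>z\<in>?K. if ?P z then lookup p (fst z) * lookup q (snd z) else 0)"
    by (simp add: sum.cartesian_product case_prod_unfold)
  also have "\<dots> = (\<Sum>z | z \<in> ?K \<and> ?P z. lookup p (fst z) * lookup q (snd z))"
    by (simp add: sum.inter_filter)
  also have "\<dots> = (lookup p \<otimes>\<^bsub>groupoid_algebra G\<^esub> lookup q) m"
    by (simp add: groupoid_algebra_def) (intro sum.cong; auto simp: in_keys_iff)
  finally show "(lookup p \<otimes>\<^bsub>groupoid_algebra G\<^esub> lookup q) m = lookup (pmul G p q) m" ..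
qed

lemma gface_mid: "length y = i \<Longrightarrow> gface G i (y @ x # x' # w) = (if src G x = tgt G x' then bas (y @ comp_mor G x x' # w) else 0)"
  by (auto simp: gface_def face_list_def nxt_def ldg_def nth_append)

text \<open>The face index \<open>i\<close> addresses a position in a word, so the prefix
  \<open>us\<close> must expand into words of length exactly \<open>i\<close>.\<close>

lemma tens_mult:
  assumes us: "tens us \<in> Lin {y. length y = i}"
  shows "tens (us @ lookup (pmul G p q) # vs) = lext (gface G i) (tens (us @ lookup p # lookup q # vs))"
proof -
  let ?T = "tens vs"
  let ?M = "\<lambda>y. lext (\<lambda>x. lext (\<lambda>x'. if src G x = tgt G x' then lext (\<lambda>w. bas (y @ comp_mor G x x' # w)) ?T else 0) q) p"
  have "tens (us @ lookup (pmul G p q) # vs) = lext ?M (tens us)"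
    by (simp add: tens_append pmul_def pmap_def lext_lext lext_if cong: if_cong)
  also have "\<dots> = lext (\<lambda>y. lext (gface G i) (pmap ((@) y) (tens (lookup p # lookup q # vs)))) (tens us)"
    by (rule lext_cong_on[OF us]) (simp add: pmap_def lext_lext gface_mid lext_fun_if)
  also have "\<dots> = lext (gface G i) (tens (us @ lookup p # lookup q # vs))"
    unfolding tens_append[of us] lext_lext ..
  finally show ?thesis .
qed

context groupoid
begin

abbreviation alg :: "('k::field, 'm \<Rightarrow> 'k) module" where "alg \<equiv> groupoid_algebra G"

lemma pmul_in: "p \<in> Lin (mors G) \<Longrightarrow> q \<in> Lin (mors G) \<Longrightarrow> pmul G p q \<in> Lin (mors G)"
  unfolding pmul_def by (erule Lin_lext, erule Lin_lext) (auto simp: comp_closed)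

lemma hoch_face_tens:
  fixes xs :: "('m \<Rightarrow> 'k::field) list"
  assumes xs: "xs \<in> free_tensor.tuples alg (Suc n)" and i: "i < n"
  shows "hoch_face_tuple alg n i xs \<in> free_tensor.tuples alg n \<and> tens (hoch_face_tuple alg n i xs) = lext (gface G i) (tens xs)"
proof -
  interpret T: free_tensor "alg :: ('k, 'm \<Rightarrow> 'k) module" "mors G" by (rule free_tensor_algebra)
  have x: "set xs \<subseteq> carrier alg" "length xs = Suc n" using xs by (auto simp: T.tuples_def)
  have e: "xs = take i xs @ xs ! i # xs ! Suc i # drop (i + 2) xs"
    using id_take_nth_drop[of i xs] Cons_nth_drop_Suc[of "Suc i" xs] x(2) i by simp
  have "xs ! i \<in> carrier alg" "xs ! Suc i \<in> carrier alg" using x i nth_mem[of i xs] nth_mem[of "Suc i" xs] by auto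
  then obtain p q where p: "p \<in> Lin (mors G)" "xs ! i = lookup p" and q: "q \<in> Lin (mors G)" "xs ! Suc i = lookup q"
    by (auto simp: T.carrier_B)
  have f: "hoch_face_tuple alg n i xs = take i xs @ lookup (pmul G p q) # drop (i + 2) xs"
    using i by (simp add: hoch_face_tuple_def p(2) q(2) mult_algebra)
  have us: "take i xs \<in> T.tuples i" using x i by (auto simp: T.tuples_def dest: in_set_takeD)
  have "tens (take i xs) \<in> Lin {y. length y = i}"
    by (rule Lin_mono[OF T.tens_in[OF us]]) (auto simp: T.words_def)
  from tens_mult[OF this, of G p q "drop (i + 2) xs"]
  have "tens (hoch_face_tuple alg n i xs) = lext (gface G i) (tens xs)"
    unfolding f p(2)[symmetric] q(2)[symmetric] e[symmetric] .
  moreover have "hoch_face_tuple alg n i xs \<in> T.tuples n"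
    unfolding f using x i pmul_in[OF p(1) q(1)] by (auto simp: T.tuples_def T.carrier_B[symmetric] dest: in_set_takeD in_set_dropD) (auto simp: T.carrier_B)
  ultimately show ?thesis by blast
qed

lemma tens_rot:
  fixes xs :: "('m \<Rightarrow> 'k::field) list"
  assumes xs: "xs \<in> free_tensor.tuples alg (Suc n)"
  shows "last xs # butlast xs \<in> free_tensor.tuples alg (Suc n) \<and>
    tens (last xs # butlast xs) = lext (\<lambda>y. bas (cycl y)) (tens xs)"
proof -
  interpret T: free_tensor "alg :: ('k, 'm \<Rightarrow> 'k) module" "mors G" by (rule free_tensor_algebra)
  have ne: "xs \<noteq> []" using xs by (auto simp: T.tuples_def)
  then obtain us a where e: "xs = us @ [a]" by (cases xs rule: rev_cases) auto
  obtain p where p: "p \<in> Lin (mors G)" "a = lookup p" using xs by (auto simp: T.tuples_def e T.carrier_B)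
  have "tens (lookup p # us) = lext (\<lambda>y. bas (cycl y)) (tens (us @ [lookup p]))"
    by (simp add: tens_append pmap_def lext_lext rot_def) (rule lext_swap)
  then show ?thesis using xs by (auto simp: T.tuples_def e p(2))
qed

lemma words_eq: "free_tensor.words (mors G) (Suc n) = {xs \<in> cells. ldg xs = n}"
proof -
  interpret T: free_tensor "alg :: ('k::field, 'm \<Rightarrow> 'k) module" "mors G" by (rule free_tensor_algebra)
  show ?thesis by (auto simp: T.words_def nelists_def ldg_def)
qed

text \<open>The last face is face 0 after a rotation, both for tuples of algebra elements and for
  words; this reduces it to \<open>hoch_face_tens\<close>.\<close>

lemma hoch_face_tens_last:
  fixes xs :: "('m \<Rightarrow> 'k::field) list"
  assumes xs: "xs \<in> free_tensor.tuples alg (Suc n)" and n: "0 < n"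
  shows "hoch_face_tuple alg n n xs \<in> free_tensor.tuples alg n \<and> tens (hoch_face_tuple alg n n xs) = lext (gface G n) (tens xs)"
proof -
  interpret T: free_tensor "alg :: ('k, 'm \<Rightarrow> 'k) module" "mors G" by (rule free_tensor_algebra)
  have len: "length xs = Suc n" using xs by (simp add: T.tuples_def)
  have "tl (butlast xs) = butlast (tl xs)" by (simp add: butlast_tl)
  moreover have "butlast xs ! 0 = hd xs" using len n by (cases xs) (auto simp: nth_butlast)
  ultimately have e: "hoch_face_tuple alg n n xs = hoch_face_tuple alg n 0 (last xs # butlast xs)"
    using n by (simp add: hoch_face_tuple_def drop_Suc)
  have t: "tens xs \<in> Lin {xs \<in> cells. ldg xs = n}" using T.tens_in[OF xs] by (simp add: words_eq)
  have "lext (gface G 0) (lext (\<lambda>y. bas (cycl y)) (tens xs)) = lext (gface G n) (tens xs)"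
    unfolding lext_lext lext_bas by (rule lext_cong_on[OF t]) (use n gface_0_rot in auto)
  then show ?thesis
    unfolding e using hoch_face_tens[OF conjunct1[OF tens_rot[OF xs]] n] tens_rot[OF xs] by simp
qed

abbreviation hrep :: "nat \<Rightarrow> (('m list, 'k::field) chain) \<Rightarrow> (('m \<Rightarrow> 'k) list \<Rightarrow> 'k) set" where
  "hrep n \<equiv> free_tensor.trep alg (Suc n)"

abbreviation nerve :: "nat \<Rightarrow> 'm list set" where "nerve n \<equiv> {xs \<in> cells. ldg xs = n}"

lemma hoch_represents: "represents (hoch_chain (alg :: ('k::field, 'm \<Rightarrow> 'k) module) n) (hrep n) (nerve n)"
  unfolding hoch_chain_def words_eq[symmetric] by (rule free_tensor.tensor_power_represents(1)[OF free_tensor_algebra])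

lemma hoch_face_hrep:
  assumes r: "r \<in> Lin (nerve (Suc n))" and i: "i \<le> Suc n"
  shows "lext (gface G i) r \<in> Lin (nerve n) \<and> hoch_face (alg :: ('k::field, 'm \<Rightarrow> 'k) module) (Suc n) i (hrep (Suc n) r) = hrep n (lext (gface G i) r)"
proof
  interpret S: cyclic_basis cells ldg "gface G :: nat \<Rightarrow> 'm list \<Rightarrow> ('m list, 'k) chain" cycl by (rule nerve_cyclic_basis)
  show "lext (gface G i) r \<in> Lin (nerve n)"
  proof (rule Lin_lext[OF r])
    fix x assume x: "x \<in> nerve (Suc n)"
    show "(gface G i x :: ('m list, 'k) chain) \<in> Lin (nerve n)"
      by (rule Lin_mono[OF S.face_in[of x i]]) (use x i in auto)
  qed
  have r': "r \<in> Lin (free_tensor.words (mors G) (Suc (Suc n)))" using r by (simp add: words_eq)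
  show "hoch_face alg (Suc n) i (hrep (Suc n) r) = hrep n (lext (gface G i) r)"
    unfolding hoch_face_def
  proof (rule free_tensor.tensor_map_trep[OF free_tensor_algebra _ _ r'])
    fix xs :: "('m \<Rightarrow> 'k) list" assume xs: "xs \<in> free_tensor.tuples alg (Suc (Suc n))"
    show "hoch_face_tuple alg (Suc n) i xs \<in> free_tensor.tuples alg (Suc n)"
      "tens (hoch_face_tuple alg (Suc n) i xs) = lext (gface G i) (tens xs)"
      using hoch_face_tens[OF xs, of i] hoch_face_tens_last[OF xs] i by (cases "i = Suc n"; simp)+
  qed
qed

lemma hoch_cyc_hrep:
  assumes r: "r \<in> Lin (nerve n)"
  shows "hoch_cyc (alg :: ('k::field, 'm \<Rightarrow> 'k) module) n (hrep n r) = hrep n (pmap cycl r)"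
proof -
  have r': "r \<in> Lin (free_tensor.words (mors G) (Suc n))" using r by (simp add: words_eq)
  show ?thesis
    unfolding hoch_cyc_def pmap_def
    by (rule free_tensor.tensor_map_trep[OF free_tensor_algebra _ _ r']) (use tens_rot in auto)
qed

lemma lext_gb:
  fixes r :: "('m list, 'k::field) chain"
  assumes r: "r \<in> Lin (nerve (Suc n))"
  shows "lext gb r = (\<Sum>i\<le>Suc n. cmul ((-1) ^ i) (lext (gface G i) r))"
    and "lext gb' r = (\<Sum>i<Suc n. cmul ((-1) ^ i) (lext (gface G i) r))"
proof -
  interpret S: cyclic_basis cells ldg "gface G :: nat \<Rightarrow> 'm list \<Rightarrow> ('m list, 'k) chain" cycl by (rule nerve_cyclic_basis)
  show "lext gb r = (\<Sum>i\<le>Suc n. cmul ((-1) ^ i) (lext (gface G i) r))"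
    unfolding lext_fun_cmul[symmetric] lext_fun_sum[symmetric] by (rule lext_cong_on[OF r]) (simp add: S.b_def)
  show "lext gb' r = (\<Sum>i<Suc n. cmul ((-1) ^ i) (lext (gface G i) r))"
    unfolding lext_fun_cmul[symmetric] lext_fun_sum[symmetric] by (rule lext_cong_on[OF r]) (simp add: S.b'_def)
qed

lemma face_sum_hrep:
  fixes r :: "('m list, 'k::field) chain"
  assumes r: "r \<in> Lin (nerve (Suc n))"
  shows "face_sum (hoch_chain alg) (hoch_face alg) (Suc n) (hrep (Suc n) r) = hrep n (lext gb r)"
    and "face_sum' (hoch_chain alg) (hoch_face alg) (Suc n) (hrep (Suc n) r) = hrep n (lext gb' r)"
proof -
  note * = face_sum_represents[where C = "hoch_chain alg" and \<delta> = "hoch_face alg" and \<beta> = hrep and A = nerve and n = "Suc n"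
    and F = "\<lambda>i. lext (gface G i)" and r = r]
  have "face_sum (hoch_chain alg) (hoch_face alg) (Suc n) (hrep (Suc n) r) = hrep (Suc n - 1) (\<Sum>i\<le>Suc n. cmul ((-1) ^ i) (lext (gface G i) r))"
    by (rule *(1)[OF hoch_represents r]) (use hoch_face_hrep[OF r] in simp)
  then show "face_sum (hoch_chain alg) (hoch_face alg) (Suc n) (hrep (Suc n) r) = hrep n (lext gb r)" unfolding lext_gb(1)[OF r] by simp
  have "face_sum' (hoch_chain alg) (hoch_face alg) (Suc n) (hrep (Suc n) r) = hrep (Suc n - 1) (\<Sum>i<Suc n. cmul ((-1) ^ i) (lext (gface G i) r))"
    by (rule *(2)[OF hoch_represents r]) (use hoch_face_hrep[OF r] in simp)
  then show "face_sum' (hoch_chain alg) (hoch_face alg) (Suc n) (hrep (Suc n) r) = hrep n (lext gb' r)" unfolding lext_gb(2)[OF r] by simp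
qed

lemma hochschild_presents:
  "\<exists>\<phi>. presents (hochschild_homology (alg :: ('k::field, 'm \<Rightarrow> 'k) module) n) \<phi>
     {p \<in> Lin {x \<in> cells. ldg x = n}. lext gb p = 0} (lext gb ` Lin {x \<in> cells. ldg x = Suc n})"
  unfolding hochschild_homology_def
proof (rule homology_presents[OF hoch_represents])
  interpret S: cyclic_basis cells ldg "gface G :: nat \<Rightarrow> 'm list \<Rightarrow> ('m list, 'k) chain" cycl by (rule nerve_cyclic_basis)
  fix m and r :: "('m list, 'k) chain" assume r: "r \<in> Lin (nerve (Suc m))"
  show "lext gb r \<in> Lin (nerve m) \<and> face_sum (hoch_chain alg) (hoch_face alg) (Suc m) (hrep (Suc m) r) = hrep m (lext gb r)"
    using S.lext_b_in[OF r] face_sum_hrep(1)[OF r] by simp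
next
  interpret S: cyclic_basis cells ldg "gface G :: nat \<Rightarrow> 'm list \<Rightarrow> ('m list, 'k) chain" cycl by (rule nerve_cyclic_basis)
  fix r :: "('m list, 'k) chain" assume r: "r \<in> Lin (nerve 0)"
  show "lext gb r = 0" by (rule lext_eqI[OF _ r]) (simp add: S.b_def)
qed

end

section \<open>The total complex\<close>

lemma direct_sum_represents:
  fixes V :: "nat \<Rightarrow> ('k::field, 'v) module" and \<beta> :: "nat \<Rightarrow> ('x \<Rightarrow>\<^sub>0 'k) \<Rightarrow> 'v"
  assumes V: "\<And>p. p \<le> n \<Longrightarrow> represents (V p) (\<beta> p) (A p)"
  shows "represents (direct_sum {..n} V) (\<lambda>r. \<lambda>p\<in>{..n}. \<beta> p (col p r)) {(p, x). p \<le> n \<and> x \<in> A p}"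
proof -
  let ?A = "{(p, x). p \<le> n \<and> x \<in> A p}"
  have b: "linear_into (Lin (A p)) (V p) (\<beta> p)" "carrier (V p) = \<beta> p ` Lin (A p)" "inj_on (\<beta> p) (Lin (A p))" if "p \<le> n" for p
    using V[OF that] by (auto simp: represents_def)
  have c: "col p r \<in> Lin (A p)" if "r \<in> Lin ?A" for p r
    by (rule Lin_mono[OF col_in[OF that]]) auto
  have cm: "col p (cmul c r) = cmul c (col p r)" for p c and r :: "nat \<times> 'c \<Rightarrow>\<^sub>0 'k"
    by (simp add: col_def lext_cmul)
  have dec: "(\<Sum>p\<le>n. pmap (Pair p) (col p r)) = r" if "r \<in> Lin ?A" for r
    unfolding Pair_col by (rule sum_part) (use that in \<open>auto simp: Lin_def\<close>)
  show ?thesis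
    unfolding represents_def linear_into_def
  proof (intro conjI ballI allI)
    show "carrier (direct_sum {..n} V) = (\<lambda>r. \<lambda>p\<in>{..n}. \<beta> p (col p r)) ` Lin ?A"
    proof (intro equalityI subsetI)
      fix g assume "g \<in> carrier (direct_sum {..n} V)"
      then have g: "g \<in> (\<Pi>\<^sub>E i\<in>{..n}. carrier (V i))" by (simp add: direct_sum_def)
      have "\<forall>p. \<exists>x. p \<le> n \<longrightarrow> x \<in> Lin (A p) \<and> \<beta> p x = g p" using g b(2) by (fastforce simp: PiE_iff)
      then obtain x where "\<forall>p. p \<le> n \<longrightarrow> x p \<in> Lin (A p) \<and> \<beta> p (x p) = g p" by (rule choice[THEN exE])
      then have x: "x p \<in> Lin (A p)" "\<beta> p (x p) = g p" if "p \<le> n" for p using that by auto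
      define r where "r = (\<Sum>p\<le>n. pmap (Pair p) (x p))"
      have "col p r = (if p \<le> n then x p else 0)" for p
        by (simp add: r_def col_def lext_sum) (simp add: col_Pair flip: col_def)
      then have "(\<lambda>p\<in>{..n}. \<beta> p (col p r)) = g"
        using g x(2) by (auto simp: fun_eq_iff PiE_def extensional_def)
      moreover have "r \<in> Lin ?A"
        unfolding r_def
      proof (rule Lin_sum)
        fix p assume "p \<in> {..n}"
        then show "pmap (Pair p) (x p) \<in> Lin ?A" by (intro Lin_pmap[OF x(1)]) auto
      qed
      ultimately show "g \<in> (\<lambda>r. \<lambda>p\<in>{..n}. \<beta> p (col p r)) ` Lin ?A" by blast
    next
      fix g assume "g \<in> (\<lambda>r. \<lambda>p\<in>{..n}. \<beta> p (col p r)) ` Lin ?A"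
      then obtain r where r: "r \<in> Lin ?A" "g = (\<lambda>p\<in>{..n}. \<beta> p (col p r))" by blast
      have "\<beta> p (col p r) \<in> carrier (V p)" if "p \<le> n" for p using c[OF r(1)] b(2)[OF that] by blast
      then show "g \<in> carrier (direct_sum {..n} V)" by (simp add: direct_sum_def r(2) restrict_PiE_iff)
    qed
    show "inj_on (\<lambda>r. \<lambda>p\<in>{..n}. \<beta> p (col p r)) (Lin ?A)"
    proof (rule inj_onI)
      fix r s assume r: "r \<in> Lin ?A" and s: "s \<in> Lin ?A"
        and eq: "(\<lambda>p\<in>{..n}. \<beta> p (col p r)) = (\<lambda>p\<in>{..n}. \<beta> p (col p s))"
      have "col p r = col p s" if "p \<le> n" for p
        by (rule inj_onD[OF b(3)[OF that] _ c[OF r] c[OF s]]) (use fun_cong[OF eq, of p] that in simp)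
      then have "(\<Sum>p\<le>n. pmap (Pair p) (col p r)) = (\<Sum>p\<le>n. pmap (Pair p) (col p s))" by simp
      then show "r = s" by (simp only: dec[OF r] dec[OF s])
    qed
    fix r s :: "nat \<times> 'x \<Rightarrow>\<^sub>0 'k" assume r: "r \<in> Lin ?A"
    show "(\<lambda>p\<in>{..n}. \<beta> p (col p (cmul k r))) = k \<odot>\<^bsub>direct_sum {..n} V\<^esub> (\<lambda>p\<in>{..n}. \<beta> p (col p r))" for k
      using linear_intoD(2)[OF b(1) c[OF r]] by (auto simp: direct_sum_def cm intro!: restrict_ext)
    assume s: "s \<in> Lin ?A"
    show "(\<lambda>p\<in>{..n}. \<beta> p (col p (r + s))) = (\<lambda>p\<in>{..n}. \<beta> p (col p r)) \<oplus>\<^bsub>direct_sum {..n} V\<^esub> (\<lambda>p\<in>{..n}. \<beta> p (col p s))"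
      using linear_intoD(1)[OF b(1) c[OF r] c[OF s]] by (auto simp: direct_sum_def col_lin intro!: restrict_ext)
  next
    show "(\<lambda>p\<in>{..n}. \<beta> p (col p 0)) = \<zero>\<^bsub>direct_sum {..n} V\<^esub>"
      using linear_intoD(3)[OF b(1)] by (auto simp: direct_sum_def col_lin intro!: restrict_ext)
  qed
qed

context groupoid
begin

abbreviation totrep :: "nat \<Rightarrow> (nat \<times> 'm list \<Rightarrow>\<^sub>0 'k::field) \<Rightarrow> nat \<Rightarrow> (('m \<Rightarrow> 'k) list \<Rightarrow> 'k) set" where
  "totrep n r \<equiv> \<lambda>p\<in>{..n}. hrep (n - p) (col p r)"

lemma tot_index: "{z \<in> UNIV \<times> cells. gtdeg z = n} = {(p, x). p \<le> n \<and> x \<in> nerve (n - p)}"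
  \<comment> \<open>The degree does not involve the field; a concrete field is named only to
    instantiate the locale fact.\<close>
  using precyclic.tdeg_def[OF cyclic_basis.axioms(1)[OF nerve_cyclic_basis[where 'k = rat]]] by auto

lemma tot_represents:
  "represents (tot_chain (hoch_chain (alg :: ('k::field, 'm \<Rightarrow> 'k) module)) n) (totrep n) {z \<in> UNIV \<times> cells. gtdeg z = n}"
  unfolding tot_chain_def tot_index by (rule direct_sum_represents) (rule hoch_represents)

lemma signed_cyc_hrep:
  fixes c :: "('m list, 'k::field) chain"
  assumes c: "c \<in> Lin (nerve q)"
  shows "signed_cyc (hoch_chain alg) (hoch_cyc alg) q (hrep q c) = hrep q (lext (precyclic.t ldg cycl) c)"
    and "cyc_norm (hoch_chain alg) (hoch_cyc alg) q (hrep q c) = hrep q (lext (precyclic.N ldg cycl) c)"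
proof -
  interpret S: cyclic_basis cells ldg "gface G :: nat \<Rightarrow> 'm list \<Rightarrow> ('m list, 'k) chain" cycl by (rule nerve_cyclic_basis)
  have lin: "linear_into (Lin (nerve q)) (hoch_chain (alg :: ('k, 'm \<Rightarrow> 'k) module) q) (hrep q)"
    using hoch_represents[of q] unfolding represents_def by blast
  have s: "signed_cyc (hoch_chain alg) (hoch_cyc alg) q (hrep q c) = hrep q (lext S.t c)" if c: "c \<in> Lin (nerve q)" for c
  proof -
    have "pmap cycl c \<in> Lin (nerve q)" by (rule Lin_pmap[OF c]) (auto simp: S.tau_in S.dg_tau)
    then show ?thesis unfolding signed_cyc_def hoch_cyc_hrep[OF c] S.lext_t_eq[OF c] by (simp add: linear_intoD(2)[OF lin])
  qed
  show "signed_cyc (hoch_chain alg) (hoch_cyc alg) q (hrep q c) = hrep q (lext S.t c)" by (rule s[OF c])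
  have pow: "(signed_cyc (hoch_chain alg) (hoch_cyc alg) q ^^ i) (hrep q c) = hrep q ((lext S.t ^^ i) c)" for i
    by (induction i) (simp_all add: s[OF S.t_pow_in[OF c]])
  show "cyc_norm (hoch_chain alg) (hoch_cyc alg) q (hrep q c) = hrep q (lext S.N c)"
    unfolding cyc_norm_def S.lext_N[OF c]
    by (rule represents_finsum[OF hoch_represents]) (use S.t_pow_in[OF c] pow in auto)
qed

lemma tot_diff_totrep:
  fixes r :: "nat \<times> 'm list \<Rightarrow>\<^sub>0 'k::field"
  assumes r: "r \<in> Lin {z \<in> UNIV \<times> cells. gtdeg z = Suc m}"
  shows "tot_diff (hoch_chain alg) (hoch_face alg) (hoch_cyc alg) (Suc m) (totrep (Suc m) r) = totrep m (lext gtdiff r)"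
proof (rule ext)
  fix p
  interpret S: cyclic_basis cells ldg "gface G :: nat \<Rightarrow> 'm list \<Rightarrow> ('m list, 'k) chain" cycl by (rule nerve_cyclic_basis)
  show "tot_diff (hoch_chain alg) (hoch_face alg) (hoch_cyc alg) (Suc m) (totrep (Suc m) r) p = totrep m (lext gtdiff r) p"
  proof (cases "p \<le> m")
    case False
    \<comment> \<open>Beyond row and column range both sides are \<open>undefined\<close>, by the
      restriction to \<open>{..m}\<close>.\<close>
    then show ?thesis by (simp add: tot_diff_def)
  next
    case True
    define q where "q = m - p"
    have c: "col i r \<in> Lin (nerve (Suc m - i))" if "i \<le> Suc m" for i
      by (rule Lin_mono[OF col_in[OF r]]) (use that in \<open>auto simp: S.tdeg_def\<close>)
    have q: "Suc m - p = Suc q" "Suc m - Suc p = q" using True by (auto simp: q_def)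
    have a: "col p r \<in> Lin (nerve (Suc q))" and b: "col (Suc p) r \<in> Lin (nerve q)"
      using c[of p] c[of "Suc p"] True q by auto
    have rp: "represents (hoch_chain (alg :: ('k, 'm \<Rightarrow> 'k) module) q) (hrep q) (nerve q)" by (rule hoch_represents)
    have lin: "linear_into (Lin (nerve q)) (hoch_chain (alg :: ('k, 'm \<Rightarrow> 'k) module) q) (hrep q)"
      using rp unfolding represents_def by blast
    have v: "lext (S.vert p) (col p r) \<in> Lin (nerve q)" using S.vert_in[OF a] by simp
    have h: "lext (S.hor p) (col (Suc p) r) \<in> Lin (nerve q)" by (rule S.hor_in[OF b])
    have b'in: "lext S.b' (col p r) \<in> Lin (nerve q)" using S.lext_b'_in[OF a] by simp
    have tin: "lext S.t (col (Suc p) r) \<in> Lin (nerve q)" by (rule S.lext_t_in[OF b])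
    have 1: "(if even p then face_sum (hoch_chain alg) (hoch_face alg) (Suc q) (hrep (Suc q) (col p r))
        else \<ominus>\<^bsub>hoch_chain alg q\<^esub> face_sum' (hoch_chain alg) (hoch_face alg) (Suc q) (hrep (Suc q) (col p r))) = hrep q (lext (S.vert p) (col p r))"
      by (simp add: face_sum_hrep[OF a] S.lext_vert represents_uminus[OF rp b'in])
    have 2: "(if even p then hrep q (col (Suc p) r) \<ominus>\<^bsub>hoch_chain alg q\<^esub> signed_cyc (hoch_chain alg) (hoch_cyc alg) q (hrep q (col (Suc p) r))
        else cyc_norm (hoch_chain alg) (hoch_cyc alg) q (hrep q (col (Suc p) r))) = hrep q (lext (S.hor p) (col (Suc p) r))"
      using linear_intoD(1)[OF lin b Lin_uminus[OF tin]]
      by (simp add: signed_cyc_hrep[OF b] S.lext_hor a_minus_def represents_uminus[OF rp tin])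
    have "tot_diff (hoch_chain alg) (hoch_face alg) (hoch_cyc alg) (Suc m) (totrep (Suc m) r) p =
      hrep q (lext (S.vert p) (col p r)) \<oplus>\<^bsub>hoch_chain alg q\<^esub> hrep q (lext (S.hor p) (col (Suc p) r))"
      unfolding 1[symmetric] 2[symmetric] using True by (simp add: tot_diff_def Let_def q_def[symmetric] q del: diff_Suc_Suc)
    also have "\<dots> = hrep q (col p (lext gtdiff r))"
      unfolding S.col_tdiff by (rule linear_intoD(1)[OF lin v h, symmetric])
    finally show ?thesis using True by (simp add: q_def)
  qed
qed

lemma cyclic_presents:
  "\<exists>\<phi>. presents (cyclic_homology (alg :: ('k::field, 'm \<Rightarrow> 'k) module) n) \<phi>
     {p \<in> Lin {z \<in> UNIV \<times> cells. gtdeg z = n}. lext gtdiff p = 0}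
     (lext gtdiff ` Lin {z \<in> UNIV \<times> cells. gtdeg z = Suc n})"
  unfolding cyclic_homology_def
proof (rule homology_presents[OF tot_represents])
  interpret S: cyclic_basis cells ldg "gface G :: nat \<Rightarrow> 'm list \<Rightarrow> ('m list, 'k) chain" cycl by (rule nerve_cyclic_basis)
  have d: "lext gtdiff r \<in> Lin {z \<in> UNIV \<times> cells. Suc (gtdeg z) = m}"
    if "r \<in> Lin {z \<in> UNIV \<times> cells. gtdeg z = m}" for m and r :: "nat \<times> 'm list \<Rightarrow>\<^sub>0 'k"
  proof (rule Lin_lext[OF that])
    fix z assume z: "z \<in> {z \<in> UNIV \<times> cells. gtdeg z = m}"
    show "S.tdiff z \<in> Lin {z \<in> UNIV \<times> cells. Suc (gtdeg z) = m}"
      by (rule Lin_mono[OF S.tdiff_in[of z]]) (use z in auto)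
  qed
  fix m and r :: "nat \<times> 'm list \<Rightarrow>\<^sub>0 'k" assume r: "r \<in> Lin {z \<in> UNIV \<times> cells. gtdeg z = Suc m}"
  show "lext gtdiff r \<in> Lin {z \<in> UNIV \<times> cells. gtdeg z = m} \<and>
      tot_diff (hoch_chain alg) (hoch_face alg) (hoch_cyc alg) (Suc m) (totrep (Suc m) r) = totrep m (lext gtdiff r)"
    using d[OF r] tot_diff_totrep[OF r] by simp
next
  interpret S: cyclic_basis cells ldg "gface G :: nat \<Rightarrow> 'm list \<Rightarrow> ('m list, 'k) chain" cycl by (rule nerve_cyclic_basis)
  fix r :: "nat \<times> 'm list \<Rightarrow>\<^sub>0 'k" assume r: "r \<in> Lin {z \<in> UNIV \<times> cells. gtdeg z = 0}"
  have "S.tdiff z \<in> Lin {}" if "z \<in> {z \<in> UNIV \<times> cells. gtdeg z = 0}" for z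
    by (rule Lin_mono[OF S.tdiff_in[of z]]) (use that in auto)
  then show "lext gtdiff r = 0" by (intro lext_eqI[OF _ r]) simp
qed

end

section \<open>Rearranging direct sums\<close>

lemma vs_isomorphic_trans:
  assumes "vs_isomorphic U V" "vs_isomorphic V W"
  shows "vs_isomorphic U W"
proof -
  obtain f where f: "bij_betw f (carrier U) (carrier V)"
    "\<forall>x\<in>carrier U. \<forall>y\<in>carrier U. f (x \<oplus>\<^bsub>U\<^esub> y) = f x \<oplus>\<^bsub>V\<^esub> f y" "\<forall>k. \<forall>x\<in>carrier U. f (k \<odot>\<^bsub>U\<^esub> x) = k \<odot>\<^bsub>V\<^esub> f x"
    using assms(1) by (auto simp: vs_isomorphic_def)
  obtain g where g: "bij_betw g (carrier V) (carrier W)"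
    "\<forall>x\<in>carrier V. \<forall>y\<in>carrier V. g (x \<oplus>\<^bsub>V\<^esub> y) = g x \<oplus>\<^bsub>W\<^esub> g y" "\<forall>k. \<forall>x\<in>carrier V. g (k \<odot>\<^bsub>V\<^esub> x) = k \<odot>\<^bsub>W\<^esub> g x"
    using assms(2) by (auto simp: vs_isomorphic_def)
  have fV: "f x \<in> carrier V" if "x \<in> carrier U" for x by (rule bij_betwE[OF f(1), rule_format, OF that])
  show ?thesis
    unfolding vs_isomorphic_def
    by (intro exI[of _ "g \<circ> f"] conjI bij_betw_trans[OF f(1) g(1)]) (simp_all add: f g fV)
qed

text \<open>Since \<open>J\<close> is finite, the support condition of the inner sums is void, and a
  family on the pairs over \<open>C1\<close> has finite support exactly when only finitely many of
  its rows are nonzero.\<close>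

lemma direct_sum_flatten:
  fixes W :: "'c \<times> nat \<Rightarrow> ('k, 'v) module"
  assumes J: "finite J" "0 \<in> J" and dis: "C1 \<inter> C2 = {}" and I: "I = C1 \<times> J \<union> C2 \<times> {0}"
  shows "vs_isomorphic (direct_sum I W)
    (direct_sum2 (direct_sum C1 (\<lambda>c. direct_sum J (\<lambda>i. W (c, i)))) (direct_sum C2 (\<lambda>c. W (c, 0))))"
    (is "vs_isomorphic ?M ?M'")
proof -
  define f where "f g = ((\<lambda>c\<in>C1. \<lambda>i\<in>J. g (c, i)), (\<lambda>c\<in>C2. g (c, 0)))" for g :: "'c \<times> nat \<Rightarrow> 'v"
  define h where "h x = (\<lambda>z\<in>I. if fst z \<in> C1 then fst x (fst z) (snd z) else snd x (fst z))" for x :: "('c \<Rightarrow> nat \<Rightarrow> 'v) \<times> ('c \<Rightarrow> 'v)"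
  have zI: "z \<in> I \<longleftrightarrow> (fst z \<in> C1 \<and> snd z \<in> J) \<or> (fst z \<in> C2 \<and> snd z = 0)" for z by (cases z) (auto simp: I)
  have C: "c \<in> C2 \<Longrightarrow> c \<notin> C1" for c using dis by auto
  have car: "g \<in> carrier ?M \<longleftrightarrow> g \<in> (\<Pi>\<^sub>E z\<in>I. carrier (W z)) \<and> finite {z \<in> I. g z \<noteq> \<zero>\<^bsub>W z\<^esub>}" for g
    by (simp add: direct_sum_def)
  have car': "x \<in> carrier ?M' \<longleftrightarrow> (fst x \<in> (\<Pi>\<^sub>E c\<in>C1. \<Pi>\<^sub>E i\<in>J. carrier (W (c, i))) \<and> finite {c \<in> C1. fst x c \<noteq> (\<lambda>i\<in>J. \<zero>\<^bsub>W (c, i)\<^esub>)}) \<and>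
      snd x \<in> (\<Pi>\<^sub>E c\<in>C2. carrier (W (c, 0))) \<and> finite {c \<in> C2. snd x c \<noteq> \<zero>\<^bsub>W (c, 0)\<^esub>}" for x
    using J(1) by (cases x) (simp add: direct_sum2_def direct_sum_def)
  have f_in: "f g \<in> carrier ?M'" if g: "g \<in> carrier ?M" for g
  proof -
    have fin: "finite (fst ` {z \<in> I. g z \<noteq> \<zero>\<^bsub>W z\<^esub>})" using g by (simp add: car)
    have m: "g z \<in> carrier (W z)" if "z \<in> I" for z using g that by (auto simp: car)
    have "{c \<in> C1. fst (f g) c \<noteq> (\<lambda>i\<in>J. \<zero>\<^bsub>W (c, i)\<^esub>)} \<subseteq> fst ` {z \<in> I. g z \<noteq> \<zero>\<^bsub>W z\<^esub>}"
    proof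
      fix c assume "c \<in> {c \<in> C1. fst (f g) c \<noteq> (\<lambda>i\<in>J. \<zero>\<^bsub>W (c, i)\<^esub>)}"
      then have c: "c \<in> C1" "(\<lambda>i\<in>J. g (c, i)) \<noteq> (\<lambda>i\<in>J. \<zero>\<^bsub>W (c, i)\<^esub>)" by (auto simp: f_def)
      then obtain i where "i \<in> J" "g (c, i) \<noteq> \<zero>\<^bsub>W (c, i)\<^esub>" by (metis (no_types, lifting) restrict_ext)
      then show "c \<in> fst ` {z \<in> I. g z \<noteq> \<zero>\<^bsub>W z\<^esub>}" using c(1) by (intro image_eqI[of _ _ "(c, i)"]) (auto simp: zI)
    qed
    then have 1: "finite {c \<in> C1. fst (f g) c \<noteq> (\<lambda>i\<in>J. \<zero>\<^bsub>W (c, i)\<^esub>)}" by (rule finite_subset[OF _ fin])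
    have "{c \<in> C2. snd (f g) c \<noteq> \<zero>\<^bsub>W (c, 0)\<^esub>} \<subseteq> fst ` {z \<in> I. g z \<noteq> \<zero>\<^bsub>W z\<^esub>}"
    proof
      fix c assume "c \<in> {c \<in> C2. snd (f g) c \<noteq> \<zero>\<^bsub>W (c, 0)\<^esub>}"
      then show "c \<in> fst ` {z \<in> I. g z \<noteq> \<zero>\<^bsub>W z\<^esub>}" by (intro image_eqI[of _ _ "(c, 0)"]) (auto simp: zI f_def)
    qed
    then have 2: "finite {c \<in> C2. snd (f g) c \<noteq> \<zero>\<^bsub>W (c, 0)\<^esub>}" by (rule finite_subset[OF _ fin])
    show ?thesis
      unfolding car' using 1 2 by (auto simp: f_def restrict_PiE_iff m zI)
  qed
  have h_in: "h x \<in> carrier ?M" if x: "x \<in> carrier ?M'" for x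
  proof -
    have 1: "fst x c i \<in> carrier (W (c, i))" if "c \<in> C1" "i \<in> J" for c i
      using x that by (auto simp: car' PiE_iff)
    have 2: "snd x c \<in> carrier (W (c, 0))" if "c \<in> C2" for c
      using x that by (auto simp: car' PiE_iff)
    have "{z \<in> I. h x z \<noteq> \<zero>\<^bsub>W z\<^esub>} \<subseteq> {c \<in> C1. fst x c \<noteq> (\<lambda>i\<in>J. \<zero>\<^bsub>W (c, i)\<^esub>)} \<times> J \<union> {c \<in> C2. snd x c \<noteq> \<zero>\<^bsub>W (c, 0)\<^esub>} \<times> {0}"
    proof
      fix z assume z: "z \<in> {z \<in> I. h x z \<noteq> \<zero>\<^bsub>W z\<^esub>}"
      obtain c i where ci: "z = (c, i)" by (cases z)
      show "z \<in> {c \<in> C1. fst x c \<noteq> (\<lambda>i\<in>J. \<zero>\<^bsub>W (c, i)\<^esub>)} \<times> J \<union> {c \<in> C2. snd x c \<noteq> \<zero>\<^bsub>W (c, 0)\<^esub>} \<times> {0}"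
        using z C[of c] by (auto simp: ci zI h_def)
    qed
    moreover have "finite ({c \<in> C1. fst x c \<noteq> (\<lambda>i\<in>J. \<zero>\<^bsub>W (c, i)\<^esub>)} \<times> J \<union> {c \<in> C2. snd x c \<noteq> \<zero>\<^bsub>W (c, 0)\<^esub>} \<times> {0})"
      using x J(1) by (simp add: car')
    ultimately have "finite {z \<in> I. h x z \<noteq> \<zero>\<^bsub>W z\<^esub>}" by (rule finite_subset)
    moreover have "h x z \<in> carrier (W z)" if "z \<in> I" for z
      using that 1[of "fst z" "snd z"] 2[of "fst z"] C[of "fst z"] by (cases z) (auto simp: h_def zI)
    ultimately show ?thesis by (auto simp: car h_def)
  qed
  have hf: "h (f g) = g" if g: "g \<in> carrier ?M" for g
  proof
    fix z
    have "g z = undefined" if "z \<notin> I" by (rule PiE_arb[OF _ that]) (use g car in blast)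
    then show "h (f g) z = g z" using C[of "fst z"] by (cases z) (auto simp: h_def f_def zI)
  qed
  have fh: "f (h x) = x" if x: "x \<in> carrier ?M'" for x
  proof (rule prod_eqI)
    have e: "fst x c = undefined" if "c \<notin> C1" for c using x that by (auto simp: car' PiE_def extensional_def)
    have e': "fst x c i = undefined" if "c \<in> C1" "i \<notin> J" for c i using x that by (auto simp: car' PiE_iff extensional_def)
    have e2: "snd x c = undefined" if "c \<notin> C2" for c using x that by (auto simp: car' PiE_def extensional_def)
    show "fst (f (h x)) = fst x"
    proof
      fix c show "fst (f (h x)) c = fst x c"
        using e[of c] e'[of c] by (cases "c \<in> C1") (auto simp: f_def h_def zI fun_eq_iff)
    qed
    show "snd (f (h x)) = snd x"
    proof
      fix c show "snd (f (h x)) c = snd x c"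
        using e2[of c] C[of c] by (cases "c \<in> C2") (auto simp: f_def h_def zI)
    qed
  qed
  show ?thesis
    unfolding vs_isomorphic_def
  proof (intro exI[of _ f] conjI ballI allI)
    show "bij_betw f (carrier ?M) (carrier ?M')"
      by (rule bij_betw_byWitness[of _ h]) (use f_in h_in hf fh in auto)
    show "f (x \<oplus>\<^bsub>?M\<^esub> y) = f x \<oplus>\<^bsub>?M'\<^esub> f y" for x y
      using J(2) by (auto simp: f_def direct_sum_def direct_sum2_def zI intro!: restrict_ext)
    show "f (k \<odot>\<^bsub>?M\<^esub> x) = k \<odot>\<^bsub>?M'\<^esub> f x" for k x
      using J(2) by (auto simp: f_def direct_sum_def direct_sum2_def zI intro!: restrict_ext)
  qed
qed

context groupoid_rep
begin

lemma ZZ_closed: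
  assumes "c \<in> loop_orbits G" "x \<in> carrier (ZZ c)" "y \<in> carrier (ZZ c)"
  shows "x \<otimes>\<^bsub>ZZ c\<^esub> y \<in> carrier (ZZ c)"
proof -
  interpret P: pointed_groupoid G "rep c" by (rule pointed[OF assms(1)])
  show ?thesis by (rule P.Z.m_closed[OF assms(2,3)])
qed

lemma NN_closed:
  assumes "c \<in> loop_orbits G" "x \<in> carrier (NN c)" "y \<in> carrier (NN c)"
  shows "x \<otimes>\<^bsub>NN c\<^esub> y \<in> carrier (NN c)"
proof -
  interpret P: pointed_groupoid G "rep c" by (rule pointed[OF assms(1)])
  show ?thesis by (rule P.N.m_closed[OF assms(2,3)])
qed

lemma hochschild_homology_groupoid_algebra:
  "vs_isomorphic (hochschild_homology (groupoid_algebra G :: ('k::field, 'b \<Rightarrow> 'k) module) n)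
     (direct_sum (loop_orbits G) (\<lambda>c. group_homology (ZZ c) n))"
proof -
  obtain \<phi> where \<phi>: "presents (hochschild_homology (groupoid_algebra G :: ('k, 'b \<Rightarrow> 'k) module) n) \<phi>
     {p \<in> Lin {x \<in> cells. ldg x = n}. lext gb p = 0} (lext gb ` Lin {x \<in> cells. ldg x = Suc n})"
    using hochschild_presents by (rule exE)
  obtain \<psi> where \<psi>: "presents (direct_sum {j \<in> loop_orbits G. (0::nat) \<le> n} (\<lambda>j. group_homology (ZZ j) (n - 0)) :: ('k, 'b set \<Rightarrow> ('b list \<Rightarrow> 'k) set) module) \<psi>
     {p \<in> Lin {z \<in> bar_basis (loop_orbits G) ZZ. bar_deg (\<lambda>_. 0) z = n}. lext (bar_sum_del ZZ) p = 0}
     (lext (bar_sum_del ZZ) ` Lin {z \<in> bar_basis (loop_orbits G) ZZ. bar_deg (\<lambda>_. 0) z = Suc n})"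
    using direct_sum_presents[of "loop_orbits G" ZZ "\<lambda>_. 0" n, OF ZZ_closed] by (rule exE)
  from quasi_iso_homology[OF hh_quasi_iso_total \<phi> \<psi>] show ?thesis by simp
qed

lemma cyclic_homology_groupoid_algebra:
  "vs_isomorphic (cyclic_homology (groupoid_algebra G :: ('k::field_char_0, 'b \<Rightarrow> 'k) module) n)
     (direct_sum2
       (direct_sum {c \<in> loop_orbits G. loop_ord G (rep c) \<noteq> 0}
         (\<lambda>c. direct_sum {i. 2 * i \<le> n} (\<lambda>i. group_homology (NN c) (n - 2 * i))))
       (direct_sum {c \<in> loop_orbits G. loop_ord G (rep c) = 0} (\<lambda>c. group_homology (NN c) n)))"
proof -
  let ?W = "\<lambda>j. group_homology (NN (fst j)) (n - 2 * snd j) :: ('k, ('b set list \<Rightarrow> 'k) set) module"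
  obtain \<phi> where \<phi>: "presents (cyclic_homology (groupoid_algebra G :: ('k, 'b \<Rightarrow> 'k) module) n) \<phi>
     {p \<in> Lin {z \<in> UNIV \<times> cells. gtdeg z = n}. lext gtdiff p = 0}
     (lext gtdiff ` Lin {z \<in> UNIV \<times> cells. gtdeg z = Suc n})"
    using cyclic_presents by (rule exE)
  have cl: "x \<otimes>\<^bsub>NN (fst j)\<^esub> y \<in> carrier (NN (fst j))"
    if "j \<in> hc_index" "x \<in> carrier (NN (fst j))" "y \<in> carrier (NN (fst j))" for j x y
    by (rule NN_closed[OF _ that(2,3)]) (use that(1) in \<open>auto simp: hc_index_def\<close>)
  obtain \<psi> where \<psi>: "presents (direct_sum {j \<in> hc_index. 2 * snd j \<le> n} ?W) \<psi>
     {p \<in> Lin {z \<in> bar_basis hc_index (\<lambda>j. NN (fst j)). bar_deg (\<lambda>j. 2 * snd j) z = n}. lext (bar_sum_del (\<lambda>j. NN (fst j))) p = 0}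
     (lext (bar_sum_del (\<lambda>j. NN (fst j))) ` Lin {z \<in> bar_basis hc_index (\<lambda>j. NN (fst j)). bar_deg (\<lambda>j. 2 * snd j) z = Suc n})"
    using direct_sum_presents[of hc_index "\<lambda>j. NN (fst j)" "\<lambda>j. 2 * snd j" n, OF cl] by (rule exE)
  have 1: "vs_isomorphic (cyclic_homology (groupoid_algebra G :: ('k, 'b \<Rightarrow> 'k) module) n) (direct_sum {j \<in> hc_index. 2 * snd j \<le> n} ?W)"
    by (rule quasi_iso_homology[OF hc_quasi_iso_total \<phi> \<psi>])
  have "{i. 2 * i \<le> n} \<subseteq> {..n}" by auto
  then have fin: "finite {i. 2 * i \<le> n}" by (rule finite_subset) simp
  have 2: "vs_isomorphic (direct_sum {j \<in> hc_index. 2 * snd j \<le> n} ?W)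
     (direct_sum2
       (direct_sum {c \<in> loop_orbits G. loop_ord G (rep c) \<noteq> 0} (\<lambda>c. direct_sum {i. 2 * i \<le> n} (\<lambda>i. ?W (c, i))))
       (direct_sum {c \<in> loop_orbits G. loop_ord G (rep c) = 0} (\<lambda>c. ?W (c, 0))))"
    by (rule direct_sum_flatten[OF fin]) (auto simp: hc_index_def)
  from vs_isomorphic_trans[OF 1 2] show ?thesis by simp
qed

end

theorem corollary3p12:
  fixes G :: "('o, 'm) groupoid_data"
    and B :: "('k::field_char_0, 'm \<Rightarrow> 'k) module"
    and rep :: "'m set \<Rightarrow> 'm"
  assumes "groupoid G"
    and "finite (objs G)"
    and "B = groupoid_algebra G"
    and "\<And>c. c \<in> loop_orbits G \<Longrightarrow> rep c \<in> c"
  shows "(\<forall>n. vs_isomorphic (hochschild_homology B n)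
           (direct_sum (loop_orbits G) (\<lambda>c. group_homology (centralizer G (rep c)) n))) \<and>
         (\<forall>n. vs_isomorphic (cyclic_homology B n)
           (direct_sum2
             (direct_sum {c \<in> loop_orbits G. loop_ord G (rep c) \<noteq> 0}
               (\<lambda>c. direct_sum {i. 2 * i \<le> n}
                 (\<lambda>i. group_homology
                   (centralizer G (rep c) Mod cyclic_subgroup G (rep c)) (n - 2 * i))))
             (direct_sum {c \<in> loop_orbits G. loop_ord G (rep c) = 0}
               (\<lambda>c. group_homology
                   (centralizer G (rep c) Mod cyclic_subgroup G (rep c)) n))))"
proof -
  interpret groupoid_rep G rep
    by (rule groupoid_rep.intro[OF assms(1)]) (unfold_locales, rule assms(4))
  show ?thesis
    unfolding assms(3) using hochschild_homology_groupoid_algebra cyclic_homology_groupoid_algebra by blast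
qed

end
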